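(* Let $\mathcal C$ be a stably 2-Calabi–Yau category with a cluster structure defined by cluster tilting objects, where the indecomposable projectives are the coefficients; assume the cluster tilting objects have $n$ cluster variables and $c$ coefficients, $1\le n\le\infty$, $0\le c\le\infty$, and put $m=n+c$, $\mathbf F=\mathbb Q(u_1,\dots,u_m)$. Let $\Delta$ be a connected component of the cluster tilting graph of $\mathcal C$, $\mathcal E=\operatorname{add}\{T\mid T\in\Delta\}$, and let $\varphi\colon\mathcal E\to\mathbf F$ be a cluster map for $\Delta$. Then: (a) Let $\mathbf A$ be the subalgebra of $\mathbf F$ generated by $\varphi(X)$ for $X\in\mathcal E$. Then $\mathbf A$ is a cluster algebra, and $(\varphi(T),B_{\operatorname{End}_{\mathcal C}(T)})$ is a seed for $\mathbf A$ for any cluster tilting object $T$ in $\Delta$. (b) Let $\mathcal B$ be a subcategory of $\mathcal C$ with a substructure, and $\mathcal E'$ a subcategory of $\mathcal B$ defined by a connected component of the cluster tilting graph of $\mathcal B$. Then the elements $\varphi(X)$ for $X\in\mathcal E'$ generate a subcluster algebra of $\mathbf A$.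
   Context: Categories. All categories are Krull–Schmidt over an algebraically closed field $k$. A $\operatorname{Hom}$-finite triangulated category is 2-CY if there are functorial isomorphisms $D\operatorname{Ext}^1(A,B)\simeq\operatorname{Ext}^1(B,A)$, $D=\operatorname{Hom}_k(-,k)$. A category is stably 2-CY if it is either an exact Frobenius category whose stable category is ($\operatorname{Hom}$-finite) 2-CY, or a functorially finite extension closed subcategory $\mathcal C$ of a triangulated 2-CY category (then $X\in\mathcal C$ is projective if $\operatorname{Hom}(X,\mathcal C[1])=0$). A cluster tilting object $T$ satisfies $\operatorname{Ext}^1(T,T)=0$ and: $\operatorname{Ext}^1(T,X)=0$ implies $X\in\operatorname{add}T$ (with $\operatorname{add}T$ functorially finite; infinitely many indecomposable summands are allowed, in which case $T$ is a cluster tilting subcategory). Cluster variables are the non-projective indecomposable summands of cluster tilting objects. Cluster structure (by cluster tilting objects): (1) for each cluster tilting $T$ and non-projective indecomposable summand $M$ there is a unique indecomposable $M^*\not\simeq M$ such that replacing $M$ by $M^*$ gives a cluster tilting $T^*$ (exchange); (2) there are triangles/short exact sequences $M^*\xrightarrow{f}B\xrightarrow{g}M$ and $M\xrightarrow{s}B'\xrightarrow{t}M^*$ in which $g,t$ are minimal right and $f,s$ are minimal left $\operatorname{add}(T\setminus\{M\})$-approximations; (3) the quivers $Q_T$ (vertices: indecomposable summands; $\dim\operatorname{rad}(T_i,T_j)/\operatorname{rad}^2(T_i,T_j)$ arrows $T_i\to T_j$, radicals taken in $\operatorname{add}T$, arrows between projectives discarded) have no loops or 2-cycles; (4) $Q_{T^*}$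 is the Fomin–Zelevinsky mutation of $Q_T$ at $M$. A weak cluster structure requires only (1) and (2). Cluster tilting graph: vertices are the non-isomorphic basic cluster tilting objects, joined by an edge when they differ in exactly one indecomposable summand. The subcategory defined by a connected component is the additive closure of the cluster tilting objects in it. Substructure: for $\mathcal B\subseteq\mathcal C$ extension closed, both with a weak cluster structure, an extended cluster (here, cluster tilting object) $T'$ in $\mathcal B$ induces a substructure of $\mathcal C$ if there is a set $A$ of indecomposable objects of $\mathcal C$ such that $T''\cup A$ is an extended cluster in $\mathcal C$ for every extended cluster $T''$ in $\mathcal B$ obtained from $T'$ by finitely many exchanges. $B_{\operatorname{End}_{\mathcal C}(T)}$ is the $m\times n$ matrix obtained from the skew-symmetric $m\times m$ matrix of the quiver of $\operatorname{End}_{\mathcal C}(T)$ by removing the last $m-n$ columns, those corresponding to the projective summands. Cluster map for $\Delta$: a map $\varphi\colon\mathcal E\to\mathbf F$, constant on isomorphism classes, such that (M1) for a cluster tilting object $T$ in $\Delta$, $\varphi(T)$ (the set of images of indecomposable summands) is a transcendence basis for $\mathbf F$; (M2) for all indecomposables $M,N\in\mathcal E$ with $\dim_k\operatorname{Ext}^1(M,N)=1$, $\varphi(M)\varphi(N)=\varphi(V)+\varphi(V')$, where $V,V'$ are the middle terms of the non-split triangles/short exact sequences $N\to V\to M$ and $M\to V'\to N$; (M3) $\varphi(A\oplus A')=\varphi(A)\varphi(A')$ for all $A,A'\in\mathcal E$. Cluster algebra: a seed is a triple $(\underline x,\underline c,\widetilde B)$, also written $(\underline{\widetilde x},\widetilde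 B)$, with $\underline{\widetilde x}=\underline x\cup\underline c=\{x_1,\dots,x_m\}$ a transcendence basis of $\mathbf F$, $\underline x=\{x_1,\dots,x_n\}$ (cluster), $\underline c=\{x_{n+1},\dots,x_m\}$ (coefficients), and $\widetilde B=(b_{ij})$ a locally finite $m\times n$ integer matrix whose first $n$ rows form a skew-symmetric matrix. Mutation in direction $k\in\{1,\dots,n\}$ replaces $x_k$ by $x_k'=x_k^{-1}(\prod_{b_{ik}>0}x_i^{b_{ik}}+\prod_{b_{ik}<0}x_i^{-b_{ik}})$ and $b_{ij}$ by $-b_{ij}$ if $i=k$ or $j=k$, and by $b_{ij}+\frac{|b_{ik}|b_{kj}+b_{ik}|b_{kj}|}{2}$ otherwise. The cluster algebra with a subset $\underline c_0\subseteq\underline c$ of coefficients inverted is the $\mathbb Z[\underline c,\underline c_0^{-1}]$-subalgebra of $\mathbf F$ generated by all elements of clusters of seeds obtained by iterated mutation from an initial seed. Subcluster algebra of $\mathbf A$: a cluster algebra $\mathbf A'$ such that there are a seed $(\underline x,\underline c,Q)$ of $\mathbf A$ and a seed $(\underline x',\underline c',Q')$ of $\mathbf A'$ (matrices written as quivers) with (S1) $\underline x'\subseteq\underline x$ and $\underline c'\subseteq\underline x\cup\underline c$; (S2) for each $x_i\in\underline x'$ the set of arrows entering and leaving $i$ in $Q$ lie in $Q'$; (S3) the inverted coefficients $\underline c_0$ of $\mathbf A$ and $\underline c_0'\subseteq\underline c'$ of $\mathbf A'$ satisfy $\underline c_0\cap\underline c'\subseteq\underline c_0'$. *)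

theory Defs
  imports
    "HOL-Library.Poly_Mapping"
    "HOL-Library.Extended_Nat"
    "HOL-Computational_Algebra.Polynomial"
begin

section \<open>Linear categories\<close>

text \<open>
  A small \<open>k\<close>-linear category whose morphism spaces are subspaces of one \<open>k\<close>-vector space \<open>'m\<close>.
  This is no restriction: inside the direct sum of all morphism spaces, composition and scalar
  multiplication extend to operations that do not mention source and target.
  \<open>cmp K g f\<close> is \<open>g\<close> after \<open>f\<close>.
\<close>

record ('o, 'm, 'k) kcat =
  ob :: "'o set"
  hom :: "'o \<Rightarrow> 'o \<Rightarrow> 'm set"
  cmp :: "'m \<Rightarrow> 'm \<Rightarrow> 'm"
  idn :: "'o \<Rightarrow> 'm"
  scl :: "'k \<Rightarrow> 'm \<Rightarrow> 'm"

definition lin_cat :: "('o, 'm::ab_group_add, 'k::field, 'z) kcat_scheme \<Rightarrow> bool" where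
  "lin_cat K \<longleftrightarrow>
     vector_space (scl K) \<and>
     (\<forall>A\<in>ob K. \<forall>B\<in>ob K. module.subspace (scl K) (hom K A B)) \<and>
     (\<forall>A\<in>ob K. idn K A \<in> hom K A A) \<and>
     (\<forall>A\<in>ob K. \<forall>B\<in>ob K. \<forall>f\<in>hom K A B. cmp K f (idn K A) = f \<and> cmp K (idn K B) f = f) \<and>
     (\<forall>A\<in>ob K. \<forall>B\<in>ob K. \<forall>C\<in>ob K. \<forall>f\<in>hom K A B. \<forall>g\<in>hom K B C. cmp K g f \<in> hom K A C) \<and>
     (\<forall>A\<in>ob K. \<forall>B\<in>ob K. \<forall>C\<in>ob K. \<forall>D\<in>ob K.
        \<forall>f\<in>hom K A B. \<forall>g\<in>hom K B C. \<forall>h\<in>hom K C D.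
          cmp K h (cmp K g f) = cmp K (cmp K h g) f) \<and>
     (\<forall>A\<in>ob K. \<forall>B\<in>ob K. \<forall>C\<in>ob K.
        \<forall>f\<in>hom K A B. \<forall>f'\<in>hom K A B. \<forall>g\<in>hom K B C. \<forall>g'\<in>hom K B C. \<forall>a.
          cmp K g (f + f') = cmp K g f + cmp K g f' \<and>
          cmp K (g + g') f = cmp K g f + cmp K g' f \<and>
          cmp K g (scl K a f) = scl K a (cmp K g f) \<and>
          cmp K (scl K a g) f = scl K a (cmp K g f))"

definition is_iso :: "('o, 'm::ab_group_add, 'k, 'z) kcat_scheme \<Rightarrow> 'o \<Rightarrow> 'o \<Rightarrow> 'm \<Rightarrow> bool" where
  "is_iso K A B f \<longleftrightarrow>
     f \<in> hom K A B \<and> (\<exists>g\<in>hom K B A. cmp K g f = idn K A \<and> cmp K f g = idn K B)"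

definition isomorphic :: "('o, 'm::ab_group_add, 'k, 'z) kcat_scheme \<Rightarrow> 'o \<Rightarrow> 'o \<Rightarrow> bool" where
  "isomorphic K A B \<longleftrightarrow> A \<in> ob K \<and> B \<in> ob K \<and> (\<exists>f. is_iso K A B f)"

definition iso_class :: "('o, 'm::ab_group_add, 'k, 'z) kcat_scheme \<Rightarrow> 'o \<Rightarrow> 'o set" where
  "iso_class K A = {B. isomorphic K A B}"

definition iso_closure :: "('o, 'm::ab_group_add, 'k, 'z) kcat_scheme \<Rightarrow> 'o set \<Rightarrow> 'o set" where
  "iso_closure K S = (\<Union>A\<in>S. iso_class K A)"

definition is_zero :: "('o, 'm::ab_group_add, 'k, 'z) kcat_scheme \<Rightarrow> 'o \<Rightarrow> bool" where
  "is_zero K Z \<longleftrightarrow> Z \<in> ob K \<and> idn K Z = 0"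

definition biproduct ::
  "('o, 'm::ab_group_add, 'k, 'z) kcat_scheme \<Rightarrow> 'o \<Rightarrow> 'o \<Rightarrow> 'o \<Rightarrow> bool" where
  "biproduct K A B C \<longleftrightarrow>
     A \<in> ob K \<and> B \<in> ob K \<and> C \<in> ob K \<and>
     (\<exists>i\<in>hom K A C. \<exists>j\<in>hom K B C. \<exists>p\<in>hom K C A. \<exists>q\<in>hom K C B.
        cmp K p i = idn K A \<and> cmp K q j = idn K B \<and> cmp K q i = 0 \<and> cmp K p j = 0 \<and>
        cmp K i p + cmp K j q = idn K C)"

definition additive_cat :: "('o, 'm::ab_group_add, 'k::field, 'z) kcat_scheme \<Rightarrow> bool" where
  "additive_cat K \<longleftrightarrow>
     lin_cat K \<and> (\<exists>Z. is_zero K Z) \<and> (\<forall>A\<in>ob K. \<forall>B\<in>ob K. \<exists>C. biproduct K A B C)"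

inductive_set finite_sums ::
  "('o, 'm::ab_group_add, 'k, 'z) kcat_scheme \<Rightarrow> 'o set \<Rightarrow> 'o set"
  for K :: "('o, 'm::ab_group_add, 'k, 'z) kcat_scheme" and S :: "'o set" where
  zero: "is_zero K Z \<Longrightarrow> Z \<in> finite_sums K S"
| single: "A \<in> S \<Longrightarrow> A \<in> ob K \<Longrightarrow> A \<in> finite_sums K S"
| sum: "A \<in> finite_sums K S \<Longrightarrow> B \<in> finite_sums K S \<Longrightarrow> biproduct K A B C
    \<Longrightarrow> C \<in> finite_sums K S"

text \<open>\<open>add S\<close>: the direct summands of finite direct sums of members of \<open>S\<close>.\<close>

definition add_closure :: "('o, 'm::ab_group_add, 'k, 'z) kcat_scheme \<Rightarrow> 'o set \<Rightarrow> 'o set" where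
  "add_closure K S = {A. \<exists>B C. C \<in> finite_sums K S \<and> biproduct K A B C}"

definition indecomposable :: "('o, 'm::ab_group_add, 'k, 'z) kcat_scheme \<Rightarrow> 'o \<Rightarrow> bool" where
  "indecomposable K M \<longleftrightarrow>
     M \<in> ob K \<and> \<not> is_zero K M \<and> (\<forall>A B. biproduct K A B M \<longrightarrow> is_zero K A \<or> is_zero K B)"

definition local_end :: "('o, 'm::ab_group_add, 'k, 'z) kcat_scheme \<Rightarrow> 'o \<Rightarrow> bool" where
  "local_end K M \<longleftrightarrow>
     M \<in> ob K \<and> idn K M \<noteq> 0 \<and>
     (\<forall>f\<in>hom K M M. is_iso K M M f \<or> is_iso K M M (idn K M - f))"

definition krull_schmidt :: "('o, 'm::ab_group_add, 'k::field, 'z) kcat_scheme \<Rightarrow> bool" where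
  "krull_schmidt K \<longleftrightarrow> additive_cat K \<and> ob K \<subseteq> finite_sums K {M. local_end K M}"

text \<open>
  Subcategories are full and given by their objects. Closure under direct summands (and hence
  under isomorphism) is what makes such a subcategory of a Krull--Schmidt category
  Krull--Schmidt again.
\<close>

definition full_subcat :: "('o, 'm::ab_group_add, 'k, 'z) kcat_scheme \<Rightarrow> 'o set \<Rightarrow> bool" where
  "full_subcat K S \<longleftrightarrow>
     S \<subseteq> ob K \<and> (\<forall>Z. is_zero K Z \<longrightarrow> Z \<in> S) \<and>
     (\<forall>A B C. biproduct K A B C \<longrightarrow> (C \<in> S \<longleftrightarrow> A \<in> S \<and> B \<in> S))"

definition right_approx ::
  "('o, 'm::ab_group_add, 'k, 'z) kcat_scheme \<Rightarrow> 'o set \<Rightarrow> 'o \<Rightarrow> 'm \<Rightarrow> 'o \<Rightarrow> bool" where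
  "right_approx K \<X> B g M \<longleftrightarrow>
     B \<in> \<X> \<and> g \<in> hom K B M \<and> (\<forall>Y\<in>\<X>. \<forall>h\<in>hom K Y M. \<exists>u\<in>hom K Y B. h = cmp K g u)"

definition left_approx ::
  "('o, 'm::ab_group_add, 'k, 'z) kcat_scheme \<Rightarrow> 'o set \<Rightarrow> 'o \<Rightarrow> 'm \<Rightarrow> 'o \<Rightarrow> bool" where
  "left_approx K \<X> M f B \<longleftrightarrow>
     B \<in> \<X> \<and> f \<in> hom K M B \<and> (\<forall>Y\<in>\<X>. \<forall>h\<in>hom K M Y. \<exists>u\<in>hom K B Y. h = cmp K u f)"

definition functorially_finite ::
  "('o, 'm::ab_group_add, 'k, 'z) kcat_scheme \<Rightarrow> 'o set \<Rightarrow> 'o set \<Rightarrow> bool" where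
  "functorially_finite K \<X> S \<longleftrightarrow>
     \<X> \<subseteq> S \<and> (\<forall>M\<in>S. (\<exists>B g. right_approx K \<X> B g M) \<and> (\<exists>B f. left_approx K \<X> M f B))"

definition right_minimal ::
  "('o, 'm::ab_group_add, 'k, 'z) kcat_scheme \<Rightarrow> 'o \<Rightarrow> 'm \<Rightarrow> bool" where
  "right_minimal K B g \<longleftrightarrow> (\<forall>u\<in>hom K B B. cmp K g u = g \<longrightarrow> is_iso K B B u)"

definition left_minimal ::
  "('o, 'm::ab_group_add, 'k, 'z) kcat_scheme \<Rightarrow> 'm \<Rightarrow> 'o \<Rightarrow> bool" where
  "left_minimal K f B \<longleftrightarrow> (\<forall>u\<in>hom K B B. cmp K u f = f \<longrightarrow> is_iso K B B u)"

text \<open>\<open>V/W\<close> has dimension \<open>n\<close>: the classes of some \<open>n\<close> elements of \<open>V\<close> form a basis of \<open>V/W\<close>.\<close>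

definition quot_dim ::
  "('k::field \<Rightarrow> 'm::ab_group_add \<Rightarrow> 'm) \<Rightarrow> 'm set \<Rightarrow> 'm set \<Rightarrow> nat \<Rightarrow> bool" where
  "quot_dim s V W n \<longleftrightarrow>
     (\<exists>B. B \<subseteq> V \<and> finite B \<and> card B = n \<and>
        (\<forall>c. (\<Sum>b\<in>B. s (c b) b) \<in> W \<longrightarrow> (\<forall>b\<in>B. c b = 0)) \<and>
        (\<forall>v\<in>V. \<exists>c. v - (\<Sum>b\<in>B. s (c b) b) \<in> W))"


section \<open>The 2-Calabi--Yau condition\<close>

text \<open>
  The condition is stated for a quotient category \<open>K/I\<close> with a suspension that is \<open>s\<close> on objects and
  is given on morphisms by representatives: \<open>R A B f h\<close> says that \<open>h : s A \<rightarrow> s B\<close> represents the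
  suspension of the class of \<open>f : A \<rightarrow> B\<close>. Thus \<open>Ext(A,B) = Hom(A,s B)/I(A,s B)\<close>.
  A functorial isomorphism from \<open>Ext(B,A)\<close> to the dual of \<open>Ext(A,B)\<close> is given by linear maps
  \<open>\<Psi> A B\<close> on \<open>Hom(B,s A)\<close> with kernel \<open>I(B,s A)\<close> whose image consists of all linear forms on
  \<open>Hom(A,s B)\<close> that vanish on \<open>I(A,s B)\<close>.
\<close>

definition linear_form ::
  "('k::field \<Rightarrow> 'm::ab_group_add \<Rightarrow> 'm) \<Rightarrow> 'm set \<Rightarrow> ('m \<Rightarrow> 'k) \<Rightarrow> bool" where
  "linear_form s V \<xi> \<longleftrightarrow>
     (\<forall>x\<in>V. \<forall>y\<in>V. \<xi> (x + y) = \<xi> x + \<xi> y) \<and> (\<forall>a. \<forall>x\<in>V. \<xi> (s a x) = a * \<xi> x)"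

definition two_CY ::
  "('o, 'm::ab_group_add, 'k::field, 'z) kcat_scheme \<Rightarrow> ('o \<Rightarrow> 'o \<Rightarrow> 'm set) \<Rightarrow>
   ('o \<Rightarrow> 'o) \<Rightarrow> ('o \<Rightarrow> 'o \<Rightarrow> 'm \<Rightarrow> 'm \<Rightarrow> bool) \<Rightarrow> bool" where
  "two_CY K I s R \<longleftrightarrow>
     (\<forall>A\<in>ob K. \<forall>B\<in>ob K. \<exists>n. quot_dim (scl K) (hom K A B) (I A B) n) \<and>
     (\<exists>\<Psi> :: 'o \<Rightarrow> 'o \<Rightarrow> 'm \<Rightarrow> 'm \<Rightarrow> 'k.
        (\<forall>A\<in>ob K. \<forall>B\<in>ob K.
           (\<forall>x\<in>hom K B (s A).
              linear_form (scl K) (hom K A (s B)) (\<Psi> A B x) \<and> (\<forall>t\<in>I A (s B). \<Psi> A B x t = 0)) \<and>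
           (\<forall>t\<in>hom K A (s B). linear_form (scl K) (hom K B (s A)) (\<lambda>x. \<Psi> A B x t)) \<and>
           (\<forall>x\<in>hom K B (s A). (\<forall>t\<in>hom K A (s B). \<Psi> A B x t = 0) \<longleftrightarrow> x \<in> I B (s A)) \<and>
           (\<forall>\<xi>. linear_form (scl K) (hom K A (s B)) \<xi> \<and> (\<forall>t\<in>I A (s B). \<xi> t = 0) \<longrightarrow>
              (\<exists>x\<in>hom K B (s A). \<forall>t\<in>hom K A (s B). \<Psi> A B x t = \<xi> t))) \<and>
        (\<forall>A'\<in>ob K. \<forall>A\<in>ob K. \<forall>B\<in>ob K. \<forall>a\<in>hom K A' A. \<forall>h. R A' A a h \<longrightarrow>
           (\<forall>x\<in>hom K B (s A'). \<forall>t\<in>hom K A (s B).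
              \<Psi> A B (cmp K h x) t = \<Psi> A' B x (cmp K t a))) \<and>
        (\<forall>A\<in>ob K. \<forall>B\<in>ob K. \<forall>B'\<in>ob K. \<forall>b\<in>hom K B B'. \<forall>h. R B B' b h \<longrightarrow>
           (\<forall>x\<in>hom K B' (s A). \<forall>t\<in>hom K A (s B).
              \<Psi> A B (cmp K x b) t = \<Psi> A B' x (cmp K h t))))"


section \<open>Exact Frobenius categories\<close>

text \<open>\<open>cfl E A f B g C\<close>: the sequence \<open>A \<rightarrow> B \<rightarrow> C\<close> with maps \<open>f\<close>, \<open>g\<close> is a conflation.\<close>

record ('o, 'm, 'k) exact_cat = "('o, 'm, 'k) kcat" +
  cfl :: "'o \<Rightarrow> 'm \<Rightarrow> 'o \<Rightarrow> 'm \<Rightarrow> 'o \<Rightarrow> bool"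

definition ker_coker_pair ::
  "('o, 'm::ab_group_add, 'k, 'z) kcat_scheme \<Rightarrow> 'o \<Rightarrow> 'm \<Rightarrow> 'o \<Rightarrow> 'm \<Rightarrow> 'o \<Rightarrow> bool" where
  "ker_coker_pair K A f B g C \<longleftrightarrow>
     A \<in> ob K \<and> B \<in> ob K \<and> C \<in> ob K \<and> f \<in> hom K A B \<and> g \<in> hom K B C \<and> cmp K g f = 0 \<and>
     (\<forall>Y\<in>ob K. \<forall>h\<in>hom K Y B. cmp K g h = 0 \<longrightarrow> (\<exists>!u. u \<in> hom K Y A \<and> cmp K f u = h)) \<and>
     (\<forall>Y\<in>ob K. \<forall>h\<in>hom K B Y. cmp K h f = 0 \<longrightarrow> (\<exists>!u. u \<in> hom K C Y \<and> cmp K u g = h))"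

text \<open>The square with \<open>f : A \<rightarrow> B\<close>, \<open>a : A \<rightarrow> A'\<close>, \<open>f' : A' \<rightarrow> B'\<close>, \<open>b : B \<rightarrow> B'\<close> is a pushout.\<close>

definition pushout ::
  "('o, 'm::ab_group_add, 'k, 'z) kcat_scheme \<Rightarrow> 'o \<Rightarrow> 'o \<Rightarrow> 'o \<Rightarrow> 'o \<Rightarrow>
   'm \<Rightarrow> 'm \<Rightarrow> 'm \<Rightarrow> 'm \<Rightarrow> bool" where
  "pushout K A B A' B' f a f' b \<longleftrightarrow>
     B' \<in> ob K \<and> f' \<in> hom K A' B' \<and> b \<in> hom K B B' \<and> cmp K b f = cmp K f' a \<and>
     (\<forall>Y\<in>ob K. \<forall>u\<in>hom K A' Y. \<forall>v\<in>hom K B Y. cmp K v f = cmp K u a \<longrightarrow>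
        (\<exists>!w. w \<in> hom K B' Y \<and> cmp K w f' = u \<and> cmp K w b = v))"

text \<open>The square with \<open>g : B \<rightarrow> C\<close>, \<open>c : C' \<rightarrow> C\<close>, \<open>g' : B' \<rightarrow> C'\<close>, \<open>b : B' \<rightarrow> B\<close> is a pullback.\<close>

definition pullback ::
  "('o, 'm::ab_group_add, 'k, 'z) kcat_scheme \<Rightarrow> 'o \<Rightarrow> 'o \<Rightarrow> 'o \<Rightarrow> 'o \<Rightarrow>
   'm \<Rightarrow> 'm \<Rightarrow> 'm \<Rightarrow> 'm \<Rightarrow> bool" where
  "pullback K B C B' C' g c g' b \<longleftrightarrow>
     B' \<in> ob K \<and> g' \<in> hom K B' C' \<and> b \<in> hom K B' B \<and> cmp K g b = cmp K c g' \<and>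
     (\<forall>Y\<in>ob K. \<forall>u\<in>hom K Y C'. \<forall>v\<in>hom K Y B. cmp K g v = cmp K c u \<longrightarrow>
        (\<exists>!w. w \<in> hom K Y B' \<and> cmp K g' w = u \<and> cmp K b w = v))"

definition inflation ::
  "('o, 'm::ab_group_add, 'k, 'z) exact_cat_scheme \<Rightarrow> 'o \<Rightarrow> 'o \<Rightarrow> 'm \<Rightarrow> bool" where
  "inflation E A B f \<longleftrightarrow> (\<exists>g C. cfl E A f B g C)"

definition deflation ::
  "('o, 'm::ab_group_add, 'k, 'z) exact_cat_scheme \<Rightarrow> 'o \<Rightarrow> 'o \<Rightarrow> 'm \<Rightarrow> bool" where
  "deflation E B C g \<longleftrightarrow> (\<exists>f A. cfl E A f B g C)"

definition exact :: "('o, 'm::ab_group_add, 'k::field, 'z) exact_cat_scheme \<Rightarrow> bool" where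
  "exact E \<longleftrightarrow>
     additive_cat E \<and>
     (\<forall>A f B g C. cfl E A f B g C \<longrightarrow> ker_coker_pair E A f B g C) \<and>
     (\<forall>A f B g C A' f' B' g' C' a b c.
        cfl E A f B g C \<and> A' \<in> ob E \<and> B' \<in> ob E \<and> C' \<in> ob E \<and>
        f' \<in> hom E A' B' \<and> g' \<in> hom E B' C' \<and>
        is_iso E A A' a \<and> is_iso E B B' b \<and> is_iso E C C' c \<and>
        cmp E b f = cmp E f' a \<and> cmp E c g = cmp E g' b \<longrightarrow> cfl E A' f' B' g' C') \<and>
     (\<forall>A\<in>ob E. inflation E A A (idn E A) \<and> deflation E A A (idn E A)) \<and>
     (\<forall>A B C f g. inflation E A B f \<and> inflation E B C g \<longrightarrow> inflation E A C (cmp E g f)) \<and>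
     (\<forall>A B C f g. deflation E A B f \<and> deflation E B C g \<longrightarrow> deflation E A C (cmp E g f)) \<and>
     (\<forall>A B f. inflation E A B f \<longrightarrow> (\<forall>A'\<in>ob E. \<forall>a\<in>hom E A A'.
        \<exists>B' f' b. pushout E A B A' B' f a f' b \<and> inflation E A' B' f')) \<and>
     (\<forall>B C g. deflation E B C g \<longrightarrow> (\<forall>C'\<in>ob E. \<forall>c\<in>hom E C' C.
        \<exists>B' g' b. pullback E B C B' C' g c g' b \<and> deflation E B' C' g'))"

definition exact_projective ::
  "('o, 'm::ab_group_add, 'k, 'z) exact_cat_scheme \<Rightarrow> 'o \<Rightarrow> bool" where
  "exact_projective E P \<longleftrightarrow>
     P \<in> ob E \<and> (\<forall>B C g. deflation E B C g \<longrightarrow> (\<forall>h\<in>hom E P C. \<exists>u\<in>hom E P B. cmp E g u = h))"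

definition exact_injective ::
  "('o, 'm::ab_group_add, 'k, 'z) exact_cat_scheme \<Rightarrow> 'o \<Rightarrow> bool" where
  "exact_injective E Q \<longleftrightarrow>
     Q \<in> ob E \<and> (\<forall>A B f. inflation E A B f \<longrightarrow> (\<forall>h\<in>hom E A Q. \<exists>u\<in>hom E B Q. cmp E u f = h))"

definition frobenius :: "('o, 'm::ab_group_add, 'k::field, 'z) exact_cat_scheme \<Rightarrow> bool" where
  "frobenius E \<longleftrightarrow>
     exact E \<and>
     (\<forall>A\<in>ob E. \<exists>B f P g. exact_projective E P \<and> cfl E B f P g A) \<and>
     (\<forall>A\<in>ob E. \<exists>Q f B g. exact_injective E Q \<and> cfl E A f Q g B) \<and>
     (\<forall>P. exact_projective E P \<longleftrightarrow> exact_injective E P)"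

text \<open>
  A chosen conflation \<open>A \<rightarrow> Q \<rightarrow> \<Sigma>A\<close> with \<open>Q\<close> injective, as the tuple \<open>(i, Q, p, \<Sigma>A)\<close>. Then \<open>\<Sigma>\<close> is the
  suspension of the stable category, in which maps factoring through projectives are zero.
\<close>

definition cosyz ::
  "('o, 'm::ab_group_add, 'k, 'z) exact_cat_scheme \<Rightarrow> 'o \<Rightarrow> 'm \<times> 'o \<times> 'm \<times> 'o" where
  "cosyz E A = (SOME (i, Q, p, C). exact_injective E Q \<and> cfl E A i Q p C)"

definition stable_ideal ::
  "('o, 'm::ab_group_add, 'k, 'z) exact_cat_scheme \<Rightarrow> 'o \<Rightarrow> 'o \<Rightarrow> 'm set" where
  "stable_ideal E A B =
     {cmp E g f | P f g. exact_projective E P \<and> f \<in> hom E A P \<and> g \<in> hom E P B}"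

definition stable_susp ::
  "('o, 'm::ab_group_add, 'k, 'z) exact_cat_scheme \<Rightarrow> 'o \<Rightarrow> 'o" where
  "stable_susp E A = (case cosyz E A of (i, Q, p, C) \<Rightarrow> C)"

definition stable_susp_rel ::
  "('o, 'm::ab_group_add, 'k, 'z) exact_cat_scheme \<Rightarrow> 'o \<Rightarrow> 'o \<Rightarrow> 'm \<Rightarrow> 'm \<Rightarrow> bool" where
  "stable_susp_rel E A B f h \<longleftrightarrow>
     (case (cosyz E A, cosyz E B) of ((i, Q, p, C), (i', Q', p', C')) \<Rightarrow>
        h \<in> hom E C C' \<and> (\<exists>u\<in>hom E Q Q'. cmp E u i = cmp E i' f \<and> cmp E h p = cmp E p' u))"


section \<open>Triangulated categories\<close>

text \<open>\<open>dist T A f B g C h\<close>: the triangle \<open>A \<rightarrow> B \<rightarrow> C \<rightarrow> A[1]\<close> with maps \<open>f\<close>, \<open>g\<close>, \<open>h\<close> is distinguished.\<close>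

record ('o, 'm, 'k) tri_cat = "('o, 'm, 'k) kcat" +
  sh :: "'o \<Rightarrow> 'o"
  shm :: "'m \<Rightarrow> 'm"
  dist :: "'o \<Rightarrow> 'm \<Rightarrow> 'o \<Rightarrow> 'm \<Rightarrow> 'o \<Rightarrow> 'm \<Rightarrow> bool"

text \<open>The shift is a \<open>k\<close>-linear autoequivalence.\<close>

definition shift_equiv :: "('o, 'm::ab_group_add, 'k::field, 'z) tri_cat_scheme \<Rightarrow> bool" where
  "shift_equiv T \<longleftrightarrow>
     (\<forall>A\<in>ob T. sh T A \<in> ob T \<and> shm T (idn T A) = idn T (sh T A)) \<and>
     (\<forall>A\<in>ob T. \<forall>B\<in>ob T. bij_betw (shm T) (hom T A B) (hom T (sh T A) (sh T B)) \<and>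
        (\<forall>f\<in>hom T A B. \<forall>f'\<in>hom T A B. \<forall>a.
           shm T (f + f') = shm T f + shm T f' \<and> shm T (scl T a f) = scl T a (shm T f))) \<and>
     (\<forall>A\<in>ob T. \<forall>B\<in>ob T. \<forall>C\<in>ob T. \<forall>f\<in>hom T A B. \<forall>g\<in>hom T B C.
        shm T (cmp T g f) = cmp T (shm T g) (shm T f)) \<and>
     (\<forall>B\<in>ob T. \<exists>A\<in>ob T. isomorphic T (sh T A) B)"

definition triangulated :: "('o, 'm::ab_group_add, 'k::field, 'z) tri_cat_scheme \<Rightarrow> bool" where
  "triangulated T \<longleftrightarrow>
     additive_cat T \<and> shift_equiv T \<and>
     (\<forall>A f B g C h. dist T A f B g C h \<longrightarrow>
        A \<in> ob T \<and> B \<in> ob T \<and> C \<in> ob T \<and>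
        f \<in> hom T A B \<and> g \<in> hom T B C \<and> h \<in> hom T C (sh T A)) \<and>
     \<comment> \<open>TR1\<close>
     (\<forall>A f B g C h A' f' B' g' C' h' a b c.
        dist T A f B g C h \<and> A' \<in> ob T \<and> B' \<in> ob T \<and> C' \<in> ob T \<and>
        f' \<in> hom T A' B' \<and> g' \<in> hom T B' C' \<and> h' \<in> hom T C' (sh T A') \<and>
        is_iso T A A' a \<and> is_iso T B B' b \<and> is_iso T C C' c \<and>
        cmp T b f = cmp T f' a \<and> cmp T c g = cmp T g' b \<and> cmp T (shm T a) h = cmp T h' c \<longrightarrow>
        dist T A' f' B' g' C' h') \<and>
     (\<forall>A\<in>ob T. \<forall>Z. is_zero T Z \<longrightarrow> dist T A (idn T A) A 0 Z 0) \<and>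
     (\<forall>A\<in>ob T. \<forall>B\<in>ob T. \<forall>f\<in>hom T A B. \<exists>g C h. dist T A f B g C h) \<and>
     \<comment> \<open>TR2\<close>
     (\<forall>A\<in>ob T. \<forall>B\<in>ob T. \<forall>C\<in>ob T. \<forall>f\<in>hom T A B. \<forall>g\<in>hom T B C. \<forall>h\<in>hom T C (sh T A).
        dist T A f B g C h \<longleftrightarrow> dist T B g C h (sh T A) (- shm T f)) \<and>
     \<comment> \<open>TR3\<close>
     (\<forall>A f B g C h A' f' B' g' C' h' a b.
        dist T A f B g C h \<and> dist T A' f' B' g' C' h' \<and>
        a \<in> hom T A A' \<and> b \<in> hom T B B' \<and> cmp T b f = cmp T f' a \<longrightarrow>
        (\<exists>c\<in>hom T C C'. cmp T c g = cmp T g' b \<and> cmp T (shm T a) h = cmp T h' c)) \<and>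
     \<comment> \<open>TR4\<close>
     (\<forall>A B C A' B' C' f f' f'' g g' g'' h' h''.
        dist T A f B f' C' f'' \<and> dist T B g C g' A' g'' \<and> dist T A (cmp T g f) C h' B' h'' \<longrightarrow>
        (\<exists>u v. dist T C' u B' v A' (cmp T (shm T f') g'') \<and>
           cmp T u f' = cmp T h' g \<and> cmp T h'' u = f'' \<and>
           cmp T v h' = g' \<and> cmp T g'' v = cmp T (shm T f) h''))"


section \<open>Stably 2-Calabi--Yau categories\<close>

text \<open>
  The common structure of the two kinds of stably 2-Calabi--Yau categories: a \<open>k\<close>-category with its
  conflations (short exact sequences, respectively triangles with all three terms in the category)
  and with \<open>Ext(A,B)\<close>, the first extension space, presented as the quotient of \<open>ext_cyc A B\<close> by
  \<open>ext_bd A B\<close>.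
\<close>

record ('o, 'm, 'k) ext_cat = "('o, 'm, 'k) exact_cat" +
  ext_cyc :: "'o \<Rightarrow> 'o \<Rightarrow> 'm set"
  ext_bd :: "'o \<Rightarrow> 'o \<Rightarrow> 'm set"

text \<open>In an exact category \<open>Ext(A,B)\<close> is the cokernel of \<open>Hom(A,Q) \<rightarrow> Hom(A,\<Sigma>B)\<close>.\<close>

definition ext_cat_of_exact ::
  "('o, 'm::ab_group_add, 'k) exact_cat \<Rightarrow> ('o, 'm, 'k) ext_cat" where
  "ext_cat_of_exact E =
     \<lparr>ob = ob E, hom = hom E, cmp = cmp E, idn = idn E, scl = scl E, cfl = cfl E,
      ext_cyc = (\<lambda>A B. case cosyz E B of (i, Q, p, C) \<Rightarrow> hom E A C),
      ext_bd = (\<lambda>A B. case cosyz E B of (i, Q, p, C) \<Rightarrow> (\<lambda>u. cmp E p u) ` hom E A Q)\<rparr>"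

definition ext_cat_of_subcat ::
  "('o, 'm::ab_group_add, 'k) tri_cat \<Rightarrow> 'o set \<Rightarrow> ('o, 'm, 'k) ext_cat" where
  "ext_cat_of_subcat T S =
     \<lparr>ob = S, hom = hom T, cmp = cmp T, idn = idn T, scl = scl T,
      cfl = (\<lambda>A f B g C. A \<in> S \<and> B \<in> S \<and> C \<in> S \<and> (\<exists>h. dist T A f B g C h)),
      ext_cyc = (\<lambda>A B. hom T A (sh T B)), ext_bd = (\<lambda>A B. {0})\<rparr>"

definition two_CY_frobenius :: "('o, 'm::ab_group_add, 'k::field) exact_cat \<Rightarrow> bool" where
  "two_CY_frobenius E \<longleftrightarrow>
     frobenius E \<and> krull_schmidt E \<and>
     two_CY E (stable_ideal E) (stable_susp E) (stable_susp_rel E)"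

definition two_CY_triangulated :: "('o, 'm::ab_group_add, 'k::field) tri_cat \<Rightarrow> bool" where
  "two_CY_triangulated T \<longleftrightarrow>
     triangulated T \<and> krull_schmidt T \<and>
     two_CY T (\<lambda>A B. {0}) (sh T) (\<lambda>A B f h. h = shm T f)"

definition stably_2CY :: "('o, 'm::ab_group_add, 'k::field) ext_cat \<Rightarrow> bool" where
  "stably_2CY X \<longleftrightarrow>
     (\<exists>E. two_CY_frobenius E \<and> X = ext_cat_of_exact E) \<or>
     (\<exists>T S. two_CY_triangulated T \<and> full_subcat T S \<and> functorially_finite T S (ob T) \<and>
        (\<forall>A f B g C h. dist T A f B g C h \<and> A \<in> S \<and> C \<in> S \<longrightarrow> B \<in> S) \<and>
        X = ext_cat_of_subcat T S)"


section \<open>Cluster tilting objects and cluster structures\<close>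

text \<open>
  Everything below is relative to a full subcategory \<open>S\<close> of \<open>X\<close>; \<open>S = ob X\<close> gives \<open>X\<close> itself. If \<open>S\<close> is
  extension closed then its conflations and extension spaces are those of \<open>X\<close>.
\<close>

definition ext_closed :: "('o, 'm::ab_group_add, 'k::field) ext_cat \<Rightarrow> 'o set \<Rightarrow> bool" where
  "ext_closed X S \<longleftrightarrow> (\<forall>A f B g C. cfl X A f B g C \<and> A \<in> S \<and> C \<in> S \<longrightarrow> B \<in> S)"

definition ext_zero :: "('o, 'm::ab_group_add, 'k::field) ext_cat \<Rightarrow> 'o \<Rightarrow> 'o \<Rightarrow> bool" where
  "ext_zero X A B \<longleftrightarrow> ext_cyc X A B \<subseteq> ext_bd X A B"

definition projective_in :: "('o, 'm::ab_group_add, 'k::field) ext_cat \<Rightarrow> 'o set \<Rightarrow> 'o \<Rightarrow> bool" where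
  "projective_in X S P \<longleftrightarrow> P \<in> S \<and> (\<forall>Y\<in>S. ext_zero X P Y)"

text \<open>
  A basic cluster tilting object, possibly with infinitely many summands, is represented up to
  isomorphism by the isomorphism-closed set of its indecomposable summands.
\<close>

definition cluster_tilting ::
  "('o, 'm::ab_group_add, 'k::field) ext_cat \<Rightarrow> 'o set \<Rightarrow> 'o set \<Rightarrow> bool" where
  "cluster_tilting X S T \<longleftrightarrow>
     T \<subseteq> S \<and> (\<forall>M\<in>T. indecomposable X M \<and> iso_class X M \<subseteq> T) \<and>
     (\<forall>M\<in>T. \<forall>N\<in>T. ext_zero X M N) \<and>
     (\<forall>Y\<in>S. (\<forall>M\<in>T. ext_zero X M Y) \<longrightarrow> Y \<in> add_closure X T) \<and>
     functorially_finite X (add_closure X T) S"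

definition replace ::
  "('o, 'm::ab_group_add, 'k::field) ext_cat \<Rightarrow> 'o set \<Rightarrow> 'o \<Rightarrow> 'o \<Rightarrow> 'o set" where
  "replace X T M N = (T - iso_class X M) \<union> iso_class X N"

definition exchangeable ::
  "('o, 'm::ab_group_add, 'k::field) ext_cat \<Rightarrow> 'o set \<Rightarrow> 'o set \<Rightarrow> 'o \<Rightarrow> 'o \<Rightarrow> bool" where
  "exchangeable X S T M N \<longleftrightarrow>
     cluster_tilting X S T \<and> M \<in> T \<and> \<not> projective_in X S M \<and>
     N \<in> S \<and> indecomposable X N \<and> \<not> isomorphic X M N \<and>
     cluster_tilting X S (replace X T M N)"

text \<open>
  A conflation \<open>N \<rightarrow> B \<rightarrow> M\<close> whose maps are minimal left and right approximations with respect to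
  \<open>\<X>\<close>.
\<close>

definition exchange_sequence ::
  "('o, 'm::ab_group_add, 'k::field) ext_cat \<Rightarrow> 'o set \<Rightarrow> 'o \<Rightarrow> 'o \<Rightarrow> bool" where
  "exchange_sequence X \<X> N M \<longleftrightarrow>
     (\<exists>f B g. cfl X N f B g M \<and>
        right_approx X \<X> B g M \<and> right_minimal X B g \<and>
        left_approx X \<X> N f B \<and> left_minimal X f B)"

definition weak_cluster_structure ::
  "('o, 'm::ab_group_add, 'k::field) ext_cat \<Rightarrow> 'o set \<Rightarrow> bool" where
  "weak_cluster_structure X S \<longleftrightarrow>
     (\<forall>T M. cluster_tilting X S T \<and> M \<in> T \<and> \<not> projective_in X S M \<longrightarrow>
        (\<exists>N. exchangeable X S T M N) \<and>
        (\<forall>N N'. exchangeable X S T M N \<and> exchangeable X S T M N' \<longrightarrow> isomorphic X N N') \<and>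
        (\<forall>N. exchangeable X S T M N \<longrightarrow>
           exchange_sequence X (add_closure X (T - iso_class X M)) N M \<and>
           exchange_sequence X (add_closure X (T - iso_class X M)) M N))"

definition rad :: "('o, 'm::ab_group_add, 'k, 'z) kcat_scheme \<Rightarrow> 'o \<Rightarrow> 'o \<Rightarrow> 'm set" where
  "rad K A B = {f \<in> hom K A B. \<forall>g\<in>hom K B A. is_iso K A A (idn K A - cmp K g f)}"

text \<open>The square of the radical of the category \<open>add T\<close>.\<close>

definition rad_sq ::
  "('o, 'm::ab_group_add, 'k::field, 'z) kcat_scheme \<Rightarrow> 'o set \<Rightarrow> 'o \<Rightarrow> 'o \<Rightarrow> 'm set" where
  "rad_sq K T A B = module.span (scl K)
     {cmp K g f | Y f g. Y \<in> add_closure K T \<and> f \<in> rad K A Y \<and> g \<in> rad K Y B}"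

text \<open>
  The number of arrows \<open>A \<rightarrow> B\<close> of the quiver of \<open>T\<close>. It is meaningful only if the space of irreducible
  maps is finite-dimensional, which \<open>finite_quiver\<close> demands.
\<close>

definition arrows ::
  "('o, 'm::ab_group_add, 'k::field, 'z) kcat_scheme \<Rightarrow> 'o set \<Rightarrow> 'o \<Rightarrow> 'o \<Rightarrow> nat" where
  "arrows K T A B = (THE n. quot_dim (scl K) (rad K A B) (rad_sq K T A B) n)"

definition finite_quiver ::
  "('o, 'm::ab_group_add, 'k::field) ext_cat \<Rightarrow> 'o set \<Rightarrow> 'o set \<Rightarrow> bool" where
  "finite_quiver X S T \<longleftrightarrow>
     (\<forall>A\<in>T. \<forall>B\<in>T. \<not> (projective_in X S A \<and> projective_in X S B) \<longrightarrow>
        (\<exists>n. quot_dim (scl X) (rad X A B) (rad_sq X T A B) n))"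

definition no_loops_or_2_cycles ::
  "('o, 'm::ab_group_add, 'k::field) ext_cat \<Rightarrow> 'o set \<Rightarrow> 'o set \<Rightarrow> bool" where
  "no_loops_or_2_cycles X S T \<longleftrightarrow>
     (\<forall>A\<in>T. \<not> projective_in X S A \<longrightarrow> arrows X T A A = 0) \<and>
     (\<forall>A\<in>T. \<forall>B\<in>T. \<not> (projective_in X S A \<and> projective_in X S B) \<longrightarrow>
        arrows X T A B = 0 \<or> arrows X T B A = 0)"

text \<open>The skew-symmetric matrix of the quiver of \<open>T\<close>, arrows between projectives discarded.\<close>

definition quiver_matrix ::
  "('o, 'm::ab_group_add, 'k::field) ext_cat \<Rightarrow> 'o set \<Rightarrow> 'o set \<Rightarrow> 'o \<Rightarrow> 'o \<Rightarrow> int" where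
  "quiver_matrix X S T A B =
     (if projective_in X S A \<and> projective_in X S B then 0
      else int (arrows X T A B) - int (arrows X T B A))"

text \<open>
  Fomin--Zelevinsky mutation in direction \<open>k\<close>, for index types in which several elements may stand for
  the same index; \<open>P i\<close> says that \<open>i\<close> stands for \<open>k\<close>.
\<close>

definition fz_mutation ::
  "('i \<Rightarrow> 'i \<Rightarrow> int) \<Rightarrow> ('i \<Rightarrow> bool) \<Rightarrow> 'i \<Rightarrow> 'i \<Rightarrow> 'i \<Rightarrow> int" where
  "fz_mutation b P k i j =
     (if P i \<or> P j then - b i j
      else b i j + (\<bar>b i k\<bar> * b k j + b i k * \<bar>b k j\<bar>) div 2)"

definition cluster_structure ::
  "('o, 'm::ab_group_add, 'k::field) ext_cat \<Rightarrow> 'o set \<Rightarrow> bool" where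
  "cluster_structure X S \<longleftrightarrow>
     weak_cluster_structure X S \<and>
     (\<forall>T. cluster_tilting X S T \<longrightarrow> finite_quiver X S T \<and> no_loops_or_2_cycles X S T) \<and>
     (\<forall>T M M'. exchangeable X S T M M' \<longrightarrow>
        (\<forall>A\<in>T. \<forall>B\<in>T. \<not> (projective_in X S A \<and> projective_in X S B) \<longrightarrow>
           quiver_matrix X S (replace X T M M')
               (if isomorphic X M A then M' else A) (if isomorphic X M B then M' else B) =
             fz_mutation (quiver_matrix X S T) (isomorphic X M) M A B))"

definition ct_edge ::
  "('o, 'm::ab_group_add, 'k::field) ext_cat \<Rightarrow> 'o set \<Rightarrow> 'o set \<Rightarrow> 'o set \<Rightarrow> bool" where
  "ct_edge X S T T' \<longleftrightarrow>
     cluster_tilting X S T \<and> cluster_tilting X S T' \<and>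
     (\<exists>M\<in>T. \<exists>M'\<in>T'. T - T' = iso_class X M \<and> T' - T = iso_class X M')"

text \<open>\<open>\<Delta>\<close> is a connected component of the cluster tilting graph of \<open>S\<close>.\<close>

definition ct_component ::
  "('o, 'm::ab_group_add, 'k::field) ext_cat \<Rightarrow> 'o set \<Rightarrow> 'o set set \<Rightarrow> bool" where
  "ct_component X S \<Delta> \<longleftrightarrow>
     (\<exists>T. cluster_tilting X S T \<and> \<Delta> = {T'. (ct_edge X S)\<^sup>*\<^sup>* T T'})"

definition component_subcat ::
  "('o, 'm::ab_group_add, 'k::field) ext_cat \<Rightarrow> 'o set set \<Rightarrow> 'o set" where
  "component_subcat X \<Delta> = add_closure X (\<Union>\<Delta>)"

definition ecard :: "'a set \<Rightarrow> enat" where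
  "ecard A = (if finite A then enat (card A) else \<infinity>)"

definition num_cluster_vars ::
  "('o, 'm::ab_group_add, 'k::field) ext_cat \<Rightarrow> 'o set \<Rightarrow> 'o set \<Rightarrow> enat" where
  "num_cluster_vars X S T = ecard (iso_class X ` {M\<in>T. \<not> projective_in X S M})"

definition num_coeffs ::
  "('o, 'm::ab_group_add, 'k::field) ext_cat \<Rightarrow> 'o set \<Rightarrow> 'o set \<Rightarrow> enat" where
  "num_coeffs X S T = ecard (iso_class X ` {M\<in>T. projective_in X S M})"

text \<open>
  The cluster tilting object \<open>T'\<close> of \<open>\<B>\<close> induces a substructure of \<open>X\<close> by means of the set \<open>\<A>\<close>.
\<close>

definition exchange_step ::
  "('o, 'm::ab_group_add, 'k::field) ext_cat \<Rightarrow> 'o set \<Rightarrow> 'o set \<Rightarrow> 'o set \<Rightarrow> bool" where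
  "exchange_step X S T T' \<longleftrightarrow> (\<exists>M N. exchangeable X S T M N \<and> T' = replace X T M N)"

definition induces_substructure ::
  "('o, 'm::ab_group_add, 'k::field) ext_cat \<Rightarrow> 'o set \<Rightarrow> 'o set \<Rightarrow> 'o set \<Rightarrow> bool" where
  "induces_substructure X \<B> T' \<A> \<longleftrightarrow>
     full_subcat X \<B> \<and> ext_closed X \<B> \<and>
     weak_cluster_structure X (ob X) \<and> weak_cluster_structure X \<B> \<and>
     cluster_tilting X \<B> T' \<and> (\<forall>M\<in>\<A>. indecomposable X M) \<and>
     (\<forall>T''. (exchange_step X \<B>)\<^sup>*\<^sup>* T' T'' \<longrightarrow> cluster_tilting X (ob X) (T'' \<union> iso_closure X \<A>))"


section \<open>Algebraic independence over the rationals\<close>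

definition is_subfield :: "'f::field set \<Rightarrow> bool" where
  "is_subfield K \<longleftrightarrow>
     0 \<in> K \<and> 1 \<in> K \<and> (\<forall>x\<in>K. \<forall>y\<in>K. x - y \<in> K \<and> x * y \<in> K) \<and> (\<forall>x\<in>K. inverse x \<in> K)"

definition is_subring :: "'f::ring_1 set \<Rightarrow> bool" where
  "is_subring R \<longleftrightarrow> 1 \<in> R \<and> (\<forall>x\<in>R. \<forall>y\<in>R. x - y \<in> R \<and> x * y \<in> R)"

text \<open>
  Polynomials over the rationals whose variables are elements of the field itself: a monomial is a
  finitely supported exponent function, and evaluation sends every variable to the element it is.
\<close>

definition eval_monom :: "('f::field_char_0 \<Rightarrow>\<^sub>0 nat) \<Rightarrow> 'f" where
  "eval_monom e = (\<Prod>x\<in>Poly_Mapping.keys e. x ^ Poly_Mapping.lookup e x)"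

definition eval_mpoly :: "(('f::field_char_0 \<Rightarrow>\<^sub>0 nat) \<Rightarrow>\<^sub>0 rat) \<Rightarrow> 'f" where
  "eval_mpoly p = (\<Sum>e\<in>Poly_Mapping.keys p. of_rat (Poly_Mapping.lookup p e) * eval_monom e)"

definition alg_independent :: "'f::field_char_0 set \<Rightarrow> bool" where
  "alg_independent S \<longleftrightarrow>
     (\<forall>p. (\<forall>e\<in>Poly_Mapping.keys p. Poly_Mapping.keys e \<subseteq> S) \<and> eval_mpoly p = 0 \<longrightarrow> p = 0)"

definition algebraic_over :: "'f::field set \<Rightarrow> 'f \<Rightarrow> bool" where
  "algebraic_over K x \<longleftrightarrow> (\<exists>p. p \<noteq> 0 \<and> (\<forall>i. coeff p i \<in> K) \<and> poly p x = 0)"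

definition transcendence_basis :: "'f::field_char_0 set \<Rightarrow> 'f set \<Rightarrow> bool" where
  "transcendence_basis F S \<longleftrightarrow>
     S \<subseteq> F \<and> alg_independent S \<and> (\<forall>x\<in>F. algebraic_over (is_subfield hull S) x)"

text \<open>\<open>F = \<rat>(u\<^sub>1, \<dots>, u\<^sub>m)\<close> inside an ambient field, where \<open>m = \<infinity>\<close> means countably many variables.\<close>

definition rational_function_field :: "'f::field_char_0 set \<Rightarrow> enat \<Rightarrow> bool" where
  "rational_function_field F m \<longleftrightarrow>
     (\<exists>u :: nat \<Rightarrow> 'f. inj_on u {i. enat i < m} \<and> alg_independent (u ` {i. enat i < m}) \<and>
        F = is_subfield hull (u ` {i. enat i < m}))"


section \<open>Cluster algebras\<close>

text \<open>
  The extended cluster of a seed consists of distinct field elements, so these elements serve as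
  row and column indices of the matrix: rows are indexed by \<open>cluster \<union> coeffs\<close>, columns by \<open>cluster\<close>,
  and entries outside this range are \<open>0\<close>.
\<close>

record 'f seed =
  cluster :: "'f set"
  coeffs :: "'f set"
  exmat :: "'f \<Rightarrow> 'f \<Rightarrow> int"

text \<open>
  Local finiteness is required of the columns, which is what mutation needs; for the rows of the
  skew-symmetric part it follows.
\<close>

definition is_seed :: "'f::field_char_0 set \<Rightarrow> 'f seed \<Rightarrow> bool" where
  "is_seed F S \<longleftrightarrow>
     cluster S \<inter> coeffs S = {} \<and> transcendence_basis F (cluster S \<union> coeffs S) \<and>
     (\<forall>x y. exmat S x y \<noteq> 0 \<longrightarrow> x \<in> cluster S \<union> coeffs S \<and> y \<in> cluster S) \<and>
     (\<forall>x\<in>cluster S. \<forall>y\<in>cluster S. exmat S x y = - exmat S y x) \<and>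
     (\<forall>y. finite {x. exmat S x y \<noteq> 0})"

definition new_var :: "'f::field_char_0 seed \<Rightarrow> 'f \<Rightarrow> 'f" where
  "new_var S z = inverse z *
     ((\<Prod>x\<in>{x. exmat S x z > 0}. x ^ nat (exmat S x z)) +
      (\<Prod>x\<in>{x. exmat S x z < 0}. x ^ nat (- exmat S x z)))"

definition mutate :: "'f::field_char_0 seed \<Rightarrow> 'f \<Rightarrow> 'f seed" where
  "mutate S z =
     (let z' = new_var S z;
          cl = insert z' (cluster S - {z});
          old = (\<lambda>x. if x = z' then z else x)
      in \<lparr>cluster = cl, coeffs = coeffs S,
          exmat = (\<lambda>x y. if x \<in> cl \<union> coeffs S \<and> y \<in> cl
                          then fz_mutation (exmat S) (\<lambda>x. x = z) z (old x) (old y) else 0)\<rparr>)"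

inductive_set mutation_class :: "'f::field_char_0 seed \<Rightarrow> 'f seed set" for S0 :: "'f seed" where
  initial: "S0 \<in> mutation_class S0"
| step: "S \<in> mutation_class S0 \<Longrightarrow> z \<in> cluster S \<Longrightarrow> mutate S z \<in> mutation_class S0"

text \<open>
  \<open>A\<close> is a cluster algebra in the rational function field \<open>F\<close>, with set of seeds \<open>\<S>\<close> and set of
  inverted coefficients \<open>c0\<close>.
\<close>

definition is_cluster_algebra ::
  "'f::field_char_0 set \<Rightarrow> 'f set \<Rightarrow> 'f seed set \<Rightarrow> 'f set \<Rightarrow> bool" where
  "is_cluster_algebra F A \<S> c0 \<longleftrightarrow>
     (\<exists>m. rational_function_field F m) \<and>
     (\<exists>S0. is_seed F S0 \<and> \<S> = mutation_class S0 \<and> c0 \<subseteq> coeffs S0 \<and>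
        A = is_subring hull (coeffs S0 \<union> inverse ` c0 \<union> (\<Union>S\<in>\<S>. cluster S)))"

text \<open>
  \<open>A'\<close> is a subcluster algebra of the cluster algebra with seeds \<open>\<S>\<close> and inverted coefficients \<open>c0\<close>.
  Its ambient field \<open>F'\<close> is usually smaller. Column \<open>y\<close> of the matrix records the arrows entering and
  leaving \<open>y\<close>.
\<close>

definition subcluster_algebra ::
  "'f::field_char_0 set \<Rightarrow> 'f seed set \<Rightarrow> 'f set \<Rightarrow> bool" where
  "subcluster_algebra A' \<S> c0 \<longleftrightarrow>
     (\<exists>F' \<S>' c0'. is_cluster_algebra F' A' \<S>' c0' \<and>
        (\<exists>S\<in>\<S>. \<exists>S'\<in>\<S>'.
           cluster S' \<subseteq> cluster S \<and> coeffs S' \<subseteq> cluster S \<union> coeffs S \<and>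
           (\<forall>y\<in>cluster S'. \<forall>x. exmat S' x y = exmat S x y) \<and>
           c0 \<inter> coeffs S' \<subseteq> c0'))"


section \<open>Cluster maps\<close>

definition ext_dim_1 :: "('o, 'm::ab_group_add, 'k::field) ext_cat \<Rightarrow> 'o \<Rightarrow> 'o \<Rightarrow> bool" where
  "ext_dim_1 X A B \<longleftrightarrow> quot_dim (scl X) (ext_cyc X A B) (ext_bd X A B) 1"

definition nonsplit_cfl ::
  "('o, 'm::ab_group_add, 'k::field) ext_cat \<Rightarrow> 'o \<Rightarrow> 'o \<Rightarrow> 'o \<Rightarrow> bool" where
  "nonsplit_cfl X A B C \<longleftrightarrow>
     (\<exists>f g. cfl X A f B g C \<and> \<not> (\<exists>s\<in>hom X C B. cmp X g s = idn X C))"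

text \<open>
  Only the values of \<open>\<phi>\<close> on \<open>component_subcat X \<Delta>\<close> matter; in particular the exchange relation is
  imposed only if both middle terms lie there. For infinitely many summands, \<open>\<phi>(T)\<close> being a
  transcendence basis has to be read for the family of images, so \<open>\<phi>\<close> separates the
  non-isomorphic summands of \<open>T\<close>. One \<open>T\<close> in \<open>\<Delta>\<close> is enough.
\<close>

definition cluster_map ::
  "('o, 'm::ab_group_add, 'k::field) ext_cat \<Rightarrow> 'o set \<Rightarrow> 'o set set \<Rightarrow>
   ('o \<Rightarrow> 'f::field_char_0) \<Rightarrow> 'f set \<Rightarrow> bool" where
  "cluster_map X S \<Delta> \<phi> F \<longleftrightarrow>
     (let \<E> = component_subcat X \<Delta> in
        \<phi> ` \<E> \<subseteq> F \<and>
        (\<forall>A\<in>\<E>. \<forall>B\<in>\<E>. isomorphic X A B \<longrightarrow> \<phi> A = \<phi> B) \<and>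
        (\<exists>T\<in>\<Delta>. (\<forall>M\<in>T. \<forall>N\<in>T. \<phi> M = \<phi> N \<longrightarrow> isomorphic X M N) \<and>
           transcendence_basis F (\<phi> ` T)) \<and>
        (\<forall>M\<in>\<E>. \<forall>N\<in>\<E>. \<forall>V\<in>\<E>. \<forall>V'\<in>\<E>.
           indecomposable X M \<and> indecomposable X N \<and> ext_dim_1 X M N \<and>
           nonsplit_cfl X N V M \<and> nonsplit_cfl X M V' N \<longrightarrow> \<phi> M * \<phi> N = \<phi> V + \<phi> V') \<and>
        (\<forall>A\<in>\<E>. \<forall>A'\<in>\<E>. \<forall>Y\<in>\<E>. biproduct X A A' Y \<longrightarrow> \<phi> Y = \<phi> A * \<phi> A'))"

text \<open>The seed \<open>(\<phi>(T), B)\<close>, where \<open>B\<close> is the matrix of the quiver of \<open>T\<close> without projective columns.\<close>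

definition seed_of ::
  "('o, 'm::ab_group_add, 'k::field) ext_cat \<Rightarrow> 'o set \<Rightarrow> ('o \<Rightarrow> 'f) \<Rightarrow> 'o set \<Rightarrow> 'f seed" where
  "seed_of X S \<phi> T =
     (let summand = (\<lambda>x. SOME M. M \<in> T \<and> \<phi> M = x);
          cl = \<phi> ` {M\<in>T. \<not> projective_in X S M};
          co = \<phi> ` {M\<in>T. projective_in X S M}
      in \<lparr>cluster = cl, coeffs = co,
          exmat = (\<lambda>x y. if x \<in> cl \<union> co \<and> y \<in> cl
                          then quiver_matrix X S T (summand x) (summand y) else 0)\<rparr>)"

end

theory Submission
  imports Defs "HOL-Library.Countable_Set"
begin

text \<open>
  If \<open>M\<close> is exchanged for \<open>N\<close> in a cluster tilting object \<open>T\<close>, the maps in the conflations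
  \<open>N \<rightarrow> B \<rightarrow> M\<close> and \<open>M \<rightarrow> B' \<rightarrow> N\<close> are minimal approximations by \<open>add (T - M)\<close>. As the quiver has no
  loop at \<open>M\<close>, Nakayama's lemma in the finite-dimensional algebra \<open>End(M)\<close> modulo the maps through \<open>B\<close> shows
  that every radical endomorphism of \<open>M\<close> factors through \<open>B\<close>. Hence \<open>Ext(M,N) = End(M)/rad = k\<close>, so that
  the exchange relation \<open>\<phi>(M) \<phi>(N) = \<phi>(B) + \<phi>(B')\<close> is available, and the multiplicity of \<open>A\<close> in \<open>B\<close>
  (in \<open>B'\<close>) is the number of arrows \<open>A \<rightarrow> M\<close> (\<open>M \<rightarrow> A\<close>). Therefore \<open>\<phi>(N)\<close> is the new variable of the seed
  mutation at \<open>\<phi>(M)\<close>, and the component \<open>\<Delta>\<close> is mapped onto a mutation class.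

  For a substructure given by \<open>\<B>\<close> and \<open>\<A>\<close>, an exchange of \<open>M\<close> for \<open>N\<close> in \<open>\<B>\<close> is also an exchange
  after adding \<open>\<A>\<close>. The middle terms of its conflations in \<open>\<B>\<close> are approximations in the big category too,
  because \<open>N\<close> has no extensions with the remaining summands. So the column of \<open>\<phi>(M)\<close> is supported on the
  summands that lie in \<open>\<B>\<close>, and the restricted seeds mutate compatibly.
\<close>

section \<open>Dimensions of quotient spaces\<close>

text \<open>In a Frobenius category only stable hom spaces need be finite-dimensional. So dimensions
  are always taken modulo a subspace, and finiteness of \<open>End(M)\<close> enters through maps
  that factor through projectives. Such maps also factor through the middle terms of exchange
  conflations, because projectives have no extensions with \<open>N\<close>; this makes Nakayama's
  lemma applicable. The residue field is \<open>k\<close> because \<open>k\<close> is algebraically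
  closed.

  Exact and triangulated categories are treated at once: \<open>extension_category\<close> records
  the consequences of long exact sequences and of the 2-Calabi--Yau condition that the exchange
  argument rests on.

  A cluster map gives a transcendence basis at one vertex of \<Delta> only. This spreads along
  edges, since replacing \<open>z\<close> by \<open>q/z\<close>, with \<open>q\<close> a nonzero
  polynomial in the other variables, preserves algebraic independence.

  A substructure has only a weak cluster structure on \<open>\<B>\<close>, so quiver mutation is not
  known there. Its seeds are cut out of seeds of the big category (\<open>subseed\<close>), and both
  halves of the theorem rest on one statement about such restricted seeds.\<close>

context vector_space begin

text \<open>Modulo \<open>W\<close> the \<open>n + 1\<close> vectors lie in the span of
  \<open>n\<close> vectors, which forces a relation. Representatives that coincide give one at once;
  they are split off because dependence of a set does not see repetitions.\<close>

lemma quot_dim_dependent: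
  assumes W: "subspace W" and q: "quot_dim scale V W n" and v: "\<And>i. i \<le> n \<Longrightarrow> v i \<in> V"
  obtains c where "\<exists>i\<le>n. c i \<noteq> 0" "(\<Sum>i\<le>n. c i *s v i) \<in> W"
proof -
  from q obtain B where B: "finite B" "card B = n"
    "\<And>v. v \<in> V \<Longrightarrow> \<exists>c. v - (\<Sum>b\<in>B. c b *s b) \<in> W" unfolding quot_dim_def by metis
  have "\<forall>i. \<exists>a. i \<le> n \<longrightarrow> v i - (\<Sum>b\<in>B. a b *s b) \<in> W" using B(3) v by blast
  then obtain a where a: "\<And>i. i \<le> n \<Longrightarrow> v i - (\<Sum>b\<in>B. a i b *s b) \<in> W" by metis
  define w where "w i = (\<Sum>b\<in>B. a i b *s b)" for i
  have w: "w i \<in> span B" for i unfolding w_def by (intro span_sum span_scale span_base)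
  have fin: "(\<Sum>i\<le>n. c i *s v i) \<in> W" if "(\<Sum>i\<le>n. c i *s w i) = 0" for c
  proof -
    have "(\<Sum>i\<le>n. c i *s (v i - w i)) \<in> W"
      using a W by (auto intro!: subspace_sum subspace_scale simp: w_def)
    moreover have "(\<Sum>i\<le>n. c i *s (v i - w i)) = (\<Sum>i\<le>n. c i *s v i)"
      using that by (simp add: scale_right_diff_distrib sum_subtractf)
    ultimately show ?thesis by simp
  qed
  show ?thesis
  proof (cases "inj_on w {..n}")
    case False
    then obtain i j where ij: "i \<le> n" "j \<le> n" "i \<noteq> j" "w i = w j" by (auto simp: inj_on_def)
    define c where "c = (\<lambda>k. if k = i then 1 else if k = j then - 1 else (0::'a))"
    have "(\<Sum>k\<le>n. c k *s w k) = (\<Sum>k\<in>{i,j}. c k *s w k)"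
      by (rule sum.mono_neutral_right) (use ij in \<open>auto simp: c_def\<close>)
    also have "\<dots> = 0" using ij by (simp add: c_def)
    finally have "(\<Sum>k\<le>n. c k *s v k) \<in> W" by (rule fin)
    moreover have "\<exists>i\<le>n. c i \<noteq> 0" using ij by (auto simp: c_def)
    ultimately show ?thesis using that by blast
  next
    case True
    have "dependent (w ` {..n})"
    proof (rule ccontr)
      assume "\<not> dependent (w ` {..n})"
      then have "card (w ` {..n}) \<le> card B" using independent_span_bound[OF B(1)] w by blast
      then show False using True B(2) by (simp add: card_image)
    qed
    then obtain u x where u: "(\<Sum>x\<in>w ` {..n}. u x *s x) = 0" "x \<in> w ` {..n}" "u x \<noteq> 0"
      unfolding dependent_finite[OF finite_imageI[OF finite_atMost]] by blast
    have "(\<Sum>i\<le>n. u (w i) *s w i) = 0" using u(1) by (simp add: sum.reindex[OF True])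
    then show ?thesis using that[of "\<lambda>i. u (w i)"] fin[of "\<lambda>i. u (w i)"] u by auto
  qed
qed

text \<open>This is what allows \<open>arrows\<close>, a definite description, to be evaluated. If
  one basis were larger than the other, \<open>quot_dim_dependent\<close> would give a relation
  inside it.\<close>

lemma quot_dim_unique:
  assumes W: "subspace W" and q: "quot_dim scale V W n" and q': "quot_dim scale V W n'"
  shows "n = n'"
proof -
  have *: "a \<le> b" if q: "quot_dim scale V W a" and q': "quot_dim scale V W b" for a b
  proof (rule ccontr)
    assume "\<not> a \<le> b"
    then have ab: "b < a" by simp
    from q obtain B where B: "B \<subseteq> V" "finite B" "card B = a"
      "\<And>c. (\<Sum>b\<in>B. c b *s b) \<in> W \<Longrightarrow> \<forall>b\<in>B. c b = 0" unfolding quot_dim_def by metis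
    obtain h where h: "bij_betw h {..<a} B"
      using ex_bij_betw_nat_finite[OF B(2)] B(3) by (auto simp: atLeast0LessThan)
    have hi: "inj_on h {..b}" using h ab by (auto simp: bij_betw_def inj_on_def)
    have hB: "h i \<in> B" if "i \<le> b" for i using h ab that by (auto simp: bij_betw_def)
    obtain c where c: "\<exists>i\<le>b. c i \<noteq> 0" "(\<Sum>i\<le>b. c i *s h i) \<in> W"
      using quot_dim_dependent[OF W q', of h] hB B(1) by blast
    define d where "d x = (if x \<in> h ` {..b} then c (the_inv_into {..b} h x) else 0)" for x
    have dh: "d (h i) = c i" if "i \<le> b" for i
      using the_inv_into_f_f[of h "{..b}" i] hi that by (auto simp: d_def)
    have "(\<Sum>x\<in>B. d x *s x) = (\<Sum>x\<in>h ` {..b}. d x *s x)"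
      by (rule sum.mono_neutral_right) (use B(2) hB in \<open>auto simp: d_def\<close>)
    also have "\<dots> = (\<Sum>i\<le>b. c i *s h i)" using hi dh by (simp add: sum.reindex)
    finally have "(\<Sum>x\<in>B. d x *s x) \<in> W" using c(2) by simp
    from B(4)[OF this] have "c i = 0" if "i \<le> b" for i using dh[OF that] hB[OF that] by simp
    then show False using c(1) by blast
  qed
  show ?thesis using *[OF q q'] *[OF q' q] by simp
qed

lemma quot_dim_0: "quot_dim scale V W 0 \<longleftrightarrow> V \<subseteq> W"
proof
  assume "quot_dim scale V W 0"
  then show "V \<subseteq> W" unfolding quot_dim_def by (auto simp: card_eq_0_iff)
next
  assume "V \<subseteq> W"
  then show "quot_dim scale V W 0" unfolding quot_dim_def by (intro exI[of _ "{}"]) auto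
qed

lemma quot_dim_1I:
  assumes "v \<in> V" "v \<notin> W" "subspace W" "\<And>x. x \<in> V \<Longrightarrow> \<exists>a. x - a *s v \<in> W"
  shows "quot_dim scale V W 1"
  unfolding quot_dim_def
proof (intro exI[of _ "{v}"] conjI allI ballI impI)
  fix c b assume "(\<Sum>b\<in>{v}. c b *s b) \<in> W" "b \<in> {v}"
  then have cv: "c v *s v \<in> W" "b = v" by auto
  have "c v = 0"
  proof (rule ccontr)
    assume "c v \<noteq> 0"
    then have "v = inverse (c v) *s (c v *s v)" by simp
    then show False using subspace_scale[OF assms(3) cv(1)] assms(2) by metis
  qed
  then show "c b = 0" using cv by simp
next
  fix x assume "x \<in> V"
  then obtain a where "x - a *s v \<in> W" using assms(4) by blast
  then show "\<exists>c. x - (\<Sum>b\<in>{v}. c b *s b) \<in> W" by (intro exI[of _ "\<lambda>_. a"]) simp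
qed (use assms in auto)

text \<open>Numbered families, unlike the sets in \<open>quot_dim\<close>, can be carried along
  linear maps without regard to coincidences. Independence modulo \<open>W\<close> makes the family
  injective, so its image has the right cardinality.\<close>

lemma quot_dim_lessThanI:
  fixes v :: "nat \<Rightarrow> 'b"
  assumes V: "\<And>i. i < n \<Longrightarrow> v i \<in> V" and W: "subspace W"
    and ind: "\<And>c i. (\<Sum>i<n. c i *s v i) \<in> W \<Longrightarrow> i < n \<Longrightarrow> c i = 0"
    and sp: "\<And>x. x \<in> V \<Longrightarrow> \<exists>c. x - (\<Sum>i<n. c i *s v i) \<in> W"
  shows "quot_dim scale V W n"
proof -
  have inj: "inj_on v {..<n}"
  proof (rule inj_onI, rule ccontr)
    fix i j assume ij: "i \<in> {..<n}" "j \<in> {..<n}" "v i = v j" "i \<noteq> j"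
    define c where "c = (\<lambda>k. if k = i then 1 else if k = j then - 1 else (0::'a))"
    have "(\<Sum>k<n. c k *s v k) = (\<Sum>k\<in>{i,j}. c k *s v k)"
      by (rule sum.mono_neutral_right) (use ij in \<open>auto simp: c_def\<close>)
    also have "\<dots> = 0" using ij by (simp add: c_def)
    finally show False using ind[of c i] ij W by (auto simp: c_def subspace_0)
  qed
  show ?thesis unfolding quot_dim_def
  proof (intro exI[of _ "v ` {..<n}"] conjI allI ballI impI)
    show "card (v ` {..<n}) = n" using inj by (simp add: card_image)
    fix c b assume "(\<Sum>b\<in>v ` {..<n}. c b *s b) \<in> W" "b \<in> v ` {..<n}"
    then show "c b = 0" using ind[of "\<lambda>i. c (v i)"] by (auto simp: sum.reindex[OF inj])
  next
    fix x assume "x \<in> V"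
    then obtain c where c: "x - (\<Sum>i<n. c i *s v i) \<in> W" using sp by blast
    have "(\<Sum>b\<in>v ` {..<n}. c (the_inv_into {..<n} v b) *s b) = (\<Sum>i<n. c i *s v i)"
      by (simp add: sum.reindex[OF inj] the_inv_into_f_f[OF inj])
    then show "\<exists>c. x - (\<Sum>b\<in>v ` {..<n}. c b *s b) \<in> W" using c by metis
  qed (use V in auto)
qed

end

lemma (in vector_space) quot_dim_lessThanD:
  assumes "quot_dim scale V W n"
  shows "\<exists>v :: nat \<Rightarrow> 'b. (\<forall>i<n. v i \<in> V) \<and>
    (\<forall>c. (\<Sum>i<n. c i *s v i) \<in> W \<longrightarrow> (\<forall>i<n. c i = 0)) \<and>
    (\<forall>x\<in>V. \<exists>c. x - (\<Sum>i<n. c i *s v i) \<in> W)"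
proof -
  from assms obtain B where B': "B \<subseteq> V \<and> finite B \<and> card B = n \<and>
        (\<forall>c. (\<Sum>b\<in>B. c b *s b) \<in> W \<longrightarrow> (\<forall>b\<in>B. c b = 0)) \<and>
        (\<forall>v\<in>V. \<exists>c. v - (\<Sum>b\<in>B. c b *s b) \<in> W)" unfolding quot_dim_def by (rule exE)
  have B: "B \<subseteq> V" "finite B" "card B = n" using B' by simp_all
  have B4: "\<forall>b\<in>B. c b = 0" if "(\<Sum>b\<in>B. c b *s b) \<in> W" for c using B' that by blast
  have B5: "\<exists>c. v - (\<Sum>b\<in>B. c b *s b) \<in> W" if "v \<in> V" for v using B' that by blast
  obtain h where h: "bij_betw h {..<n} B"
    using ex_bij_betw_nat_finite[OF B(2)] B(3) by (auto simp: atLeast0LessThan)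
  have inj: "inj_on h {..<n}" and Bh: "B = h ` {..<n}" using h by (auto simp: bij_betw_def)
  have 2: "\<forall>c. (\<Sum>i<n. c i *s h i) \<in> W \<longrightarrow> (\<forall>i<n. c i = 0)"
  proof (intro allI impI)
    fix c i assume c: "(\<Sum>i<n. c i *s h i) \<in> W" and i: "i < n"
    have "(\<Sum>b\<in>B. c (the_inv_into {..<n} h b) *s b) = (\<Sum>i<n. c i *s h i)"
      by (simp add: Bh sum.reindex[OF inj] the_inv_into_f_f[OF inj])
    then have "(\<Sum>b\<in>B. c (the_inv_into {..<n} h b) *s b) \<in> W" using c by simp
    from B4[OF this] have "c (the_inv_into {..<n} h (h i)) = 0" using i Bh by blast
    then show "c i = 0" using i by (simp add: the_inv_into_f_f[OF inj])
  qed
  have 3: "\<forall>x\<in>V. \<exists>c. x - (\<Sum>i<n. c i *s h i) \<in> W"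
  proof
    fix x assume "x \<in> V"
    from B5[OF this] obtain c where "x - (\<Sum>b\<in>B. c b *s b) \<in> W" by blast
    then show "\<exists>c. x - (\<Sum>i<n. c i *s h i) \<in> W"
      by (intro exI[of _ "\<lambda>i. c (h i)"]) (simp add: Bh sum.reindex[OF inj])
  qed
  have 1: "\<forall>i<n. h i \<in> V" using B(1) Bh by auto
  show ?thesis by (rule exI[of _ h], rule conjI[OF 1 conjI[OF 2 3]])
qed

text \<open>The conditions say that \<theta> induces an isomorphism of \<open>V\<close> modulo
  \<open>W\<close> onto \<open>V'\<close> modulo \<open>W'\<close>. Linearity is asked on
  \<open>V\<close> only, since composition with a fixed morphism is linear on a hom space but not on
  the whole type of morphisms.\<close>

lemma (in vector_space) quot_dim_transfer:
  assumes q: "quot_dim scale V W n" and V: "subspace V" and W': "subspace W'"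
    and map: "\<And>x. x \<in> V \<Longrightarrow> \<theta> x \<in> V'"
    and add: "\<And>x y. x \<in> V \<Longrightarrow> y \<in> V \<Longrightarrow> \<theta> (x + y) = \<theta> x + \<theta> y"
    and scale: "\<And>a x. x \<in> V \<Longrightarrow> \<theta> (a *s x) = a *s \<theta> x"
    and ker: "\<And>x. x \<in> V \<Longrightarrow> \<theta> x \<in> W' \<longleftrightarrow> x \<in> W"
    and surj: "\<And>y. y \<in> V' \<Longrightarrow> \<exists>x\<in>V. y - \<theta> x \<in> W'"
  shows "quot_dim scale V' W' n"
proof -
  obtain v :: "nat \<Rightarrow> 'b" where v': "(\<forall>i<n. v i \<in> V) \<and>
    (\<forall>c. (\<Sum>i<n. c i *s v i) \<in> W \<longrightarrow> (\<forall>i<n. c i = 0)) \<and>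
    (\<forall>x\<in>V. \<exists>c. x - (\<Sum>i<n. c i *s v i) \<in> W)" using quot_dim_lessThanD[OF q] by (rule exE)
  have v: "i < n \<Longrightarrow> v i \<in> V" "(\<Sum>i<n. c i *s v i) \<in> W \<Longrightarrow> i < n \<Longrightarrow> c i = 0"
    "x \<in> V \<Longrightarrow> \<exists>c. x - (\<Sum>i<n. c i *s v i) \<in> W" for i c x using v' by simp_all
  have \<theta>0: "\<theta> 0 = 0" using scale[of 0 0] V by (simp add: subspace_0)
  have lin: "(\<Sum>i<k. c i *s v i) \<in> V \<and> \<theta> (\<Sum>i<k. c i *s v i) = (\<Sum>i<k. c i *s \<theta> (v i))" if "k \<le> n" for c k
    using that
  proof (induction k)
    case 0 then show ?case using V \<theta>0 by (simp add: subspace_0)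
  next
    case (Suc k)
    then show ?case using v(1) V by (simp add: add scale subspace_add subspace_scale)
  qed
  have diff: "\<theta> (x - y) = \<theta> x - \<theta> y" if "x \<in> V" "y \<in> V" for x y
    using add[of "x - y" y] that V by (simp add: subspace_diff)
  show ?thesis
  proof (rule quot_dim_lessThanI[of n "\<lambda>i. \<theta> (v i)"])
    show "\<theta> (v i) \<in> V'" if "i < n" for i using map v(1) that by blast
    show "c i = 0" if "(\<Sum>i<n. c i *s \<theta> (v i)) \<in> W'" "i < n" for c i
      using that lin[of n c] ker[of "\<Sum>i<n. c i *s v i"] v(2)[of c i] by simp
    show "\<exists>c. y - (\<Sum>i<n. c i *s \<theta> (v i)) \<in> W'" if yV: "y \<in> V'" for y
    proof -
      from surj[OF yV] obtain x where x: "x \<in> V" "y - \<theta> x \<in> W'" by blast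
      from v(3)[OF x(1)] obtain c where c: "x - (\<Sum>i<n. c i *s v i) \<in> W" by blast
      have "\<theta> x - (\<Sum>i<n. c i *s \<theta> (v i)) \<in> W'"
        using ker[of "x - (\<Sum>i<n. c i *s v i)"] c lin[of n c] x(1) V by (simp add: diff subspace_diff)
      from subspace_add[OF W' x(2) this] show ?thesis by (intro exI[of _ c]) simp
    qed
  qed (rule W')
qed


text \<open>A longest family in \<open>V'\<close> that is independent modulo \<open>W'\<close>
  exists, because \<open>n + 1\<close> vectors of \<open>V\<close> are dependent modulo
  \<open>W\<close> and hence modulo \<open>W'\<close>; being longest, it spans.\<close>

lemma (in vector_space) quot_dim_subquotient:
  assumes q: "quot_dim scale V W n" and W: "subspace W" and W': "subspace W'" and V': "subspace V'"
    and sub: "V' \<subseteq> V" "W \<subseteq> W'"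
  shows "\<exists>m. quot_dim scale V' W' m"
proof -
  define P where "P m \<longleftrightarrow> (\<exists>v :: nat \<Rightarrow> 'b. (\<forall>i<m. v i \<in> V') \<and> (\<forall>c. (\<Sum>i<m. c i *s v i) \<in> W' \<longrightarrow> (\<forall>i<m. c i = 0)))" for m
  have bound: "m \<le> n" if Pm: "P m" for m
  proof (rule ccontr)
    assume m: "\<not> m \<le> n"
    from Pm obtain v :: "nat \<Rightarrow> 'b" where v: "\<And>i. i < m \<Longrightarrow> v i \<in> V'"
      and ind: "\<forall>c. (\<Sum>i<m. c i *s v i) \<in> W' \<longrightarrow> (\<forall>i<m. c i = 0)" unfolding P_def by blast
    obtain c where c: "\<exists>i\<le>n. c i \<noteq> 0" "(\<Sum>i\<le>n. c i *s v i) \<in> W"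
      using quot_dim_dependent[OF W q, of v] v m sub(1) by (metis le_less_trans not_le subsetD)
    define d where "d i = (if i \<le> n then c i else 0)" for i
    have "(\<Sum>i<m. d i *s v i) = (\<Sum>i\<le>n. d i *s v i)"
      by (rule sum.mono_neutral_right) (use m in \<open>auto simp: d_def\<close>)
    also have "\<dots> = (\<Sum>i\<le>n. c i *s v i)" by (simp add: d_def)
    finally have "(\<Sum>i<m. d i *s v i) \<in> W'" using c(2) sub(2) by auto
    with ind have d0: "\<forall>i<m. d i = 0" by blast
    from c(1) obtain i where "i \<le> n" "c i \<noteq> 0" by blast
    then show False using d0[rule_format, of i] m by (simp add: d_def)
  qed
  have P0: "P 0" by (simp add: P_def)
  define m where "m = (GREATEST m. P m)"
  have Pm: "P m" unfolding m_def using GreatestI_nat[of P 0 n] P0 bound by blast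
  have nP: "\<not> P (Suc m)" using Greatest_le_nat[of P "Suc m" n] bound unfolding m_def by auto
  from Pm obtain v :: "nat \<Rightarrow> 'b" where v: "\<And>i. i < m \<Longrightarrow> v i \<in> V'"
      and ind: "\<forall>c. (\<Sum>i<m. c i *s v i) \<in> W' \<longrightarrow> (\<forall>i<m. c i = 0)" unfolding P_def by blast
  have "quot_dim scale V' W' m"
  proof (rule quot_dim_lessThanI[of m v])
    show "c i = 0" if "(\<Sum>i<m. c i *s v i) \<in> W'" "i < m" for c i using ind that by blast
    show "\<exists>c. x - (\<Sum>i<m. c i *s v i) \<in> W'" if x: "x \<in> V'" for x
    proof -
      have "\<exists>c. (\<Sum>i<Suc m. c i *s (v(m := x)) i) \<in> W' \<and> \<not> (\<forall>i<Suc m. c i = 0)"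
      proof (rule ccontr)
        assume "\<nexists>c. (\<Sum>i<Suc m. c i *s (v(m := x)) i) \<in> W' \<and> \<not> (\<forall>i<Suc m. c i = 0)"
        moreover have "\<forall>i<Suc m. (v(m := x)) i \<in> V'" using v x by (auto simp: less_Suc_eq)
        ultimately have "P (Suc m)" unfolding P_def by blast
        then show False using nP by blast
      qed
      then obtain c where c: "(\<Sum>i<Suc m. c i *s (v(m := x)) i) \<in> W'" "\<not> (\<forall>i<Suc m. c i = 0)" by blast
      have s: "(\<Sum>i<m. c i *s v i) + c m *s x \<in> W'" using c(1) by simp
      \<comment> \<open>A relation without \<open>x\<close> would contradict the independence of the
        first \<open>m\<close> vectors.\<close>
      have cm: "c m \<noteq> 0"
      proof
        assume "c m = 0"
        then have "\<forall>i<m. c i = 0" using s ind by simp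
        then show False using c(2) \<open>c m = 0\<close> by (auto simp: less_Suc_eq)
      qed
      have "inverse (c m) *s ((\<Sum>i<m. c i *s v i) + c m *s x) \<in> W'" using W' s by (rule subspace_scale)
      moreover have "inverse (c m) *s ((\<Sum>i<m. c i *s v i) + c m *s x) = x - (\<Sum>i<m. (- inverse (c m) * c i) *s v i)"
        using cm by (simp add: scale_right_distrib scale_sum_right sum_negf)
      ultimately show ?thesis by (intro exI[of _ "\<lambda>i. - inverse (c m) * c i"]) simp
    qed
  qed (use v W' in auto)
  then show ?thesis by blast
qed

section \<open>Linear Krull--Schmidt categories\<close>

locale linear_category =
  fixes K :: "('o, 'm::ab_group_add, 'k::field, 'z) kcat_scheme"
  assumes lin: "lin_cat K"
begin

sublocale vs: vector_space "scl K"
  using lin by (simp add: lin_cat_def)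

abbreviation comp (infixl "\<cdot>" 70) where "g \<cdot> f \<equiv> cmp K g f"

text \<open>The axioms of \<open>lin_cat\<close> constrain \<open>hom\<close> and \<open>cmp\<close>
  at objects only, so membership in a hom set is of no use unless both ends are known to be
  objects.\<close>

definition arr :: "'o \<Rightarrow> 'o \<Rightarrow> 'm \<Rightarrow> bool" where
  "arr A B f \<longleftrightarrow> A \<in> ob K \<and> B \<in> ob K \<and> f \<in> hom K A B"

lemma arrD: assumes "arr A B f" shows "A \<in> ob K" "B \<in> ob K" "f \<in> hom K A B"
  using assms by (auto simp: arr_def)

lemma subspace_hom: "A \<in> ob K \<Longrightarrow> B \<in> ob K \<Longrightarrow> vs.subspace (hom K A B)"
  using lin by (simp add: lin_cat_def)

lemma arr_id [intro]: "A \<in> ob K \<Longrightarrow> arr A A (idn K A)"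
  using lin by (auto simp: lin_cat_def arr_def)

lemma arr_cmp [intro]: "arr A B f \<Longrightarrow> arr B C g \<Longrightarrow> arr A C (g \<cdot> f)"
  using lin unfolding lin_cat_def arr_def by blast

lemma arr_zero [intro]: "A \<in> ob K \<Longrightarrow> B \<in> ob K \<Longrightarrow> arr A B 0"
  by (simp add: arr_def vs.subspace_0 subspace_hom)

lemma arr_add [intro]: "arr A B f \<Longrightarrow> arr A B g \<Longrightarrow> arr A B (f + g)"
  by (simp add: arr_def vs.subspace_add subspace_hom)

lemma arr_diff [intro]: "arr A B f \<Longrightarrow> arr A B g \<Longrightarrow> arr A B (f - g)"
  by (simp add: arr_def vs.subspace_diff subspace_hom)

lemma arr_neg [intro]: "arr A B f \<Longrightarrow> arr A B (- f)"
  by (simp add: arr_def vs.subspace_neg subspace_hom)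

lemma arr_scl [intro]: "arr A B f \<Longrightarrow> arr A B (scl K a f)"
  by (simp add: arr_def vs.subspace_scale subspace_hom)

lemma arr_sum [intro]:
  "A \<in> ob K \<Longrightarrow> B \<in> ob K \<Longrightarrow> (\<And>i. i \<in> I \<Longrightarrow> arr A B (f i)) \<Longrightarrow> arr A B (\<Sum>i\<in>I. f i)"
  by (simp add: arr_def vs.subspace_sum subspace_hom)

lemma id_left [simp]: "arr A B f \<Longrightarrow> idn K B \<cdot> f = f"
  and id_right [simp]: "arr A B f \<Longrightarrow> f \<cdot> idn K A = f"
  using lin by (auto simp: lin_cat_def arr_def)

lemma assoc:
  assumes "arr A B f" "arr B C g" "arr C D h" shows "(h \<cdot> g) \<cdot> f = h \<cdot> (g \<cdot> f)"
proof -
  have "\<forall>A\<in>ob K. \<forall>B\<in>ob K. \<forall>C\<in>ob K. \<forall>D\<in>ob K. \<forall>f\<in>hom K A B. \<forall>g\<in>hom K B C. \<forall>h\<in>hom K C D.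
      h \<cdot> (g \<cdot> f) = (h \<cdot> g) \<cdot> f"
    using lin unfolding lin_cat_def by (elim conjE)
  then have "h \<cdot> (g \<cdot> f) = (h \<cdot> g) \<cdot> f" using assms unfolding arr_def by blast
  then show ?thesis by simp
qed

lemma cmp_bilinear:
  assumes "arr A B f" "arr A B f'" "arr B C g" "arr B C g'"
  shows "g \<cdot> (f + f') = g \<cdot> f + g \<cdot> f' \<and> (g + g') \<cdot> f = g \<cdot> f + g' \<cdot> f \<and>
    g \<cdot> scl K a f = scl K a (g \<cdot> f) \<and> scl K a g \<cdot> f = scl K a (g \<cdot> f)"
proof -
  have "\<forall>A\<in>ob K. \<forall>B\<in>ob K. \<forall>C\<in>ob K.
        \<forall>f\<in>hom K A B. \<forall>f'\<in>hom K A B. \<forall>g\<in>hom K B C. \<forall>g'\<in>hom K B C. \<forall>a.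
          g \<cdot> (f + f') = g \<cdot> f + g \<cdot> f' \<and> (g + g') \<cdot> f = g \<cdot> f + g' \<cdot> f \<and>
          g \<cdot> scl K a f = scl K a (g \<cdot> f) \<and> scl K a g \<cdot> f = scl K a (g \<cdot> f)"
    using lin unfolding lin_cat_def by (elim conjE)
  then show ?thesis using assms unfolding arr_def by blast
qed

lemma cmp_add_right: "arr A B f \<Longrightarrow> arr A B f' \<Longrightarrow> arr B C g \<Longrightarrow> g \<cdot> (f + f') = g \<cdot> f + g \<cdot> f'"
  and cmp_add_left: "arr A B f \<Longrightarrow> arr B C g \<Longrightarrow> arr B C g' \<Longrightarrow> (g + g') \<cdot> f = g \<cdot> f + g' \<cdot> f"
  and cmp_scl_right: "arr A B f \<Longrightarrow> arr B C g \<Longrightarrow> g \<cdot> scl K a f = scl K a (g \<cdot> f)"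
  and cmp_scl_left: "arr A B f \<Longrightarrow> arr B C g \<Longrightarrow> scl K a g \<cdot> f = scl K a (g \<cdot> f)"
  using cmp_bilinear by blast+

lemma cmp_zero_right: "A \<in> ob K \<Longrightarrow> arr B C g \<Longrightarrow> g \<cdot> 0 = 0"
  using cmp_add_right[of A B 0 0 C g] arrD(1) by (auto simp: arr_zero)

lemma cmp_zero_left: "arr A B f \<Longrightarrow> C \<in> ob K \<Longrightarrow> 0 \<cdot> f = 0"
  using cmp_add_left[of A B f C 0 0] arrD(2) by (auto simp: arr_zero)

lemma cmp_diff_right: "arr A B f \<Longrightarrow> arr A B f' \<Longrightarrow> arr B C g \<Longrightarrow> g \<cdot> (f - f') = g \<cdot> f - g \<cdot> f'"
  using cmp_add_right[of A B "f - f'" f' C g] by (auto simp: arr_diff algebra_simps)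

lemma cmp_diff_left: "arr A B f \<Longrightarrow> arr B C g \<Longrightarrow> arr B C g' \<Longrightarrow> (g - g') \<cdot> f = g \<cdot> f - g' \<cdot> f"
  using cmp_add_left[of A B f C "g - g'" g'] by (auto simp: arr_diff algebra_simps)

lemma cmp_neg_right: "arr A B f \<Longrightarrow> arr B C g \<Longrightarrow> g \<cdot> (- f) = - (g \<cdot> f)"
  using cmp_diff_right[of A B 0 f C g] cmp_zero_right[of A B C g] by (auto simp: arr_zero arr_def vs.subspace_0 subspace_hom)

lemma cmp_neg_left: "arr A B f \<Longrightarrow> arr B C g \<Longrightarrow> (- g) \<cdot> f = - (g \<cdot> f)"
  using cmp_diff_left[of A B f C 0 g] cmp_zero_left[of A B f C] by (auto simp: arr_zero arr_def vs.subspace_0 subspace_hom)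

lemma cmp_sum_right:
  assumes "finite I" "A \<in> ob K" "\<And>i. i \<in> I \<Longrightarrow> arr A B (f i)" "arr B C g"
  shows "g \<cdot> (\<Sum>i\<in>I. f i) = (\<Sum>i\<in>I. g \<cdot> f i)"
  using assms(1,3)
proof (induction I rule: finite_induct)
  case empty then show ?case using assms by (simp add: cmp_zero_right)
next
  case (insert i I)
  have "arr A B (\<Sum>i\<in>I. f i)" using insert assms arrD by (auto intro!: arr_sum)
  then show ?case using insert assms(4) by (simp add: cmp_add_right[of A B "f i" _ C])
qed

lemma cmp_sum_left:
  assumes "finite I" "C \<in> ob K" "\<And>i. i \<in> I \<Longrightarrow> arr B C (g i)" "arr A B f"
  shows "(\<Sum>i\<in>I. g i) \<cdot> f = (\<Sum>i\<in>I. g i \<cdot> f)"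
  using assms(1,3)
proof (induction I rule: finite_induct)
  case empty then show ?case using assms by (simp add: cmp_zero_left)
next
  case (insert i I)
  have "arr B C (\<Sum>i\<in>I. g i)" using insert assms arrD by (auto intro!: arr_sum)
  then show ?case using insert assms(4) by (simp add: cmp_add_left[of A B f C "g i"])
qed

section \<open>Isomorphisms and local endomorphism rings\<close>

lemma isoE:
  assumes "is_iso K A B f" "A \<in> ob K" "B \<in> ob K"
  obtains g where "arr A B f" "arr B A g" "g \<cdot> f = idn K A" "f \<cdot> g = idn K B"
  using assms unfolding is_iso_def arr_def by blast

lemma isoI: "arr A B f \<Longrightarrow> arr B A g \<Longrightarrow> g \<cdot> f = idn K A \<Longrightarrow> f \<cdot> g = idn K B \<Longrightarrow> is_iso K A B f"
  unfolding is_iso_def arr_def by blast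

lemma iso_id: "A \<in> ob K \<Longrightarrow> is_iso K A A (idn K A)"
  by (rule isoI[of A A _ "idn K A"]) (auto intro: id_left)

lemma iso_cmp:
  assumes "is_iso K A B f" "is_iso K B C g" "A \<in> ob K" "B \<in> ob K" "C \<in> ob K"
  shows "is_iso K A C (g \<cdot> f)"
proof -
  obtain f' where f: "arr A B f" "arr B A f'" "f' \<cdot> f = idn K A" "f \<cdot> f' = idn K B" using assms by (metis isoE)
  obtain g' where g: "arr B C g" "arr C B g'" "g' \<cdot> g = idn K B" "g \<cdot> g' = idn K C" using assms by (metis isoE)
  show ?thesis
  proof (rule isoI[of A C _ "f' \<cdot> g'"])
    have "(f' \<cdot> g') \<cdot> (g \<cdot> f) = f' \<cdot> ((g' \<cdot> g) \<cdot> f)"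
      using assoc[OF arr_cmp[OF f(1) g(1)] g(2) f(2)] assoc[OF f(1) g(1,2)] by simp
    then show "(f' \<cdot> g') \<cdot> (g \<cdot> f) = idn K A" using f g by simp
    have "(g \<cdot> f) \<cdot> (f' \<cdot> g') = g \<cdot> ((f \<cdot> f') \<cdot> g')"
      using assoc[OF arr_cmp[OF g(2) f(2)] f(1) g(1)] assoc[OF g(2) f(2) f(1)] by simp
    then show "(g \<cdot> f) \<cdot> (f' \<cdot> g') = idn K C" using f g by simp
  qed (use f g in blast)+
qed

lemma iso_cancel_right:
  assumes "is_iso K A C (g \<cdot> f)" "is_iso K A B f" "arr B C g"  "A \<in> ob K"
  shows "is_iso K B C g"
proof -
  have ob: "B \<in> ob K" "C \<in> ob K" using assms(3) arrD by auto
  obtain f' where f: "arr A B f" "arr B A f'" "f' \<cdot> f = idn K A" "f \<cdot> f' = idn K B" using assms ob by (metis isoE)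
  have "is_iso K B A f'" using f isoI by blast
  from iso_cmp[OF this assms(1)] ob assms(4) have "is_iso K B C ((g \<cdot> f) \<cdot> f')" by simp
  moreover have "(g \<cdot> f) \<cdot> f' = g" using assoc[OF f(2,1) assms(3)] f assms(3) by simp
  ultimately show ?thesis by simp
qed

lemma isomorphicE:
  assumes "isomorphic K A B"
  obtains f g where "arr A B f" "arr B A g" "g \<cdot> f = idn K A" "f \<cdot> g = idn K B"
  using assms unfolding isomorphic_def by (metis isoE)

lemma isomorphicI: "arr A B f \<Longrightarrow> arr B A g \<Longrightarrow> g \<cdot> f = idn K A \<Longrightarrow> f \<cdot> g = idn K B \<Longrightarrow> isomorphic K A B"
  unfolding isomorphic_def using isoI arrD by blast

lemma isomorphic_refl: "A \<in> ob K \<Longrightarrow> isomorphic K A A"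
  unfolding isomorphic_def using iso_id by blast

lemma isomorphic_sym: "isomorphic K A B \<Longrightarrow> isomorphic K B A"
  by (metis isomorphicE isomorphicI)

lemma isomorphic_trans: "isomorphic K A B \<Longrightarrow> isomorphic K B C \<Longrightarrow> isomorphic K A C"
  unfolding isomorphic_def using iso_cmp by blast

lemma zero_arr: "is_zero K Z \<Longrightarrow> arr A Z f \<Longrightarrow> f = 0" "is_zero K Z \<Longrightarrow> arr Z A f \<Longrightarrow> f = 0"
  using id_left[of A Z f] id_right[of Z A f] cmp_zero_left[of A Z f Z] cmp_zero_right[of Z Z A f] arrD
  by (auto simp: is_zero_def)

text \<open>\<open>f \<cdot> g\<close> is an idempotent of a local ring, hence the identity or zero,
  and zero is impossible since \<open>A\<close> is nonzero.\<close>

lemma local_retract_iso: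
  assumes L: "local_end K B" and f: "arr A B f" and g: "arr B A g" and gf: "g \<cdot> f = idn K A" and A: "idn K A \<noteq> 0"
  shows "f \<cdot> g = idn K B"
proof -
  let ?e = "f \<cdot> g"
  have e: "arr B B ?e" using f g by blast
  have ee: "?e \<cdot> ?e = ?e"
    using assoc[OF e g f] assoc[OF g f g] gf g by simp
  have B: "B \<in> ob K" using f arrD by blast
  from L e have "is_iso K B B ?e \<or> is_iso K B B (idn K B - ?e)"
    unfolding local_end_def using arrD(3) by blast
  then show ?thesis
  proof
    assume "is_iso K B B ?e"
    then obtain h where h: "arr B B h" "h \<cdot> ?e = idn K B" using B by (metis isoE)
    have "h \<cdot> (?e \<cdot> ?e) = ?e" using assoc[OF e e h(1)] h e by simp
    then show ?thesis using ee h by simp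
  next
    assume "is_iso K B B (idn K B - ?e)"
    then obtain h where h: "arr B B h" "h \<cdot> (idn K B - ?e) = idn K B" using B by (metis isoE)
    have i: "arr B B (idn K B - ?e)" using e B by blast
    have "(idn K B - ?e) \<cdot> f = 0"
      using cmp_diff_left[OF f arr_id[OF B] e] assoc[OF f g f] gf f by simp
    then have "f = 0" using assoc[OF f i h(1)] h f cmp_zero_right[OF arrD(1)[OF f] h(1)] by simp
    then show ?thesis using gf A cmp_zero_right[OF arrD(1)[OF f] g] by simp
  qed
qed

lemma local_iso_transfer:
  assumes L: "local_end K B" and iso: "isomorphic K A B"
  shows "local_end K A"
proof -
  obtain f g where fg: "arr A B f" "arr B A g" "g \<cdot> f = idn K A" "f \<cdot> g = idn K B" using iso by (rule isomorphicE)
  have A: "A \<in> ob K" and B: "B \<in> ob K" using fg arrD by auto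
  have isof: "is_iso K A B f" and isog: "is_iso K B A g" using fg isoI by blast+
  have tr: "is_iso K A A (g \<cdot> (x \<cdot> f))" if "is_iso K B B x" for x
    using iso_cmp[OF iso_cmp[OF isof that A B B] isog] A B by simp
  have "is_iso K A A x \<or> is_iso K A A (idn K A - x)" if "x \<in> hom K A A" for x
  proof -
    have x: "arr A A x" using that A by (simp add: arr_def)
    define y where "y = f \<cdot> (x \<cdot> g)"
    have y: "arr B B y" unfolding y_def using x fg by blast
    have gy: "g \<cdot> (y \<cdot> f) = x"
    proof -
      have "y \<cdot> f = f \<cdot> x" unfolding y_def
        using assoc[OF fg(1) arr_cmp[OF fg(2) x] fg(1)] assoc[OF fg(1,2) x] fg x by simp
      then show ?thesis using assoc[OF x fg(1,2)] fg x by simp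
    qed
    have "g \<cdot> ((idn K B - y) \<cdot> f) = idn K A - x"
      using cmp_diff_left[OF fg(1) arr_id[OF B] y] cmp_diff_right[OF fg(1) arr_cmp[OF fg(1) y] fg(2)] gy fg by simp
    then show ?thesis using tr[of y] tr[of "idn K B - y"] gy L y unfolding local_end_def
      using arrD(3) by metis
  qed
  moreover have "idn K A \<noteq> 0"
  proof
    assume "idn K A = 0"
    then have "f = 0" using id_right[OF fg(1)] cmp_zero_right[OF A fg(1)] by simp
    then have "idn K B = 0" using fg(4) cmp_zero_left[OF fg(2) B] by simp
    then show False using L by (simp add: local_end_def)
  qed
  ultimately show ?thesis using A by (simp add: local_end_def)
qed

text \<open>Divide by the invertible sum: of two endomorphisms that add up to the identity of a
  local object one is invertible.\<close>

lemma local_add: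
  assumes L: "local_end K A" and f: "arr A A f" "arr A A g" and iso: "is_iso K A A (f + g)"
  shows "is_iso K A A f \<or> is_iso K A A g"
proof -
  have A: "A \<in> ob K" using f arrD by blast
  obtain u where u: "arr A A u" "u \<cdot> (f + g) = idn K A" "(f + g) \<cdot> u = idn K A" using iso A by (metis isoE)
  have isou: "is_iso K A A u" using u f isoI by (metis arr_add)
  have "f \<cdot> u + g \<cdot> u = idn K A" using cmp_add_left[OF u(1) f] u by simp
  then have "g \<cdot> u = idn K A - f \<cdot> u" by (simp add: algebra_simps)
  moreover have "is_iso K A A (f \<cdot> u) \<or> is_iso K A A (idn K A - f \<cdot> u)"
    using L arrD(3)[OF arr_cmp[OF u(1) f(1)]] by (simp add: local_end_def)
  ultimately show ?thesis using iso_cancel_right[OF _ isou _ A] f by metis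
qed

lemma zero_not_iso: "A \<in> ob K \<Longrightarrow> idn K A \<noteq> 0 \<Longrightarrow> \<not> is_iso K A A 0"
  by (metis isoE cmp_zero_right)

lemma local_sum:
  assumes L: "local_end K A" and "finite I" "\<And>i. i \<in> I \<Longrightarrow> arr A A (f i)" "is_iso K A A (\<Sum>i\<in>I. f i)"
  shows "\<exists>i\<in>I. is_iso K A A (f i)"
  using assms(2-4)
proof (induction I rule: finite_induct)
  case empty then show ?case using L zero_not_iso by (auto simp: local_end_def)
next
  case (insert i I)
  have A: "A \<in> ob K" using L by (simp add: local_end_def)
  have "arr A A (\<Sum>i\<in>I. f i)" using insert A by (auto intro!: arr_sum)
  then have "is_iso K A A (f i) \<or> is_iso K A A (\<Sum>i\<in>I. f i)"
    using local_add[OF L, of "f i"] insert by simp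
  then show ?case using insert by auto
qed

section \<open>The radical of a linear category\<close>

lemma rad_arr: "A \<in> ob K \<Longrightarrow> B \<in> ob K \<Longrightarrow> f \<in> rad K A B \<Longrightarrow> arr A B f"
  by (simp add: rad_def arr_def)

lemma radI: "arr A B f \<Longrightarrow> (\<And>g. arr B A g \<Longrightarrow> is_iso K A A (idn K A - g \<cdot> f)) \<Longrightarrow> f \<in> rad K A B"
  by (simp add: rad_def arr_def)

lemma radD: "f \<in> rad K A B \<Longrightarrow> arr B A g \<Longrightarrow> is_iso K A A (idn K A - g \<cdot> f)"
  by (simp add: rad_def arr_def)

text \<open>If \<open>u\<close> inverts \<open>idn K A - g \<cdot> f\<close>, then
  \<open>idn K B + f \<cdot> (u \<cdot> g)\<close> inverts \<open>idn K B - f \<cdot> g\<close>, as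
  the formal geometric series suggests. Thus the one-sided definition of \<open>rad\<close> is
  left-right symmetric, which closes it under composition on the right and makes it
  self-dual.\<close>

lemma iso_swap:
  assumes f: "arr A B f" and g: "arr B A g" and iso: "is_iso K A A (idn K A - g \<cdot> f)"
  shows "is_iso K B B (idn K B - f \<cdot> g)"
proof -
  have A: "A \<in> ob K" and B: "B \<in> ob K" using f arrD by auto
  have gf: "arr A A (g \<cdot> f)" and fg: "arr B B (f \<cdot> g)" using f g by auto
  obtain u where u: "arr A A u" "u \<cdot> (idn K A - g \<cdot> f) = idn K A" "(idn K A - g \<cdot> f) \<cdot> u = idn K A"
    using iso A by (metis isoE)
  have 1: "u = idn K A + u \<cdot> (g \<cdot> f)"
    using u(2) cmp_diff_right[OF arr_id[OF A] gf u(1)] u(1) by (simp add: algebra_simps)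
  have 2: "u = idn K A + (g \<cdot> f) \<cdot> u"
    using u(3) cmp_diff_left[OF u(1) arr_id[OF A] gf] u(1) by (simp add: algebra_simps)
  let ?w = "f \<cdot> (u \<cdot> g)"
  have ug: "arr B A (u \<cdot> g)" and w: "arr B B ?w" using u f g by auto
  have ugf: "arr A A (u \<cdot> (g \<cdot> f))" "arr A A ((g \<cdot> f) \<cdot> u)" using u gf by auto
  have "f \<cdot> (u \<cdot> g) = f \<cdot> g + ?w \<cdot> (f \<cdot> g)"
  proof -
    have "u \<cdot> g = g + (u \<cdot> (g \<cdot> f)) \<cdot> g"
      using arg_cong[OF 1, of "\<lambda>x. x \<cdot> g"] cmp_add_left[OF g arr_id[OF A] ugf(1)] g by simp
    also have "(u \<cdot> (g \<cdot> f)) \<cdot> g = (u \<cdot> g) \<cdot> (f \<cdot> g)"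
      using assoc[OF g gf u(1)] assoc[OF g f g] assoc[OF fg g u(1)] by simp
    finally have "f \<cdot> (u \<cdot> g) = f \<cdot> (g + (u \<cdot> g) \<cdot> (f \<cdot> g))" by simp
    then show ?thesis using cmp_add_right[OF g arr_cmp[OF fg ug] f] assoc[OF fg ug f] by simp
  qed
  moreover have "f \<cdot> (u \<cdot> g) = f \<cdot> g + (f \<cdot> g) \<cdot> ?w"
  proof -
    have "u \<cdot> g = g + ((g \<cdot> f) \<cdot> u) \<cdot> g"
      using arg_cong[OF 2, of "\<lambda>x. x \<cdot> g"] cmp_add_left[OF g arr_id[OF A] ugf(2)] g by simp
    also have "((g \<cdot> f) \<cdot> u) \<cdot> g = g \<cdot> ?w"
      using assoc[OF g u(1) gf] assoc[OF ug f g] by simp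
    finally have "f \<cdot> (u \<cdot> g) = f \<cdot> (g + g \<cdot> ?w)" by simp
    then show ?thesis using cmp_add_right[OF g arr_cmp[OF w g] f] assoc[OF w g f] by simp
  qed
  ultimately show ?thesis
    using w fg B
    by (intro isoI[of B B _ "idn K B + ?w"])
      (auto simp: cmp_diff_left[of B B _ B] cmp_diff_right[of B B _ _ B] cmp_add_right[of B B _ _ B]
         cmp_add_left[of B B _ B] arr_id id_left[OF arr_id] arr_add arr_diff algebra_simps)
qed

lemma rad_cmp_left:
  assumes "f \<in> rad K A B" "arr B C h" "A \<in> ob K"
  shows "h \<cdot> f \<in> rad K A C"
proof -
  have f: "arr A B f" using assms rad_arr arrD by blast
  show ?thesis
  proof (rule radI)
    show "is_iso K A A (idn K A - g \<cdot> (h \<cdot> f))" if "arr C A g" for g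
      using radD[OF assms(1) arr_cmp[OF assms(2) that]] assoc[OF f assms(2) that] by simp
  qed (use f assms in blast)
qed

lemma rad_cmp_right:
  assumes "f \<in> rad K A B" "arr C A h" "B \<in> ob K"
  shows "f \<cdot> h \<in> rad K C B"
proof -
  have f: "arr A B f" using assms rad_arr arrD by blast
  show ?thesis
  proof (rule radI)
    fix g assume g: "arr B C g"
    have "is_iso K A A (idn K A - h \<cdot> (g \<cdot> f))"
      using radD[OF assms(1) arr_cmp[OF g assms(2)]] assoc[OF f g assms(2)] by simp
    from iso_swap[OF _ assms(2) this] show "is_iso K C C (idn K C - g \<cdot> (f \<cdot> h))"
      using assoc[OF assms(2) f g] f g by auto
  qed (use f assms in blast)
qed

text \<open>With \<open>x = idn K A - g \<cdot> f\<close> and its inverse \<open>u\<close>, the map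
  to be inverted is the product of the invertible maps \<open>x\<close> and
  \<open>idn K A - (u \<cdot> g) \<cdot> f'\<close>.\<close>

lemma rad_add:
  assumes "f \<in> rad K A B" "f' \<in> rad K A B" "A \<in> ob K" "B \<in> ob K"
  shows "f + f' \<in> rad K A B"
proof (rule radI)
  have f: "arr A B f" "arr A B f'" using assms rad_arr by auto
  show "arr A B (f + f')" using f by blast
  fix g assume g: "arr B A g"
  let ?x = "idn K A - g \<cdot> f"
  have x: "arr A A ?x" using f g assms by blast
  have isox: "is_iso K A A ?x" using radD[OF assms(1) g] .
  then obtain u where u: "arr A A u" "u \<cdot> ?x = idn K A" "?x \<cdot> u = idn K A"
    using assms(3) by (metis isoE)
  have "is_iso K A A (idn K A - (u \<cdot> g) \<cdot> f')" using radD[OF assms(2) arr_cmp[OF g u(1)]] .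
  from iso_cmp[OF this isox] assms(3) have "is_iso K A A (?x \<cdot> (idn K A - (u \<cdot> g) \<cdot> f'))" by simp
  moreover have "?x \<cdot> (idn K A - (u \<cdot> g) \<cdot> f') = idn K A - g \<cdot> (f + f')"
  proof -
    have gf: "arr A A (g \<cdot> f')" using f g by blast
    have "?x \<cdot> (idn K A - (u \<cdot> g) \<cdot> f') = ?x - ?x \<cdot> (u \<cdot> (g \<cdot> f'))"
      using cmp_diff_right[OF arr_id[OF assms(3)] arr_cmp[OF gf u(1)] x] assoc[OF f(2) g u(1)] x by simp
    also have "?x \<cdot> (u \<cdot> (g \<cdot> f')) = g \<cdot> f'" using assoc[OF gf u(1) x] u gf by simp
    finally show ?thesis using cmp_add_right[OF f g] by (simp add: algebra_simps)
  qed
  ultimately show "is_iso K A A (idn K A - g \<cdot> (f + f'))" by simp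
qed

lemma rad_zero: "A \<in> ob K \<Longrightarrow> B \<in> ob K \<Longrightarrow> 0 \<in> rad K A B"
  by (rule radI) (auto simp: cmp_zero_right[of A] iso_id)

lemma rad_scl:
  assumes "f \<in> rad K A B" "A \<in> ob K" "B \<in> ob K" shows "scl K a f \<in> rad K A B"
proof -
  have f: "arr A B f" using assms rad_arr by auto
  have "scl K a (idn K B) \<cdot> f \<in> rad K A B" using assms by (intro rad_cmp_left) auto
  then show ?thesis using cmp_scl_left[OF f arr_id] assms f by simp
qed

lemma subspace_rad: "A \<in> ob K \<Longrightarrow> B \<in> ob K \<Longrightarrow> vs.subspace (rad K A B)"
  unfolding vs.subspace_def using rad_zero rad_add rad_scl by blast

lemma rad_sum: "A \<in> ob K \<Longrightarrow> B \<in> ob K \<Longrightarrow> (\<And>i. i \<in> I \<Longrightarrow> f i \<in> rad K A B) \<Longrightarrow> (\<Sum>i\<in>I. f i) \<in> rad K A B"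
  by (simp add: vs.subspace_sum subspace_rad)

lemma not_rad_split:
  assumes L: "local_end K A" and f: "arr A B f" and n: "f \<notin> rad K A B"
  obtains g where "arr B A g" "g \<cdot> f = idn K A"
proof -
  have A: "A \<in> ob K" using f arrD by blast
  obtain g where g: "arr B A g" "\<not> is_iso K A A (idn K A - g \<cdot> f)" using n f radI by blast
  then have "is_iso K A A (g \<cdot> f)" using L arrD(3)[OF arr_cmp[OF f g(1)]] by (auto simp: local_end_def)
  then obtain u where u: "arr A A u" "u \<cdot> (g \<cdot> f) = idn K A" using A by (metis isoE)
  show ?thesis using that[of "u \<cdot> g"] assoc[OF f g(1) u(1)] u g by auto
qed

lemma split_not_rad:
  assumes "arr A B f" "arr B A g" "g \<cdot> f = idn K A" "idn K A \<noteq> 0"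
  shows "f \<notin> rad K A B"
  using radD[OF _ assms(2), of f] assms zero_not_iso[of A] arrD(1) by auto

text \<open>A non-radical map out of a local object has a retraction, and a split monomorphism into
  a local object is an isomorphism unless its source is zero.\<close>

lemma local_not_iso_rad:
  assumes L: "local_end K A" "local_end K B" and f: "arr A B f" and n: "\<not> is_iso K A B f"
  shows "f \<in> rad K A B"
proof (rule ccontr)
  assume "f \<notin> rad K A B"
  then obtain g where g: "arr B A g" "g \<cdot> f = idn K A" using not_rad_split[OF L(1) f] by blast
  then show False using local_retract_iso[OF L(2) f g] L(1) n isoI[OF f g(1)] by (auto simp: local_end_def)
qed

lemma local_rad_iso:
  assumes L: "local_end K A" and f: "f \<in> rad K A A" shows "\<not> is_iso K A A f"
proof
  assume i: "is_iso K A A f"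
  have A: "A \<in> ob K" using L by (simp add: local_end_def)
  then obtain u where "arr A A u" "u \<cdot> f = idn K A" using i by (metis isoE)
  then show False using split_not_rad[of A A f u] f rad_arr[OF A A] L by (auto simp: local_end_def)
qed

lemma local_nonisomorphic_rad:
  assumes L: "local_end K A" "local_end K B" and n: "\<not> isomorphic K A B" and f: "arr A B f"
  shows "f \<in> rad K A B"
  using local_not_iso_rad[OF L f] n f arrD by (auto simp: isomorphic_def)

end

section \<open>Finite direct sums and their structure maps\<close>

text \<open>Unlike membership in \<open>finite_sums\<close>, a list keeps the summands with their
  multiplicities, which later count arrows.\<close>

inductive sumlist :: "('o, 'm::ab_group_add, 'k, 'z) kcat_scheme \<Rightarrow> 'o list \<Rightarrow> 'o \<Rightarrow> bool"
  for K :: "('o, 'm::ab_group_add, 'k, 'z) kcat_scheme" where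
  Nil: "is_zero K Z \<Longrightarrow> sumlist K [] Z"
| Cons: "sumlist K ys C' \<Longrightarrow> biproduct K y C' C \<Longrightarrow> sumlist K (y # ys) C"

context linear_category begin

lemma biproductE:
  assumes "biproduct K A B C"
  obtains i j p q where "arr A C i" "arr B C j" "arr C A p" "arr C B q"
    "p \<cdot> i = idn K A" "q \<cdot> j = idn K B" "q \<cdot> i = 0" "p \<cdot> j = 0" "i \<cdot> p + j \<cdot> q = idn K C"
  using assms unfolding biproduct_def arr_def by blast

lemma biproductI:
  assumes "arr A C i" "arr B C j" "arr C A p" "arr C B q"
    "p \<cdot> i = idn K A" "q \<cdot> j = idn K B" "q \<cdot> i = 0" "p \<cdot> j = 0" "i \<cdot> p + j \<cdot> q = idn K C"
  shows "biproduct K A B C"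
  using assms unfolding biproduct_def arr_def by blast

lemma biproduct_ob: "biproduct K A B C \<Longrightarrow> A \<in> ob K \<and> B \<in> ob K \<and> C \<in> ob K"
  by (simp add: biproduct_def)

lemma biproduct_zero_right: "A \<in> ob K \<Longrightarrow> is_zero K Z \<Longrightarrow> biproduct K A Z A"
  by (rule biproductI[of A A "idn K A" Z 0 "idn K A" 0])
    (auto simp: is_zero_def cmp_zero_left[of A A] cmp_zero_right[of Z A A] cmp_zero_left[of A Z 0 A] id_left[OF arr_id]
      arr_zero arr_id cmp_zero_right[of Z A Z] cmp_zero_left[of A A "idn K A" Z] )

lemma biproduct_zero_iso:
  assumes "biproduct K A B C" "is_zero K A" shows "isomorphic K C B"
proof -
  from assms(1) obtain i j p q where b: "arr A C i" "arr B C j" "arr C A p" "arr C B q"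
    "p \<cdot> i = idn K A" "q \<cdot> j = idn K B" "q \<cdot> i = 0" "p \<cdot> j = 0" "i \<cdot> p + j \<cdot> q = idn K C" by (rule biproductE)
  have "i \<cdot> p = 0" using zero_arr(2)[OF assms(2) b(1)] b(3) cmp_zero_left arrD by blast
  then show ?thesis using b by (intro isomorphicI[of C B q j]) auto
qed

lemma biproduct_sym: "biproduct K A B C \<Longrightarrow> biproduct K B A C"
  by (erule biproductE, rule biproductI[of B C _ A], assumption, assumption, assumption, assumption)
    (simp_all add: add.commute)

lemma biproduct_iso:
  assumes "biproduct K A B C" "isomorphic K C D" shows "biproduct K A B D"
proof -
  from assms(1) obtain i j p q where b: "arr A C i" "arr B C j" "arr C A p" "arr C B q"
    "p \<cdot> i = idn K A" "q \<cdot> j = idn K B" "q \<cdot> i = 0" "p \<cdot> j = 0" "i \<cdot> p + j \<cdot> q = idn K C" by (rule biproductE)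
  from assms(2) obtain f g where f: "arr C D f" "arr D C g" "g \<cdot> f = idn K C" "f \<cdot> g = idn K D" by (rule isomorphicE)
  have *: "(x \<cdot> g) \<cdot> (f \<cdot> y) = x \<cdot> y" if "arr U C y" "arr C V x" for x y U V
    using assoc[OF arr_cmp[OF that(1) f(1)] f(2) that(2)] assoc[OF that(1) f(1,2)] f that by simp
  show ?thesis
  proof (rule biproductI[of A D "f \<cdot> i" B "f \<cdot> j" "p \<cdot> g" "q \<cdot> g"])
    have "(f \<cdot> i) \<cdot> (p \<cdot> g) + (f \<cdot> j) \<cdot> (q \<cdot> g) = f \<cdot> ((i \<cdot> p) \<cdot> g) + f \<cdot> ((j \<cdot> q) \<cdot> g)"
      using b f assoc[OF arr_cmp[OF f(2) b(3)] b(1) f(1)] assoc[OF arr_cmp[OF f(2) b(4)] b(2) f(1)]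
        assoc[OF f(2) b(3) b(1)] assoc[OF f(2) b(4) b(2)] by simp
    also have "\<dots> = f \<cdot> ((i \<cdot> p + j \<cdot> q) \<cdot> g)"
      using cmp_add_left[OF f(2) arr_cmp[OF b(3,1)] arr_cmp[OF b(4,2)]]
        cmp_add_right[OF arr_cmp[OF f(2) arr_cmp[OF b(3,1)]] arr_cmp[OF f(2) arr_cmp[OF b(4,2)]] f(1)] by simp
    finally show "(f \<cdot> i) \<cdot> (p \<cdot> g) + (f \<cdot> j) \<cdot> (q \<cdot> g) = idn K D" using b f by simp
  qed (use b f * in auto)
qed

lemma zero_iso: "is_zero K Z \<Longrightarrow> isomorphic K Z Y \<Longrightarrow> is_zero K Y"
  by (erule isomorphicE) (metis is_zero_def zero_arr cmp_zero_left arrD)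

text \<open>The inclusion and projection of \<open>F\<close> in \<open>E\<close> are assembled from
  those of \<open>B\<close> and \<open>C\<close>. Associativity is what lets lists of summands be
  concatenated.\<close>

lemma biproduct_assoc:
  assumes "biproduct K A B D" "biproduct K D C E" "biproduct K B C F"
  shows "biproduct K A F E"
proof -
  from assms(1) obtain i1 j1 p1 q1 where b1: "arr A D i1" "arr B D j1" "arr D A p1" "arr D B q1"
    "p1 \<cdot> i1 = idn K A" "q1 \<cdot> j1 = idn K B" "q1 \<cdot> i1 = 0" "p1 \<cdot> j1 = 0" "i1 \<cdot> p1 + j1 \<cdot> q1 = idn K D" by (rule biproductE)
  from assms(2) obtain i2 j2 p2 q2 where b2: "arr D E i2" "arr C E j2" "arr E D p2" "arr E C q2"
    "p2 \<cdot> i2 = idn K D" "q2 \<cdot> j2 = idn K C" "q2 \<cdot> i2 = 0" "p2 \<cdot> j2 = 0" "i2 \<cdot> p2 + j2 \<cdot> q2 = idn K E" by (rule biproductE)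
  from assms(3) obtain i3 j3 p3 q3 where b3: "arr B F i3" "arr C F j3" "arr F B p3" "arr F C q3"
    "p3 \<cdot> i3 = idn K B" "q3 \<cdot> j3 = idn K C" "q3 \<cdot> i3 = 0" "p3 \<cdot> j3 = 0" "i3 \<cdot> p3 + j3 \<cdot> q3 = idn K F" by (rule biproductE)
  have ob: "A \<in> ob K" "B \<in> ob K" "C \<in> ob K" "D \<in> ob K" "E \<in> ob K" "F \<in> ob K" using b1 b2 b3 arrD by auto
  define i where "i = i2 \<cdot> i1"
  define jb where "jb = i2 \<cdot> j1"
  define p where "p = p1 \<cdot> p2"
  define qb where "qb = q1 \<cdot> p2"
  have ar: "arr A E i" "arr B E jb" "arr E A p" "arr E B qb" unfolding i_def jb_def p_def qb_def using b1 b2 by blast+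
  have mid: "(x \<cdot> p2) \<cdot> (i2 \<cdot> y) = x \<cdot> y" if "arr U D y" "arr D V x" for x y U V
    using assoc[OF arr_cmp[OF that(1) b2(1)] b2(3) that(2)] assoc[OF that(1) b2(1,3)] b2 that by simp
  have e1: "p \<cdot> i = idn K A" "qb \<cdot> jb = idn K B" "qb \<cdot> i = 0" "p \<cdot> jb = 0"
    unfolding i_def jb_def p_def qb_def using mid b1 by auto
  have e2: "p \<cdot> j2 = 0" "qb \<cdot> j2 = 0" unfolding p_def qb_def
    using assoc[OF b2(2,3) b1(3)] assoc[OF b2(2,3) b1(4)] b2(8) cmp_zero_right[OF ob(3) b1(3)] cmp_zero_right[OF ob(3) b1(4)] by auto
  have e3: "q2 \<cdot> i = 0" "q2 \<cdot> jb = 0" unfolding i_def jb_def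
    using assoc[OF b1(1) b2(1,4)] assoc[OF b1(2) b2(1,4)] b2(7) cmp_zero_left[OF b1(1) ob(3)] cmp_zero_left[OF b1(2) ob(3)] by auto
  have e4: "i \<cdot> p + jb \<cdot> qb + j2 \<cdot> q2 = idn K E"
  proof -
    have "i \<cdot> p = i2 \<cdot> ((i1 \<cdot> p1) \<cdot> p2)" "jb \<cdot> qb = i2 \<cdot> ((j1 \<cdot> q1) \<cdot> p2)"
      unfolding i_def p_def jb_def qb_def
      using assoc[OF arr_cmp[OF b2(3) b1(3)] b1(1) b2(1)] assoc[OF b2(3) b1(3,1)]
        assoc[OF arr_cmp[OF b2(3) b1(4)] b1(2) b2(1)] assoc[OF b2(3) b1(4,2)] by auto
    then have "i \<cdot> p + jb \<cdot> qb = i2 \<cdot> ((i1 \<cdot> p1 + j1 \<cdot> q1) \<cdot> p2)"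
      using cmp_add_left[OF b2(3) arr_cmp[OF b1(3,1)] arr_cmp[OF b1(4,2)]]
        cmp_add_right[OF arr_cmp[OF b2(3) arr_cmp[OF b1(3,1)]] arr_cmp[OF b2(3) arr_cmp[OF b1(4,2)]] b2(1)] by simp
    then show ?thesis using b1 b2 by simp
  qed
  let ?j = "jb \<cdot> p3 + j2 \<cdot> q3" and ?q = "i3 \<cdot> qb + j3 \<cdot> q2"
  have c: "arr F E (jb \<cdot> p3)" "arr F E (j2 \<cdot> q3)" "arr E F (i3 \<cdot> qb)" "arr E F (j3 \<cdot> q2)" using ar b2 b3 by blast+
  have jq: "arr F E ?j" "arr E F ?q" using c by blast+
  show ?thesis
  proof (rule biproductI[OF ar(1) jq(1) ar(3) jq(2)])
    show "p \<cdot> i = idn K A" by fact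
    have q2j: "q2 \<cdot> ?j = q3"
      using cmp_add_right[OF c(1,2) b2(4)] assoc[OF b3(3) ar(2) b2(4)] assoc[OF b3(4) b2(2,4)] e3 b2(6) b3
        cmp_zero_left[OF b3(3) ob(3)] by simp
    have qbj: "qb \<cdot> ?j = p3"
      using cmp_add_right[OF c(1,2) ar(4)] assoc[OF b3(3) ar(2) ar(4)] assoc[OF b3(4) b2(2) ar(4)] e1 e2 b3
        cmp_zero_left[OF b3(4) ob(2)] by simp
    show "?q \<cdot> ?j = idn K F"
      using cmp_add_left[OF jq(1) c(3,4)] assoc[OF jq(1) ar(4) b3(1)] assoc[OF jq(1) b2(4) b3(2)] q2j qbj b3 by simp
    show "?q \<cdot> i = 0"
      using cmp_add_left[OF ar(1) c(3,4)] assoc[OF ar(1,4) b3(1)] assoc[OF ar(1) b2(4) b3(2)] e1 e3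
        cmp_zero_right[OF ob(1) b3(1)] cmp_zero_right[OF ob(1) b3(2)] by simp
    show "p \<cdot> ?j = 0"
      using cmp_add_right[OF c(1,2) ar(3)] assoc[OF b3(3) ar(2,3)] assoc[OF b3(4) b2(2) ar(3)] e1 e2
        cmp_zero_left[OF b3(3) ob(1)] cmp_zero_left[OF b3(4) ob(1)] by simp
    have "?j \<cdot> i3 = jb" "?j \<cdot> j3 = j2"
      using cmp_add_left[OF b3(1) c(1,2)] cmp_add_left[OF b3(2) c(1,2)] assoc[OF b3(1,3) ar(2)] assoc[OF b3(2,3) ar(2)]
        assoc[OF b3(1,4) b2(2)] assoc[OF b3(2,4) b2(2)] b3(5-8) ar(2) b2(2) cmp_zero_right[OF ob(2) b2(2)]
        cmp_zero_right[OF ob(3) ar(2)] by auto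
    then have "?j \<cdot> ?q = jb \<cdot> qb + j2 \<cdot> q2"
      using cmp_add_right[OF c(3,4) jq(1)] assoc[OF ar(4) b3(1) jq(1)] assoc[OF b2(4) b3(2) jq(1)] by simp
    then show "i \<cdot> p + ?j \<cdot> ?q = idn K E" using e4 by (simp add: add.assoc)
  qed
qed

text \<open>The structure maps of a direct sum, numbered by list positions so that morphisms into or
  out of \<open>C\<close> can be expanded as columns and rows. Repeated summands stay apart.\<close>

definition decomp :: "'o \<Rightarrow> 'o list \<Rightarrow> (nat \<Rightarrow> 'm) \<Rightarrow> (nat \<Rightarrow> 'm) \<Rightarrow> bool" where
  "decomp C ys \<iota> \<pi> \<longleftrightarrow> C \<in> ob K \<and>
     (\<forall>j<length ys. arr (ys ! j) C (\<iota> j) \<and> arr C (ys ! j) (\<pi> j)) \<and>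
     (\<forall>j<length ys. \<forall>k<length ys. \<pi> j \<cdot> \<iota> k = (if j = k then idn K (ys ! j) else 0)) \<and>
     (\<Sum>j<length ys. \<iota> j \<cdot> \<pi> j) = idn K C"

lemma decompD:
  assumes "decomp C ys \<iota> \<pi>"
  shows "C \<in> ob K" "j < length ys \<Longrightarrow> arr (ys ! j) C (\<iota> j)" "j < length ys \<Longrightarrow> arr C (ys ! j) (\<pi> j)"
    "j < length ys \<Longrightarrow> \<pi> j \<cdot> \<iota> j = idn K (ys ! j)"
    "j < length ys \<Longrightarrow> k < length ys \<Longrightarrow> j \<noteq> k \<Longrightarrow> \<pi> j \<cdot> \<iota> k = 0"
    "(\<Sum>j<length ys. \<iota> j \<cdot> \<pi> j) = idn K C"
  using assms by (auto simp: decomp_def)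

lemma decomp_map_right:
  assumes d: "decomp C ys \<iota> \<pi>" and f: "arr C D f"
  shows "f = (\<Sum>j<length ys. (f \<cdot> \<iota> j) \<cdot> \<pi> j)"
proof -
  have "f = f \<cdot> (\<Sum>j<length ys. \<iota> j \<cdot> \<pi> j)" using decompD(6)[OF d] f by simp
  also have "\<dots> = (\<Sum>j<length ys. f \<cdot> (\<iota> j \<cdot> \<pi> j))"
    using decompD[OF d] f by (intro cmp_sum_right) auto
  also have "\<dots> = (\<Sum>j<length ys. (f \<cdot> \<iota> j) \<cdot> \<pi> j)"
    using assoc[OF decompD(3)[OF d] decompD(2)[OF d] f] by (intro sum.cong) auto
  finally show ?thesis .
qed

lemma decomp_map_left:
  assumes d: "decomp C ys \<iota> \<pi>" and f: "arr D C f"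
  shows "f = (\<Sum>j<length ys. \<iota> j \<cdot> (\<pi> j \<cdot> f))"
proof -
  have "f = (\<Sum>j<length ys. \<iota> j \<cdot> \<pi> j) \<cdot> f" using decompD(6)[OF d] f by simp
  also have "\<dots> = (\<Sum>j<length ys. (\<iota> j \<cdot> \<pi> j) \<cdot> f)"
    using decompD[OF d] f by (intro cmp_sum_left) auto
  also have "\<dots> = (\<Sum>j<length ys. \<iota> j \<cdot> (\<pi> j \<cdot> f))"
    using assoc[OF f decompD(3)[OF d] decompD(2)[OF d]] by (intro sum.cong) auto
  finally show ?thesis .
qed

lemma sumlist_ob: "sumlist K ys C \<Longrightarrow> C \<in> ob K \<and> set ys \<subseteq> ob K"
  by (induction rule: sumlist.induct) (auto simp: is_zero_def biproduct_def)

lemma sumlist_decomp: "sumlist K ys C \<Longrightarrow> \<exists>\<iota> \<pi>. decomp C ys \<iota> \<pi>"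
proof (induction rule: sumlist.induct)
  case (Nil Z) then show ?case by (auto simp: decomp_def is_zero_def)
next
  case (Cons ys C' y C)
  from Cons.IH obtain \<iota> \<pi> where d: "decomp C' ys \<iota> \<pi>" by blast
  from Cons.hyps(2) obtain i j p q where b: "arr y C i" "arr C' C j" "arr C y p" "arr C C' q"
    "p \<cdot> i = idn K y" "q \<cdot> j = idn K C'" "q \<cdot> i = 0" "p \<cdot> j = 0" "i \<cdot> p + j \<cdot> q = idn K C" by (rule biproductE)
  note d' = decompD[OF d]
  define I where "I = case_nat i (\<lambda>n. j \<cdot> \<iota> n)"
  define P where "P = case_nat p (\<lambda>n. \<pi> n \<cdot> q)"
  have C: "C \<in> ob K" and y: "y \<in> ob K" using b arrD by auto
  have 1: "arr ((y # ys) ! n) C (I n) \<and> arr C ((y # ys) ! n) (P n)" if "n < length (y # ys)" for n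
    using that b d' by (cases n) (auto simp: I_def P_def)
  have mid: "(x \<cdot> q) \<cdot> (j \<cdot> z) = x \<cdot> z" if "arr U C' z" "arr C' V x" for x z U V
    using assoc[OF arr_cmp[OF that(1) b(2)] b(4) that(2)] assoc[OF that(1) b(2,4)] b that by simp
  have 2: "P n \<cdot> I k = (if n = k then idn K ((y # ys) ! n) else 0)" if "n < length (y # ys)" "k < length (y # ys)" for n k
  proof (cases n)
    case 0
    show ?thesis
    proof (cases k)
      case (Suc k')
      then have k': "k' < length ys" using that by simp
      have "p \<cdot> (j \<cdot> \<iota> k') = 0"
        using assoc[OF d'(2)[OF k'] b(2,3)] b(8) cmp_zero_left[OF d'(2)[OF k'] y] by simp
      then show ?thesis using Suc 0 by (simp add: I_def P_def)
    qed (use 0 b in \<open>simp add: I_def P_def\<close>)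
  next
    case (Suc n')
    then have n': "n' < length ys" using that by simp
    show ?thesis
    proof (cases k)
      case 0
      have "(\<pi> n' \<cdot> q) \<cdot> i = 0"
        using assoc[OF b(1,4) d'(3)[OF n']] b(7) cmp_zero_right[OF y d'(3)[OF n']] by simp
      then show ?thesis using Suc 0 by (simp add: I_def P_def)
    next
      case (Suc k')
      then have k': "k' < length ys" using that by simp
      show ?thesis using Suc \<open>n = Suc n'\<close> mid[OF d'(2)[OF k'] d'(3)[OF n']] d'(4)[OF n'] d'(5)[OF n' k']
        by (auto simp: I_def P_def)
    qed
  qed
  have "(\<Sum>n<length ys. (j \<cdot> \<iota> n) \<cdot> (\<pi> n \<cdot> q)) = (\<Sum>n<length ys. j \<cdot> ((\<iota> n \<cdot> \<pi> n) \<cdot> q))"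
  proof (rule sum.cong[OF refl])
    fix n assume "n \<in> {..<length ys}"
    then have n: "n < length ys" by simp
    show "(j \<cdot> \<iota> n) \<cdot> (\<pi> n \<cdot> q) = j \<cdot> ((\<iota> n \<cdot> \<pi> n) \<cdot> q)"
      using assoc[OF arr_cmp[OF b(4) d'(3)[OF n]] d'(2)[OF n] b(2)] assoc[OF b(4) d'(3)[OF n] d'(2)[OF n]] by simp
  qed
  also have "\<dots> = j \<cdot> ((\<Sum>n<length ys. \<iota> n \<cdot> \<pi> n) \<cdot> q)"
  proof -
    have "(\<Sum>n<length ys. \<iota> n \<cdot> \<pi> n) \<cdot> q = (\<Sum>n<length ys. (\<iota> n \<cdot> \<pi> n) \<cdot> q)"
      using d' b arrD by (intro cmp_sum_left) auto
    moreover have "j \<cdot> (\<Sum>n<length ys. (\<iota> n \<cdot> \<pi> n) \<cdot> q) = (\<Sum>n<length ys. j \<cdot> ((\<iota> n \<cdot> \<pi> n) \<cdot> q))"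
      using d' b C by (intro cmp_sum_right[of _ C C' _ C j]) auto
    ultimately show ?thesis by simp
  qed
  also have "\<dots> = j \<cdot> q" using d'(6) b by simp
  finally have "(\<Sum>n<length (y # ys). I n \<cdot> P n) = idn K C"
    using b(9) by (simp add: I_def P_def sum.lessThan_Suc_shift del: sum.lessThan_Suc)
  then show ?case unfolding decomp_def using C 1 2 by blast
qed

lemma sumlist_iso: "sumlist K ys C \<Longrightarrow> isomorphic K C D \<Longrightarrow> sumlist K ys D"
  by (erule sumlist.cases) (auto intro: sumlist.intros zero_iso biproduct_iso)

end

section \<open>Krull--Schmidt decompositions\<close>

locale ks_category = linear_category K
  for K :: "('o, 'm::ab_group_add, 'k::field, 'z) kcat_scheme" +
  assumes ks: "krull_schmidt K"
begin

lemma additive: "additive_cat K"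
  using ks by (simp add: krull_schmidt_def)

lemma sumlist_append:
  "sumlist K ys A \<Longrightarrow> sumlist K zs B \<Longrightarrow> biproduct K A B C \<Longrightarrow> sumlist K (ys @ zs) C"
proof (induction arbitrary: C rule: sumlist.induct)
  case (Nil Z) then show ?case using biproduct_zero_iso isomorphic_sym sumlist_iso by auto
next
  case (Cons ys C' y D)
  obtain F where F: "biproduct K C' B F"
    using additive biproduct_ob[OF Cons.hyps(2)] biproduct_ob[OF Cons.prems(2)] unfolding additive_cat_def by blast
  show ?case
    using Cons.IH[OF Cons.prems(1) F] biproduct_assoc[OF Cons.hyps(2) Cons.prems(2) F] by (auto intro: sumlist.Cons)
qed

lemma sumlist_single: assumes "A \<in> ob K" shows "sumlist K [A] A"
proof -
  obtain Z where "is_zero K Z" using additive unfolding additive_cat_def by blast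
  then show ?thesis using assms biproduct_zero_right by (metis sumlist.intros)
qed

lemma finite_sums_sumlist: "C \<in> finite_sums K S \<Longrightarrow> \<exists>ys. set ys \<subseteq> S \<and> sumlist K ys C"
proof (induction rule: finite_sums.induct)
  case (zero Z) then show ?case by (intro exI[of _ "[]"]) (auto intro: sumlist.Nil)
next
  case (single A) then show ?case by (intro exI[of _ "[A]"]) (auto intro: sumlist_single)
next
  case (sum A B C)
  then obtain ys zs where "set ys \<subseteq> S" "sumlist K ys A" "set zs \<subseteq> S" "sumlist K zs B" by blast
  then show ?case using sumlist_append sum.hyps(3) by (intro exI[of _ "ys @ zs"]) auto
qed

lemma sumlist_finite_sums: "sumlist K ys C \<Longrightarrow> set ys \<subseteq> S \<Longrightarrow> C \<in> finite_sums K S"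
proof (induction rule: sumlist.induct)
  case (Nil Z) then show ?case by (auto intro: finite_sums.zero)
next
  case (Cons ys C' y C)
  have "y \<in> finite_sums K S" using Cons biproduct_ob by (auto intro: finite_sums.single)
  then show ?case using Cons by (auto intro: finite_sums.sum)
qed

lemma finite_sums_add: "C \<in> finite_sums K S \<Longrightarrow> C \<in> add_closure K S"
proof -
  assume C: "C \<in> finite_sums K S"
  then have "C \<in> ob K" using finite_sums_sumlist sumlist_ob by blast
  then show ?thesis using C biproduct_zero_right additive unfolding add_closure_def additive_cat_def by blast
qed

lemma sumlist_add: "sumlist K ys C \<Longrightarrow> set ys \<subseteq> S \<Longrightarrow> C \<in> add_closure K S"
  by (intro finite_sums_add sumlist_finite_sums)

lemma add_closure_superset: "A \<in> S \<Longrightarrow> A \<in> ob K \<Longrightarrow> A \<in> add_closure K S"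
  by (intro finite_sums_add finite_sums.single)

lemma add_closure_ob: "A \<in> add_closure K S \<Longrightarrow> A \<in> ob K"
  unfolding add_closure_def biproduct_def by blast

lemma finite_sums_mono: "S \<subseteq> S' \<Longrightarrow> finite_sums K S \<subseteq> finite_sums K S'"
proof
  fix C assume "S \<subseteq> S'" "C \<in> finite_sums K S"
  from this(2,1) show "C \<in> finite_sums K S'" by induction (auto intro: finite_sums.intros)
qed

lemma add_closure_mono: "S \<subseteq> S' \<Longrightarrow> add_closure K S \<subseteq> add_closure K S'"
  unfolding add_closure_def using finite_sums_mono by blast

lemma local_indecomposable:
  assumes L: "local_end K M" shows "indecomposable K M"
  unfolding indecomposable_def
proof (intro conjI allI impI)
  show "M \<in> ob K" "\<not> is_zero K M" using L by (auto simp: local_end_def is_zero_def)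
  fix A B assume b': "biproduct K A B M"
  then obtain i j p q where b: "arr A M i" "arr B M j" "arr M A p" "arr M B q"
    "p \<cdot> i = idn K A" "q \<cdot> j = idn K B" "q \<cdot> i = 0" "p \<cdot> j = 0" "i \<cdot> p + j \<cdot> q = idn K M" by (rule biproductE)
  show "is_zero K A \<or> is_zero K B"
  proof (rule ccontr)
    assume "\<not> (is_zero K A \<or> is_zero K B)"
    then have nz: "idn K A \<noteq> 0" "idn K B \<noteq> 0" using biproduct_ob[OF b'] by (auto simp: is_zero_def)
    have "i \<cdot> p = idn K M" using local_retract_iso[OF L b(1,3,5) nz(1)] .
    moreover have "q \<cdot> (i \<cdot> p) = 0" using assoc[OF b(3,1,4)] b(7) cmp_zero_left[OF b(3)] arrD[OF b(4)] by simp
    ultimately have "q = 0" using b by simp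
    then show False using nz b(6) cmp_zero_left[OF b(2)] arrD[OF b(4)] by simp
  qed
qed

text \<open>Together with \<open>local_indecomposable\<close> this identifies indecomposable with
  local objects: \<open>krull_schmidt\<close> supplies sums of local objects, and such a sum is
  local unless it is zero or properly decomposable.\<close>

lemma finite_sums_local_cases:
  "C \<in> finite_sums K {M. local_end K M} \<Longrightarrow> is_zero K C \<or> local_end K C \<or>
     (\<exists>A B. biproduct K A B C \<and> \<not> is_zero K A \<and> \<not> is_zero K B)"
proof (induction rule: finite_sums.induct)
  case (sum A B C)
  show ?case
  proof (cases "is_zero K A")
    case True
    then have iso: "isomorphic K C B" using biproduct_zero_iso sum.hyps by blast
    from sum.IH(2) show ?thesis
      using iso isomorphic_sym zero_iso local_iso_transfer biproduct_iso by metis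
  next
    case False
    show ?thesis
    proof (cases "is_zero K B")
      case True
      then have iso: "isomorphic K C A" using biproduct_zero_iso biproduct_sym sum.hyps by blast
      from sum.IH(1) show ?thesis
        using iso isomorphic_sym zero_iso local_iso_transfer biproduct_iso by metis
    qed (use False sum.hyps in blast)
  qed
qed auto

lemma indecomposable_local: "indecomposable K M \<longleftrightarrow> local_end K M"
proof
  assume M: "indecomposable K M"
  then have "M \<in> finite_sums K {M. local_end K M}" using ks by (auto simp: krull_schmidt_def indecomposable_def)
  from finite_sums_local_cases[OF this] M show "local_end K M" unfolding indecomposable_def by blast
qed (rule local_indecomposable)

text \<open>The identity of \<open>L\<close> is the sum of its components through the summands, so
  one component is invertible. It makes \<open>L\<close> a retract of that summand, and a nonzero
  retract of a local object is isomorphic to it. This is the core of the uniqueness half of the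
  Krull--Schmidt theorem.\<close>

lemma local_retract_of_sum:
  assumes L: "local_end K L" and s: "sumlist K ys C" and f: "arr L C f" "arr C L g" "g \<cdot> f = idn K L"
    and ys: "\<And>y. y \<in> set ys \<Longrightarrow> local_end K y"
  shows "\<exists>y\<in>set ys. isomorphic K L y"
proof -
  obtain \<iota> \<pi> where d: "decomp C ys \<iota> \<pi>" using sumlist_decomp[OF s] by blast
  note d' = decompD[OF d]
  have ob: "L \<in> ob K" using f arrD by blast
  have gd: "arr (ys ! j) L (g \<cdot> \<iota> j)" "arr L (ys ! j) (\<pi> j \<cdot> f)" if "j < length ys" for j using d' f that by blast+
  have "idn K L = (\<Sum>j<length ys. (g \<cdot> \<iota> j) \<cdot> \<pi> j) \<cdot> f" using decomp_map_right[OF d f(2)] f(3) by simp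
  also have "\<dots> = (\<Sum>j<length ys. ((g \<cdot> \<iota> j) \<cdot> \<pi> j) \<cdot> f)"
    using arr_cmp[OF d'(3) gd(1)] f ob by (intro cmp_sum_left[of _ L C _ L f]) auto
  also have "\<dots> = (\<Sum>j<length ys. (g \<cdot> \<iota> j) \<cdot> (\<pi> j \<cdot> f))"
    using assoc[OF f(1) d'(3) gd(1)] by (intro sum.cong) auto
  finally have "is_iso K L L (\<Sum>j<length ys. (g \<cdot> \<iota> j) \<cdot> (\<pi> j \<cdot> f))" using iso_id[OF ob] by simp
  then obtain j where j: "j < length ys" "is_iso K L L ((g \<cdot> \<iota> j) \<cdot> (\<pi> j \<cdot> f))"
    using local_sum[OF L, of "{..<length ys}" "\<lambda>j. (g \<cdot> \<iota> j) \<cdot> (\<pi> j \<cdot> f)"] arr_cmp[OF gd(2) gd(1)] by auto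
  then obtain u where u: "arr L L u" "u \<cdot> ((g \<cdot> \<iota> j) \<cdot> (\<pi> j \<cdot> f)) = idn K L" using ob by (metis isoE)
  have r: "(u \<cdot> (g \<cdot> \<iota> j)) \<cdot> (\<pi> j \<cdot> f) = idn K L" using assoc[OF gd(2)[OF j(1)] gd(1)[OF j(1)] u(1)] u by simp
  have "local_end K (ys ! j)" using ys j by simp
  then have "(\<pi> j \<cdot> f) \<cdot> (u \<cdot> (g \<cdot> \<iota> j)) = idn K (ys ! j)"
    using local_retract_iso[OF _ gd(2)[OF j(1)] _ r] L u gd(1)[OF j(1)] by (auto simp: local_end_def)
  then have "isomorphic K L (ys ! j)" using r gd[OF j(1)] u by (intro isomorphicI[of L _ "\<pi> j \<cdot> f" "u \<cdot> (g \<cdot> \<iota> j)"]) auto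
  then show ?thesis using j by auto
qed

definition indec_closed :: "'o set \<Rightarrow> bool" where
  "indec_closed T \<longleftrightarrow> (\<forall>M\<in>T. indecomposable K M \<and> iso_class K M \<subseteq> T)"

lemma indec_closedD:
  assumes "indec_closed T" "M \<in> T"
  shows "local_end K M" "M \<in> ob K" "isomorphic K M N \<Longrightarrow> N \<in> T"
  using assms unfolding indec_closed_def indecomposable_local by (auto simp: local_end_def iso_class_def)

text \<open>A retract of a summand of a finite sum is a retract of the sum itself, so
  \<open>local_retract_of_sum\<close> finds it among the listed members of \<open>T\<close>, up to
  isomorphism.\<close>

lemma add_closure_retract:
  assumes T: "indec_closed T" and L: "local_end K L" and C: "C \<in> add_closure K T"
    and f: "arr L C f" "arr C L g" "g \<cdot> f = idn K L"
  shows "L \<in> T"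
proof -
  from C obtain B D where D: "D \<in> finite_sums K T" "biproduct K C B D" unfolding add_closure_def by blast
  obtain ys where ys: "set ys \<subseteq> T" "sumlist K ys D" using finite_sums_sumlist[OF D(1)] by blast
  from D(2) obtain i j p q where b: "arr C D i" "arr B D j" "arr D C p" "arr D B q"
    "p \<cdot> i = idn K C" "q \<cdot> j = idn K B" "q \<cdot> i = 0" "p \<cdot> j = 0" "i \<cdot> p + j \<cdot> q = idn K D" by (rule biproductE)
  have "(g \<cdot> p) \<cdot> (i \<cdot> f) = idn K L"
    using assoc[OF arr_cmp[OF f(1) b(1)] b(3) f(2)] assoc[OF f(1) b(1,3)] b f by simp
  then obtain y where "y \<in> set ys" "isomorphic K L y"
    using local_retract_of_sum[OF L ys(2), of "i \<cdot> f" "g \<cdot> p"] f b ys T indec_closedD by blast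
  then show ?thesis using T ys indec_closedD(3)[OF T] isomorphic_sym by blast
qed

lemma add_closure_local: "indec_closed T \<Longrightarrow> L \<in> add_closure K T \<Longrightarrow> local_end K L \<Longrightarrow> L \<in> T"
  using add_closure_retract[of T L L "idn K L" "idn K L"] add_closure_ob arr_id id_left[OF arr_id] by blast

text \<open>By definition \<open>C\<close> is only a summand of a sum of members of
  \<open>T\<close>. Its own Krull--Schmidt summands are local retracts of \<open>C\<close>, and
  those lie in \<open>T\<close> by \<open>add_closure_retract\<close>.\<close>

lemma add_closure_sumlist:
  assumes T: "indec_closed T" and C: "C \<in> add_closure K T"
  obtains ys where "set ys \<subseteq> T" "sumlist K ys C"
proof -
  have "C \<in> finite_sums K {M. local_end K M}" using ks add_closure_ob[OF C] by (auto simp: krull_schmidt_def)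
  then obtain ys where ys: "set ys \<subseteq> {M. local_end K M}" "sumlist K ys C" using finite_sums_sumlist by blast
  obtain \<iota> \<pi> where d: "decomp C ys \<iota> \<pi>" using sumlist_decomp[OF ys(2)] by blast
  have "ys ! j \<in> T" if "j < length ys" for j
    using add_closure_retract[OF T _ C decompD(2,3,4)[OF d that]] ys(1) nth_mem[OF that] by blast
  then have "set ys \<subseteq> T" by (auto simp: in_set_conv_nth)
  then show ?thesis using that ys(2) by blast
qed

lemma indec_closed_diff: "indec_closed T \<Longrightarrow> indec_closed (T - iso_class K M)"
  unfolding indec_closed_def iso_class_def using isomorphic_sym isomorphic_trans by blast

end

section \<open>Approximations and arrows\<close>

context linear_category begin

text \<open>The value of a polynomial at the endomorphism \<open>x\<close>, in Horner form.
  Composition is an associative multiplication only on the hom space from \<open>A\<close> to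
  \<open>A\<close>, not on the type of all morphisms.\<close>

definition end_eval :: "'o \<Rightarrow> 'm \<Rightarrow> 'k poly \<Rightarrow> 'm" where
  "end_eval A x = (\<lambda>p. fold_coeffs (\<lambda>a y. scl K a (idn K A) + x \<cdot> y) p 0)"

lemma end_eval_0 [simp]: "end_eval A x 0 = 0"
  by (simp add: end_eval_def)

lemma end_eval_pCons:
  assumes "arr A A x" shows "end_eval A x (pCons a p) = scl K a (idn K A) + x \<cdot> end_eval A x p"
  using cmp_zero_right[OF arrD(1)[OF assms] assms]
  by (cases "a = 0 \<and> p = 0") (auto simp: end_eval_def)

lemma arr_end_eval: "arr A A x \<Longrightarrow> arr A A (end_eval A x p)"
proof (induction p)
  case 0 then show ?case using arrD by (auto intro!: arr_zero)
next
  case (pCons a p)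
  show ?case unfolding end_eval_pCons[OF pCons.prems]
    using pCons arrD[OF pCons.prems] by (intro arr_add arr_scl arr_id arr_cmp[of A A "end_eval A x p" A x]) auto
qed

lemma end_eval_add: "arr A A x \<Longrightarrow> end_eval A x (p + q) = end_eval A x p + end_eval A x q"
proof (induction p q rule: poly_induct2)
  case (pCons a p b q)
  then show ?case
    using cmp_add_right[OF arr_end_eval[OF pCons.prems, of p] arr_end_eval[OF pCons.prems, of q] pCons.prems]
    by (simp add: end_eval_pCons vs.scale_left_distrib algebra_simps)
qed simp

lemma end_eval_smult: "arr A A x \<Longrightarrow> end_eval A x (smult c p) = scl K c (end_eval A x p)"
proof (induction p)
  case (pCons a p)
  then show ?case
    using cmp_scl_right[OF arr_end_eval[OF pCons.prems, of p] pCons.prems, of c]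
    by (simp add: end_eval_pCons vs.scale_right_distrib)
qed simp

lemma end_eval_sum: "arr A A x \<Longrightarrow> end_eval A x (\<Sum>i\<in>I. p i) = (\<Sum>i\<in>I. end_eval A x (p i))"
  by (induction I rule: infinite_finite_induct) (auto simp: end_eval_add)

lemma end_eval_linear_factor:
  assumes x: "arr A A x"
  shows "end_eval A x ([:- c, 1:] * q) = (x - scl K c (idn K A)) \<cdot> end_eval A x q"
proof -
  have A: "A \<in> ob K" using x arrD by blast
  note e = arr_end_eval[OF x, of q]
  have "end_eval A x ([:- c, 1:] * q) = scl K (- c) (end_eval A x q) + x \<cdot> end_eval A x q"
  proof -
    have "[:- c, 1:] * q = smult (- c) q + pCons 0 q" by (simp add: mult_pCons_left)
    then show ?thesis using x by (simp only: end_eval_add end_eval_smult end_eval_pCons) simp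
  qed
  also have "\<dots> = (x - scl K c (idn K A)) \<cdot> end_eval A x q"
    using cmp_diff_left[OF e x arr_scl[OF arr_id[OF A], of c]] cmp_scl_left[OF e arr_id[OF A], of c] e by simp
  finally show ?thesis .
qed

end

locale alg_closed_ks_category = ks_category K
  for K :: "('o, 'm::ab_group_add, 'k::alg_closed_field, 'z) kcat_scheme"
begin

text \<open>Split a linear factor off \<open>p\<close>, as \<open>k\<close> is algebraically closed.
  If the cofactor takes a radical value, its degree is smaller. Otherwise that value is invertible,
  so \<open>x\<close> minus the root cannot be invertible as well, and in a local ring
  non-invertible means radical.\<close>

lemma end_eval_rad_root:
  assumes L: "local_end K A" and x: "arr A A x"
  shows "p \<noteq> 0 \<Longrightarrow> end_eval A x p \<in> rad K A A \<Longrightarrow> \<exists>c. x - scl K c (idn K A) \<in> rad K A A"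
proof (induction "degree p" arbitrary: p rule: less_induct)
  case less
  have A: "A \<in> ob K" using L by (simp add: local_end_def)
  show ?case
  proof (cases "degree p = 0")
    case True
    then obtain a where p: "p = [:a:]" using degree_eq_zeroE by blast
    then have "scl K (inverse a) (end_eval A x p) = idn K A"
      using less.prems cmp_zero_right[OF A x] by (simp add: end_eval_pCons[OF x])
    then have "idn K A \<in> rad K A A" using rad_scl[OF less.prems(2) A A] by metis
    then show ?thesis using local_rad_iso[OF L] iso_id[OF A] by blast
  next
    case False
    then obtain c where "poly p c = 0" using alg_closed_imp_poly_has_root by blast
    then obtain q where pq: "p = [:- c, 1:] * q" by (auto simp: poly_eq_0_iff_dvd elim: dvdE)
    then have q: "q \<noteq> 0" using less.prems by auto
    have deg: "degree q < degree p" using q by (simp add: pq degree_mult_eq del: mult_pCons_left)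
    show ?thesis
    proof (cases "end_eval A x q \<in> rad K A A")
      case True then show ?thesis using less.hyps[OF deg q] by blast
    next
      case False
      note e = arr_end_eval[OF x, of q]
      have iq: "is_iso K A A (end_eval A x q)" using local_not_iso_rad[OF L L e] False by blast
      have xc: "arr A A (x - scl K c (idn K A))" using x A by (intro arr_diff arr_scl arr_id)
      have "\<not> is_iso K A A (x - scl K c (idn K A))"
      proof
        assume i: "is_iso K A A (x - scl K c (idn K A))"
        have "is_iso K A A (end_eval A x p)"
          unfolding pq end_eval_linear_factor[OF x] using iso_cmp[OF iq i A A A] .
        then show False using local_rad_iso[OF L less.prems(2)] by blast
      qed
      then show ?thesis using local_not_iso_rad[OF L L xc] by blast
    qed
  qed
qed

text \<open>
  The residue field of \<open>End(A)\<close> is \<open>k\<close> as soon as some finite-dimensional quotient of a vector space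
  detects the radical of \<open>End(A)\<close>.
\<close>

lemma local_residue_field:
  assumes L: "local_end K A" and x: "arr A A x" and q: "quot_dim (scl K) V W n" and W: "vs.subspace W"
    and V: "\<And>y. arr A A y \<Longrightarrow> \<psi> y \<in> V"
    and add: "\<And>y z. arr A A y \<Longrightarrow> arr A A z \<Longrightarrow> \<psi> (y + z) = \<psi> y + \<psi> z"
    and scl: "\<And>c y. arr A A y \<Longrightarrow> \<psi> (scl K c y) = scl K c (\<psi> y)"
    and ker: "\<And>y. arr A A y \<Longrightarrow> \<psi> y \<in> W \<Longrightarrow> y \<in> rad K A A"
  shows "\<exists>c. x - scl K c (idn K A) \<in> rad K A A"
proof -
  have A: "A \<in> ob K" using L by (simp add: local_end_def)
  \<comment> \<open>The \<open>n + 1\<close> powers of \<open>x\<close> up to exponent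
    \<open>n\<close> become dependent modulo \<open>W\<close>; the relation is a polynomial whose
    value at \<open>x\<close> is radical.\<close>
  define v where "v i = \<psi> (end_eval A x (monom 1 i))" for i
  obtain c where c: "\<exists>i\<le>n. c i \<noteq> 0" "(\<Sum>i\<le>n. scl K (c i) (v i)) \<in> W"
    using vs.quot_dim_dependent[OF W q, of v] V arr_end_eval[OF x] unfolding v_def by blast
  define p where "p = (\<Sum>i\<le>n. monom (c i) i)"
  have \<psi>0: "\<psi> 0 = 0" using scl[of 0 0] A by (simp add: arr_zero)
  have sum: "\<psi> (\<Sum>i\<in>I. f i) = (\<Sum>i\<in>I. \<psi> (f i))" if "finite I" "\<And>i. arr A A (f i)" for I :: "nat set" and f
    using that by (induction I rule: finite_induct) (auto simp: \<psi>0 add arr_sum A)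
  have "end_eval A x p = (\<Sum>i\<le>n. scl K (c i) (end_eval A x (monom 1 i)))"
    unfolding p_def end_eval_sum[OF x]
  proof (rule sum.cong[OF refl])
    fix i
    have "monom (c i) i = smult (c i) (monom 1 i)" by (simp add: smult_monom)
    then show "end_eval A x (monom (c i) i) = scl K (c i) (end_eval A x (monom 1 i))" using end_eval_smult[OF x] by simp
  qed
  then have "\<psi> (end_eval A x p) = (\<Sum>i\<le>n. scl K (c i) (v i))"
    using arr_end_eval[OF x] by (simp add: sum arr_scl v_def scl)
  then have "end_eval A x p \<in> rad K A A" using ker[OF arr_end_eval[OF x]] c(2) by simp
  moreover have "p \<noteq> 0"
  proof
    assume "p = 0"
    moreover have "coeff p i = c i" if "i \<le> n" for i using that by (simp add: p_def coeff_sum coeff_monom)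
    ultimately show False using c(1) by auto
  qed
  ultimately show ?thesis using end_eval_rad_root[OF L x] by blast
qed

end

context ks_category begin

text \<open>Nakayama's lemma for the radical of \<open>End(M)\<close> modulo a left ideal \<open>W\<close> of finite codimension.\<close>

lemma rad_subset_ideal:
  assumes L: "local_end K M" and q: "quot_dim (scl K) (hom K M M) W n"
    and W: "vs.subspace W" "W \<subseteq> hom K M M"
      "\<And>x w. arr M M x \<Longrightarrow> w \<in> W \<Longrightarrow> x \<cdot> w \<in> W"
    and sq: "rad K M M \<subseteq> vs.span ({b \<cdot> a | a b. a \<in> rad K M M \<and> b \<in> rad K M M} \<union> W)"
  shows "rad K M M \<subseteq> W"
proof -
  have M: "M \<in> ob K" using L by (simp add: local_end_def)
  have rsub: "vs.subspace (rad K M M)" by (rule subspace_rad[OF M M])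
  have rhom: "rad K M M \<subseteq> hom K M M" using rad_arr[OF M M] arrD by blast
  obtain m where m: "quot_dim (scl K) (rad K M M) W m"
    using vs.quot_dim_subquotient[OF q W(1) W(1) rsub rhom order.refl] by blast
  obtain v :: "nat \<Rightarrow> 'm" where v': "(\<forall>i<m. v i \<in> rad K M M) \<and>
    (\<forall>c. (\<Sum>i<m. scl K (c i) (v i)) \<in> W \<longrightarrow> (\<forall>i<m. c i = 0)) \<and>
    (\<forall>x\<in>rad K M M. \<exists>c. x - (\<Sum>i<m. scl K (c i) (v i)) \<in> W)" using vs.quot_dim_lessThanD[OF m] by (rule exE)
  have v: "v i \<in> rad K M M" if "i < m" for i using v' that by blast
  have va: "arr M M (v i)" if "i < m" for i using v that rad_arr[OF M M] by blast
  have gen: "\<exists>c. x - (\<Sum>i<m. scl K (c i) (v i)) \<in> W" if "x \<in> rad K M M" for x using v' that by blast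
  \<comment> \<open>\<open>P k\<close> says that, modulo \<open>W\<close>, the radical is generated
    by the first \<open>k\<close> of the finitely many \<open>v i\<close> with radical coefficients.
    It holds for \<open>m\<close> by \<open>sq\<close>, and \<open>P 0\<close> is the claim.\<close>
  define P where "P k \<longleftrightarrow> (\<forall>x\<in>rad K M M. \<exists>r. (\<forall>i<k. r i \<in> rad K M M) \<and> x - (\<Sum>i<k. r i \<cdot> v i) \<in> W)" for k
  have "P m"
  proof -
    \<comment> \<open>\<open>G\<close> collects the maps of the required form. It is a subspace
      containing \<open>W\<close> and all products of two radical maps, hence the whole span in
      \<open>sq\<close>.\<close>
    define G where "G = {x. \<exists>r. (\<forall>i<m. r i \<in> rad K M M) \<and> x - (\<Sum>i<m. r i \<cdot> v i) \<in> W}"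
    have "vs.subspace G"
    proof (rule vs.subspaceI)
      show "0 \<in> G" unfolding G_def
        using rad_zero[OF M M] cmp_zero_left[OF va M] W(1) by (auto intro!: exI[of _ "\<lambda>_. 0"] simp: vs.subspace_0)
      fix x y c assume x: "x \<in> G"
      then obtain r where r: "\<forall>i<m. r i \<in> rad K M M" "x - (\<Sum>i<m. r i \<cdot> v i) \<in> W" unfolding G_def by blast
      have ra: "arr M M (r i)" if "i < m" for i using r that rad_arr[OF M M] by blast
      have "scl K c (x - (\<Sum>i<m. r i \<cdot> v i)) \<in> W" using W(1) r(2) by (rule vs.subspace_scale)
      moreover have "(\<Sum>i<m. scl K c (r i) \<cdot> v i) = scl K c (\<Sum>i<m. r i \<cdot> v i)"
        unfolding vs.scale_sum_right by (intro sum.cong refl cmp_scl_left[of M M _ M]) (use va ra in auto)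
      ultimately show "scl K c x \<in> G" unfolding G_def
        using r rad_scl[OF _ M M] by (auto intro!: exI[of _ "\<lambda>i. scl K c (r i)"] simp: vs.scale_right_diff_distrib)
      assume y: "y \<in> G"
      then obtain s where s: "\<forall>i<m. s i \<in> rad K M M" "y - (\<Sum>i<m. s i \<cdot> v i) \<in> W" unfolding G_def by blast
      have sa: "arr M M (s i)" if "i < m" for i using s that rad_arr[OF M M] by blast
      have "(\<Sum>i<m. (r i + s i) \<cdot> v i) = (\<Sum>i<m. r i \<cdot> v i) + (\<Sum>i<m. s i \<cdot> v i)"
        unfolding sum.distrib[symmetric] by (intro sum.cong refl cmp_add_left[of M M _ M]) (use va ra sa in auto)
      moreover have "(x - (\<Sum>i<m. r i \<cdot> v i)) + (y - (\<Sum>i<m. s i \<cdot> v i)) \<in> W"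
        using W(1) r(2) s(2) by (rule vs.subspace_add)
      ultimately show "x + y \<in> G" unfolding G_def
        using r s rad_add[OF _ _ M M] by (auto intro!: exI[of _ "\<lambda>i. r i + s i"] simp: algebra_simps)
    qed
    moreover have "W \<subseteq> G" unfolding G_def
      using rad_zero[OF M M] cmp_zero_left[OF va M] by (auto intro!: exI[of _ "\<lambda>_. 0"])
    moreover have "b \<cdot> a \<in> G" if a: "a \<in> rad K M M" and b: "b \<in> rad K M M" for a b
    proof -
      have aa: "arr M M a" "arr M M b" using a b rad_arr[OF M M] by auto
      obtain c where c: "a - (\<Sum>i<m. scl K (c i) (v i)) \<in> W" using gen[OF a] by blast
      have cv: "arr M M (\<Sum>i<m. scl K (c i) (v i))" using va M by (intro arr_sum arr_scl) auto
      have "b \<cdot> (a - (\<Sum>i<m. scl K (c i) (v i))) \<in> W" using W(3)[OF aa(2) c] .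
      moreover have "b \<cdot> (\<Sum>i<m. scl K (c i) (v i)) = (\<Sum>i<m. b \<cdot> scl K (c i) (v i))"
        using va M aa by (intro cmp_sum_right[of _ M M _ M b]) (auto intro!: arr_scl)
      moreover have "(\<Sum>i<m. b \<cdot> scl K (c i) (v i)) = (\<Sum>i<m. scl K (c i) b \<cdot> v i)"
        using va aa by (intro sum.cong refl) (auto simp: cmp_scl_right[of M M _ M] cmp_scl_left[of M M _ M])
      ultimately have "b \<cdot> a - (\<Sum>i<m. scl K (c i) b \<cdot> v i) \<in> W" using cmp_diff_right[OF aa(1) cv aa(2)] by simp
      then show ?thesis unfolding G_def using rad_scl[OF b M M] by (auto intro!: exI[of _ "\<lambda>i. scl K (c i) b"])
    qed
    ultimately have "vs.span ({b \<cdot> a | a b. a \<in> rad K M M \<and> b \<in> rad K M M} \<union> W) \<subseteq> G"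
      by (intro vs.span_minimal) auto
    then show ?thesis unfolding P_def using sq G_def by blast
  qed
  moreover have "P k" if Pk: "P (Suc k)" and k: "Suc k \<le> m" for k
    unfolding P_def
  proof
    have vk: "arr M M (v k)" using va k by simp
    from Pk[unfolded P_def] v[of k] k obtain r where
      r: "\<forall>i<Suc k. r i \<in> rad K M M" "v k - (\<Sum>i<Suc k. r i \<cdot> v i) \<in> W" by auto
    have ra: "arr M M (r i)" if "i < Suc k" for i using r that rad_arr[OF M M] by blast
    \<comment> \<open>\<open>v k\<close> occurs in its own expression with the radical coefficient
      \<open>r k\<close>. Moving that term to the left and dividing by the invertible
      \<open>idn K M - r k\<close> expresses \<open>v k\<close> by the earlier generators.\<close>
    have "is_iso K M M (idn K M - idn K M \<cdot> r k)" using r(1) by (intro radD[of _ _ M] arr_id M) auto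
    then have "is_iso K M M (idn K M - r k)" using id_left[OF ra[of k]] by simp
    then obtain u where u: "arr M M u" "u \<cdot> (idn K M - r k) = idn K M" using M by (metis isoE)
    define S where "S = (\<Sum>i<k. r i \<cdot> v i)"
    have Sa: "arr M M S" unfolding S_def using ra va k M by (intro arr_sum arr_cmp[of M M]) auto
    have 1: "(idn K M - r k) \<cdot> v k - S \<in> W"
    proof -
      have "(idn K M - r k) \<cdot> v k = v k - r k \<cdot> v k" using cmp_diff_left[OF vk arr_id[OF M] ra[of k]] vk by simp
      then have "(idn K M - r k) \<cdot> v k - S = v k - (\<Sum>i<Suc k. r i \<cdot> v i)" by (simp add: S_def)
      then show ?thesis using r(2) by simp
    qed
    have i: "arr M M (idn K M - r k)" using ra M by blast
    have "u \<cdot> ((idn K M - r k) \<cdot> v k - S) = v k - u \<cdot> S"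
      using cmp_diff_right[OF arr_cmp[OF vk i] Sa u(1)] assoc[OF vk i u(1)] u vk by simp
    then have 2: "v k - u \<cdot> S \<in> W" using W(3)[OF u(1) 1] by simp
    fix x assume "x \<in> rad K M M"
    with Pk[unfolded P_def] obtain s where
      s: "\<forall>i<Suc k. s i \<in> rad K M M" "x - (\<Sum>i<Suc k. s i \<cdot> v i) \<in> W" by blast
    have sa: "arr M M (s i)" if "i < Suc k" for i using s that rad_arr[OF M M] by blast
    have 3: "s k \<cdot> (v k - u \<cdot> S) \<in> W" using W(3)[OF sa 2] by simp
    \<comment> \<open>The coefficients of \<open>x\<close> after the expression for
      \<open>v k\<close> has been substituted; they are radical again.\<close>
    define t where "t i = s i + (s k \<cdot> u) \<cdot> r i" for i
    have ta: "t i \<in> rad K M M" if "i < k" for i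
      unfolding t_def using s r that sa u by (intro rad_add rad_cmp_left M) auto
    have "(\<Sum>i<k. t i \<cdot> v i) = (\<Sum>i<k. s i \<cdot> v i) + (s k \<cdot> u) \<cdot> S"
    proof -
      have "(s k \<cdot> u) \<cdot> S = (\<Sum>i<k. (s k \<cdot> u) \<cdot> (r i \<cdot> v i))" unfolding S_def
        using sa[of k] u ra va k M by (intro cmp_sum_right[of _ M M _ M]) (auto intro!: arr_cmp[of M M _ M])
      also have "\<dots> = (\<Sum>i<k. ((s k \<cdot> u) \<cdot> r i) \<cdot> v i)"
        using sa[of k] u ra va k by (intro sum.cong refl assoc[of M M _ M _ M, symmetric]) (auto intro!: arr_cmp[of M M _ M])
      finally have "(\<Sum>i<k. s i \<cdot> v i) + (s k \<cdot> u) \<cdot> S = (\<Sum>i<k. s i \<cdot> v i + ((s k \<cdot> u) \<cdot> r i) \<cdot> v i)"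
        by (simp add: sum.distrib)
      also have "\<dots> = (\<Sum>i<k. t i \<cdot> v i)" unfolding t_def
        using sa u ra va k by (intro sum.cong refl cmp_add_left[of M M _ M, symmetric]) (auto intro!: arr_cmp[of M M _ M])
      finally show ?thesis by simp
    qed
    moreover have "(s k \<cdot> u) \<cdot> S = s k \<cdot> (u \<cdot> S)" using assoc[OF Sa u(1) sa[of k]] by simp
    moreover have "s k \<cdot> (v k - u \<cdot> S) = s k \<cdot> v k - s k \<cdot> (u \<cdot> S)"
      using cmp_diff_right[OF vk arr_cmp[OF Sa u(1)] sa[of k]] by simp
    ultimately have "x - (\<Sum>i<k. t i \<cdot> v i) = (x - (\<Sum>i<Suc k. s i \<cdot> v i)) + s k \<cdot> (v k - u \<cdot> S)"
      by (simp add: algebra_simps)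
    also have "\<dots> \<in> W" using W(1) s(2) 3 by (rule vs.subspace_add)
    finally show "\<exists>r. (\<forall>i<k. r i \<in> rad K M M) \<and> x - (\<Sum>i<k. r i \<cdot> v i) \<in> W" using ta by blast
  qed
  ultimately have "P 0" using inc_induct[of 0 m P] by (metis Suc_leI zero_le)
  then show ?thesis by (auto simp: P_def)
qed

end

context linear_category begin

lemma rad_sq_eq_span:
  "rad_sq K T A B = vs.span {g \<cdot> f | Y f g. Y \<in> add_closure K T \<and> f \<in> rad K A Y \<and> g \<in> rad K Y B}"
  by (simp add: rad_sq_def)

lemma subspace_rad_sq: "vs.subspace (rad_sq K T A B)"
  by (simp add: rad_sq_def)

lemma rad_sqI: "Y \<in> add_closure K T \<Longrightarrow> f \<in> rad K A Y \<Longrightarrow> g \<in> rad K Y B \<Longrightarrow> g \<cdot> f \<in> rad_sq K T A B"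
  unfolding rad_sq_def by (rule vs.span_base) blast

end

section \<open>Minimal right approximations and arrows into a summand\<close>

text \<open>\<open>End(M)\<close> need not be finite-dimensional. What is assumed is a subspace
  \<open>I\<close> of finite codimension whose elements all factor through \<open>g\<close>; in the
  applications they do so because they factor through projective objects. \<open>no_loop\<close>
  says that the quiver has no loop at \<open>M\<close>.\<close>

locale approximation = alg_closed_ks_category K
  for K :: "('o, 'm::ab_group_add, 'k::alg_closed_field, 'z) kcat_scheme" +
  fixes T :: "'o set" and M :: 'o and B :: 'o and g :: 'm and I :: "'m set" and n :: nat
  assumes T: "indec_closed T" and M: "M \<in> T"
    and approx: "right_approx K (add_closure K (T - iso_class K M)) B g M"
    and minimal: "right_minimal K B g"
    and no_loop: "rad K M M \<subseteq> rad_sq K T M M"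
    and finite_end: "quot_dim (scl K) (hom K M M) I n" "vs.subspace I"
      "I \<subseteq> {g \<cdot> t | t. t \<in> hom K M B}"
begin

abbreviation "T0 \<equiv> T - iso_class K M"

lemma T0: "indec_closed T0"
  using T by (rule indec_closed_diff)

lemma obs: "M \<in> ob K" "B \<in> ob K" "local_end K M"
  using T M approx indec_closedD add_closure_ob unfolding right_approx_def by blast+

lemma g: "arr B M g"
  using approx obs by (simp add: right_approx_def arr_def)

lemma B: "B \<in> add_closure K T0"
  using approx by (simp add: right_approx_def)

lemma factor:
  assumes "Y \<in> add_closure K T0" "arr Y M h"
  obtains u where "arr Y B u" "h = g \<cdot> u"
proof -
  obtain u where "u \<in> hom K Y B" "h = g \<cdot> u" using assms approx by (auto simp: right_approx_def arr_def)
  then show ?thesis using that assms(2) obs by (auto simp: arr_def)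
qed

lemma T0_add: "Y \<in> T0 \<Longrightarrow> Y \<in> add_closure K T0"
  using add_closure_superset indec_closedD(2)[OF T0] by blast

text \<open>The right ideal of endomorphisms that factor through \<open>g\<close>. It turns out to
  be the radical of \<open>End(M)\<close>.\<close>

definition W :: "'m set" where "W = {g \<cdot> t | t. t \<in> hom K M B}"

lemma W_I: "arr M B t \<Longrightarrow> g \<cdot> t \<in> W" by (auto simp: W_def arr_def)

lemma W_E: assumes "w \<in> W" obtains t where "arr M B t" "w = g \<cdot> t"
  using assms obs by (auto simp: W_def arr_def)

lemma subspace_W: "vs.subspace W"
proof (rule vs.subspaceI)
  show "0 \<in> W" using W_I[OF arr_zero[OF obs(1,2)]] cmp_zero_right[OF obs(1) g] by simp
  fix x y c assume "x \<in> W"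
  then obtain t where t: "arr M B t" "x = g \<cdot> t" by (rule W_E)
  show "scl K c x \<in> W" using W_I[OF arr_scl[OF t(1), of c]] cmp_scl_right[OF t(1) g] t by simp
  assume "y \<in> W"
  then obtain s where s: "arr M B s" "y = g \<cdot> s" by (rule W_E)
  show "x + y \<in> W" using W_I[OF arr_add[OF t(1) s(1)]] cmp_add_right[OF t(1) s(1) g] t s by simp
qed

lemma W_hom: "W \<subseteq> hom K M M"
  using W_E g arr_cmp arrD(3) by (metis subsetI)

text \<open>\<open>x \<cdot> g\<close> starts at \<open>B\<close>, which lies in the additive
  closure of \<open>T0\<close>, so the approximation property moves \<open>x\<close> past
  \<open>g\<close>. Nakayama's argument multiplies from the left and therefore needs this side of
  the ideal property.\<close>

lemma W_left: "arr M M x \<Longrightarrow> w \<in> W \<Longrightarrow> x \<cdot> w \<in> W"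
proof -
  assume x: "arr M M x" and "w \<in> W"
  then obtain t where t: "arr M B t" "w = g \<cdot> t" by (metis W_E)
  obtain u where u: "arr B B u" "x \<cdot> g = g \<cdot> u" using factor[OF B arr_cmp[OF g x]] by blast
  have "x \<cdot> w = g \<cdot> (u \<cdot> t)" using assoc[OF t(1) g x] assoc[OF t(1) u(1) g] t u by simp
  then show "x \<cdot> w \<in> W" using W_I[OF arr_cmp[OF t(1) u(1)]] by simp
qed

lemma finite_W: "\<exists>n. quot_dim (scl K) (hom K M M) W n"
  using vs.quot_dim_subquotient[OF finite_end(1,2) subspace_W subspace_hom[OF obs(1,1)] order.refl] finite_end(3)
  by (simp add: W_def)

text \<open>Write a product of radical maps \<open>M \<rightarrow> Y \<rightarrow> M\<close> as a
  sum over the summands of \<open>Y\<close>. A summand isomorphic to \<open>M\<close> contributes a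
  product of two radical endomorphisms of \<open>M\<close>; any other contribution factors through
  the approximation \<open>g\<close>. As there are no loops, the radical lies in its square plus
  \<open>W\<close>.\<close>

lemma rad_subset_W: "rad K M M \<subseteq> W"
proof -
  let ?S = "vs.span ({b \<cdot> a | a b. a \<in> rad K M M \<and> b \<in> rad K M M} \<union> W)"
  have "rad_sq K T M M \<subseteq> ?S" unfolding rad_sq_eq_span
  proof (rule vs.span_minimal)
    show "vs.subspace ?S" by simp
    show "{g \<cdot> f | Y f g. Y \<in> add_closure K T \<and> f \<in> rad K M Y \<and> g \<in> rad K Y M} \<subseteq> ?S"
    proof clarify
      fix Y a b assume Y: "Y \<in> add_closure K T" and a: "a \<in> rad K M Y" and b: "b \<in> rad K Y M"
      have Yob: "Y \<in> ob K" using Y by (rule add_closure_ob)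
      have aa: "arr M Y a" "arr Y M b" using a b Yob obs rad_arr by auto
      obtain ys where ys: "set ys \<subseteq> T" "sumlist K ys Y" using add_closure_sumlist[OF T Y] .
      obtain \<iota> \<pi> where d: "decomp Y ys \<iota> \<pi>" using sumlist_decomp[OF ys(2)] by blast
      note d' = decompD[OF d]
      have "(b \<cdot> \<iota> j) \<cdot> (\<pi> j \<cdot> a) \<in> ?S" if j: "j < length ys" for j
      proof (cases "isomorphic K M (ys ! j)")
        case True
        then obtain e e' where e: "arr M (ys ! j) e" "arr (ys ! j) M e'" "e' \<cdot> e = idn K M" "e \<cdot> e' = idn K (ys ! j)"
          by (rule isomorphicE)
        have bi: "arr (ys ! j) M (b \<cdot> \<iota> j)" and pa: "arr M (ys ! j) (\<pi> j \<cdot> a)" using d' j aa by blast+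
        have "((b \<cdot> \<iota> j) \<cdot> e) \<cdot> (e' \<cdot> (\<pi> j \<cdot> a)) = (b \<cdot> \<iota> j) \<cdot> (\<pi> j \<cdot> a)"
          using assoc[OF arr_cmp[OF pa e(2)] e(1) bi] assoc[OF pa e(2,1)] e pa by simp
        moreover have "(b \<cdot> \<iota> j) \<cdot> e \<in> rad K M M"
          using rad_cmp_right[OF rad_cmp_right[OF b d'(2)[OF j] obs(1)] e(1) obs(1)] .
        moreover have "e' \<cdot> (\<pi> j \<cdot> a) \<in> rad K M M"
          using rad_cmp_left[OF rad_cmp_left[OF a d'(3)[OF j] obs(1)] e(2) obs(1)] .
        ultimately show ?thesis by (intro vs.span_base) (auto, metis)
      next
        case False
        then have "ys ! j \<in> T0" using ys j by (auto simp: iso_class_def)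
        then obtain u where u: "arr (ys ! j) B u" "b \<cdot> \<iota> j = g \<cdot> u"
          using factor[OF T0_add, of "ys ! j" "b \<cdot> \<iota> j"] d'(2)[OF j] aa by blast
        have pa: "arr M (ys ! j) (\<pi> j \<cdot> a)" using d' j aa by blast
        have "(b \<cdot> \<iota> j) \<cdot> (\<pi> j \<cdot> a) = g \<cdot> (u \<cdot> (\<pi> j \<cdot> a))" using assoc[OF pa u(1) g] u by simp
        then have "(b \<cdot> \<iota> j) \<cdot> (\<pi> j \<cdot> a) \<in> W" using W_I[OF arr_cmp[OF pa u(1)]] by simp
        then show ?thesis by (intro vs.span_base) simp
      qed
      moreover have "b \<cdot> a = (\<Sum>j<length ys. (b \<cdot> \<iota> j) \<cdot> (\<pi> j \<cdot> a))"
      proof -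
        have "b \<cdot> a = (\<Sum>j<length ys. (b \<cdot> \<iota> j) \<cdot> \<pi> j) \<cdot> a" using decomp_map_right[OF d aa(2)] by simp
        also have "\<dots> = (\<Sum>j<length ys. ((b \<cdot> \<iota> j) \<cdot> \<pi> j) \<cdot> a)"
          using arr_cmp[OF d'(3) arr_cmp[OF d'(2) aa(2)]] aa obs by (intro cmp_sum_left[of _ M Y _ M a]) auto
        also have "\<dots> = (\<Sum>j<length ys. (b \<cdot> \<iota> j) \<cdot> (\<pi> j \<cdot> a))"
          using assoc[OF aa(1) d'(3) arr_cmp[OF d'(2) aa(2)]] by (intro sum.cong) auto
        finally show ?thesis .
      qed
      ultimately show "b \<cdot> a \<in> ?S" using vs.span_sum[of "{..<length ys}" "\<lambda>j. (b \<cdot> \<iota> j) \<cdot> (\<pi> j \<cdot> a)"] by simp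
    qed
  qed
  then have "rad K M M \<subseteq> ?S" using no_loop by blast
  moreover obtain n' where "quot_dim (scl K) (hom K M M) W n'" using finite_W by blast
  ultimately show ?thesis using rad_subset_ideal[OF obs(3) _ subspace_W W_hom W_left] by blast
qed

text \<open>An invertible \<open>g \<cdot> t\<close> would make \<open>M\<close> a direct summand of
  \<open>B\<close>, which has no summand isomorphic to \<open>M\<close>.\<close>

lemma W_subset_rad: "W \<subseteq> rad K M M"
proof
  fix w assume w: "w \<in> W"
  then obtain t where t: "arr M B t" "w = g \<cdot> t" by (rule W_E)
  have "\<not> is_iso K M M w"
  proof
    assume "is_iso K M M w"
    then obtain u where u: "arr M M u" "w \<cdot> u = idn K M" using obs by (metis isoE)
    have "g \<cdot> (t \<cdot> u) = idn K M" using assoc[OF u(1) t(1) g] t u by simp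
    then have "M \<in> T0" using add_closure_retract[OF T0 obs(3) B arr_cmp[OF u(1) t(1)] g] by simp
    then show False using isomorphic_refl[OF obs(1)] by (simp add: iso_class_def)
  qed
  then show "w \<in> rad K M M" using local_not_iso_rad[OF obs(3,3)] arr_cmp[OF t(1) g] t by simp
qed

lemma W_eq_rad: "W = rad K M M"
  using rad_subset_W W_subset_rad by blast

text \<open>\<open>W\<close> is now the radical of a local algebra and has finite codimension, so
  the residue field is \<open>k\<close>. Later this quotient becomes
  \<open>Ext(M,N)\<close>.\<close>

lemma quot_dim_end: "quot_dim (scl K) (hom K M M) {g \<cdot> t | t. t \<in> hom K M B} 1"
proof -
  obtain n' where n': "quot_dim (scl K) (hom K M M) W n'" using finite_W by blast
  have "quot_dim (scl K) (hom K M M) W 1"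
  proof (rule vs.quot_dim_1I)
    show "idn K M \<in> hom K M M" using obs arrD(3) by blast
    show "idn K M \<notin> W" using W_eq_rad local_rad_iso[OF obs(3)] iso_id[OF obs(1)] by blast
    show "\<exists>a. x - scl K a (idn K M) \<in> W" if "x \<in> hom K M M" for x
      using local_residue_field[OF obs(3) _ n' subspace_W, of x "\<lambda>y. y"] W_eq_rad that obs by (auto simp: arr_def)
  qed (rule subspace_W)
  then show ?thesis by (simp add: W_def)
qed

lemma not_split: "arr M B s \<Longrightarrow> g \<cdot> s \<noteq> idn K M"
  using W_I[of s] W_eq_rad local_rad_iso[OF obs(3)] iso_id[OF obs(1)] by metis

text \<open>On summands isomorphic to \<open>M\<close> this is \<open>W_eq_rad\<close>, on the
  others the approximation property. Together with \<open>g_rad\<close> it says that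
  \<open>g\<close> is a sink map for \<open>M\<close> in the additive closure of
  \<open>T\<close>.\<close>

lemma rad_factor:
  assumes Y: "Y \<in> add_closure K T" and b: "b \<in> rad K Y M"
  shows "\<exists>c. arr Y B c \<and> b = g \<cdot> c"
proof -
  have Yob: "Y \<in> ob K" using Y by (rule add_closure_ob)
  have ba: "arr Y M b" using b Yob obs rad_arr by auto
  obtain ys where ys: "set ys \<subseteq> T" "sumlist K ys Y" using add_closure_sumlist[OF T Y] .
  obtain \<iota> \<pi> where d: "decomp Y ys \<iota> \<pi>" using sumlist_decomp[OF ys(2)] by blast
  note d' = decompD[OF d]
  have "\<exists>c. arr (ys ! j) B c \<and> b \<cdot> \<iota> j = g \<cdot> c" if j: "j < length ys" for j
  proof (cases "isomorphic K M (ys ! j)")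
    case True
    then obtain e e' where e: "arr M (ys ! j) e" "arr (ys ! j) M e'" "e' \<cdot> e = idn K M" "e \<cdot> e' = idn K (ys ! j)"
      by (rule isomorphicE)
    have bi: "arr (ys ! j) M (b \<cdot> \<iota> j)" using d' j ba by blast
    have "(b \<cdot> \<iota> j) \<cdot> e \<in> rad K M M"
      using rad_cmp_right[OF rad_cmp_right[OF b d'(2)[OF j] obs(1)] e(1) obs(1)] .
    then obtain t where t: "arr M B t" "(b \<cdot> \<iota> j) \<cdot> e = g \<cdot> t" using W_eq_rad W_E by metis
    have "b \<cdot> \<iota> j = ((b \<cdot> \<iota> j) \<cdot> e) \<cdot> e'" using assoc[OF e(2,1) bi] e bi by simp
    then have "b \<cdot> \<iota> j = g \<cdot> (t \<cdot> e')" using t assoc[OF e(2) t(1) g] by simp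
    then show ?thesis using e t by blast
  next
    case False
    then have "ys ! j \<in> T0" using ys j by (auto simp: iso_class_def)
    then show ?thesis using factor[OF T0_add, of "ys ! j" "b \<cdot> \<iota> j"] d'(2)[OF j] ba by blast
  qed
  then obtain c where c: "\<And>j. j < length ys \<Longrightarrow> arr (ys ! j) B (c j) \<and> b \<cdot> \<iota> j = g \<cdot> c j" by metis
  have ca: "arr Y B (c j \<cdot> \<pi> j)" if "j < length ys" for j using c d'(3) that by blast
  have "b = (\<Sum>j<length ys. (b \<cdot> \<iota> j) \<cdot> \<pi> j)" using decomp_map_right[OF d ba] .
  also have "\<dots> = (\<Sum>j<length ys. g \<cdot> (c j \<cdot> \<pi> j))"
    using c d'(3) g by (intro sum.cong) (auto intro!: assoc)
  also have "\<dots> = g \<cdot> (\<Sum>j<length ys. c j \<cdot> \<pi> j)"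
    using ca g Yob by (intro cmp_sum_right[of _ Y B _ M g, symmetric]) auto
  finally show ?thesis using ca Yob obs by (intro exI[of _ "\<Sum>j<length ys. c j \<cdot> \<pi> j"]) (auto intro!: arr_sum)
qed

lemma T0_hom_rad: assumes "A \<in> T0" "arr A M h" shows "h \<in> rad K A M"
proof -
  have "\<not> isomorphic K A M" using assms isomorphic_sym by (auto simp: iso_class_def)
  then show ?thesis using local_nonisomorphic_rad[OF indec_closedD(1)[OF T0 assms(1)] obs(3)] assms(2) by blast
qed

lemma g_rad: "g \<in> rad K B M"
proof -
  obtain ys where ys: "set ys \<subseteq> T0" "sumlist K ys B" using add_closure_sumlist[OF T0 B] .
  obtain \<iota> \<pi> where d: "decomp B ys \<iota> \<pi>" using sumlist_decomp[OF ys(2)] by blast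
  note d' = decompD[OF d]
  have "g \<cdot> \<iota> j \<in> rad K (ys ! j) M" if "j < length ys" for j
    using T0_hom_rad[of "ys ! j" "g \<cdot> \<iota> j"] ys nth_mem[OF that] d'(2)[OF that] g by blast
  then have "(\<Sum>j<length ys. (g \<cdot> \<iota> j) \<cdot> \<pi> j) \<in> rad K B M"
    using rad_cmp_right[OF _ d'(3) obs(1)] obs by (intro rad_sum) auto
  then show ?thesis using decomp_map_right[OF d g] by simp
qed

text \<open>By \<open>rad_factor\<close> every element of \<open>rad_sq K T A M\<close> is
  \<open>g \<cdot> c'\<close> with \<open>c'\<close> radical. The point is that \<open>g\<close>
  identifies no radical map with a non-radical one, and this is where minimality of \<open>g\<close>
  enters.\<close>

lemma rad_sq_iff:
  assumes A: "A \<in> T0" and c: "arr A B c"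
  shows "g \<cdot> c \<in> rad_sq K T A M \<longleftrightarrow> c \<in> rad K A B"
proof
  have LA: "local_end K A" and Aob: "A \<in> ob K" using indec_closedD[OF T0 A] by auto
  assume "g \<cdot> c \<in> rad_sq K T A M"
  moreover have "rad_sq K T A M \<subseteq> {g \<cdot> c | c. c \<in> rad K A B}" unfolding rad_sq_eq_span
  proof (rule vs.span_minimal)
    show "{g \<cdot> f | Y f g. Y \<in> add_closure K T \<and> f \<in> rad K A Y \<and> g \<in> rad K Y M} \<subseteq> {g \<cdot> c | c. c \<in> rad K A B}"
    proof clarify
      fix Y a b assume Y: "Y \<in> add_closure K T" and a: "a \<in> rad K A Y" and b: "b \<in> rad K Y M"
      obtain e where e: "arr Y B e" "b = g \<cdot> e" using rad_factor[OF Y b] by blast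
      have aa: "arr A Y a" using a rad_arr Aob add_closure_ob[OF Y] by blast
      have "b \<cdot> a = g \<cdot> (e \<cdot> a)" using e assoc[OF aa e(1) g] by simp
      then show "\<exists>c. b \<cdot> a = g \<cdot> c \<and> c \<in> rad K A B" using rad_cmp_left[OF a e(1) Aob] by blast
    qed
    show "vs.subspace {g \<cdot> c | c. c \<in> rad K A B}"
    proof (rule vs.subspaceI)
      show "0 \<in> {g \<cdot> c | c. c \<in> rad K A B}" using rad_zero[OF Aob obs(2)] cmp_zero_right[OF Aob g] by force
    next
      fix x y assume "x \<in> {g \<cdot> c | c. c \<in> rad K A B}" "y \<in> {g \<cdot> c | c. c \<in> rad K A B}"
      then obtain c d where cd: "c \<in> rad K A B" "x = g \<cdot> c" "d \<in> rad K A B" "y = g \<cdot> d" by blast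
      then have "x + y = g \<cdot> (c + d)" using cmp_add_right[OF rad_arr[OF Aob obs(2)] rad_arr[OF Aob obs(2)] g] by simp
      then show "x + y \<in> {g \<cdot> c | c. c \<in> rad K A B}" using cd rad_add[OF _ _ Aob obs(2)] by blast
    next
      fix k x assume "x \<in> {g \<cdot> c | c. c \<in> rad K A B}"
      then obtain c where c: "c \<in> rad K A B" "x = g \<cdot> c" by blast
      then have "scl K k x = g \<cdot> scl K k c" using cmp_scl_right[OF rad_arr[OF Aob obs(2)] g] by simp
      then show "scl K k x \<in> {g \<cdot> c | c. c \<in> rad K A B}" using c rad_scl[OF _ Aob obs(2)] by blast
    qed
  qed
  ultimately obtain c' where c': "c' \<in> rad K A B" "g \<cdot> c = g \<cdot> c'" by blast
  have c'a: "arr A B c'" using c' rad_arr Aob obs by blast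
  define v where "v = c - c'"
  have v: "arr A B v" "g \<cdot> v = 0" unfolding v_def using c c'a c'(2) cmp_diff_right[OF c c'a g] by auto
  show "c \<in> rad K A B"
  proof (rule ccontr)
    assume "c \<notin> rad K A B"
    then have "v \<notin> rad K A B" using rad_add[OF _ c'(1) Aob obs(2), of v] by (auto simp: v_def)
    then obtain p where p: "arr B A p" "p \<cdot> v = idn K A" using not_rad_split[OF LA v(1)] by blast
    \<comment> \<open>\<open>v\<close> is a split monomorphism killed by \<open>g\<close>, and
      \<open>u\<close> projects away from its image: \<open>g \<cdot> u = g\<close> makes
      \<open>u\<close> invertible by minimality, although \<open>u \<cdot> v = 0\<close>.\<close>
    define u where "u = idn K B - v \<cdot> p"
    have vp: "arr B B (v \<cdot> p)" using p v by blast
    have u: "arr B B u" unfolding u_def using vp obs by blast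
    have "g \<cdot> u = g" unfolding u_def
      using cmp_diff_right[OF arr_id[OF obs(2)] vp g] assoc[OF p(1) v(1) g] v cmp_zero_left[OF p(1) obs(1)] g by simp
    then have "is_iso K B B u" using minimal u arrD(3) by (simp add: right_minimal_def)
    then obtain w where w: "arr B B w" "w \<cdot> u = idn K B" using obs by (metis isoE)
    have "u \<cdot> v = 0" unfolding u_def
      using cmp_diff_left[OF v(1) arr_id[OF obs(2)] vp] assoc[OF v(1) p(1) v(1)] p v by simp
    then have "v = 0" using assoc[OF v(1) u w(1)] w v cmp_zero_right[OF Aob w(1)] by simp
    then have "idn K A = 0" using p cmp_zero_right[OF Aob p(1)] by simp
    then show False using LA by (simp add: local_end_def)
  qed
next
  assume "c \<in> rad K A B"
  moreover have "B \<in> add_closure K T" using B add_closure_mono[of T0 T] by blast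
  ultimately show "g \<cdot> c \<in> rad_sq K T A M" using g_rad rad_sqI by blast
qed

text \<open>Composition with \<open>g\<close> identifies \<open>Hom(A,B)\<close> modulo its radical
  with the space of arrows from \<open>A\<close> to \<open>M\<close>. The former has as basis the
  inclusions of the summands isomorphic to \<open>A\<close>, because the residue field of
  \<open>A\<close> is \<open>k\<close>.\<close>

lemma quot_dim_arrows:
  assumes A: "A \<in> T0" and fin: "quot_dim (scl K) (rad K A M) (rad_sq K T A M) N" and s: "sumlist K ys B" and ys: "set ys \<subseteq> T0"
  shows "quot_dim (scl K) (rad K A M) (rad_sq K T A M) (card {j. j < length ys \<and> isomorphic K A (ys ! j)})"
proof -
  have LA: "local_end K A" and Aob: "A \<in> ob K" using indec_closedD[OF T0 A] by auto
  obtain \<iota> \<pi> where d: "decomp B ys \<iota> \<pi>" using sumlist_decomp[OF s] by blast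
  note d' = decompD[OF d]
  define J where "J = {j. j < length ys \<and> isomorphic K A (ys ! j)}"
  define a where "a = card J"
  have "finite J" by (simp add: J_def)
  then obtain h where h: "bij_betw h {..<a} J" using ex_bij_betw_nat_finite[of J] by (auto simp: a_def atLeast0LessThan)
  have hJ: "h i < length ys" "isomorphic K A (ys ! h i)" if "i < a" for i
    using h that by (auto simp: bij_betw_def J_def)
  have hinj: "h i = h k \<longleftrightarrow> i = k" if "i < a" "k < a" for i k
    using h that by (auto simp: bij_betw_def inj_on_def)
  have "\<exists>e e'. i < a \<longrightarrow> arr A (ys ! h i) e \<and> arr (ys ! h i) A e' \<and> e' \<cdot> e = idn K A \<and> e \<cdot> e' = idn K (ys ! h i)" for i
    using hJ(2)[of i] isomorphicE by metis
  then obtain e e' where e: "\<And>i. i < a \<Longrightarrow> arr A (ys ! h i) (e i)" "\<And>i. i < a \<Longrightarrow> arr (ys ! h i) A (e' i)"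
    "\<And>i. i < a \<Longrightarrow> e' i \<cdot> e i = idn K A" "\<And>i. i < a \<Longrightarrow> e i \<cdot> e' i = idn K (ys ! h i)" by metis
  \<comment> \<open>Inclusions and projections of the \<open>a\<close> summands isomorphic to
    \<open>A\<close>, with the chosen isomorphisms built in.\<close>
  define \<kappa> where "\<kappa> i = \<iota> (h i) \<cdot> e i" for i
  define \<rho> where "\<rho> i = e' i \<cdot> \<pi> (h i)" for i
  have \<kappa>: "arr A B (\<kappa> i)" and \<rho>: "arr B A (\<rho> i)" if "i < a" for i
    unfolding \<kappa>_def \<rho>_def using e that hJ d' by blast+
  have \<rho>\<kappa>: "\<rho> i \<cdot> \<kappa> k = (if i = k then idn K A else 0)" if ik: "i < a" "k < a" for i k
  proof -
    have "\<rho> i \<cdot> \<kappa> k = e' i \<cdot> ((\<pi> (h i) \<cdot> \<iota> (h k)) \<cdot> e k)"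
      unfolding \<kappa>_def \<rho>_def
      using assoc[OF arr_cmp[OF e(1)[OF ik(2)] d'(2)[OF hJ(1)[OF ik(2)]]] d'(3)[OF hJ(1)[OF ik(1)]] e(2)[OF ik(1)]]
        assoc[OF e(1)[OF ik(2)] d'(2)[OF hJ(1)[OF ik(2)]] d'(3)[OF hJ(1)[OF ik(1)]]] by simp
    then show ?thesis
      using d'(4,5) hJ(1) ik hinj[OF ik] e cmp_zero_left[OF e(1)[OF ik(2)] arrD(1)[OF e(2)[OF ik(1)]]]
        cmp_zero_right[OF Aob e(2)[OF ik(1)]] id_left[OF e(1)[OF ik(2)]] by auto
  qed
  \<comment> \<open>By way of one summand isomorphic to \<open>A\<close>, the residue field of
    \<open>A\<close> embeds into the space of arrows, which is finite-dimensional by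
    \<open>fin\<close>. So it is \<open>k\<close>; the argument needs such a summand, hence the
    condition on \<open>a\<close>.\<close>
  have res: "\<exists>c. x - scl K c (idn K A) \<in> rad K A A" if x: "arr A A x" and a: "0 < a" for x
  proof (rule local_residue_field[OF LA x fin subspace_rad_sq, of "\<lambda>y. g \<cdot> (\<kappa> 0 \<cdot> y)"])
    note k0 = \<kappa>[OF a] \<rho>[OF a]
    fix y assume y: "arr A A y"
    have ky: "arr A B (\<kappa> 0 \<cdot> y)" using k0 y by blast
    show "g \<cdot> (\<kappa> 0 \<cdot> y) \<in> rad K A M" using T0_hom_rad[OF A arr_cmp[OF ky g]] .
    show "g \<cdot> (\<kappa> 0 \<cdot> scl K c y) = scl K c (g \<cdot> (\<kappa> 0 \<cdot> y))" for c
      using cmp_scl_right[OF y k0(1)] cmp_scl_right[OF ky g] by simp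
    show "y \<in> rad K A A" if "g \<cdot> (\<kappa> 0 \<cdot> y) \<in> rad_sq K T A M"
    proof -
      have "\<kappa> 0 \<cdot> y \<in> rad K A B" using that rad_sq_iff[OF A ky] by blast
      from rad_cmp_left[OF this k0(2) Aob] show ?thesis
        using assoc[OF y k0] \<rho>\<kappa>[OF a a] y by simp
    qed
    fix z assume z: "arr A A z"
    show "g \<cdot> (\<kappa> 0 \<cdot> (y + z)) = g \<cdot> (\<kappa> 0 \<cdot> y) + g \<cdot> (\<kappa> 0 \<cdot> z)"
      using cmp_add_right[OF y z k0(1)] cmp_add_right[OF ky arr_cmp[OF z k0(1)] g] by simp
  qed
  have "quot_dim (scl K) (hom K A B) (rad K A B) a"
  proof (rule vs.quot_dim_lessThanI[of a \<kappa>])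
    show "\<kappa> i \<in> hom K A B" if "i < a" for i using \<kappa>[OF that] arrD by blast
    show "vs.subspace (rad K A B)" using subspace_rad Aob obs by blast
    show "c i = 0" if c: "(\<Sum>i<a. scl K (c i) (\<kappa> i)) \<in> rad K A B" and i: "i < a" for c i
    proof -
      have "\<rho> i \<cdot> (\<Sum>j<a. scl K (c j) (\<kappa> j)) = (\<Sum>j<a. \<rho> i \<cdot> scl K (c j) (\<kappa> j))"
        using \<kappa> \<rho>[OF i] Aob by (intro cmp_sum_right[of _ A B _ A]) auto
      also have "\<dots> = (\<Sum>j<a. scl K (c j) (\<rho> i \<cdot> \<kappa> j))"
        using cmp_scl_right[OF \<kappa> \<rho>[OF i]] by (intro sum.cong) auto
      also have "\<dots> = (\<Sum>j<a. if i = j then scl K (c j) (idn K A) else 0)"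
        using \<rho>\<kappa>[OF i] by (intro sum.cong) auto
      also have "\<dots> = scl K (c i) (idn K A)" using i by simp
      finally have r: "scl K (c i) (idn K A) \<in> rad K A A" using rad_cmp_left[OF c \<rho>[OF i] Aob] by simp
      show "c i = 0"
      proof (rule ccontr)
        assume "c i \<noteq> 0"
        then have "idn K A \<in> rad K A A" using rad_scl[OF r Aob Aob, of "inverse (c i)"] by simp
        then show False using local_rad_iso[OF LA] iso_id[OF Aob] by blast
      qed
    qed
    fix x assume "x \<in> hom K A B"
    then have x: "arr A B x" using Aob obs by (simp add: arr_def)
    have "\<exists>c. i < a \<longrightarrow> \<rho> i \<cdot> x - scl K c (idn K A) \<in> rad K A A" for i
      using res[OF arr_cmp[OF x \<rho>]] by force
    then obtain c where c: "\<And>i. i < a \<Longrightarrow> \<rho> i \<cdot> x - scl K (c i) (idn K A) \<in> rad K A A" by metis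
    have px: "\<iota> j \<cdot> (\<pi> j \<cdot> x) \<in> rad K A B" if j: "j < length ys" "j \<notin> J" for j
    proof -
      have "\<not> isomorphic K A (ys ! j)" using j by (simp add: J_def)
      moreover have "local_end K (ys ! j)" using indec_closedD(1)[OF T0, of "ys ! j"] ys nth_mem[OF j(1)] by blast
      ultimately have "\<pi> j \<cdot> x \<in> rad K A (ys ! j)"
        using local_nonisomorphic_rad[OF LA] arr_cmp[OF x d'(3)[OF j(1)]] by blast
      then show ?thesis using rad_cmp_left[OF _ d'(2)[OF j(1)] Aob] by blast
    qed
    have hx: "\<iota> (h i) \<cdot> (\<pi> (h i) \<cdot> x) - scl K (c i) (\<kappa> i) \<in> rad K A B" if i: "i < a" for i
    proof -
      note di = d'(2,3)[OF hJ(1)[OF i]] and ei = e(1,2)[OF i]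
      have "\<kappa> i \<cdot> (\<rho> i \<cdot> x - scl K (c i) (idn K A)) \<in> rad K A B" using rad_cmp_left[OF c[OF i] \<kappa>[OF i] Aob] .
      moreover have "\<kappa> i \<cdot> (\<rho> i \<cdot> x - scl K (c i) (idn K A)) = \<kappa> i \<cdot> (\<rho> i \<cdot> x) - scl K (c i) (\<kappa> i)"
        using cmp_diff_right[OF arr_cmp[OF x \<rho>[OF i]] arr_scl[OF arr_id[OF Aob]] \<kappa>[OF i], of "c i"]
          cmp_scl_right[OF arr_id[OF Aob] \<kappa>[OF i], of "c i"] \<kappa>[OF i] by simp
      moreover have "\<kappa> i \<cdot> (\<rho> i \<cdot> x) = \<iota> (h i) \<cdot> (\<pi> (h i) \<cdot> x)"
        unfolding \<kappa>_def \<rho>_def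
        using assoc[OF x di(2) ei(2)] assoc[OF arr_cmp[OF arr_cmp[OF x di(2)] ei(2)] ei(1) di(1)]
          assoc[OF arr_cmp[OF x di(2)] ei(2,1)] e(4)[OF i] arr_cmp[OF x di(2)] by simp
      ultimately show ?thesis by simp
    qed
    have "x = (\<Sum>j<length ys. \<iota> j \<cdot> (\<pi> j \<cdot> x))" using decomp_map_left[OF d x] .
    also have "\<dots> = (\<Sum>j\<in>J. \<iota> j \<cdot> (\<pi> j \<cdot> x)) + (\<Sum>j\<in>{..<length ys} - J. \<iota> j \<cdot> (\<pi> j \<cdot> x))"
      by (subst sum.subset_diff[of J]) (auto simp: J_def add.commute)
    also have "(\<Sum>j\<in>J. \<iota> j \<cdot> (\<pi> j \<cdot> x)) = (\<Sum>i<a. \<iota> (h i) \<cdot> (\<pi> (h i) \<cdot> x))"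
      using sum.reindex_bij_betw[OF h, of "\<lambda>j. \<iota> j \<cdot> (\<pi> j \<cdot> x)"] by simp
    finally have "x - (\<Sum>i<a. scl K (c i) (\<kappa> i)) = (\<Sum>i<a. \<iota> (h i) \<cdot> (\<pi> (h i) \<cdot> x) - scl K (c i) (\<kappa> i)) +
        (\<Sum>j\<in>{..<length ys} - J. \<iota> j \<cdot> (\<pi> j \<cdot> x))"
      by (simp add: sum_subtractf)
    also have "\<dots> \<in> rad K A B" using hx px Aob obs by (intro rad_add rad_sum) auto
    finally show "\<exists>c. x - (\<Sum>i<a. scl K (c i) (\<kappa> i)) \<in> rad K A B" by blast
  qed
  then show ?thesis unfolding J_def[symmetric] a_def[symmetric]
  proof (rule vs.quot_dim_transfer[of _ _ _ _ "\<lambda>c. g \<cdot> c"])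
    show "vs.subspace (hom K A B)" using subspace_hom Aob obs by blast
    show "vs.subspace (rad_sq K T A M)" by (rule subspace_rad_sq)
    fix x assume "x \<in> hom K A B"
    then have x: "arr A B x" using Aob obs by (simp add: arr_def)
    show "g \<cdot> x \<in> rad K A M" using T0_hom_rad[OF A arr_cmp[OF x g]] .
    show "g \<cdot> scl K c x = scl K c (g \<cdot> x)" for c using cmp_scl_right[OF x g] .
    show "(g \<cdot> x \<in> rad_sq K T A M) = (x \<in> rad K A B)" using rad_sq_iff[OF A x] .
    fix y assume "y \<in> hom K A B"
    then have y: "arr A B y" using Aob obs by (simp add: arr_def)
    show "g \<cdot> (x + y) = g \<cdot> x + g \<cdot> y" using cmp_add_right[OF x y g] .
  next
    fix y assume "y \<in> rad K A M"
    then have "arr A M y" using rad_arr Aob obs by blast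
    then obtain u where "arr A B u" "y = g \<cdot> u" using factor[OF T0_add[OF A]] by blast
    then show "\<exists>x\<in>hom K A B. y - g \<cdot> x \<in> rad_sq K T A M"
      using vs.subspace_0[OF subspace_rad_sq] arrD(3) by (intro bexI[of _ u]) auto
  qed
qed

end

section \<open>Duality: the opposite category\<close>

definition op_cat :: "('o, 'm, 'k, 'z) kcat_scheme \<Rightarrow> ('o, 'm, 'k) kcat" where
  "op_cat K = \<lparr>ob = ob K, hom = (\<lambda>A B. hom K B A), cmp = (\<lambda>g f. cmp K f g), idn = idn K, scl = scl K\<rparr>"

lemma op_cat_simps [simp]:
  "ob (op_cat K) = ob K" "hom (op_cat K) A B = hom K B A" "cmp (op_cat K) g f = cmp K f g"
  "idn (op_cat K) = idn K" "scl (op_cat K) = scl K"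
  by (simp_all add: op_cat_def)

lemma is_zero_op [simp]: "is_zero (op_cat K) = is_zero K"
  by (rule ext) (simp add: is_zero_def)

lemma is_iso_op [simp]: "is_iso (op_cat K) A B f = is_iso K B A f"
  unfolding is_iso_def by auto

lemma biproduct_op [simp]:
  "biproduct (op_cat K) A B C = biproduct K A B C" for K :: "('o, 'b::ab_group_add, 'k, 'z) kcat_scheme"
proof -
  show ?thesis unfolding biproduct_def op_cat_simps by blast
qed

lemma finite_sums_op [simp]: "finite_sums (op_cat K) S = finite_sums K S"
proof (intro equalityI subsetI)
  fix C assume "C \<in> finite_sums (op_cat K) S"
  then show "C \<in> finite_sums K S" by induction (auto intro: finite_sums.intros)
next
  fix C assume "C \<in> finite_sums K S"
  then show "C \<in> finite_sums (op_cat K) S" by induction (auto intro: finite_sums.intros)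
qed

lemma add_closure_op [simp]: "add_closure (op_cat K) S = add_closure K S"
  by (simp add: add_closure_def)

lemma indecomposable_op [simp]: "indecomposable (op_cat K) = indecomposable K"
  by (rule ext) (simp add: indecomposable_def)

lemma local_end_op [simp]: "local_end (op_cat K) = local_end K"
  by (rule ext) (simp add: local_end_def)

lemma sumlist_op [simp]: "sumlist (op_cat K) ys C = sumlist K ys C"
proof
  assume "sumlist (op_cat K) ys C" then show "sumlist K ys C" by induction (auto intro: sumlist.intros)
next
  assume "sumlist K ys C" then show "sumlist (op_cat K) ys C" by induction (auto intro: sumlist.intros)
qed

context linear_category begin

lemma lin_cat_op: "lin_cat (op_cat K)"
  unfolding lin_cat_def op_cat_simps
proof (intro conjI ballI allI)
  show "vector_space (scl K)" by unfold_locales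
next
  fix A B assume "A \<in> ob K" "B \<in> ob K"
  then show "vs.subspace (hom K B A)" by (simp add: subspace_hom)
next
  fix A assume "A \<in> ob K" then show "idn K A \<in> hom K A A" using arr_id arrD(3) by blast
next
  fix A B f assume "A \<in> ob K" "B \<in> ob K" "f \<in> hom K B A"
  then have "arr B A f" by (simp add: arr_def)
  then show "idn K A \<cdot> f = f" "f \<cdot> idn K B = f" by simp_all
next
  fix A B C f g assume "A \<in> ob K" "B \<in> ob K" "C \<in> ob K" "f \<in> hom K B A" "g \<in> hom K C B"
  then have "arr B A f" "arr C B g" by (simp_all add: arr_def)
  then show "f \<cdot> g \<in> hom K C A" using arr_cmp arrD(3) by blast
next
  fix A B C D f g h assume "A \<in> ob K" "B \<in> ob K" "C \<in> ob K" "D \<in> ob K" "f \<in> hom K B A" "g \<in> hom K C B" "h \<in> hom K D C"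
  then have "arr B A f" "arr C B g" "arr D C h" by (simp_all add: arr_def)
  then show "(f \<cdot> g) \<cdot> h = f \<cdot> (g \<cdot> h)" by (intro assoc)
next
  fix A B C f f' g g' a assume "A \<in> ob K" "B \<in> ob K" "C \<in> ob K" "f \<in> hom K B A" "f' \<in> hom K B A"
    "g \<in> hom K C B" "g' \<in> hom K C B"
  then have a: "arr B A f" "arr B A f'" "arr C B g" "arr C B g'" by (simp_all add: arr_def)
  show "(f + f') \<cdot> g = f \<cdot> g + f' \<cdot> g" using cmp_add_left[OF a(3,1,2)] .
  show "f \<cdot> (g + g') = f \<cdot> g + f \<cdot> g'" using cmp_add_right[OF a(3,4,1)] .
  show "scl K a f \<cdot> g = scl K a (f \<cdot> g)" using cmp_scl_left[OF a(3,1)] .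
  show "f \<cdot> scl K a g = scl K a (f \<cdot> g)" using cmp_scl_right[OF a(3,1)] .
qed

lemma isomorphic_op [simp]: "isomorphic (op_cat K) = isomorphic K"
proof (intro ext iffI)
  fix A B
  show "isomorphic K A B" if "isomorphic (op_cat K) A B" using that isomorphic_sym[of B A] by (simp add: isomorphic_def)
  show "isomorphic (op_cat K) A B" if "isomorphic K A B" using isomorphic_sym[OF that] by (simp add: isomorphic_def)
qed

lemma iso_class_op [simp]: "iso_class (op_cat K) = iso_class K"
  by (rule ext) (simp add: iso_class_def)

lemma rad_op:
  assumes "A \<in> ob K" "B \<in> ob K" shows "rad (op_cat K) A B = rad K B A"
  unfolding rad_def op_cat_simps is_iso_op using assms iso_swap by (auto simp: arr_def)

lemma rad_sq_op:
  assumes "A \<in> ob K" "B \<in> ob K" "\<And>Y. Y \<in> add_closure K T \<Longrightarrow> Y \<in> ob K"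
  shows "rad_sq (op_cat K) T A B = rad_sq K T B A"
proof -
  have "{cmp (op_cat K) g f | Y f g. Y \<in> add_closure (op_cat K) T \<and> f \<in> rad (op_cat K) A Y \<and> g \<in> rad (op_cat K) Y B} =
    {cmp K g f | Y f g. Y \<in> add_closure K T \<and> f \<in> rad K B Y \<and> g \<in> rad K Y A}"
    unfolding op_cat_simps add_closure_op using assms(3) rad_op[OF assms(1)] rad_op[OF _ assms(2)] by blast
  then show ?thesis unfolding rad_sq_def by simp
qed

end

lemma right_approx_op [simp]: "right_approx (op_cat K) \<X> B g M = left_approx K \<X> M g B"
  by (auto simp: right_approx_def left_approx_def)

lemma right_minimal_op [simp]: "right_minimal (op_cat K) B g = left_minimal K g B"
  by (simp add: right_minimal_def left_minimal_def)

lemma (in ks_category) krull_schmidt_op: "krull_schmidt (op_cat K)"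
  using ks lin_cat_op by (simp add: krull_schmidt_def additive_cat_def)

context alg_closed_ks_category begin

text \<open>Restates the results of the locale \<open>approximation\<close> as plain implications,
  so that they can be instantiated in the opposite category as well.\<close>

lemma right_approx_arrows:
  assumes T: "indec_closed T" and M: "M \<in> T"
    and approx: "right_approx K (add_closure K (T - iso_class K M)) B g M" "right_minimal K B g"
    and no_loop: "rad K M M \<subseteq> rad_sq K T M M"
    and finite_end: "quot_dim (scl K) (hom K M M) I n" "vs.subspace I"
      "\<And>x. x \<in> I \<Longrightarrow> \<exists>t\<in>hom K M B. x = g \<cdot> t"
    and ys: "sumlist K ys B" "set ys \<subseteq> T - iso_class K M"
  shows "quot_dim (scl K) (hom K M M) {g \<cdot> t | t. t \<in> hom K M B} 1"
    and "A \<in> T - iso_class K M \<Longrightarrow> quot_dim (scl K) (rad K A M) (rad_sq K T A M) N \<Longrightarrow>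
      quot_dim (scl K) (rad K A M) (rad_sq K T A M) (card {j. j < length ys \<and> isomorphic K A (ys ! j)})"
    and "arr M B s \<Longrightarrow> g \<cdot> s \<noteq> idn K M"
proof -
  interpret approximation K T M B g I n using assms by unfold_locales blast+
  show "quot_dim (scl K) (hom K M M) {g \<cdot> t | t. t \<in> hom K M B} 1" by (rule quot_dim_end)
  show "A \<in> T - iso_class K M \<Longrightarrow> quot_dim (scl K) (rad K A M) (rad_sq K T A M) N \<Longrightarrow>
      quot_dim (scl K) (rad K A M) (rad_sq K T A M) (card {j. j < length ys \<and> isomorphic K A (ys ! j)})"
    using quot_dim_arrows ys by blast
  show "arr M B s \<Longrightarrow> g \<cdot> s \<noteq> idn K M" by (rule not_split)
qed

text \<open>In the opposite category \<open>g\<close> is a minimal right approximation of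
  \<open>M\<close> and arrows are reversed. The radical is the same there thanks to
  \<open>iso_swap\<close>, and so is its square.\<close>

lemma left_approx_arrows:
  assumes T: "indec_closed T" and M: "M \<in> T"
    and approx: "left_approx K (add_closure K (T - iso_class K M)) M g B" "left_minimal K g B"
    and no_loop: "rad K M M \<subseteq> rad_sq K T M M"
    and finite_end: "quot_dim (scl K) (hom K M M) I n" "vs.subspace I"
      "\<And>x. x \<in> I \<Longrightarrow> \<exists>t\<in>hom K B M. x = t \<cdot> g"
    and ys: "sumlist K ys B" "set ys \<subseteq> T - iso_class K M"
    and A: "A \<in> T - iso_class K M" "quot_dim (scl K) (rad K M A) (rad_sq K T M A) N"
  shows "quot_dim (scl K) (rad K M A) (rad_sq K T M A) (card {j. j < length ys \<and> isomorphic K A (ys ! j)})"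
proof -
  interpret op: alg_closed_ks_category "op_cat K"
    by unfold_locales (auto simp: lin_cat_op krull_schmidt_op)
  have ob: "M \<in> ob K" "A \<in> ob K" using indec_closedD[OF T] M A by auto
  have T': "op.indec_closed T" using T unfolding op.indec_closed_def indec_closed_def by simp
  have sq: "rad_sq (op_cat K) T U V = rad_sq K T V U" if "U \<in> ob K" "V \<in> ob K" for U V
    using rad_sq_op[OF that] add_closure_ob by blast
  show ?thesis
    using op.right_approx_arrows(2)[OF T' M, of B g I n ys A N] assms sq ob by (simp add: rad_op)
qed

end

section \<open>Extensions in stably 2-Calabi--Yau categories\<close>

text \<open>What is kept of the long exact sequences: a connecting map \<delta> into
  \<open>Ext(Y,N)\<close>, exact at \<open>Hom(Y,M)\<close> and onto when \<open>Ext(Y,B)\<close>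
  vanishes, and extension of maps along \<open>f\<close> when \<open>Ext(M,Y)\<close> vanishes. Of
  the 2-Calabi--Yau condition there remain the symmetry of the vanishing of \<open>Ext\<close> and
  finiteness modulo projectives. Everything is phrased with \<open>ext_cyc\<close> and
  \<open>ext_bd\<close>, so that no quotient space has to be formed.\<close>

locale extension_category = alg_closed_ks_category X
  for X :: "('o, 'm::ab_group_add, 'k::alg_closed_field) ext_cat" +
  assumes cfl_hom: "cfl X N f B g M \<Longrightarrow>
      N \<in> ob X \<and> B \<in> ob X \<and> M \<in> ob X \<and> f \<in> hom X N B \<and> g \<in> hom X B M"
    and connecting_map: "cfl X N f B g M \<Longrightarrow> Y \<in> ob X \<Longrightarrow>
      \<exists>\<delta>. (\<forall>h\<in>hom X Y M. \<delta> h \<in> ext_cyc X Y N) \<and>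
        (\<forall>h\<in>hom X Y M. \<forall>h'\<in>hom X Y M. \<delta> (h + h') = \<delta> h + \<delta> h') \<and>
        (\<forall>h\<in>hom X Y M. \<forall>a. \<delta> (scl X a h) = scl X a (\<delta> h)) \<and>
        (\<forall>h\<in>hom X Y M. \<delta> h \<in> ext_bd X Y N \<longleftrightarrow> (\<exists>t\<in>hom X Y B. h = cmp X g t)) \<and>
        (ext_zero X Y B \<longrightarrow> (\<forall>e\<in>ext_cyc X Y N. \<exists>h\<in>hom X Y M. e - \<delta> h \<in> ext_bd X Y N))"
    and extend: "cfl X N f B g M \<Longrightarrow> Y \<in> ob X \<Longrightarrow> ext_zero X M Y \<Longrightarrow> h \<in> hom X N Y \<Longrightarrow>
      \<exists>t\<in>hom X B Y. h = cmp X t f"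
    and ext_zero_sym: "A \<in> ob X \<Longrightarrow> B \<in> ob X \<Longrightarrow> ext_zero X A B \<Longrightarrow> ext_zero X B A"
    and finite_stable_end: "A \<in> ob X \<Longrightarrow> \<exists>I n. quot_dim (scl X) (hom X A A) I n \<and>
      module.subspace (scl X) I \<and>
      (\<forall>x\<in>I. \<exists>P f g. projective_in X (ob X) P \<and> f \<in> hom X A P \<and> g \<in> hom X P A \<and> x = cmp X g f)"
    and ext_zero_biproduct: "biproduct X A B C \<Longrightarrow> N \<in> ob X \<Longrightarrow>
      ext_zero X C N \<longleftrightarrow> ext_zero X A N \<and> ext_zero X B N"
    and ext_zero_zero: "is_zero X Z \<Longrightarrow> N \<in> ob X \<Longrightarrow> ext_zero X Z N"
    and subspace_ext_bd: "A \<in> ob X \<Longrightarrow> B \<in> ob X \<Longrightarrow> module.subspace (scl X) (ext_bd X A B)"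

text \<open>The pairing \<Psi> vanishes identically, since its second argument always lies in
  \<open>I A (s B)\<close>; its kernel in the first argument is then everything, and this kernel is
  \<open>I B (s A)\<close>.\<close>

lemma two_CY_sym:
  assumes "two_CY K I s R" "A \<in> ob K" "B \<in> ob K" "hom K A (s B) \<subseteq> I A (s B)"
  shows "hom K B (s A) \<subseteq> I B (s A)"
proof
  fix x assume x: "x \<in> hom K B (s A)"
  from assms(1) obtain \<Psi> :: "'a \<Rightarrow> 'a \<Rightarrow> 'b \<Rightarrow> 'b \<Rightarrow> 'c" where
    \<Psi>: "\<forall>A\<in>ob K. \<forall>B\<in>ob K.
           (\<forall>x\<in>hom K B (s A).
              linear_form (scl K) (hom K A (s B)) (\<Psi> A B x) \<and> (\<forall>t\<in>I A (s B). \<Psi> A B x t = 0)) \<and>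
           (\<forall>t\<in>hom K A (s B). linear_form (scl K) (hom K B (s A)) (\<lambda>x. \<Psi> A B x t)) \<and>
           (\<forall>x\<in>hom K B (s A). (\<forall>t\<in>hom K A (s B). \<Psi> A B x t = 0) \<longleftrightarrow> x \<in> I B (s A)) \<and>
           (\<forall>\<xi>. linear_form (scl K) (hom K A (s B)) \<xi> \<and> (\<forall>t\<in>I A (s B). \<xi> t = 0) \<longrightarrow>
              (\<exists>x\<in>hom K B (s A). \<forall>t\<in>hom K A (s B). \<Psi> A B x t = \<xi> t))"
    unfolding two_CY_def by (elim conjE exE)
  note \<Psi>' = \<Psi>[THEN bspec, OF assms(2), THEN bspec, OF assms(3)]
  have "\<forall>t\<in>hom K A (s B). \<Psi> A B x t = 0" using \<Psi>' x assms(4) by blast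
  then show "x \<in> I B (s A)" using \<Psi>' x by blast
qed

lemma two_CY_finite:
  "two_CY K I s R \<Longrightarrow> A \<in> ob K \<Longrightarrow> B \<in> ob K \<Longrightarrow> \<exists>n. quot_dim (scl K) (hom K A B) (I A B) n"
  by (simp add: two_CY_def)

text \<open>Closure under direct summands keeps decompositions inside the subcategory, and zero
  objects, biproducts and local objects mean the same there. The two record types differ so that the
  lemma covers the passage from an exact or triangulated category to its
  \<open>ext_cat\<close>.\<close>

lemma krull_schmidt_full_subcat:
  fixes K :: "('o, 'm::ab_group_add, 'k::field, 'z) kcat_scheme" and K' :: "('o, 'm, 'k, 'y) kcat_scheme"
  assumes K: "krull_schmidt K" and S: "full_subcat K (ob K')"
    and eq: "hom K' = hom K" "cmp K' = cmp K" "idn K' = idn K" "scl K' = scl K"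
  shows "krull_schmidt K'"
proof -
  have sub: "ob K' \<subseteq> ob K" and zero: "\<And>Z. is_zero K Z \<Longrightarrow> Z \<in> ob K'"
    and bi: "\<And>A B C. biproduct K A B C \<Longrightarrow> C \<in> ob K' \<longleftrightarrow> A \<in> ob K' \<and> B \<in> ob K'"
    using S unfolding full_subcat_def by blast+
  have add: "additive_cat K" using K by (simp add: krull_schmidt_def)
  have lin: "lin_cat K" using add by (simp add: additive_cat_def)
  have z: "is_zero K' Z \<longleftrightarrow> is_zero K Z" for Z using zero sub eq by (auto simp: is_zero_def)
  have b: "biproduct K' A B C \<longleftrightarrow> biproduct K A B C \<and> C \<in> ob K'" for A B C
    using bi[of A B C] sub unfolding biproduct_def eq by blast
  have i: "is_iso K' = is_iso K" by (intro ext) (simp add: is_iso_def eq)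
  have l: "local_end K' M \<longleftrightarrow> local_end K M \<and> M \<in> ob K'" for M
    using sub by (auto simp: local_end_def eq i)
  have lin': "lin_cat K'"
  proof -
    interpret K: linear_category K by unfold_locales (rule lin)
    show ?thesis unfolding lin_cat_def eq
    proof (intro conjI ballI allI)
      show "vector_space (scl K)" by unfold_locales
    next
      fix A B assume "A \<in> ob K'" "B \<in> ob K'"
      then show "K.vs.subspace (hom K A B)" using sub K.subspace_hom by blast
    next
      fix A assume "A \<in> ob K'" then show "idn K A \<in> hom K A A" using sub K.arr_id K.arrD(3) by blast
    next
      fix A B f assume "A \<in> ob K'" "B \<in> ob K'" "f \<in> hom K A B"
      then have "K.arr A B f" using sub by (auto simp: K.arr_def)
      then show "cmp K f (idn K A) = f" "cmp K (idn K B) f = f" by simp_all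
    next
      fix A B C f g assume "A \<in> ob K'" "B \<in> ob K'" "C \<in> ob K'" "f \<in> hom K A B" "g \<in> hom K B C"
      then have "K.arr A B f" "K.arr B C g" using sub by (auto simp: K.arr_def)
      then show "cmp K g f \<in> hom K A C" using K.arr_cmp K.arrD(3) by blast
    next
      fix A B C D f g h assume "A \<in> ob K'" "B \<in> ob K'" "C \<in> ob K'" "D \<in> ob K'"
        "f \<in> hom K A B" "g \<in> hom K B C" "h \<in> hom K C D"
      then have "K.arr A B f" "K.arr B C g" "K.arr C D h" using sub by (auto simp: K.arr_def)
      then show "cmp K h (cmp K g f) = cmp K (cmp K h g) f" using K.assoc by simp
    next
      fix A B C f f' g g' a assume "A \<in> ob K'" "B \<in> ob K'" "C \<in> ob K'" "f \<in> hom K A B" "f' \<in> hom K A B"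
        "g \<in> hom K B C" "g' \<in> hom K B C"
      then have a: "K.arr A B f" "K.arr A B f'" "K.arr B C g" "K.arr B C g'" using sub by (auto simp: K.arr_def)
      show "cmp K g (f + f') = cmp K g f + cmp K g f'" using K.cmp_add_right[OF a(1-3)] .
      show "cmp K (g + g') f = cmp K g f + cmp K g' f" using K.cmp_add_left[OF a(1,3,4)] .
      show "cmp K g (scl K a f) = scl K a (cmp K g f)" using K.cmp_scl_right[OF a(1,3)] .
      show "cmp K (scl K a g) f = scl K a (cmp K g f)" using K.cmp_scl_left[OF a(1,3)] .
    qed
  qed
  have "A \<in> ob K' \<Longrightarrow> A \<in> finite_sums K' {M. local_end K' M}" if "A \<in> finite_sums K {M. local_end K M}" for A
    using that
  proof induction
    case (zero Z) then show ?case using z by (auto intro: finite_sums.zero)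
  next
    case (single A) then show ?case using l by (auto intro: finite_sums.single)
  next
    case (sum A B C) then show ?case using b bi by (blast intro: finite_sums.sum)
  qed
  moreover have "\<exists>C. biproduct K' A B C" if AB: "A \<in> ob K'" "B \<in> ob K'" for A B
  proof -
    obtain C where "biproduct K A B C" using add AB sub unfolding additive_cat_def by blast
    then show ?thesis using b bi AB by blast
  qed
  moreover have "\<exists>Z. is_zero K' Z" using add z unfolding additive_cat_def by blast
  ultimately show ?thesis unfolding krull_schmidt_def additive_cat_def using lin' K sub
    unfolding krull_schmidt_def by blast
qed

section \<open>Exact Frobenius categories\<close>

locale frobenius_2CY = linear_category E
  for E :: "('o, 'm::ab_group_add, 'k::alg_closed_field) exact_cat" +
  assumes frobenius_2CY: "two_CY_frobenius E"
begin

abbreviation comp_exact (infixl "\<cdot>" 70) where "g \<cdot> f \<equiv> cmp E g f"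

lemma exact: "exact E"
  using frobenius_2CY by (simp add: two_CY_frobenius_def frobenius_def)

lemma projective_iff_injective: "exact_projective E P \<longleftrightarrow> exact_injective E P"
  using frobenius_2CY by (simp add: two_CY_frobenius_def frobenius_def)

lemma ker_coker: "cfl E A f B g C \<Longrightarrow> ker_coker_pair E A f B g C"
  using exact by (simp add: exact_def)

lemma cflD:
  assumes "cfl E A f B g C"
  shows "arr A B f" "arr B C g" "g \<cdot> f = 0"
  using ker_coker[OF assms] by (auto simp: ker_coker_pair_def arr_def)

lemma kernel_lift:
  assumes "cfl E A f B g C" "arr Y B h" "g \<cdot> h = 0" obtains u where "arr Y A u" "f \<cdot> u = h"
  using ker_coker[OF assms(1)] assms(2,3) unfolding ker_coker_pair_def arr_def by blast

lemma kernel_mono: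
  assumes "cfl E A f B g C" "arr Y A u" "arr Y A u'" "f \<cdot> u = f \<cdot> u'" shows "u = u'"
proof -
  have fu: "arr Y B (f \<cdot> u)" using assms cflD by blast
  have "g \<cdot> (f \<cdot> u) = 0" using assoc[OF assms(2) cflD(1,2)[OF assms(1)]] cflD(3)[OF assms(1)]
      cmp_zero_left[OF assms(2)] arrD(2)[OF cflD(2)[OF assms(1)]] by simp
  then have "\<exists>!v. v \<in> hom E Y A \<and> f \<cdot> v = f \<cdot> u"
    using ker_coker[OF assms(1)] fu unfolding ker_coker_pair_def arr_def by blast
  then show ?thesis using assms arrD(3) by metis
qed

lemma cokernel_factor:
  assumes "cfl E A f B g C" "arr B Y h" "h \<cdot> f = 0" obtains u where "arr C Y u" "u \<cdot> g = h"
  using ker_coker[OF assms(1)] assms(2,3) unfolding ker_coker_pair_def arr_def by blast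

lemma cokernel_epi:
  assumes "cfl E A f B g C" "arr C Y u" "arr C Y u'" "u \<cdot> g = u' \<cdot> g" shows "u = u'"
proof -
  have fu: "arr B Y (u \<cdot> g)" using assms cflD by blast
  have "(u \<cdot> g) \<cdot> f = 0" using assoc[OF cflD(1,2)[OF assms(1)] assms(2)] cflD(3)[OF assms(1)]
      cmp_zero_right[OF arrD(1)[OF cflD(1)[OF assms(1)]] assms(2)] by simp
  then have "\<exists>!v. v \<in> hom E C Y \<and> v \<cdot> g = u \<cdot> g"
    using ker_coker[OF assms(1)] fu unfolding ker_coker_pair_def arr_def by blast
  then show ?thesis using assms arrD(3) by metis
qed

lemma injective_extend:
  assumes "cfl E A f B g C" "exact_injective E Q" "arr A Q h" obtains u where "arr B Q u" "u \<cdot> f = h"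
proof -
  have "inflation E A B f" using assms(1) by (auto simp: inflation_def)
  then obtain u where "u \<in> hom E B Q" "u \<cdot> f = h" using assms(2,3) unfolding exact_injective_def arr_def by blast
  then show ?thesis using that assms cflD(1)[OF assms(1)] by (auto simp: arr_def)
qed

lemma projective_lift:
  assumes "cfl E A f B g C" "exact_projective E P" "arr P C h" obtains u where "arr P B u" "g \<cdot> u = h"
proof -
  have "deflation E B C g" using assms(1) by (auto simp: deflation_def)
  then obtain u where "u \<in> hom E P B" "g \<cdot> u = h" using assms(2,3) unfolding exact_projective_def arr_def by blast
  then show ?thesis using that assms cflD(1)[OF assms(1)] by (auto simp: arr_def)
qed

lemma cosyzD:
  assumes "A \<in> ob E" "cosyz E A = (i, Q, p, C)"
  shows "exact_injective E Q" "cfl E A i Q p C"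
proof -
  have "\<exists>Q f B g. exact_injective E Q \<and> cfl E A f Q g B"
    using frobenius_2CY assms(1) by (simp add: two_CY_frobenius_def frobenius_def)
  then have "\<exists>x. case x of (i, Q, p, C) \<Rightarrow> exact_injective E Q \<and> cfl E A i Q p C" by force
  from someI_ex[OF this] have "case cosyz E A of (i, Q, p, C) \<Rightarrow> exact_injective E Q \<and> cfl E A i Q p C"
    unfolding cosyz_def .
  then show "exact_injective E Q" "cfl E A i Q p C" using assms(2) by simp_all
qed

text \<open>The last two clauses say that \<open>g'\<close> is a cokernel of \<open>f'\<close>.\<close>

lemma pullback_conflation:
  assumes c: "cfl E N f B g M" and h: "arr Y M h"
  obtains B' g' b f' where "arr B' Y g'" "arr B' B b" "g \<cdot> b = h \<cdot> g'" "arr N B' f'" "b \<cdot> f' = f" "g' \<cdot> f' = 0"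
    "\<And>D d. arr B' D d \<Longrightarrow> d \<cdot> f' = 0 \<Longrightarrow> \<exists>u. arr Y D u \<and> u \<cdot> g' = d"
    "\<And>D u u'. arr Y D u \<Longrightarrow> arr Y D u' \<Longrightarrow> u \<cdot> g' = u' \<cdot> g' \<Longrightarrow> u = u'"
proof -
  note c' = cflD[OF c]
  have ob: "N \<in> ob E" "Y \<in> ob E" "M \<in> ob E" "B \<in> ob E" using c' h arrD by blast+
  have "deflation E B M g" using c by (auto simp: deflation_def)
  then obtain B' g' b where pb: "pullback E B M B' Y g h g' b" and d: "deflation E B' Y g'"
  proof -
    have "\<forall>B C g. deflation E B C g \<longrightarrow> (\<forall>C'\<in>ob E. \<forall>c\<in>hom E C' C.
        \<exists>B' g' b. pullback E B C B' C' g c g' b \<and> deflation E B' C' g')"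
      using exact unfolding exact_def by (elim conjE)
    then show ?thesis using that \<open>deflation E B M g\<close> h unfolding arr_def by blast
  qed
  \<comment> \<open>The axioms give some kernel \<open>f''\<close> of \<open>g'\<close>. It factors
    through the map \<open>f'\<close> from \<open>N\<close> that the pullback provides, so a map
    killing \<open>f'\<close> kills \<open>f''\<close> and descends along \<open>g'\<close>.\<close>
  obtain f'' N'' where c'': "cfl E N'' f'' B' g' Y" using d by (auto simp: deflation_def)
  note d' = cflD[OF c'']
  have g': "arr B' Y g'" and b: "arr B' B b" and sq: "g \<cdot> b = h \<cdot> g'" using pb d'(2) c' by (auto simp: pullback_def arr_def)
  have uni: "\<exists>!w. w \<in> hom E Z B' \<and> g' \<cdot> w = u \<and> b \<cdot> w = v" if "arr Z Y u" "arr Z B v" "g \<cdot> v = h \<cdot> u" for Z u v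
    using pb that unfolding pullback_def arr_def by blast
  have "\<exists>!w. w \<in> hom E N B' \<and> g' \<cdot> w = 0 \<and> b \<cdot> w = f"
    using uni[OF arr_zero[OF ob(1,2)] c'(1)] c'(3) cmp_zero_right[OF ob(1) h] by simp
  then obtain f' where "f' \<in> hom E N B'" and f'': "g' \<cdot> f' = 0" "b \<cdot> f' = f" by blast
  then have f': "arr N B' f'" using ob b by (auto simp: arr_def)
  show ?thesis
  proof (rule that[OF g' b sq f' f''(2,1)])
    show "u = u'" if "arr Y D u" "arr Y D u'" "u \<cdot> g' = u' \<cdot> g'" for D u u'
      using cokernel_epi[OF c'' that] .
    fix D d assume d: "arr B' D d" and df: "d \<cdot> f' = 0"
    have N'': "N'' \<in> ob E" using d'(1) arrD by blast
    have bf: "arr N'' B (b \<cdot> f'')" using b d' by blast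
    have gb: "g \<cdot> (b \<cdot> f'') = 0"
      using assoc[OF d'(1) b c'(2)] assoc[OF d'(1) g' h] sq d'(3) cmp_zero_right[OF N'' h] by simp
    then obtain k where k: "arr N'' N k" "f \<cdot> k = b \<cdot> f''" using kernel_lift[OF c bf] by blast
    have "\<exists>!w. w \<in> hom E N'' B' \<and> g' \<cdot> w = 0 \<and> b \<cdot> w = b \<cdot> f''"
      using uni[OF arr_zero[OF N'' ob(2)] bf] gb cmp_zero_right[OF N'' h] by simp
    moreover have "g' \<cdot> (f' \<cdot> k) = 0" using assoc[OF k(1) f' g'] f''(1) cmp_zero_left[OF k(1) ob(2)] by simp
    moreover have "b \<cdot> (f' \<cdot> k) = b \<cdot> f''" using assoc[OF k(1) f' b] f''(2) k by simp
    ultimately have "f' \<cdot> k = f''" using arrD(3)[OF arr_cmp[OF k(1) f']] d'(3) arrD(3)[OF d'(1)] by blast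
    then have "d \<cdot> f'' = 0" using assoc[OF k(1) f' d] df cmp_zero_left[OF k(1)] arrD[OF d] by auto
    then show "\<exists>u. arr Y D u \<and> u \<cdot> g' = d" using cokernel_factor[OF c'' d] by blast
  qed
qed

text \<open>\<open>v\<close> is the map of cokernels induced by an extension of
  \<open>N \<rightarrow> Q\<close> along \<open>f\<close>; it represents the class of the conflation
  in \<open>Ext(M,N)\<close>. Exactness is checked on pullbacks of conflations, whose cokernel
  property turns maps out of the pullback into maps out of \<open>Y\<close>.\<close>

lemma connecting_map:
  assumes c: "cfl E N f B g M" and cN: "cosyz E N = (i, Q, p, C)"
  obtains v where "arr M C v"
    "\<And>Y h. arr Y M h \<Longrightarrow> (\<exists>w. arr Y Q w \<and> v \<cdot> h = p \<cdot> w) \<longleftrightarrow> (\<exists>t. arr Y B t \<and> h = g \<cdot> t)"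
    "\<forall>Y e iB QB pB CB. cosyz E B = (iB, QB, pB, CB) \<longrightarrow>
       (\<forall>x. arr Y CB x \<longrightarrow> (\<exists>w. arr Y QB w \<and> x = pB \<cdot> w)) \<longrightarrow> arr Y C e \<longrightarrow>
       (\<exists>h w. arr Y M h \<and> arr Y Q w \<and> e - v \<cdot> h = p \<cdot> w)"
proof -
  note c' = cflD[OF c]
  have ob: "N \<in> ob E" "M \<in> ob E" "B \<in> ob E" using c' arrD by blast+
  note q = cosyzD[OF ob(1) cN]
  note q' = cflD[OF q(2)]
  have obQ: "Q \<in> ob E" "C \<in> ob E" using q' arrD by blast+
  obtain u where u: "arr B Q u" "u \<cdot> f = i" using injective_extend[OF c q(1) q'(1)] .
  have pu: "arr B C (p \<cdot> u)" using u q' by blast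
  have "(p \<cdot> u) \<cdot> f = 0" using assoc[OF c'(1) u(1) q'(2)] u q' by simp
  then obtain v where v: "arr M C v" "v \<cdot> g = p \<cdot> u" using cokernel_factor[OF c pu] by blast
  show ?thesis
  proof (rule that[OF v(1)])
    fix Y h assume h: "arr Y M h"
    have Y: "Y \<in> ob E" using h arrD by blast
    show "(\<exists>w. arr Y Q w \<and> v \<cdot> h = p \<cdot> w) \<longleftrightarrow> (\<exists>t. arr Y B t \<and> h = g \<cdot> t)"
    proof
      assume "\<exists>t. arr Y B t \<and> h = g \<cdot> t"
      then obtain t where t: "arr Y B t" "h = g \<cdot> t" by blast
      have "v \<cdot> h = p \<cdot> (u \<cdot> t)" using assoc[OF t(1) c'(2) v(1)] assoc[OF t(1) u(1) q'(2)] v t by simp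
      then show "\<exists>w. arr Y Q w \<and> v \<cdot> h = p \<cdot> w" using t u by blast
    next
      assume "\<exists>w. arr Y Q w \<and> v \<cdot> h = p \<cdot> w"
      then obtain w where w: "arr Y Q w" "v \<cdot> h = p \<cdot> w" by blast
      \<comment> \<open>If \<open>v \<cdot> h\<close> lifts along \<open>p\<close>, the pulled back
        conflation splits: \<open>w \<cdot> g'\<close> and \<open>u \<cdot> b\<close> agree after
        \<open>p\<close>, their difference is \<open>i \<cdot> r\<close>, and \<open>r\<close>
        restricts to minus the identity of \<open>N\<close>. Correcting the identity of
        \<open>B'\<close> by \<open>f' \<cdot> r\<close> gives a map that descends to
        \<open>s\<close> on \<open>Y\<close>, and \<open>b \<cdot> s\<close> lifts
        \<open>h\<close>.\<close>
      obtain B' g' b f' where pb: "arr B' Y g'" "arr B' B b" "g \<cdot> b = h \<cdot> g'" "arr N B' f'" "b \<cdot> f' = f" "g' \<cdot> f' = 0"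
        and fac: "\<And>D d. arr B' D d \<Longrightarrow> d \<cdot> f' = 0 \<Longrightarrow> \<exists>u. arr Y D u \<and> u \<cdot> g' = d"
        and epi: "\<And>D u u'. arr Y D u \<Longrightarrow> arr Y D u' \<Longrightarrow> u \<cdot> g' = u' \<cdot> g' \<Longrightarrow> u = u'"
        by (rule pullback_conflation[OF c h]) (rule that)
      have B': "B' \<in> ob E" using pb arrD by blast
      have a: "arr B' Q (w \<cdot> g')" "arr B' Q (u \<cdot> b)" "arr B' M (g \<cdot> b)" using w u pb c' by blast+
      have "p \<cdot> (w \<cdot> g' - u \<cdot> b) = (p \<cdot> w) \<cdot> g' - (p \<cdot> u) \<cdot> b"
        using cmp_diff_right[OF a(1,2) q'(2)] assoc[OF pb(1) w(1) q'(2)] assoc[OF pb(2) u(1) q'(2)] by simp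
      also have "(p \<cdot> w) \<cdot> g' = v \<cdot> (g \<cdot> b)" using assoc[OF pb(1) h v(1)] w pb by simp
      also have "(p \<cdot> u) \<cdot> b = v \<cdot> (g \<cdot> b)" using assoc[OF pb(2) c'(2) v(1)] v by simp
      finally have "p \<cdot> (w \<cdot> g' - u \<cdot> b) = 0" by simp
      then obtain r where r: "arr B' N r" "i \<cdot> r = w \<cdot> g' - u \<cdot> b"
        using kernel_lift[OF q(2) arr_diff[OF a(1,2)]] by blast
      have "i \<cdot> (r \<cdot> f') = (w \<cdot> g' - u \<cdot> b) \<cdot> f'" using assoc[OF pb(4) r(1) q'(1)] r by simp
      also have "\<dots> = - i" using cmp_diff_left[OF pb(4) a(1,2)] assoc[OF pb(4,1) w(1)] assoc[OF pb(4,2) u(1)]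
          pb(5,6) u(2) cmp_zero_right[OF ob(1) w(1)] by simp
      also have "\<dots> = i \<cdot> (- idn E N)" using cmp_neg_right[OF arr_id[OF ob(1)] q'(1)] q'(1) by simp
      finally have rf: "r \<cdot> f' = - idn E N"
        using kernel_mono[OF q(2), of N "r \<cdot> f'" "- idn E N"] r(1) pb(4) ob by blast
      have fr: "arr B' B' (f' \<cdot> r)" using r pb by blast
      define d where "d = idn E B' + f' \<cdot> r"
      have d: "arr B' B' d" unfolding d_def using fr B' by blast
      have "d \<cdot> f' = 0" unfolding d_def
        using cmp_add_left[OF pb(4) arr_id[OF B'] fr] assoc[OF pb(4) r(1) pb(4)] rf
          cmp_neg_right[OF arr_id[OF ob(1)] pb(4)] pb(4) by simp
      then obtain s where s: "arr Y B' s" "s \<cdot> g' = d" using fac[OF d] by blast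
      have "(g \<cdot> (b \<cdot> s)) \<cdot> g' = g \<cdot> (b \<cdot> d)"
        using assoc[OF pb(1) arr_cmp[OF s(1) pb(2)] c'(2)] assoc[OF pb(1) s(1) pb(2)] s by simp
      also have "b \<cdot> d = b + f \<cdot> r" unfolding d_def
        using cmp_add_right[OF arr_id[OF B'] fr pb(2)] assoc[OF r(1) pb(4,2)] pb by simp
      also have "g \<cdot> (b + f \<cdot> r) = h \<cdot> g'"
        using cmp_add_right[OF pb(2) arr_cmp[OF r(1) c'(1)] c'(2)] assoc[OF r(1) c'(1,2)] c'(3) pb(3)
          cmp_zero_left[OF r(1) ob(2)] by simp
      finally have "g \<cdot> (b \<cdot> s) = h" using epi[of M "g \<cdot> (b \<cdot> s)" h] arr_cmp[OF arr_cmp[OF s(1) pb(2)] c'(2)] h by blast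
      then show "\<exists>t. arr Y B t \<and> h = g \<cdot> t" using s pb by blast
    qed
  next
    show "\<forall>Y e iB QB pB CB. cosyz E B = (iB, QB, pB, CB) \<longrightarrow>
       (\<forall>x. arr Y CB x \<longrightarrow> (\<exists>w. arr Y QB w \<and> x = pB \<cdot> w)) \<longrightarrow> arr Y C e \<longrightarrow>
       (\<exists>h w. arr Y M h \<and> arr Y Q w \<and> e - v \<cdot> h = p \<cdot> w)"
  proof (intro allI impI)
    fix Y e iB QB pB CB
    assume cB: "cosyz E B = (iB, QB, pB, CB)" and ez: "\<forall>x. arr Y CB x \<longrightarrow> (\<exists>w. arr Y QB w \<and> x = pB \<cdot> w)"
      and e: "arr Y C e"
    note r = cosyzD[OF ob(3) cB]
    note r' = cflD[OF r(2)]
    have obB: "QB \<in> ob E" "CB \<in> ob E" using r' arrD by blast+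
    \<comment> \<open>\<open>ft\<close> and \<open>sf\<close> carry \<open>f\<close> over to the
      chosen injective objects and their cokernels. As \<open>Ext(Y,B)\<close> vanishes,
      \<open>sf \<cdot> e\<close> lifts along \<open>pB\<close>.\<close>
    obtain ft where ft: "arr Q QB ft" "ft \<cdot> i = iB \<cdot> f" using injective_extend[OF q(2) r(1)] r'(1) c'(1) by blast
    have "(pB \<cdot> ft) \<cdot> i = 0" using assoc[OF q'(1) ft(1) r'(2)] assoc[OF c'(1) r'(1,2)] r'(3) ft(2)
        cmp_zero_left[OF c'(1) obB(2)] by simp
    then obtain sf where sf: "arr C CB sf" "sf \<cdot> p = pB \<cdot> ft" using cokernel_factor[OF q(2), of CB "pB \<cdot> ft"] r'(2) ft(1) by blast
    obtain w where w: "arr Y QB w" "sf \<cdot> e = pB \<cdot> w" using ez arr_cmp[OF e sf(1)] by blast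
    obtain B' g' b f' where pb: "arr B' Y g'" "arr B' Q b" "p \<cdot> b = e \<cdot> g'" "arr N B' f'" "b \<cdot> f' = i" "g' \<cdot> f' = 0"
      and fac: "\<And>D d. arr B' D d \<Longrightarrow> d \<cdot> f' = 0 \<Longrightarrow> \<exists>u. arr Y D u \<and> u \<cdot> g' = d"
      and epi: "\<And>D u u'. arr Y D u \<Longrightarrow> arr Y D u' \<Longrightarrow> u \<cdot> g' = u' \<cdot> g' \<Longrightarrow> u = u'"
      by (rule pullback_conflation[OF q(2) e]) (rule that)
    have a: "arr B' QB (ft \<cdot> b)" "arr B' QB (w \<cdot> g')" using ft pb w by blast+
    have "pB \<cdot> (ft \<cdot> b - w \<cdot> g') = (pB \<cdot> ft) \<cdot> b - (pB \<cdot> w) \<cdot> g'"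
      using cmp_diff_right[OF a r'(2)] assoc[OF pb(2) ft(1) r'(2)] assoc[OF pb(1) w(1) r'(2)] by simp
    also have "\<dots> = 0" using assoc[OF pb(2) q'(2) sf(1)] assoc[OF pb(1) e sf(1)] sf(2) w(2) pb(3) by simp
    finally obtain d where d: "arr B' B d" "iB \<cdot> d = ft \<cdot> b - w \<cdot> g'"
      using kernel_lift[OF r(2) arr_diff[OF a]] by blast
    have "iB \<cdot> (d \<cdot> f') = (ft \<cdot> b - w \<cdot> g') \<cdot> f'" using assoc[OF pb(4) d(1) r'(1)] d by simp
    also have "\<dots> = iB \<cdot> f" using cmp_diff_left[OF pb(4) a] assoc[OF pb(4,2) ft(1)] assoc[OF pb(4,1) w(1)] pb(5,6) ft(2)
        cmp_zero_right[OF ob(1) w(1)] by simp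
    finally have df: "d \<cdot> f' = f" using kernel_mono[OF r(2), of N "d \<cdot> f'" f] d(1) pb(4) c'(1) by blast
    \<comment> \<open>The pullback along \<open>e\<close> now maps to \<open>B\<close> by
      \<open>d\<close>, which restricts to \<open>f\<close> on \<open>N\<close>. Hence
      \<open>g \<cdot> d\<close> descends to the wanted \<open>h\<close>, and
      \<open>b - u \<cdot> d\<close> kills \<open>f'\<close> and descends to the lift
      \<open>w'\<close> of the difference.\<close>
    have gd: "arr B' M (g \<cdot> d)" using d c' by blast
    have "(g \<cdot> d) \<cdot> f' = 0" using assoc[OF pb(4) d(1) c'(2)] df c'(3) by simp
    then obtain h where h: "arr Y M h" "h \<cdot> g' = g \<cdot> d" using fac[OF gd] by blast
    have ud: "arr B' Q (u \<cdot> d)" using u d by blast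
    have "(b - u \<cdot> d) \<cdot> f' = 0"
      using cmp_diff_left[OF pb(4,2) ud] assoc[OF pb(4) d(1) u(1)] df u(2) pb(5) by simp
    then obtain w' where w': "arr Y Q w'" "w' \<cdot> g' = b - u \<cdot> d" using fac[OF arr_diff[OF pb(2) ud]] by blast
    have vh: "arr Y C (v \<cdot> h)" using v h by blast
    have "(p \<cdot> w') \<cdot> g' = p \<cdot> b - p \<cdot> (u \<cdot> d)"
      using assoc[OF pb(1) w'(1) q'(2)] w'(2) cmp_diff_right[OF pb(2) ud q'(2)] by simp
    also have "\<dots> = e \<cdot> g' - (v \<cdot> h) \<cdot> g'"
      using assoc[OF d(1) u(1) q'(2)] assoc[OF d(1) c'(2) v(1)] v(2) assoc[OF pb(1) h(1) v(1)] h(2) pb(3) by simp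
    also have "\<dots> = (e - v \<cdot> h) \<cdot> g'" using cmp_diff_left[OF pb(1) e vh] by simp
    finally have "p \<cdot> w' = e - v \<cdot> h"
      using epi[of C "p \<cdot> w'" "e - v \<cdot> h"] arr_cmp[OF w'(1) q'(2)] arr_diff[OF e vh] by blast
    then show "\<exists>h w. arr Y M h \<and> arr Y Q w \<and> e - v \<cdot> h = p \<cdot> w" using h w' by metis
  qed
  qed
qed

text \<open>Extend \<open>i \<cdot> h\<close> to \<open>u : B \<rightarrow> Q\<close>; the induced
  map \<open>v\<close> out of \<open>M\<close> is the class of the conflation pushed out along
  \<open>h\<close>. It lifts along \<open>p\<close> to \<open>w\<close>, and
  \<open>u - w \<cdot> g\<close> then lands in \<open>Y\<close>.\<close>

lemma extend_along_inflation:
  assumes c: "cfl E N f B g M" and cY: "cosyz E Y = (i, Q, p, C)" and h: "arr N Y h"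
    and ez: "\<And>x. arr M C x \<Longrightarrow> \<exists>w. arr M Q w \<and> x = p \<cdot> w"
  shows "\<exists>t. arr B Y t \<and> h = t \<cdot> f"
proof -
  note c' = cflD[OF c]
  have ob: "N \<in> ob E" "M \<in> ob E" "B \<in> ob E" "Y \<in> ob E" using c' h arrD by blast+
  note q = cosyzD[OF ob(4) cY]
  note q' = cflD[OF q(2)]
  obtain u where u: "arr B Q u" "u \<cdot> f = i \<cdot> h" using injective_extend[OF c q(1)] q'(1) h by blast
  have "(p \<cdot> u) \<cdot> f = 0" using assoc[OF c'(1) u(1) q'(2)] assoc[OF h q'(1,2)] u q'(3)
      cmp_zero_left[OF h] arrD[OF q'(2)] by simp
  then obtain v where v: "arr M C v" "v \<cdot> g = p \<cdot> u" using cokernel_factor[OF c, of C "p \<cdot> u"] u q' by blast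
  obtain w where w: "arr M Q w" "v = p \<cdot> w" using ez[OF v(1)] by blast
  have wg: "arr B Q (w \<cdot> g)" using w c' by blast
  have "p \<cdot> (u - w \<cdot> g) = 0" using cmp_diff_right[OF u(1) wg q'(2)] assoc[OF c'(2) w(1) q'(2)] v w by simp
  then obtain t where t: "arr B Y t" "i \<cdot> t = u - w \<cdot> g" using kernel_lift[OF q(2) arr_diff[OF u(1) wg]] by blast
  have "i \<cdot> (t \<cdot> f) = (u - w \<cdot> g) \<cdot> f" using assoc[OF c'(1) t(1) q'(1)] t by simp
  also have "\<dots> = i \<cdot> h" using cmp_diff_left[OF c'(1) u(1) wg] assoc[OF c'(1,2) w(1)] c'(3) u(2)
      cmp_zero_right[OF ob(1) w(1)] by simp
  finally have "t \<cdot> f = h" using kernel_mono[OF q(2), of N "t \<cdot> f" h] t(1) c'(1) h by blast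
  then show ?thesis using t by blast
qed

text \<open>Translates between \<open>Ext\<close>, the cokernel of a map out of
  \<open>Hom(A,Q)\<close>, and the stable hom space on which the 2-Calabi--Yau condition is imposed:
  projectives lift along \<open>p\<close>, and the injective \<open>Q\<close> is projective.\<close>

lemma stable_ideal_cosyz:
  assumes A: "A \<in> ob E" and B: "B \<in> ob E" and c: "cosyz E B = (i, Q, p, C)"
  shows "stable_ideal E A C = (\<lambda>u. p \<cdot> u) ` hom E A Q"
proof -
  note q = cosyzD[OF B c]
  note q' = cflD[OF q(2)]
  show ?thesis
  proof (intro equalityI subsetI)
    fix x assume "x \<in> stable_ideal E A C"
    then obtain P f g where P: "exact_projective E P" "f \<in> hom E A P" "g \<in> hom E P C" "x = g \<cdot> f"
      unfolding stable_ideal_def by blast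
    have f: "arr A P f" "arr P C g" using P A q'(2) by (auto simp: arr_def exact_projective_def)
    obtain u where u: "arr P Q u" "p \<cdot> u = g" using projective_lift[OF q(2) P(1) f(2)] .
    have "x = p \<cdot> (u \<cdot> f)" using assoc[OF f(1) u(1) q'(2)] u P by simp
    then show "x \<in> (\<lambda>u. p \<cdot> u) ` hom E A Q" using arrD(3)[OF arr_cmp[OF f(1) u(1)]] by blast
  next
    fix x assume "x \<in> (\<lambda>u. p \<cdot> u) ` hom E A Q"
    then show "x \<in> stable_ideal E A C" unfolding stable_ideal_def
      using projective_iff_injective q(1) arrD(3)[OF q'(2)] by blast
  qed
qed

lemma exact_projective_biproduct:
  assumes b: "biproduct E P Q R" and "exact_projective E P" "exact_projective E Q"
  shows "exact_projective E R"
proof -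
  from b obtain i j p q where b: "arr P R i" "arr Q R j" "arr R P p" "arr R Q q"
    "p \<cdot> i = idn E P" "q \<cdot> j = idn E Q" "q \<cdot> i = 0" "p \<cdot> j = 0" "i \<cdot> p + j \<cdot> q = idn E R" by (rule biproductE)
  show ?thesis unfolding exact_projective_def
  proof (intro conjI allI impI ballI)
    show "R \<in> ob E" using b arrD by blast
    fix B C g h assume d: "deflation E B C g" and h': "h \<in> hom E R C"
    obtain f A where c: "cfl E A f B g C" using d by (auto simp: deflation_def)
    note c' = cflD[OF c]
    have h: "arr R C h" using h' b c' by (auto simp: arr_def)
    obtain u where u: "arr P B u" "g \<cdot> u = h \<cdot> i" using projective_lift[OF c assms(2)] h b by blast
    obtain v where v: "arr Q B v" "g \<cdot> v = h \<cdot> j" using projective_lift[OF c assms(3)] h b by blast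
    have "g \<cdot> (u \<cdot> p + v \<cdot> q) = h \<cdot> (i \<cdot> p + j \<cdot> q)"
      using cmp_add_right[OF arr_cmp[OF b(3) u(1)] arr_cmp[OF b(4) v(1)] c'(2)]
        cmp_add_right[OF arr_cmp[OF b(3,1)] arr_cmp[OF b(4,2)] h]
        assoc[OF b(3) u(1) c'(2)] assoc[OF b(4) v(1) c'(2)] assoc[OF b(3,1) h] assoc[OF b(4,2) h] u v by simp
    then have "g \<cdot> (u \<cdot> p + v \<cdot> q) = h" using b h by simp
    then show "\<exists>u\<in>hom E R B. g \<cdot> u = h"
      using arrD(3)[OF arr_add[OF arr_cmp[OF b(3) u(1)] arr_cmp[OF b(4) v(1)]]] by blast
  qed
qed

lemma exact_projective_zero: "is_zero E Z \<Longrightarrow> exact_projective E Z"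
  unfolding exact_projective_def
proof (intro conjI allI impI ballI)
  assume Z: "is_zero E Z"
  then show "Z \<in> ob E" by (simp add: is_zero_def)
  fix B C g h assume d: "deflation E B C g" and h: "h \<in> hom E Z C"
  obtain f A where c: "cfl E A f B g C" using d by (auto simp: deflation_def)
  have "h = 0" using zero_arr(2)[OF Z, of C h] h \<open>Z \<in> ob E\<close> cflD(2)[OF c] by (auto simp: arr_def)
  then show "\<exists>u\<in>hom E Z B. g \<cdot> u = h"
    using cmp_zero_right[OF \<open>Z \<in> ob E\<close> cflD(2)[OF c]] arrD(3)[OF arr_zero[OF \<open>Z \<in> ob E\<close>]] cflD(2)[OF c] arrD
    by (intro bexI[of _ 0]) blast+
qed

text \<open>Two maps that factor through \<open>P\<close> and \<open>P'\<close> add up to one that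
  factors through their direct sum.\<close>

lemma subspace_stable_ideal:
  assumes A: "A \<in> ob E" and B: "B \<in> ob E" shows "vs.subspace (stable_ideal E A B)"
proof (rule vs.subspaceI)
  have add: "additive_cat E" using exact by (simp add: exact_def)
  then obtain Z where Z: "is_zero E Z" by (auto simp: additive_cat_def)
  have Zob: "Z \<in> ob E" using Z by (simp add: is_zero_def)
  have "0 = 0 \<cdot> 0" using cmp_zero_right[OF A arr_zero[OF Zob B]] by simp
  then show "0 \<in> stable_ideal E A B" unfolding stable_ideal_def
    using exact_projective_zero[OF Z] arrD(3)[OF arr_zero] A B Zob by blast
  fix x y c assume "x \<in> stable_ideal E A B"
  then obtain P f g where P: "exact_projective E P" "f \<in> hom E A P" "g \<in> hom E P B" "x = g \<cdot> f"
    unfolding stable_ideal_def by blast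
  have f: "arr A P f" "arr P B g" using P A B by (auto simp: arr_def exact_projective_def)
  show "scl E c x \<in> stable_ideal E A B" unfolding stable_ideal_def
    using P cmp_scl_left[OF f, of c] arrD(3)[OF arr_scl[OF f(2), of c]] by force
  assume "y \<in> stable_ideal E A B"
  then obtain P' f' g' where P': "exact_projective E P'" "f' \<in> hom E A P'" "g' \<in> hom E P' B" "y = g' \<cdot> f'"
    unfolding stable_ideal_def by blast
  have f': "arr A P' f'" "arr P' B g'" using P' A B by (auto simp: arr_def exact_projective_def)
  obtain R where R: "biproduct E P P' R" using add f f' arrD unfolding additive_cat_def by meson
  then obtain i j p q where b: "arr P R i" "arr P' R j" "arr R P p" "arr R P' q"
    "p \<cdot> i = idn E P" "q \<cdot> j = idn E P'" "q \<cdot> i = 0" "p \<cdot> j = 0" "i \<cdot> p + j \<cdot> q = idn E R" by (rule biproductE)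
  have a: "arr A R (i \<cdot> f)" "arr A R (j \<cdot> f')" "arr R B (g \<cdot> p)" "arr R B (g' \<cdot> q)" using f f' b by blast+
  have pf: "p \<cdot> (i \<cdot> f + j \<cdot> f') = f" "q \<cdot> (i \<cdot> f + j \<cdot> f') = f'"
    using cmp_add_right[OF a(1,2) b(3)] cmp_add_right[OF a(1,2) b(4)] assoc[OF f(1) b(1,3)] assoc[OF f'(1) b(2,3)]
      assoc[OF f(1) b(1,4)] assoc[OF f'(1) b(2,4)] b(5-8) f f' cmp_zero_left[OF f(1) arrD(2)[OF b(4)]]
      cmp_zero_left[OF f'(1) arrD(2)[OF b(3)]] by auto
  have "(g \<cdot> p + g' \<cdot> q) \<cdot> (i \<cdot> f + j \<cdot> f') = x + y"
    using cmp_add_left[OF arr_add[OF a(1,2)] a(3,4)] assoc[OF arr_add[OF a(1,2)] b(3) f(2)]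
      assoc[OF arr_add[OF a(1,2)] b(4) f'(2)] pf P P' by simp
  then show "x + y \<in> stable_ideal E A B" unfolding stable_ideal_def
    using exact_projective_biproduct[OF R P(1) P'(1)] arrD(3)[OF arr_add[OF a(1,2)]] arrD(3)[OF arr_add[OF a(3,4)]] by force
qed

end

lemma ext_cat_of_exact_simps [simp]:
  "ob (ext_cat_of_exact E) = ob E" "hom (ext_cat_of_exact E) = hom E" "cmp (ext_cat_of_exact E) = cmp E"
  "idn (ext_cat_of_exact E) = idn E" "scl (ext_cat_of_exact E) = scl E" "cfl (ext_cat_of_exact E) = cfl E"
  by (simp_all add: ext_cat_of_exact_def)

lemma ext_cat_of_subcat_simps [simp]:
  "ob (ext_cat_of_subcat T S) = S" "hom (ext_cat_of_subcat T S) = hom T" "cmp (ext_cat_of_subcat T S) = cmp T"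
  "idn (ext_cat_of_subcat T S) = idn T" "scl (ext_cat_of_subcat T S) = scl T"
  "ext_cyc (ext_cat_of_subcat T S) A B = hom T A (sh T B)" "ext_bd (ext_cat_of_subcat T S) A B = {0}"
  by (simp_all add: ext_cat_of_subcat_def)

lemma (in frobenius_2CY) extension_category_of_exact: "extension_category (ext_cat_of_exact E)"
proof -
  let ?X = "ext_cat_of_exact E"
  have ks: "krull_schmidt E" using frobenius_2CY by (simp add: two_CY_frobenius_def)
  have two: "two_CY E (stable_ideal E) (stable_susp E) (stable_susp_rel E)"
    using frobenius_2CY by (simp add: two_CY_frobenius_def)
  have full: "full_subcat E (ob E)" unfolding full_subcat_def by (auto simp: is_zero_def biproduct_def)
  have ksX: "krull_schmidt ?X" by (rule krull_schmidt_full_subcat[OF ks]) (auto simp: full)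
  have cyc: "ext_cyc ?X A N = hom E A C" "ext_bd ?X A N = (\<lambda>u. p \<cdot> u) ` hom E A Q"
    if "cosyz E N = (i, Q, p, C)" for A N i Q p C
    using that by (simp_all add: ext_cat_of_exact_def)
  have ez: "ext_zero ?X A N \<longleftrightarrow> (\<forall>x. arr A C x \<longrightarrow> (\<exists>w. arr A Q w \<and> x = p \<cdot> w))"
    if "cosyz E N = (i, Q, p, C)" "A \<in> ob E" "N \<in> ob E" for A N i Q p C
    unfolding ext_zero_def cyc[OF that(1)] using that cflD[OF cosyzD(2)[OF that(3,1)]]
    by (auto simp: arr_def)
  have obs: "Q \<in> ob E" "C \<in> ob E" "arr Q C p" if "cosyz E N = (i, Q, p, C)" "N \<in> ob E" for N i Q p C
    using cflD[OF cosyzD(2)[OF that(2,1)]] arrD by blast+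
  have bi: "biproduct ?X A B C \<longleftrightarrow> biproduct E A B C" for A B C by (simp add: biproduct_def)
  have zero: "is_zero ?X Z \<longleftrightarrow> is_zero E Z" for Z by (simp add: is_zero_def)
  show ?thesis
  proof unfold_locales
    show "lin_cat ?X" "krull_schmidt ?X" using ksX by (auto simp: krull_schmidt_def additive_cat_def)
    show "N \<in> ob ?X \<and> B \<in> ob ?X \<and> M \<in> ob ?X \<and> f \<in> hom ?X N B \<and> g \<in> hom ?X B M" if "cfl ?X N f B g M" for N f B g M
      using that cflD[of N f B g M] by (auto simp: arr_def)
  next
    fix N f B g M Y assume c: "cfl ?X N f B g M" and Y: "Y \<in> ob ?X"
    obtain i Q p C where cN: "cosyz E N = (i, Q, p, C)" by (metis prod_cases4)
    obtain iB QB pB CB where cB: "cosyz E B = (iB, QB, pB, CB)" by (metis prod_cases4)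
    note c' = cflD[OF c[simplified]]
    have ob: "N \<in> ob E" "B \<in> ob E" "M \<in> ob E" using c' arrD by blast+
    obtain v where v: "arr M C v"
      and 1: "\<And>Y h. arr Y M h \<Longrightarrow> (\<exists>w. arr Y Q w \<and> v \<cdot> h = p \<cdot> w) \<longleftrightarrow> (\<exists>t. arr Y B t \<and> h = g \<cdot> t)"
      and 2: "\<forall>Y e iB QB pB CB. cosyz E B = (iB, QB, pB, CB) \<longrightarrow>
         (\<forall>x. arr Y CB x \<longrightarrow> (\<exists>w. arr Y QB w \<and> x = pB \<cdot> w)) \<longrightarrow> arr Y C e \<longrightarrow>
         (\<exists>h w. arr Y M h \<and> arr Y Q w \<and> e - v \<cdot> h = p \<cdot> w)"
      by (rule connecting_map[OF c[simplified] cN]) (rule that)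
    have hom: "x \<in> hom E Y Z \<longleftrightarrow> arr Y Z x" if "Z \<in> ob E" for x Z using Y that by (simp add: arr_def)
    show "\<exists>\<delta>. (\<forall>h\<in>hom ?X Y M. \<delta> h \<in> ext_cyc ?X Y N) \<and>
        (\<forall>h\<in>hom ?X Y M. \<forall>h'\<in>hom ?X Y M. \<delta> (h + h') = \<delta> h + \<delta> h') \<and>
        (\<forall>h\<in>hom ?X Y M. \<forall>a. \<delta> (scl ?X a h) = scl ?X a (\<delta> h)) \<and>
        (\<forall>h\<in>hom ?X Y M. \<delta> h \<in> ext_bd ?X Y N \<longleftrightarrow> (\<exists>t\<in>hom ?X Y B. h = cmp ?X g t)) \<and>
        (ext_zero ?X Y B \<longrightarrow> (\<forall>e\<in>ext_cyc ?X Y N. \<exists>h\<in>hom ?X Y M. e - \<delta> h \<in> ext_bd ?X Y N))"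
    proof (intro exI[of _ "\<lambda>h. v \<cdot> h"] conjI ballI allI impI)
      fix h assume "h \<in> hom ?X Y M"
      then have h: "arr Y M h" using Y ob by (simp add: arr_def)
      show "v \<cdot> h \<in> ext_cyc ?X Y N" using arrD(3)[OF arr_cmp[OF h v]] by (simp add: cyc[OF cN])
      show "v \<cdot> scl ?X a h = scl ?X a (v \<cdot> h)" for a using cmp_scl_right[OF h v] by simp
      show "v \<cdot> h \<in> ext_bd ?X Y N \<longleftrightarrow> (\<exists>t\<in>hom ?X Y B. h = cmp ?X g t)"
        using 1[OF h] hom[OF obs(1)[OF cN ob(1)]] hom[OF ob(2)] by (auto simp: cyc[OF cN])
      fix h' assume "h' \<in> hom ?X Y M"
      then have h': "arr Y M h'" using Y ob by (simp add: arr_def)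
      show "v \<cdot> (h + h') = v \<cdot> h + v \<cdot> h'" using cmp_add_right[OF h h' v] .
    next
      fix e assume z: "ext_zero ?X Y B" and e: "e \<in> ext_cyc ?X Y N"
      then have e': "arr Y C e" using hom[OF obs(2)[OF cN ob(1)]] by (simp add: cyc[OF cN])
      have z': "\<forall>x. arr Y CB x \<longrightarrow> (\<exists>w. arr Y QB w \<and> x = pB \<cdot> w)"
        using z[unfolded ez[OF cB Y[simplified] ob(2)]] .
      obtain h w where "arr Y M h" "arr Y Q w" "e - v \<cdot> h = p \<cdot> w"
        using 2[THEN spec, THEN spec, THEN spec, THEN spec, THEN spec, THEN spec, THEN mp, OF cB, THEN mp, OF z', THEN mp, OF e'] by blast
      then show "\<exists>h\<in>hom ?X Y M. e - v \<cdot> h \<in> ext_bd ?X Y N"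
        using arrD(3)[of Y M h] arrD(3)[of Y Q w] by (intro bexI[of _ h]) (auto simp: cyc[OF cN])
    qed
  next
    fix N f B g M Y h assume c: "cfl ?X N f B g M" and Y: "Y \<in> ob ?X" and z: "ext_zero ?X M Y" and h: "h \<in> hom ?X N Y"
    obtain i Q p C where cY: "cosyz E Y = (i, Q, p, C)" by (metis prod_cases4)
    note c' = cflD[OF c[simplified]]
    have ob: "N \<in> ob E" "B \<in> ob E" "M \<in> ob E" using c' arrD by blast+
    have "arr N Y h" using h ob Y by (simp add: arr_def)
    then obtain t where "arr B Y t" "h = t \<cdot> f"
      using extend_along_inflation[OF c[simplified] cY] z ez[OF cY ob(3)] Y by auto
    then show "\<exists>t\<in>hom ?X B Y. h = cmp ?X t f" using arrD(3) by auto
  next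
    fix A B assume A: "A \<in> ob ?X" and B: "B \<in> ob ?X" and z: "ext_zero ?X A B"
    obtain iA QA pA CA where cA: "cosyz E A = (iA, QA, pA, CA)" by (metis prod_cases4)
    obtain iB QB pB CB where cB: "cosyz E B = (iB, QB, pB, CB)" by (metis prod_cases4)
    have "hom E A (stable_susp E B) \<subseteq> stable_ideal E A (stable_susp E B)"
      using z stable_ideal_cosyz[OF _ _ cB, of A] A B by (simp add: stable_susp_def cB ext_zero_def cyc[OF cB])
    then have "hom E B (stable_susp E A) \<subseteq> stable_ideal E B (stable_susp E A)"
      using two_CY_sym[OF two] A B by simp
    then show "ext_zero ?X B A"
      using stable_ideal_cosyz[OF _ _ cA, of B] A B by (simp add: stable_susp_def cA ext_zero_def cyc[OF cA])
  next
    fix A assume A: "A \<in> ob ?X"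
    \<comment> \<open>Maps out of a projective lift along \<open>p\<close>, so the projectives of
      the exact structure have no extensions; hence the stable ideal can serve as
      \<open>I\<close>.\<close>
    have pr: "projective_in ?X (ob ?X) P" if P: "exact_projective E P" for P
      unfolding projective_in_def
    proof (intro conjI ballI)
      show Pob: "P \<in> ob ?X" using P by (simp add: exact_projective_def)
      fix Y assume Y: "Y \<in> ob ?X"
      obtain i Q p C where cY: "cosyz E Y = (i, Q, p, C)" by (metis prod_cases4)
      show "ext_zero ?X P Y" unfolding ez[OF cY Pob[simplified] Y[simplified]]
        using projective_lift[OF cosyzD(2)[OF Y[simplified] cY] P] by metis
    qed
    obtain n where "quot_dim (scl E) (hom E A A) (stable_ideal E A A) n" using two_CY_finite[OF two] A by auto
    then show "\<exists>I n. quot_dim (scl ?X) (hom ?X A A) I n \<and> module.subspace (scl ?X) I \<and>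
      (\<forall>x\<in>I. \<exists>P f g. projective_in ?X (ob ?X) P \<and> f \<in> hom ?X A P \<and> g \<in> hom ?X P A \<and> x = cmp ?X g f)"
      using subspace_stable_ideal[of A A] A pr
      by (intro exI[of _ "stable_ideal E A A"] exI[of _ n]) (auto simp: stable_ideal_def)
  next
    fix A B D N assume b: "biproduct ?X A B D" and N: "N \<in> ob ?X"
    obtain a0 Q p C where cN: "cosyz E N = (a0, Q, p, C)" by (metis prod_cases4)
    note o = obs[OF cN N[simplified]]
    from b obtain i j k q where b: "arr A D i" "arr B D j" "arr D A k" "arr D B q"
      "k \<cdot> i = idn E A" "q \<cdot> j = idn E B" "q \<cdot> i = 0" "k \<cdot> j = 0" "i \<cdot> k + j \<cdot> q = idn E D" unfolding bi by (rule biproductE)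
    have ob: "A \<in> ob E" "B \<in> ob E" "D \<in> ob E" using b arrD by blast+
    note ez' = ez[OF cN _ N[simplified]]
    have sub: "\<exists>w. arr U Q w \<and> x = p \<cdot> w"
      if z: "\<forall>x. arr D C x \<longrightarrow> (\<exists>w. arr D Q w \<and> x = p \<cdot> w)" and ik: "arr U D i'" "arr D U k'" "k' \<cdot> i' = idn E U" and x: "arr U C x" for U i' k' x
    proof -
      obtain w where w: "arr D Q w" "x \<cdot> k' = p \<cdot> w" using z arr_cmp[OF ik(2) x] by blast
      have "x = p \<cdot> (w \<cdot> i')" using assoc[OF ik(1) w(1) o(3)] assoc[OF ik(1,2) x] w ik x by simp
      then show ?thesis using w ik by blast
    qed
    show "ext_zero ?X D N \<longleftrightarrow> ext_zero ?X A N \<and> ext_zero ?X B N"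
    proof
      show "ext_zero ?X A N \<and> ext_zero ?X B N" if "ext_zero ?X D N"
        using that sub b unfolding ez'[OF ob(1)] ez'[OF ob(2)] ez'[OF ob(3)] by blast
      assume z: "ext_zero ?X A N \<and> ext_zero ?X B N"
      show "ext_zero ?X D N" unfolding ez'[OF ob(3)]
      proof (intro allI impI)
        fix x assume x: "arr D C x"
        obtain w where w: "arr A Q w" "x \<cdot> i = p \<cdot> w" using z arr_cmp[OF b(1) x] unfolding ez'[OF ob(1)] by blast
        obtain w' where w': "arr B Q w'" "x \<cdot> j = p \<cdot> w'" using z arr_cmp[OF b(2) x] unfolding ez'[OF ob(2)] by blast
        have "p \<cdot> (w \<cdot> k + w' \<cdot> q) = x \<cdot> (i \<cdot> k + j \<cdot> q)"
          using cmp_add_right[OF arr_cmp[OF b(3) w(1)] arr_cmp[OF b(4) w'(1)] o(3)]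
            cmp_add_right[OF arr_cmp[OF b(3,1)] arr_cmp[OF b(4,2)] x]
            assoc[OF b(3) w(1) o(3)] assoc[OF b(4) w'(1) o(3)] assoc[OF b(3,1) x] assoc[OF b(4,2) x] w w' by simp
        then have "x = p \<cdot> (w \<cdot> k + w' \<cdot> q)" using b x by simp
        then show "\<exists>w. arr D Q w \<and> x = p \<cdot> w" using w w' b by blast
      qed
    qed
  next
    fix Z N assume Z: "is_zero ?X Z" and N: "N \<in> ob ?X"
    obtain a0 Q p C where cN: "cosyz E N = (a0, Q, p, C)" by (metis prod_cases4)
    note o = obs[OF cN N[simplified]]
    have Z': "is_zero E Z" "Z \<in> ob E" using Z zero by (auto simp: is_zero_def)
    show "ext_zero ?X Z N" unfolding ez[OF cN Z'(2) N[simplified]]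
      using zero_arr(2)[OF Z'(1)] cmp_zero_right[OF Z'(2) o(3)] arr_zero[OF Z'(2) o(1)] by metis
  next
    fix A B assume A: "A \<in> ob ?X" and B: "B \<in> ob ?X"
    obtain i Q p C where cB: "cosyz E B = (i, Q, p, C)" by (metis prod_cases4)
    note o = obs[OF cB B[simplified]]
    have "ext_bd ?X A B = stable_ideal E A C" using stable_ideal_cosyz[OF _ _ cB] A B by (simp add: cyc[OF cB])
    then show "module.subspace (scl ?X) (ext_bd ?X A B)" using subspace_stable_ideal A o by simp
  qed
qed

section \<open>Subcategories of triangulated categories\<close>

locale triangulated_2CY = linear_category T
  for T :: "('o, 'm::ab_group_add, 'k::alg_closed_field) tri_cat" +
  assumes triangulated_2CY: "two_CY_triangulated T"
begin

abbreviation comp_tri (infixl "\<cdot>" 70) where "g \<cdot> f \<equiv> cmp T g f"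
abbreviation "shf \<equiv> shm T"
abbreviation "sho \<equiv> sh T"

lemma triangulated: "triangulated T"
  using triangulated_2CY by (simp add: two_CY_triangulated_def)

lemma shift: "shift_equiv T"
  using triangulated by (simp add: triangulated_def)

lemma sho_ob: "A \<in> ob T \<Longrightarrow> sho A \<in> ob T"
  using shift by (simp add: shift_equiv_def)

lemma shf_id: "A \<in> ob T \<Longrightarrow> shf (idn T A) = idn T (sho A)"
  using shift by (simp add: shift_equiv_def)

lemma shf_bij: "A \<in> ob T \<Longrightarrow> B \<in> ob T \<Longrightarrow> bij_betw shf (hom T A B) (hom T (sho A) (sho B))"
  using shift by (simp add: shift_equiv_def)

lemma shf_arr: "arr A B f \<Longrightarrow> arr (sho A) (sho B) (shf f)"
  using shf_bij sho_ob by (auto simp: arr_def bij_betw_def)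

lemma shf_inj: "arr A B f \<Longrightarrow> arr A B f' \<Longrightarrow> shf f = shf f' \<Longrightarrow> f = f'"
  using shf_bij[of A B] by (auto simp: arr_def bij_betw_def inj_on_def)

lemma shf_surj: assumes "A \<in> ob T" "B \<in> ob T" "arr (sho A) (sho B) h" obtains f where "arr A B f" "shf f = h"
proof -
  have "h \<in> shf ` hom T A B" using shf_bij[OF assms(1,2)] arrD(3)[OF assms(3)] by (simp add: bij_betw_def)
  then show ?thesis using that assms by (auto simp: arr_def)
qed

lemma shf_add: "arr A B f \<Longrightarrow> arr A B f' \<Longrightarrow> shf (f + f') = shf f + shf f'"
  using shift unfolding shift_equiv_def arr_def by blast

lemma shf_zero: "A \<in> ob T \<Longrightarrow> B \<in> ob T \<Longrightarrow> shf 0 = 0"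
  using shf_add[of A B 0 0] by (simp add: arr_zero)

lemma shf_neg: "arr A B f \<Longrightarrow> shf (- f) = - shf f"
  using shf_add[of A B f "- f"] shf_zero[of A B] arrD by (auto simp: arr_neg eq_neg_iff_add_eq_0 add.commute)

lemma shf_cmp: "arr A B f \<Longrightarrow> arr B C g \<Longrightarrow> shf (g \<cdot> f) = shf g \<cdot> shf f"
  using shift unfolding shift_equiv_def arr_def by blast

lemma distD:
  assumes "dist T A f B g C h" shows "arr A B f" "arr B C g" "arr C (sho A) h"
proof -
  have "\<forall>A f B g C h. dist T A f B g C h \<longrightarrow>
        A \<in> ob T \<and> B \<in> ob T \<and> C \<in> ob T \<and> f \<in> hom T A B \<and> g \<in> hom T B C \<and> h \<in> hom T C (sh T A)"
    using triangulated unfolding triangulated_def by (elim conjE)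
  then show "arr A B f" "arr B C g" "arr C (sho A) h" using assms sho_ob by (auto simp: arr_def)
qed

lemma dist_id: "A \<in> ob T \<Longrightarrow> is_zero T Z \<Longrightarrow> dist T A (idn T A) A 0 Z 0"
proof -
  have "\<forall>A\<in>ob T. \<forall>Z. is_zero T Z \<longrightarrow> dist T A (idn T A) A 0 Z 0"
    using triangulated unfolding triangulated_def by (elim conjE)
  then show "A \<in> ob T \<Longrightarrow> is_zero T Z \<Longrightarrow> dist T A (idn T A) A 0 Z 0" by blast
qed

lemma rotate:
  assumes "arr A B f" "arr B C g" "arr C (sho A) h"
  shows "dist T A f B g C h \<longleftrightarrow> dist T B g C h (sho A) (- shf f)"
proof -
  have "\<forall>A\<in>ob T. \<forall>B\<in>ob T. \<forall>C\<in>ob T. \<forall>f\<in>hom T A B. \<forall>g\<in>hom T B C. \<forall>h\<in>hom T C (sh T A).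
        dist T A f B g C h \<longleftrightarrow> dist T B g C h (sh T A) (- shm T f)"
    using triangulated unfolding triangulated_def by (elim conjE)
  then show ?thesis using assms unfolding arr_def by blast
qed

lemma rotateI: "dist T A f B g C h \<Longrightarrow> dist T B g C h (sho A) (- shf f)"
  using rotate[OF distD] by blast

lemma triangle_map:
  assumes "dist T A f B g C h" "dist T A' f' B' g' C' h'" "arr A A' a" "arr B B' b" "b \<cdot> f = f' \<cdot> a"
  obtains c where "arr C C' c" "c \<cdot> g = g' \<cdot> b" "shf a \<cdot> h = h' \<cdot> c"
proof -
  have "\<forall>A f B g C h A' f' B' g' C' h' a b.
        dist T A f B g C h \<and> dist T A' f' B' g' C' h' \<and>
        a \<in> hom T A A' \<and> b \<in> hom T B B' \<and> cmp T b f = cmp T f' a \<longrightarrow>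
        (\<exists>c\<in>hom T C C'. cmp T c g = cmp T g' b \<and> cmp T (shm T a) h = cmp T h' c)"
    using triangulated unfolding triangulated_def by (elim conjE)
  then have "\<exists>c\<in>hom T C C'. c \<cdot> g = g' \<cdot> b \<and> shf a \<cdot> h = h' \<cdot> c" using assms unfolding arr_def by blast
  then show ?thesis using that arrD(2)[OF distD(2)[OF assms(1)]] arrD(2)[OF distD(2)[OF assms(2)]]
    by (auto simp: arr_def)
qed

lemma zero_ex: obtains Z where "is_zero T Z" "Z \<in> ob T"
proof -
  have "additive_cat T" using triangulated by (simp add: triangulated_def)
  then show ?thesis using that by (auto simp: additive_cat_def is_zero_def)
qed

text \<open>The trivial triangle on \<open>A\<close> maps to the given one by the identity of
  \<open>A\<close> and \<open>f\<close>; the third component starts at a zero object.\<close>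

lemma dist_comp: assumes "dist T A f B g C h" shows "g \<cdot> f = 0"
proof -
  obtain Z where Z: "is_zero T Z" "Z \<in> ob T" by (rule zero_ex)
  note d = distD[OF assms]
  have A: "A \<in> ob T" using d arrD by blast
  obtain c where "arr Z C c" "c \<cdot> 0 = g \<cdot> f"
    using triangle_map[OF dist_id[OF A Z(1)] assms arr_id[OF A] d(1)] d by auto
  then show ?thesis using cmp_zero_right[OF A] by simp
qed

text \<open>Compare with the triangle
  \<open>0 \<rightarrow> Y \<rightarrow> Y \<rightarrow> 0\<close>, which is the trivial one
  rotated; the third component of the resulting map of triangles is the factorization.\<close>

lemma dist_factor_right:
  assumes "dist T A f B g C h" "arr B Y u" "u \<cdot> f = 0" obtains c where "arr C Y c" "c \<cdot> g = u"
proof -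
  obtain Z where Z: "is_zero T Z" "Z \<in> ob T" by (rule zero_ex)
  note d = distD[OF assms(1)]
  have Y: "Y \<in> ob T" and A: "A \<in> ob T" using d assms arrD by blast+
  \<comment> \<open>The shift of a zero object is zero, so the trivial triangle on \<open>Y\<close>
    may be written with \<open>sho Z\<close> as its third term and then be rotated back to one that
    starts at \<open>Z\<close>.\<close>
  have sZ: "is_zero T (sho Z)"
    using Z shf_id[OF Z(2)] sho_ob[OF Z(2)] shf_zero[OF Z(2,2)] by (simp add: is_zero_def)
  have "dist T Y (idn T Y) Y 0 (sho Z) (- shf 0)" using dist_id[OF Y sZ] shf_zero[OF Z(2) Y] by simp
  then have "dist T Z 0 Y (idn T Y) Y 0" using rotate[OF arr_zero[OF Z(2) Y] arr_id[OF Y] arr_zero[OF Y sho_ob[OF Z(2)]]] by simp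
  from triangle_map[OF assms(1) this arr_zero[OF A Z(2)] assms(2)] assms(3)
  obtain c where "arr C Y c" "c \<cdot> g = idn T Y \<cdot> u" using cmp_zero_right[OF A arr_zero[OF Z(2) Y]] by auto
  then show ?thesis using that assms(2) by simp
qed

text \<open>Comparing rotated triangles gives a map from the shift of \<open>Y\<close> to the shift
  of \<open>A\<close>, which comes from a map of \<open>Y\<close> to \<open>A\<close> because the
  shift is fully faithful. Rotation introduces a sign on both sides, and the signs cancel.\<close>

lemma dist_factor_left:
  assumes "dist T A f B g C h" "arr Y B u" "g \<cdot> u = 0" obtains a where "arr Y A a" "f \<cdot> a = u"
proof -
  obtain Z where Z: "is_zero T Z" "Z \<in> ob T" by (rule zero_ex)
  note d = distD[OF assms(1)]
  have Y: "Y \<in> ob T" and A: "A \<in> ob T" and B: "B \<in> ob T" and C: "C \<in> ob T" using d assms arrD by blast+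
  have "0 \<cdot> 0 = g \<cdot> u" using assms(3) cmp_zero_right[OF Y arr_zero[OF Z(2) C]] by simp
  then obtain c where c: "arr (sho Y) (sho A) c" "shf u \<cdot> (- shf (idn T Y)) = (- shf f) \<cdot> c"
    using triangle_map[OF rotateI[OF dist_id[OF Y Z(1)]] rotateI[OF assms(1)] assms(2) arr_zero[OF Z(2) C]] by auto
  obtain a where a: "arr Y A a" "shf a = c" using shf_surj[OF Y A c(1)] .
  have "shf u \<cdot> (- shf (idn T Y)) = - shf u"
    using shf_id[OF Y] cmp_neg_right[OF arr_id[OF sho_ob[OF Y]] shf_arr[OF assms(2)]] shf_arr[OF assms(2)] by simp
  moreover have "(- shf f) \<cdot> c = - shf (f \<cdot> a)" using cmp_neg_left[OF c(1) shf_arr[OF d(1)]] shf_cmp[OF a(1) d(1)] a by simp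
  ultimately have "shf (f \<cdot> a) = shf u" using c by simp
  then have "f \<cdot> a = u" using shf_inj[OF arr_cmp[OF a(1) d(1)] assms(2)] by simp
  then show ?thesis using that a by blast
qed

text \<open>The connecting map is composition with the third morphism \<open>w\<close> of the
  triangle. The subspace of finite codimension is zero, since hom spaces are finite-dimensional, and
  the zero map factors through the zero object, which is projective.\<close>

lemma extension_category_of_subcat:
  assumes S: "full_subcat T S"
  shows "extension_category (ext_cat_of_subcat T S)"
proof -
  let ?X = "ext_cat_of_subcat T S"
  have ks: "krull_schmidt T" using triangulated_2CY by (simp add: two_CY_triangulated_def)
  have two: "two_CY T (\<lambda>A B. {0}) (sh T) (\<lambda>A B f h. h = shm T f)"
    using triangulated_2CY by (simp add: two_CY_triangulated_def)
  have sub: "S \<subseteq> ob T" using S by (simp add: full_subcat_def)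
  have ksX: "krull_schmidt ?X" by (rule krull_schmidt_full_subcat[OF ks]) (auto simp: S)
  have cflE: "\<exists>w. dist T N f B g M w" "N \<in> S" "B \<in> S" "M \<in> S" if "cfl ?X N f B g M" for N f B g M
    using that by (auto simp: ext_cat_of_subcat_def)
  have ez: "ext_zero ?X A N \<longleftrightarrow> (\<forall>x. arr A (sho N) x \<longrightarrow> x = 0)" if "A \<in> S" "N \<in> S" for A N
    using that sub sho_ob by (auto simp: ext_zero_def arr_def)
  show ?thesis
  proof unfold_locales
    show "lin_cat ?X" "krull_schmidt ?X" using ksX by (auto simp: krull_schmidt_def additive_cat_def)
    show "N \<in> ob ?X \<and> B \<in> ob ?X \<and> M \<in> ob ?X \<and> f \<in> hom ?X N B \<and> g \<in> hom ?X B M" if "cfl ?X N f B g M" for N f B g M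
      using cflE[OF that] distD[of N f B g M] arrD(3) by fastforce
  next
    fix N f B g M Y assume c: "cfl ?X N f B g M" and Y': "Y \<in> ob ?X"
    obtain w where w: "dist T N f B g M w" using cflE(1)[OF c] by blast
    note d = distD[OF w] and r = rotateI[OF w]
    have YS: "Y \<in> S" and Y: "Y \<in> ob T" using Y' sub by auto
    have ob: "N \<in> ob T" "B \<in> ob T" "M \<in> ob T" "sho N \<in> ob T" using d arrD by blast+
    show "\<exists>\<delta>. (\<forall>h\<in>hom ?X Y M. \<delta> h \<in> ext_cyc ?X Y N) \<and>
        (\<forall>h\<in>hom ?X Y M. \<forall>h'\<in>hom ?X Y M. \<delta> (h + h') = \<delta> h + \<delta> h') \<and>
        (\<forall>h\<in>hom ?X Y M. \<forall>a. \<delta> (scl ?X a h) = scl ?X a (\<delta> h)) \<and>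
        (\<forall>h\<in>hom ?X Y M. \<delta> h \<in> ext_bd ?X Y N \<longleftrightarrow> (\<exists>t\<in>hom ?X Y B. h = cmp ?X g t)) \<and>
        (ext_zero ?X Y B \<longrightarrow> (\<forall>e\<in>ext_cyc ?X Y N. \<exists>h\<in>hom ?X Y M. e - \<delta> h \<in> ext_bd ?X Y N))"
    proof (intro exI[of _ "\<lambda>h. w \<cdot> h"] conjI ballI allI impI)
      fix h assume "h \<in> hom ?X Y M"
      then have h: "arr Y M h" using Y ob by (simp add: arr_def)
      show "w \<cdot> h \<in> ext_cyc ?X Y N" using arrD(3)[OF arr_cmp[OF h d(3)]] by simp
      show "w \<cdot> scl ?X a h = scl ?X a (w \<cdot> h)" for a using cmp_scl_right[OF h d(3)] by simp
      show "w \<cdot> h \<in> ext_bd ?X Y N \<longleftrightarrow> (\<exists>t\<in>hom ?X Y B. h = cmp ?X g t)"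
      proof
        assume "w \<cdot> h \<in> ext_bd ?X Y N"
        then obtain t where "arr Y B t" "g \<cdot> t = h" using dist_factor_left[OF r h] by auto
        then show "\<exists>t\<in>hom ?X Y B. h = cmp ?X g t" using arrD(3) by force
      next
        assume "\<exists>t\<in>hom ?X Y B. h = cmp ?X g t"
        then obtain t where t: "arr Y B t" "h = g \<cdot> t" using Y ob by (auto simp: arr_def)
        show "w \<cdot> h \<in> ext_bd ?X Y N"
          using assoc[OF t(1) d(2,3)] dist_comp[OF r] t(2) cmp_zero_left[OF t(1) ob(4)] by simp
      qed
      fix h' assume "h' \<in> hom ?X Y M"
      then have h': "arr Y M h'" using Y ob by (simp add: arr_def)
      show "w \<cdot> (h + h') = w \<cdot> h + w \<cdot> h'" using cmp_add_right[OF h h' d(3)] .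
    next
      fix e assume z: "ext_zero ?X Y B" and "e \<in> ext_cyc ?X Y N"
      then have e: "arr Y (sho N) e" using Y ob by (simp add: arr_def)
      note r2 = rotateI[OF r]
      have "(- shf f) \<cdot> e = 0" using z[unfolded ez[OF YS cflE(3)[OF c]]] arr_cmp[OF e arr_neg[OF shf_arr[OF d(1)]]] by blast
      then obtain h where "arr Y M h" "w \<cdot> h = e" using dist_factor_left[OF r2 e] by blast
      then show "\<exists>h\<in>hom ?X Y M. e - w \<cdot> h \<in> ext_bd ?X Y N" using arrD(3) by force
    qed
  next
    fix N f B g M Y h assume c: "cfl ?X N f B g M" and Y': "Y \<in> ob ?X" and z: "ext_zero ?X M Y" and h': "h \<in> hom ?X N Y"
    obtain w where w: "dist T N f B g M w" using cflE(1)[OF c] by blast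
    note d = distD[OF w] and r2 = rotateI[OF rotateI[OF w]]
    have YS: "Y \<in> S" and Y: "Y \<in> ob T" using Y' sub by auto
    have ob: "N \<in> ob T" "B \<in> ob T" "M \<in> ob T" "sho N \<in> ob T" using d arrD by blast+
    have h: "arr N Y h" using h' ob Y by (simp add: arr_def)
    have "shf h \<cdot> w = 0" using z[unfolded ez[OF cflE(4)[OF c] YS]] arr_cmp[OF d(3) shf_arr[OF h]] by blast
    then obtain t' where t': "arr (sho B) (sho Y) t'" "t' \<cdot> (- shf f) = shf h"
      using dist_factor_right[OF r2 shf_arr[OF h]] by blast
    obtain t where t: "arr B Y t" "shf t = t'" using shf_surj[OF ob(2) Y t'(1)] .
    \<comment> \<open>The rotated triangle contains \<open>- shf f\<close>, hence the sign in the
      extension \<open>- t\<close> of \<open>h\<close>.\<close>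
    have "shf ((- t) \<cdot> f) = shf h"
      using shf_cmp[OF d(1) arr_neg[OF t(1)]] shf_neg[OF t(1)] t t'
        cmp_neg_left[OF shf_arr[OF d(1)] t'(1)] cmp_neg_right[OF shf_arr[OF d(1)] t'(1)] by simp
    then have "(- t) \<cdot> f = h" using shf_inj[OF arr_cmp[OF d(1) arr_neg[OF t(1)]] h] by simp
    then show "\<exists>t\<in>hom ?X B Y. h = cmp ?X t f" using arrD(3)[OF arr_neg[OF t(1)]] by force
  next
    fix A B assume A: "A \<in> ob ?X" and B: "B \<in> ob ?X" and z: "ext_zero ?X A B"
    then have "hom T A (sho B) \<subseteq> {0}" by (simp add: ext_zero_def)
    then have "hom T B (sho A) \<subseteq> {0}" using two_CY_sym[OF two] A B sub by auto
    then show "ext_zero ?X B A" by (simp add: ext_zero_def)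
  next
    fix A assume A: "A \<in> ob ?X"
    obtain Z where Z: "is_zero T Z" "Z \<in> ob T" by (rule zero_ex)
    have ZS: "Z \<in> S" using Z S unfolding full_subcat_def by blast
    have pr: "projective_in ?X (ob ?X) Z" unfolding projective_in_def using zero_arr(2)[OF Z(1)] ez[OF ZS] ZS by simp
    have A': "A \<in> ob T" using A sub by auto
    obtain n where n: "quot_dim (scl T) (hom T A A) {0} n" using two_CY_finite[OF two A' A'] by blast
    have "(0::'m) = 0 \<cdot> 0" using cmp_zero_right[OF A' arr_zero[OF Z(2) A']] by simp
    then show "\<exists>I n. quot_dim (scl ?X) (hom ?X A A) I n \<and> module.subspace (scl ?X) I \<and>
      (\<forall>x\<in>I. \<exists>P f g. projective_in ?X (ob ?X) P \<and> f \<in> hom ?X A P \<and> g \<in> hom ?X P A \<and> x = cmp ?X g f)"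
      using n pr arrD(3)[OF arr_zero[OF A' Z(2)]] arrD(3)[OF arr_zero[OF Z(2) A']]
      by (intro exI[of _ "{0}"] exI[of _ n]) (auto simp: vs.subspace_def intro!: exI[of _ Z] exI[of _ 0])
  next
    fix A B D N assume "biproduct ?X A B D" and N: "N \<in> ob ?X"
    then have bT: "biproduct T A B D" "A \<in> S" "B \<in> S" "D \<in> S" "N \<in> S" using sub by (auto simp: biproduct_def)
    have sN: "sho N \<in> ob T" using bT sub sho_ob by blast
    obtain i j k q where b: "arr A D i" "arr B D j" "arr D A k" "arr D B q"
      "k \<cdot> i = idn T A" "q \<cdot> j = idn T B" "q \<cdot> i = 0" "k \<cdot> j = 0" "i \<cdot> k + j \<cdot> q = idn T D" using bT(1) by (rule biproductE)
    have sub': "x = 0"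
      if z: "\<forall>x. arr D (sho N) x \<longrightarrow> x = 0" and ik: "arr U D i'" "arr D U k'" "k' \<cdot> i' = idn T U" and x: "arr U (sho N) x" for U i' k' x
      using z arr_cmp[OF ik(2) x] assoc[OF ik(1,2) x] ik x cmp_zero_left[OF ik(1) sN] by auto
    show "ext_zero ?X D N \<longleftrightarrow> ext_zero ?X A N \<and> ext_zero ?X B N"
    proof
      show "ext_zero ?X A N \<and> ext_zero ?X B N" if "ext_zero ?X D N"
        using that sub' b unfolding ez[OF bT(2,5)] ez[OF bT(3,5)] ez[OF bT(4,5)] by blast
      assume z: "ext_zero ?X A N \<and> ext_zero ?X B N"
      show "ext_zero ?X D N" unfolding ez[OF bT(4,5)]
      proof (intro allI impI)
        fix x assume x: "arr D (sho N) x"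
        have "x \<cdot> i = 0" "x \<cdot> j = 0" using z arr_cmp[OF b(1) x] arr_cmp[OF b(2) x] unfolding ez[OF bT(2,5)] ez[OF bT(3,5)] by blast+
        then have "x \<cdot> (i \<cdot> k + j \<cdot> q) = 0"
          using cmp_add_right[OF arr_cmp[OF b(3,1)] arr_cmp[OF b(4,2)] x] assoc[OF b(3,1) x] assoc[OF b(4,2) x]
            cmp_zero_left[OF b(3) sN] cmp_zero_left[OF b(4) sN] by simp
        then show "x = 0" using b x by simp
      qed
    qed
  next
    fix Z N assume Z: "is_zero ?X Z" and N: "N \<in> ob ?X"
    then have "is_zero T Z" using sub by (auto simp: is_zero_def)
    then show "ext_zero ?X Z N" using ez[of Z N] zero_arr(2) Z N by (auto simp: is_zero_def)
  next
    show "module.subspace (scl ?X) (ext_bd ?X A B)" for A B by (simp add: vs.subspace_def)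
  qed
qed

end

lemma stably_2CY_extension_category:
  fixes X :: "('o, 'm::ab_group_add, 'k::alg_closed_field) ext_cat"
  assumes "stably_2CY X" shows "extension_category X"
  using assms unfolding stably_2CY_def
proof
  assume "\<exists>E. two_CY_frobenius E \<and> X = ext_cat_of_exact E"
  then obtain E where E: "two_CY_frobenius E" "X = ext_cat_of_exact E" by blast
  then interpret frobenius_2CY E
    by unfold_locales (simp_all add: two_CY_frobenius_def krull_schmidt_def additive_cat_def)
  show ?thesis using extension_category_of_exact E by simp
next
  assume "\<exists>T S. two_CY_triangulated T \<and> full_subcat T S \<and> functorially_finite T S (ob T) \<and>
        (\<forall>A f B g C h. dist T A f B g C h \<and> A \<in> S \<and> C \<in> S \<longrightarrow> B \<in> S) \<and>
        X = ext_cat_of_subcat T S"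
  then obtain T S where T: "two_CY_triangulated T" "full_subcat T S" "X = ext_cat_of_subcat T S" by blast
  then interpret triangulated_2CY T
    by unfold_locales (simp_all add: two_CY_triangulated_def krull_schmidt_def additive_cat_def)
  show ?thesis using extension_category_of_subcat T by simp
qed

section \<open>Exchange of cluster tilting objects\<close>

context linear_category begin

lemma arrows_eq: "quot_dim (scl K) (rad K A B) (rad_sq K T A B) n \<Longrightarrow> arrows K T A B = n"
  unfolding arrows_def using vs.quot_dim_unique[OF subspace_rad_sq] by (intro the_equality) blast+

text \<open>The square of the radical is an ideal. Being a morphism is part of the conclusion
  because bilinearity of composition, used in the argument over the span, holds for morphisms
  only.\<close>

lemma rad_sq_conjugate:
  assumes ob: "A \<in> ob K" "B \<in> ob K" "\<And>Y. Y \<in> add_closure K T \<Longrightarrow> Y \<in> ob K"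
    and a: "arr A' A a" and b: "arr B B' b" and f: "f \<in> rad_sq K T A B"
  shows "arr A B f \<and> b \<cdot> (f \<cdot> a) \<in> rad_sq K T A' B'"
proof -
  have ob': "A' \<in> ob K" "B' \<in> ob K" using a b arrD by blast+
  have "rad_sq K T A B \<subseteq> {f. arr A B f \<and> b \<cdot> (f \<cdot> a) \<in> rad_sq K T A' B'}" unfolding rad_sq_eq_span[of T A B]
  proof (rule vs.span_minimal)
    show "{g \<cdot> f | Y f g. Y \<in> add_closure K T \<and> f \<in> rad K A Y \<and> g \<in> rad K Y B} \<subseteq>
      {f. arr A B f \<and> b \<cdot> (f \<cdot> a) \<in> rad_sq K T A' B'}"
    proof clarify
      fix Y f g assume Y: "Y \<in> add_closure K T" and f: "f \<in> rad K A Y" and g: "g \<in> rad K Y B"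
      have fa: "arr A Y f" and ga: "arr Y B g" using rad_arr f g ob(1,2) ob(3)[OF Y] by blast+
      have "b \<cdot> ((g \<cdot> f) \<cdot> a) = (b \<cdot> g) \<cdot> (f \<cdot> a)"
        using assoc[OF a fa ga] assoc[OF arr_cmp[OF a fa] ga b] by simp
      moreover have "(b \<cdot> g) \<cdot> (f \<cdot> a) \<in> rad_sq K T A' B'"
        using rad_sqI[OF Y rad_cmp_right[OF f a ob(3)[OF Y]] rad_cmp_left[OF g b ob(3)[OF Y]]] .
      ultimately show "arr A B (g \<cdot> f) \<and> b \<cdot> ((g \<cdot> f) \<cdot> a) \<in> rad_sq K T A' B'" using fa ga by auto
    qed
    show "vs.subspace {f. arr A B f \<and> b \<cdot> (f \<cdot> a) \<in> rad_sq K T A' B'}"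
    proof (rule vs.subspaceI)
      show "0 \<in> {f. arr A B f \<and> b \<cdot> (f \<cdot> a) \<in> rad_sq K T A' B'}"
        using ob cmp_zero_left[OF a ob(2)] cmp_zero_right[OF ob'(1) b] vs.subspace_0[OF subspace_rad_sq] by auto
    next
      fix x y assume "x \<in> {f. arr A B f \<and> b \<cdot> (f \<cdot> a) \<in> rad_sq K T A' B'}" "y \<in> {f. arr A B f \<and> b \<cdot> (f \<cdot> a) \<in> rad_sq K T A' B'}"
      then have x: "arr A B x" "b \<cdot> (x \<cdot> a) \<in> rad_sq K T A' B'" and y: "arr A B y" "b \<cdot> (y \<cdot> a) \<in> rad_sq K T A' B'" by auto
      have "b \<cdot> ((x + y) \<cdot> a) = b \<cdot> (x \<cdot> a) + b \<cdot> (y \<cdot> a)"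
        using cmp_add_left[OF a x(1) y(1)] cmp_add_right[OF arr_cmp[OF a x(1)] arr_cmp[OF a y(1)] b] by simp
      then show "x + y \<in> {f. arr A B f \<and> b \<cdot> (f \<cdot> a) \<in> rad_sq K T A' B'}"
        using x y vs.subspace_add[OF subspace_rad_sq] by auto
    next
      fix c x assume "x \<in> {f. arr A B f \<and> b \<cdot> (f \<cdot> a) \<in> rad_sq K T A' B'}"
      then have x: "arr A B x" "b \<cdot> (x \<cdot> a) \<in> rad_sq K T A' B'" by auto
      have "b \<cdot> (scl K c x \<cdot> a) = scl K c (b \<cdot> (x \<cdot> a))"
        using cmp_scl_left[OF a x(1)] cmp_scl_right[OF arr_cmp[OF a x(1)] b] by simp
      then show "scl K c x \<in> {f. arr A B f \<and> b \<cdot> (f \<cdot> a) \<in> rad_sq K T A' B'}"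
        using x vs.subspace_scale[OF subspace_rad_sq] by auto
    qed
  qed
  then show ?thesis using f by blast
qed

end

context ks_category begin

lemma quot_dim_arrows_iso:
  assumes A: "isomorphic K A A'" and B: "isomorphic K B B'"
    and q: "quot_dim (scl K) (rad K A B) (rad_sq K T A B) n"
  shows "quot_dim (scl K) (rad K A' B') (rad_sq K T A' B') n"
proof -
  obtain a a' where a: "arr A A' a" "arr A' A a'" "a' \<cdot> a = idn K A" "a \<cdot> a' = idn K A'" using A by (rule isomorphicE)
  obtain b b' where b: "arr B B' b" "arr B' B b'" "b' \<cdot> b = idn K B" "b \<cdot> b' = idn K B'" using B by (rule isomorphicE)
  have ob: "A \<in> ob K" "A' \<in> ob K" "B \<in> ob K" "B' \<in> ob K" using a b arrD by blast+
  have inv: "b' \<cdot> ((b \<cdot> (x \<cdot> a')) \<cdot> a) = x" if x: "arr A B x" for x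
    using assoc[OF a(1) arr_cmp[OF a(2) x] b(1)] assoc[OF a(1,2) x] a(3) x assoc[OF x b(1,2)] b(3) by simp
  have inv': "b \<cdot> ((b' \<cdot> (x \<cdot> a)) \<cdot> a') = x" if x: "arr A' B' x" for x
    using assoc[OF a(2) arr_cmp[OF a(1) x] b(2)] assoc[OF a(2,1) x] a(4) x assoc[OF x b(2,1)] b(4) by simp
  note conj = rad_sq_conjugate[OF _ _ add_closure_ob]
  show ?thesis
  proof (rule vs.quot_dim_transfer[OF q subspace_rad[OF ob(1,3)] subspace_rad_sq, of "\<lambda>x. b \<cdot> (x \<cdot> a')"])
    fix x assume "x \<in> rad K A B"
    then have x: "x \<in> rad K A B" "arr A B x" using rad_arr ob by blast+
    show "b \<cdot> (x \<cdot> a') \<in> rad K A' B'" using rad_cmp_left[OF rad_cmp_right[OF x(1) a(2) ob(3)] b(1) ob(2)] .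
    show "b \<cdot> (scl K c x \<cdot> a') = scl K c (b \<cdot> (x \<cdot> a'))" for c
      using cmp_scl_left[OF a(2) x(2)] cmp_scl_right[OF arr_cmp[OF a(2) x(2)] b(1)] by simp
    show "(b \<cdot> (x \<cdot> a') \<in> rad_sq K T A' B') = (x \<in> rad_sq K T A B)"
    proof
      assume "b \<cdot> (x \<cdot> a') \<in> rad_sq K T A' B'"
      from conj[OF ob(2,4) _ a(1) b(2) this] show "x \<in> rad_sq K T A B" using inv[OF x(2)] by auto
    next
      assume "x \<in> rad_sq K T A B"
      from conj[OF ob(1,3) _ a(2) b(1) this] show "b \<cdot> (x \<cdot> a') \<in> rad_sq K T A' B'" by auto
    qed
    fix y assume "y \<in> rad K A B"
    then have y: "arr A B y" using rad_arr ob by blast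
    show "b \<cdot> ((x + y) \<cdot> a') = b \<cdot> (x \<cdot> a') + b \<cdot> (y \<cdot> a')"
      using cmp_add_left[OF a(2) x(2) y] cmp_add_right[OF arr_cmp[OF a(2) x(2)] arr_cmp[OF a(2) y] b(1)] by simp
  next
    fix y assume "y \<in> rad K A' B'"
    then have y: "y \<in> rad K A' B'" "arr A' B' y" using rad_arr ob by blast+
    show "\<exists>x\<in>rad K A B. y - b \<cdot> (x \<cdot> a') \<in> rad_sq K T A' B'"
      using rad_cmp_left[OF rad_cmp_right[OF y(1) a(1) ob(4)] b(2) ob(1)] inv'[OF y(2)] vs.subspace_0[OF subspace_rad_sq]
      by (intro bexI[of _ "b' \<cdot> (y \<cdot> a)"]) auto
  qed
qed

text \<open>Seeds are indexed by field elements, and \<open>seed_of\<close> picks a summand for each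
  index by choice. Invariance makes the entries independent of that choice.\<close>

lemma arrows_iso:
  assumes "isomorphic K A A'" "isomorphic K B B'" shows "arrows K T A B = arrows K T A' B'"
proof -
  have "quot_dim (scl K) (rad K A B) (rad_sq K T A B) n = quot_dim (scl K) (rad K A' B') (rad_sq K T A' B') n" for n
    using quot_dim_arrows_iso assms isomorphic_sym by metis
  then show ?thesis by (simp add: arrows_def)
qed

end

section \<open>Exchange pairs and edges of the cluster tilting graph\<close>

context extension_category begin

lemma ext_zero_sumlist: "sumlist X ys C \<Longrightarrow> N \<in> ob X \<Longrightarrow> ext_zero X C N \<longleftrightarrow> (\<forall>y\<in>set ys. ext_zero X y N)"
  by (induction rule: sumlist.induct) (auto simp: ext_zero_zero ext_zero_biproduct)

lemma ext_zero_iso: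
  assumes "isomorphic X A B" "N \<in> ob X" shows "ext_zero X A N \<longleftrightarrow> ext_zero X B N"
proof -
  obtain Z where Z: "is_zero X Z" using additive by (auto simp: additive_cat_def)
  have "A \<in> ob X" using assms by (simp add: isomorphic_def)
  then have "biproduct X A Z B" using biproduct_iso[OF biproduct_zero_right] Z assms by blast
  then show ?thesis using ext_zero_biproduct ext_zero_zero Z assms by blast
qed

lemma projective_iso:
  assumes "isomorphic X A B" "A \<in> S" "B \<in> S" "S \<subseteq> ob X"
  shows "projective_in X S A \<longleftrightarrow> projective_in X S B"
  unfolding projective_in_def using ext_zero_iso[OF assms(1)] assms by blast

lemma cluster_tilting_indec: "cluster_tilting X S T \<Longrightarrow> indec_closed T"
  unfolding cluster_tilting_def indec_closed_def by blast

lemma cluster_tilting_ext_zero: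
  "cluster_tilting X S T \<Longrightarrow> A \<in> T \<Longrightarrow> B \<in> T \<Longrightarrow> ext_zero X A B"
  unfolding cluster_tilting_def by blast

lemma cluster_tilting_maximal:
  assumes "cluster_tilting X S T" "S \<subseteq> ob X" "L \<in> S" "local_end X L" "\<And>M. M \<in> T \<Longrightarrow> ext_zero X M L"
  shows "L \<in> T"
proof -
  have "L \<in> add_closure X T" using assms unfolding cluster_tilting_def by blast
  then show ?thesis using add_closure_local[OF cluster_tilting_indec[OF assms(1)]] assms by blast
qed

text \<open>If \<open>N\<close> were a summand of \<open>T\<close> other than \<open>M\<close>, the
  exchange would merely remove \<open>M\<close>. But \<open>M\<close> has no extensions with the
  remaining summands, so maximality of the result would put it back.\<close>

lemma exchange_not_mem:
  assumes T: "cluster_tilting X S T" and R: "cluster_tilting X S (replace X T M N)"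
    and S: "S \<subseteq> ob X" and M: "M \<in> T" and N: "N \<in> T - iso_class X M"
  shows False
proof -
  have ic: "indec_closed T" using T by (rule cluster_tilting_indec)
  have MS: "M \<in> S" using T M unfolding cluster_tilting_def by blast
  have r: "replace X T M N = T - iso_class X M"
    unfolding replace_def using N indec_closedD(3)[OF indec_closed_diff[OF ic] N] by (auto simp: iso_class_def)
  have "M \<in> T - iso_class X M"
    using cluster_tilting_maximal[OF R S MS indec_closedD(1)[OF ic M]] cluster_tilting_ext_zero[OF T _ M] r by blast
  then show False using isomorphic_refl indec_closedD(2)[OF ic M] by (simp add: iso_class_def)
qed

lemma exchangeable_not_mem:
  assumes "exchangeable X S T M N" "S \<subseteq> ob X" shows "N \<notin> T"
  using exchange_not_mem[of S T M N] assms unfolding exchangeable_def iso_class_def by blast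

text \<open>An edge only records a difference in one class. That \<open>M\<close> is not projective
  follows: a projective \<open>M\<close> has no extensions with \<open>T'\<close> and would belong
  to it by maximality.\<close>

lemma ct_edge_exchange:
  assumes e: "ct_edge X S T T'" and S: "S \<subseteq> ob X"
  obtains M N where "exchangeable X S T M N" "T' = replace X T M N"
proof -
  from e obtain M N where MN: "M \<in> T" "N \<in> T'" "T - T' = iso_class X M" "T' - T = iso_class X N"
    and T: "cluster_tilting X S T" "cluster_tilting X S T'" unfolding ct_edge_def by blast
  have ic: "indec_closed T" "indec_closed T'" using T cluster_tilting_indec by blast+
  have Mob: "M \<in> ob X" and LM: "local_end X M" using indec_closedD[OF ic(1) MN(1)] by auto
  have Nob: "N \<in> ob X" and LN: "local_end X N" using indec_closedD[OF ic(2) MN(2)] by auto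
  have "M \<in> iso_class X M" "N \<in> iso_class X N" using isomorphic_refl Mob Nob by (auto simp: iso_class_def)
  then have nm: "M \<notin> T'" "N \<notin> T" using MN by blast+
  have MS: "M \<in> S" "N \<in> S" using T MN unfolding cluster_tilting_def by blast+
  have r: "T' = replace X T M N" unfolding replace_def using MN by blast
  have "\<not> isomorphic X M N" using nm indec_closedD(3)[OF ic(1) MN(1)] by blast
  moreover have "\<not> projective_in X S M"
  proof
    assume "projective_in X S M"
    moreover have "T' \<subseteq> S" using T(2) by (simp add: cluster_tilting_def)
    ultimately have "ext_zero X Y M" if "Y \<in> T'" for Y
      using ext_zero_sym[OF Mob] that S unfolding projective_in_def by blast
    then show False using cluster_tilting_maximal[OF T(2) S MS(1) LM] nm by blast
  qed
  ultimately have "exchangeable X S T M N" unfolding exchangeable_def using T MN(1) MS LN r indecomposable_local by blast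
  then show ?thesis using that r by blast
qed

lemma exchange_ct_edge:
  assumes e: "exchangeable X S T M N" and S: "S \<subseteq> ob X" shows "ct_edge X S T (replace X T M N)"
proof -
  have T: "cluster_tilting X S T" "cluster_tilting X S (replace X T M N)" and M: "M \<in> T" and N: "N \<in> S" "\<not> isomorphic X M N"
    using e unfolding exchangeable_def by blast+
  have "N \<notin> T" using exchangeable_not_mem[OF e S] .
  then have "iso_class X N \<inter> T = {}" using indec_closedD(3)[OF cluster_tilting_indec[OF T(1)]] isomorphic_sym
    by (auto simp: iso_class_def)
  moreover have "iso_class X M \<inter> iso_class X N = {}"
    unfolding iso_class_def using N(2) isomorphic_trans[of M _ N] isomorphic_sym[of N] by blast
  moreover have "iso_class X M \<subseteq> T" using T(1) M unfolding cluster_tilting_def by blast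
  ultimately have "T - replace X T M N = iso_class X M" "replace X T M N - T = iso_class X N"
    unfolding replace_def by blast+
  moreover have "N \<in> replace X T M N" using isomorphic_refl N S by (auto simp: replace_def iso_class_def)
  ultimately show ?thesis unfolding ct_edge_def using T M by blast
qed

lemma cfl_arr: assumes "cfl X N f B g M" shows "arr N B f" "arr B M g"
  using cfl_hom[OF assms] by (auto simp: arr_def)

lemma lift_along_deflation:
  assumes c: "cfl X N f B g M" and z: "ext_zero X Y N" and h: "arr Y M h"
  obtains t where "arr Y B t" "h = cmp X g t"
proof -
  have Y: "Y \<in> ob X" using h arrD by blast
  obtain \<delta> where \<delta>: "\<forall>h\<in>hom X Y M. \<delta> h \<in> ext_cyc X Y N" "\<forall>h\<in>hom X Y M. \<delta> h \<in> ext_bd X Y N \<longleftrightarrow> (\<exists>t\<in>hom X Y B. h = cmp X g t)"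
    using connecting_map[OF c Y] by blast
  then obtain t where "t \<in> hom X Y B" "h = cmp X g t" using z arrD(3)[OF h] unfolding ext_zero_def by blast
  then show ?thesis using that Y arrD(1)[OF cfl_arr(2)[OF c]] by (auto simp: arr_def)
qed

lemma extend_along_inflation:
  assumes c: "cfl X N f B g M" and z: "ext_zero X M Y" and h: "arr N Y h"
  obtains t where "arr B Y t" "h = cmp X t f"
  using extend[OF c _ z, of h] arrD[OF h] arrD(1)[OF cfl_arr(2)[OF c]] that by (auto simp: arr_def)

text \<open>
  The middle terms of exchange conflations determine the arrows at \<open>M\<close>. Approximation properties are not
  assumed: they follow from the vanishing of extensions with \<open>N\<close>.
\<close>

lemma exchange_arrows:
  assumes T: "cluster_tilting X (ob X) T" and M: "M \<in> T" "\<not> projective_in X (ob X) M"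
    and R: "cluster_tilting X (ob X) (replace X T M N)" and N: "N \<in> ob X" "indecomposable X N"
    and quiver: "finite_quiver X (ob X) T" "no_loops_or_2_cycles X (ob X) T"
    and c1: "cfl X N f B g M" "B \<in> add_closure X (T - iso_class X M)" "right_minimal X B g"
    and c2: "cfl X M s B' t N" "B' \<in> add_closure X (T - iso_class X M)" "left_minimal X s B'"
  shows "ext_dim_1 X M N" "nonsplit_cfl X N B M" "nonsplit_cfl X M B' N"
    and "sumlist X ys B \<Longrightarrow> set ys \<subseteq> T - iso_class X M \<Longrightarrow> A \<in> T - iso_class X M \<Longrightarrow>
      arrows X T A M = card {j. j < length ys \<and> isomorphic X A (ys ! j)}"
    and "sumlist X ys' B' \<Longrightarrow> set ys' \<subseteq> T - iso_class X M \<Longrightarrow> A \<in> T - iso_class X M \<Longrightarrow>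
      arrows X T M A = card {j. j < length ys' \<and> isomorphic X A (ys' ! j)}"
proof -
  let ?T0 = "T - iso_class X M"
  note ic = cluster_tilting_indec[OF T]
  note ic0 = indec_closed_diff[OF ic, of M]
  have Mob: "M \<in> ob X" and LM: "local_end X M" using indec_closedD[OF ic M(1)] by auto
  have NR: "N \<in> replace X T M N" using isomorphic_refl[OF N(1)] by (simp add: replace_def iso_class_def)
  have zero_T: "ext_zero X Y A" if Y: "Y \<in> add_closure X ?T0" and A: "A \<in> T" for Y A
  proof -
    obtain ys where ys: "set ys \<subseteq> ?T0" "sumlist X ys Y" using add_closure_sumlist[OF ic0 Y] .
    show ?thesis unfolding ext_zero_sumlist[OF ys(2) indec_closedD(2)[OF ic A]]
      using ys(1) cluster_tilting_ext_zero[OF T _ A] by blast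
  qed
  \<comment> \<open>\<open>N\<close> and all of \<open>?T0\<close> belong to the exchanged cluster
    tilting object, whose members have no extensions with each other.\<close>
  have zero_N: "ext_zero X Y N" if Y: "Y \<in> add_closure X ?T0" for Y
  proof -
    obtain ys where ys: "set ys \<subseteq> ?T0" "sumlist X ys Y" using add_closure_sumlist[OF ic0 Y] .
    show ?thesis unfolding ext_zero_sumlist[OF ys(2) N(1)]
      using ys(1) cluster_tilting_ext_zero[OF R _ NR] by (auto simp: replace_def)
  qed
  note g = cfl_arr[OF c1(1)] and st = cfl_arr[OF c2(1)]
  have right: "right_approx X (add_closure X ?T0) B g M" unfolding right_approx_def
  proof (intro conjI ballI)
    show "g \<in> hom X B M" using g arrD(3) by blast
    fix Y h assume Y: "Y \<in> add_closure X ?T0" and "h \<in> hom X Y M"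
    then have "arr Y M h" using add_closure_ob Mob by (simp add: arr_def)
    then obtain u where "arr Y B u" "h = cmp X g u" using lift_along_deflation[OF c1(1) zero_N[OF Y]] by blast
    then show "\<exists>u\<in>hom X Y B. h = cmp X g u" using arrD(3) by blast
  qed (rule c1)
  have left: "left_approx X (add_closure X ?T0) M s B'" unfolding left_approx_def
  proof (intro conjI ballI)
    show "s \<in> hom X M B'" using st arrD(3) by blast
    fix Y h assume Y: "Y \<in> add_closure X ?T0" and "h \<in> hom X M Y"
    then have h: "arr M Y h" using add_closure_ob Mob by (simp add: arr_def)
    have "ext_zero X N Y" using ext_zero_sym[OF add_closure_ob[OF Y] N(1) zero_N[OF Y]] .
    then obtain u where "arr B' Y u" "h = cmp X u s" using extend_along_inflation[OF c2(1) _ h] by blast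
    then show "\<exists>u\<in>hom X B' Y. h = cmp X u s" using arrD(3) by blast
  qed (rule c2)
  have no_loop: "rad X M M \<subseteq> rad_sq X T M M"
  proof -
    obtain n where n: "quot_dim (scl X) (rad X M M) (rad_sq X T M M) n" using quiver(1) M unfolding finite_quiver_def by blast
    moreover have "arrows X T M M = 0" using quiver(2) M unfolding no_loops_or_2_cycles_def by blast
    ultimately show ?thesis using arrows_eq vs.quot_dim_0 by simp
  qed
  obtain I n where I: "quot_dim (scl X) (hom X M M) I n" "vs.subspace I"
    and fac: "\<forall>x\<in>I. \<exists>P f g. projective_in X (ob X) P \<and> f \<in> hom X M P \<and> g \<in> hom X P M \<and> x = cmp X g f"
    using finite_stable_end[OF Mob] by blast
  \<comment> \<open>A projective \<open>P\<close> has no extensions with \<open>N\<close>, so the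
    part \<open>P \<rightarrow> M\<close> of the factorization lifts along \<open>g\<close>.\<close>
  have I1: "\<exists>t\<in>hom X M B. x = cmp X g t" if x: "x \<in> I" for x
  proof -
    obtain P u v where P: "projective_in X (ob X) P" "u \<in> hom X M P" "v \<in> hom X P M" "x = cmp X v u" using fac x by blast
    have uv: "arr M P u" "arr P M v" using P Mob by (auto simp: projective_in_def arr_def)
    have "ext_zero X P N" using P N by (simp add: projective_in_def)
    then obtain w where w: "arr P B w" "v = cmp X g w" using lift_along_deflation[OF c1(1) _ uv(2)] by blast
    then have "x = cmp X g (cmp X w u)" using assoc[OF uv(1) w(1) g(2)] P by simp
    then show ?thesis using arrD(3)[OF arr_cmp[OF uv(1) w(1)]] by blast
  qed
  have I2: "\<exists>t\<in>hom X B' M. x = cmp X t s" if x: "x \<in> I" for x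
  proof -
    obtain P u v where P: "projective_in X (ob X) P" "u \<in> hom X M P" "v \<in> hom X P M" "x = cmp X v u" using fac x by blast
    have uv: "arr M P u" "arr P M v" using P Mob by (auto simp: projective_in_def arr_def)
    have "ext_zero X N P" using P N ext_zero_sym by (simp add: projective_in_def)
    then obtain w where w: "arr B' P w" "u = cmp X w s" using extend_along_inflation[OF c2(1) _ uv(1)] by blast
    then have "x = cmp X (cmp X v w) s" using assoc[OF st(1) w(1) uv(2)] P by simp
    then show ?thesis using arrD(3)[OF arr_cmp[OF w(1) uv(2)]] by blast
  qed
  have fin: "\<exists>n. quot_dim (scl X) (rad X A M) (rad_sq X T A M) n" "\<exists>n. quot_dim (scl X) (rad X M A) (rad_sq X T M A) n"
    if "A \<in> ?T0" for A using quiver(1) M that unfolding finite_quiver_def by blast+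
  note arr1 = right_approx_arrows[OF ic M(1) right c1(3) no_loop I I1]
  note arr2 = left_approx_arrows[OF ic M(1) left c2(3) no_loop I I2]
  show "arrows X T A M = card {j. j < length ys \<and> isomorphic X A (ys ! j)}"
    if ys: "sumlist X ys B" "set ys \<subseteq> ?T0" and A: "A \<in> ?T0" for ys A
    using arr1(2)[OF _ ys A] fin(1)[OF A] arrows_eq by blast
  show "arrows X T M A = card {j. j < length ys' \<and> isomorphic X A (ys' ! j)}"
    if ys: "sumlist X ys' B'" "set ys' \<subseteq> ?T0" and A: "A \<in> ?T0" for ys' A
    using arr2[OF _ ys A] fin(2)[OF A] arrows_eq by blast
  obtain ys where ys: "set ys \<subseteq> ?T0" "sumlist X ys B" using add_closure_sumlist[OF ic0 c1(2)] .
  show "nonsplit_cfl X N B M" unfolding nonsplit_cfl_def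
    using c1(1) arr1(3)[OF _ ys(2,1)] Mob arrD(1)[OF g(2)] by (auto simp: arr_def)
  show "nonsplit_cfl X M B' N" unfolding nonsplit_cfl_def
  proof (intro exI conjI notI)
    show "cfl X M s B' t N" by (rule c2)
    assume "\<exists>r\<in>hom X N B'. cmp X t r = idn X N"
    then obtain r where r: "arr N B' r" "cmp X t r = idn X N" using N(1) arrD(2)[OF st(1)] by (auto simp: arr_def)
    \<comment> \<open>A section would make \<open>N\<close> a summand of \<open>B'\<close>, hence a
      summand of \<open>T\<close> other than \<open>M\<close>.\<close>
    have "N \<in> ?T0" using add_closure_retract[OF ic0 _ c2(2) r(1) st(2) r(2)] N(2) indecomposable_local by blast
    then show False using exchange_not_mem[OF T R order.refl M(1)] by blast
  qed
  \<comment> \<open>As \<open>Ext(M,B)\<close> vanishes, \<delta> maps \<open>End(M)\<close> onto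
    \<open>Ext(M,N)\<close>, and its kernel consists of the maps through \<open>g\<close>, which
    have codimension one.\<close>
  have zMB: "ext_zero X M B" using ext_zero_sym[OF _ Mob zero_T[OF c1(2) M(1)]] add_closure_ob[OF c1(2)] by blast
  obtain \<delta> where \<delta>: "\<forall>h\<in>hom X M M. \<delta> h \<in> ext_cyc X M N"
        "\<forall>h\<in>hom X M M. \<forall>h'\<in>hom X M M. \<delta> (h + h') = \<delta> h + \<delta> h'"
        "\<forall>h\<in>hom X M M. \<forall>a. \<delta> (scl X a h) = scl X a (\<delta> h)"
        "\<forall>h\<in>hom X M M. \<delta> h \<in> ext_bd X M N \<longleftrightarrow> (\<exists>t\<in>hom X M B. h = cmp X g t)"
        "\<forall>e\<in>ext_cyc X M N. \<exists>h\<in>hom X M M. e - \<delta> h \<in> ext_bd X M N"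
    using connecting_map[OF c1(1) Mob] zMB by blast
  have q: "quot_dim (scl X) (hom X M M) {cmp X g t | t. t \<in> hom X M B} 1"
    using arr1(1)[OF _ ys(2,1)] by blast
  show "ext_dim_1 X M N" unfolding ext_dim_1_def
    by (rule vs.quot_dim_transfer[OF q subspace_hom[OF Mob Mob] subspace_ext_bd[OF Mob N(1)], of \<delta>])
      (use \<delta> in auto)
qed

end

section \<open>Algebraic independence and generated subfields\<close>

lemma eval_monom_superset:
  "finite A \<Longrightarrow> Poly_Mapping.keys e \<subseteq> A \<Longrightarrow> eval_monom e = (\<Prod>x\<in>A. x ^ Poly_Mapping.lookup e x)"
  unfolding eval_monom_def by (rule prod.mono_neutral_left) (auto simp: in_keys_iff)

lemma eval_monom_zero [simp]: "eval_monom 0 = 1"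
  by (simp add: eval_monom_def)

lemma eval_monom_add: "eval_monom (e + e') = eval_monom e * eval_monom e'"
proof -
  let ?A = "Poly_Mapping.keys e \<union> Poly_Mapping.keys e'"
  have "eval_monom (e + e') = (\<Prod>x\<in>?A. x ^ Poly_Mapping.lookup (e + e') x)"
    using Poly_Mapping.keys_add[of e e'] by (intro eval_monom_superset) auto
  also have "\<dots> = (\<Prod>x\<in>?A. x ^ Poly_Mapping.lookup e x) * (\<Prod>x\<in>?A. x ^ Poly_Mapping.lookup e' x)"
    by (simp add: lookup_add power_add prod.distrib)
  also have "\<dots> = eval_monom e * eval_monom e'" by (simp add: eval_monom_superset[of ?A])
  finally show ?thesis .
qed

lemma eval_monom_single: "eval_monom (Poly_Mapping.single x n) = x ^ n"
  by (simp add: eval_monom_superset[of "{x}"])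

lemma eval_mpoly_superset:
  "finite A \<Longrightarrow> Poly_Mapping.keys p \<subseteq> A \<Longrightarrow> eval_mpoly p = (\<Sum>e\<in>A. of_rat (Poly_Mapping.lookup p e) * eval_monom e)"
  unfolding eval_mpoly_def by (rule sum.mono_neutral_left) (auto simp: in_keys_iff)

lemma eval_mpoly_zero [simp]: "eval_mpoly 0 = 0"
  by (simp add: eval_mpoly_def)

lemma eval_mpoly_add: "eval_mpoly (p + q) = eval_mpoly p + eval_mpoly q"
proof -
  let ?A = "Poly_Mapping.keys p \<union> Poly_Mapping.keys q"
  have "eval_mpoly (p + q) = (\<Sum>e\<in>?A. of_rat (Poly_Mapping.lookup (p + q) e) * eval_monom e)"
    using Poly_Mapping.keys_add[of p q] by (intro eval_mpoly_superset) auto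
  then show ?thesis
    by (simp add: lookup_add of_rat_add distrib_right sum.distrib eval_mpoly_superset[of ?A])
qed

lemma eval_mpoly_single: "eval_mpoly (Poly_Mapping.single e c) = of_rat c * eval_monom e"
  by (simp add: eval_mpoly_superset[of "{e}"])

lemma eval_mpoly_sum: "eval_mpoly (\<Sum>i\<in>I. p i) = (\<Sum>i\<in>I. eval_mpoly (p i))"
  by (induction I rule: infinite_finite_induct) (auto simp: eval_mpoly_add)

lemma poly_mapping_eq_sum_single:
  "p = (\<Sum>e\<in>Poly_Mapping.keys p. Poly_Mapping.single e (Poly_Mapping.lookup p e))"
  by (rule poly_mapping_eqI) (simp add: lookup_sum lookup_single when_def in_keys_iff)

lemma eval_mpoly_mult: "eval_mpoly (p * q) = eval_mpoly p * eval_mpoly q"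
proof -
  have "p * q = (\<Sum>e\<in>Poly_Mapping.keys p. \<Sum>e'\<in>Poly_Mapping.keys q.
      Poly_Mapping.single (e + e') (Poly_Mapping.lookup p e * Poly_Mapping.lookup q e'))"
    by (subst poly_mapping_eq_sum_single[of p], subst poly_mapping_eq_sum_single[of q])
      (simp add: sum_product mult_single)
  then have "eval_mpoly (p * q) = (\<Sum>e\<in>Poly_Mapping.keys p. \<Sum>e'\<in>Poly_Mapping.keys q.
      (of_rat (Poly_Mapping.lookup p e) * eval_monom e) * (of_rat (Poly_Mapping.lookup q e') * eval_monom e'))"
    by (simp add: eval_mpoly_sum eval_mpoly_single eval_monom_add of_rat_mult mult_ac)
  then show ?thesis by (simp add: eval_mpoly_def sum_product)
qed

section \<open>Algebraic independence and transcendence\<close>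

definition mpolys_in :: "'f set \<Rightarrow> (('f::field_char_0 \<Rightarrow>\<^sub>0 nat) \<Rightarrow>\<^sub>0 rat) set" where
  "mpolys_in S = {p. \<forall>e\<in>Poly_Mapping.keys p. Poly_Mapping.keys e \<subseteq> S}"

lemma alg_independentD: "alg_independent S \<Longrightarrow> p \<in> mpolys_in S \<Longrightarrow> eval_mpoly p = 0 \<Longrightarrow> p = 0"
  by (auto simp: alg_independent_def mpolys_in_def)

lemma alg_independentI: "(\<And>p. p \<in> mpolys_in S \<Longrightarrow> eval_mpoly p = 0 \<Longrightarrow> p = 0) \<Longrightarrow> alg_independent S"
  by (auto simp: alg_independent_def mpolys_in_def)

lemma mpolys_in_mono: "S \<subseteq> S' \<Longrightarrow> mpolys_in S \<subseteq> mpolys_in S'"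
  by (auto simp: mpolys_in_def)

lemma alg_independent_subset: "alg_independent S' \<Longrightarrow> S \<subseteq> S' \<Longrightarrow> alg_independent S"
  using mpolys_in_mono[of S S'] by (intro alg_independentI) (blast intro: alg_independentD)

lemma mpolys_in_zero [simp]: "0 \<in> mpolys_in S"
  by (simp add: mpolys_in_def)

lemma mpolys_in_add: "p \<in> mpolys_in S \<Longrightarrow> q \<in> mpolys_in S \<Longrightarrow> p + q \<in> mpolys_in S"
  using Poly_Mapping.keys_add[of p q] by (auto simp: mpolys_in_def)

lemma mpolys_in_sum: "(\<And>i. i \<in> I \<Longrightarrow> p i \<in> mpolys_in S) \<Longrightarrow> (\<Sum>i\<in>I. p i) \<in> mpolys_in S"
  by (induction I rule: infinite_finite_induct) (auto intro: mpolys_in_add)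

lemma mpolys_in_mult: assumes "p \<in> mpolys_in S" "q \<in> mpolys_in S" shows "p * q \<in> mpolys_in S"
  unfolding mpolys_in_def
proof (intro CollectI ballI)
  fix e assume "e \<in> Poly_Mapping.keys (p * q)"
  then obtain a b where "a \<in> Poly_Mapping.keys p" "b \<in> Poly_Mapping.keys q" "e = a + b" using keys_mult by blast
  then show "Poly_Mapping.keys e \<subseteq> S" using assms Poly_Mapping.keys_add[of a b] unfolding mpolys_in_def by blast
qed

lemma mpolys_in_single: "Poly_Mapping.keys e \<subseteq> S \<Longrightarrow> Poly_Mapping.single e c \<in> mpolys_in S"
  by (auto simp: mpolys_in_def)

text \<open>This is the subring of the field generated by \<open>S\<close> and the rational
  numbers.\<close>

definition mpoly_values :: "'f set \<Rightarrow> 'f::field_char_0 set" where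
  "mpoly_values S = eval_mpoly ` mpolys_in S"

lemma mpoly_values_mult: "a \<in> mpoly_values S \<Longrightarrow> b \<in> mpoly_values S \<Longrightarrow> a * b \<in> mpoly_values S"
  unfolding mpoly_values_def by (elim imageE) (simp add: mpolys_in_mult flip: eval_mpoly_mult)

lemma mpoly_values_monom: "Poly_Mapping.keys e \<subseteq> S \<Longrightarrow> of_rat c * eval_monom e \<in> mpoly_values S"
  unfolding mpoly_values_def using mpolys_in_single eval_mpoly_single by (metis imageI)

lemma mpoly_values_one: "1 \<in> mpoly_values S"
  using mpoly_values_monom[of 0 S 1] by simp

lemma mpoly_values_neg: "x \<in> S \<Longrightarrow> - x \<in> mpoly_values S"
  using mpoly_values_monom[of "Poly_Mapping.single x 1" S "-1"] by (simp add: eval_monom_single)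

lemma mpoly_values_power: "a \<in> mpoly_values S \<Longrightarrow> a ^ n \<in> mpoly_values S"
  by (induction n) (auto intro: mpoly_values_one mpoly_values_mult)

text \<open>Transcendence over the field generated by \<open>S\<close>: coefficients from the
  polynomial ring suffice, as denominators can be cleared. Coefficient sequences stand for
  polynomials over that subring.\<close>

definition transcendental_over :: "'f::field_char_0 set \<Rightarrow> 'f \<Rightarrow> bool" where
  "transcendental_over S z \<longleftrightarrow>
     (\<forall>n c. (\<forall>i\<le>n. c i \<in> mpoly_values S) \<longrightarrow> (\<Sum>i\<le>n. c i * z ^ i) = 0 \<longrightarrow> (\<forall>i\<le>n. c i = 0))"

text \<open>Collect the coefficient polynomials into \<open>Q\<close>, the sum of \<open>P i\<close>
  times the \<open>i\<close>-th power of \<open>z\<close>. Since \<open>z\<close> occurs in no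
  \<open>P i\<close>, each coefficient of \<open>P i\<close> is read off from \<open>Q\<close> at a
  monomial with exponent \<open>i\<close> at \<open>z\<close>.\<close>

lemma alg_independent_insert_transcendental:
  fixes z :: "'f::field_char_0"
  assumes ind: "alg_independent (insert z S)" and z: "z \<notin> S"
  shows "transcendental_over S z"
  unfolding transcendental_over_def
proof (intro allI impI)
  fix n c i assume c: "\<forall>i\<le>n. c i \<in> mpoly_values S" and eq: "(\<Sum>i\<le>n. c i * z ^ i) = 0" and i: "i \<le> n"
  have "\<forall>i. \<exists>p. i \<le> n \<longrightarrow> p \<in> mpolys_in S \<and> c i = eval_mpoly p" using c unfolding mpoly_values_def by blast
  then obtain P where P: "\<And>i. i \<le> n \<Longrightarrow> P i \<in> mpolys_in S" "\<And>i. i \<le> n \<Longrightarrow> c i = eval_mpoly (P i)" by metis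
  define Q where "Q = (\<Sum>i\<le>n. P i * Poly_Mapping.single (Poly_Mapping.single z i) 1)"
  have "eval_mpoly Q = 0"
    using eq P(2) by (simp add: Q_def eval_mpoly_sum eval_mpoly_mult eval_mpoly_single eval_monom_single)
  moreover have "Q \<in> mpolys_in (insert z S)" unfolding Q_def
  proof (intro mpolys_in_sum mpolys_in_mult)
    fix j assume "j \<in> {..n}"
    then show "P j \<in> mpolys_in (insert z S)" using P(1) mpolys_in_mono[of S "insert z S"] by auto
    show "Poly_Mapping.single (Poly_Mapping.single z j) 1 \<in> mpolys_in (insert z S)"
      by (intro mpolys_in_single) auto
  qed
  ultimately have Q0: "Q = 0" using alg_independentD[OF ind] by blast
  have "Poly_Mapping.lookup (P i) e = 0" for e
  proof (cases "e \<in> Poly_Mapping.keys (P i)")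
    case True
    then have e: "Poly_Mapping.keys e \<subseteq> S" using P(1)[OF i] by (auto simp: mpolys_in_def)
    have ez: "Poly_Mapping.lookup e z = 0" using e z by (auto simp: in_keys_iff)
    have look: "Poly_Mapping.lookup (P j * Poly_Mapping.single (Poly_Mapping.single z j) 1) (e + Poly_Mapping.single z i)
        = (if j = i then Poly_Mapping.lookup (P i) e else 0)" if j: "j \<le> n" for j
    proof -
      have "P j * Poly_Mapping.single (Poly_Mapping.single z j) 1 =
          (\<Sum>d\<in>Poly_Mapping.keys (P j). Poly_Mapping.single (d + Poly_Mapping.single z j) (Poly_Mapping.lookup (P j) d))"
        by (subst poly_mapping_eq_sum_single[of "P j"]) (simp add: sum_distrib_right mult_single)
      then have "Poly_Mapping.lookup (P j * Poly_Mapping.single (Poly_Mapping.single z j) 1) (e + Poly_Mapping.single z i)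
        = (\<Sum>d\<in>Poly_Mapping.keys (P j). Poly_Mapping.lookup (P j) d when d + Poly_Mapping.single z j = e + Poly_Mapping.single z i)"
        by (simp add: lookup_sum lookup_single)
      also have "\<dots> = (\<Sum>d\<in>Poly_Mapping.keys (P j). if d = e then (if j = i then Poly_Mapping.lookup (P j) e else 0) else 0)"
      proof (rule sum.cong[OF refl])
        fix d assume "d \<in> Poly_Mapping.keys (P j)"
        then have "z \<notin> Poly_Mapping.keys d" using P(1)[OF j] z by (auto simp: mpolys_in_def)
        then have dz: "Poly_Mapping.lookup d z = 0" by (simp add: in_keys_iff)
        have "d + Poly_Mapping.single z j = e + Poly_Mapping.single z i \<longleftrightarrow> d = e \<and> j = i"
        proof
          assume eq: "d + Poly_Mapping.single z j = e + Poly_Mapping.single z i"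
          then have "Poly_Mapping.lookup (d + Poly_Mapping.single z j) z = Poly_Mapping.lookup (e + Poly_Mapping.single z i) z" by simp
          then have "j = i" using dz ez by (simp add: lookup_add)
          then show "d = e \<and> j = i" using eq by simp
        qed simp
        then show "(Poly_Mapping.lookup (P j) d when d + Poly_Mapping.single z j = e + Poly_Mapping.single z i) =
            (if d = e then (if j = i then Poly_Mapping.lookup (P j) e else 0) else 0)"
          by (auto simp: when_def)
      qed
      also have "\<dots> = (if j = i then Poly_Mapping.lookup (P i) e else 0)"
        by (auto simp: in_keys_iff)
      finally show ?thesis .
    qed
    have "Poly_Mapping.lookup Q (e + Poly_Mapping.single z i) =
        (\<Sum>j\<le>n. if j = i then Poly_Mapping.lookup (P i) e else 0)"
      unfolding Q_def lookup_sum using look by (intro sum.cong) auto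
    then show ?thesis using Q0 i by simp
  qed (simp add: in_keys_iff)
  then have "P i = 0" by (intro poly_mapping_eqI) simp
  then show "c i = 0" using P(2)[OF i] by simp
qed

text \<open>Sort the monomials of \<open>Q\<close> by their exponent at \<open>z\<close>. The
  coefficients \<open>P i\<close> are polynomials in \<open>S\<close>; their values vanish by
  transcendence, and they themselves by independence of \<open>S\<close>.\<close>

lemma alg_independent_insertI:
  fixes z :: "'f::field_char_0"
  assumes ind: "alg_independent S" and tr: "transcendental_over S z"
  shows "alg_independent (insert z S)"
proof (rule alg_independentI)
  fix Q :: "('f \<Rightarrow>\<^sub>0 nat) \<Rightarrow>\<^sub>0 rat" assume Q: "Q \<in> mpolys_in (insert z S)" and eq: "eval_mpoly Q = 0"
  define strip where "strip e = e - Poly_Mapping.single z (Poly_Mapping.lookup e z)" for e :: "'f \<Rightarrow>\<^sub>0 nat"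
  have strip: "e = strip e + Poly_Mapping.single z (Poly_Mapping.lookup e z)" for e :: "'f \<Rightarrow>\<^sub>0 nat"
    unfolding strip_def
    by (rule poly_mapping_eqI) (auto simp: lookup_add lookup_minus lookup_single when_def)
  have strip_keys: "Poly_Mapping.keys (strip e) \<subseteq> S" if "e \<in> Poly_Mapping.keys Q" for e
  proof
    fix x assume "x \<in> Poly_Mapping.keys (strip e)"
    then have "x \<noteq> z" "x \<in> Poly_Mapping.keys e"
      by (auto simp: strip_def in_keys_iff lookup_minus lookup_single when_def split: if_splits)
    then show "x \<in> S" using Q that unfolding mpolys_in_def by blast
  qed
  \<comment> \<open>Inserting 0 keeps the maximum meaningful when \<open>Q\<close> has no
    monomials.\<close>
  define n where "n = Max (insert 0 ((\<lambda>e. Poly_Mapping.lookup e z) ` Poly_Mapping.keys Q))"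
  have n: "Poly_Mapping.lookup e z \<le> n" if "e \<in> Poly_Mapping.keys Q" for e
    unfolding n_def using that by (intro Max_ge) auto
  define E where "E i = {e \<in> Poly_Mapping.keys Q. Poly_Mapping.lookup e z = i}" for i
  define P where "P i = (\<Sum>e\<in>E i. Poly_Mapping.single (strip e) (Poly_Mapping.lookup Q e))" for i
  have P: "P i \<in> mpolys_in S" for i unfolding P_def E_def
    using strip_keys by (intro mpolys_in_sum mpolys_in_single) auto
  have fin: "finite (E i)" for i by (simp add: E_def)
  have "eval_mpoly Q = (\<Sum>e\<in>Poly_Mapping.keys Q. of_rat (Poly_Mapping.lookup Q e) * eval_monom (strip e) * z ^ Poly_Mapping.lookup e z)"
    unfolding eval_mpoly_def
  proof (rule sum.cong[OF refl])
    fix e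
    show "of_rat (Poly_Mapping.lookup Q e) * eval_monom e =
      of_rat (Poly_Mapping.lookup Q e) * eval_monom (strip e) * z ^ Poly_Mapping.lookup e z"
      by (subst (2) strip) (simp add: eval_monom_add eval_monom_single)
  qed
  also have "\<dots> = (\<Sum>i\<le>n. \<Sum>e\<in>E i. of_rat (Poly_Mapping.lookup Q e) * eval_monom (strip e) * z ^ Poly_Mapping.lookup e z)"
    unfolding E_def by (rule sum.group[symmetric]) (use n in auto)
  also have "\<dots> = (\<Sum>i\<le>n. eval_mpoly (P i) * z ^ i)"
    by (intro sum.cong refl) (simp add: P_def eval_mpoly_sum eval_mpoly_single sum_distrib_right E_def)
  finally have s0: "(\<Sum>i\<le>n. eval_mpoly (P i) * z ^ i) = 0" using eq by simp
  have "\<forall>i\<le>n. eval_mpoly (P i) \<in> mpoly_values S" using P by (simp add: mpoly_values_def)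
  with tr[unfolded transcendental_over_def, THEN spec, THEN spec, of n "\<lambda>i. eval_mpoly (P i)"] s0
  have "\<forall>i\<le>n. eval_mpoly (P i) = 0" by blast
  then have P0: "P i = 0" if "i \<le> n" for i using alg_independentD[OF ind P] that by blast
  show "Q = 0"
  proof (rule poly_mapping_eqI)
    fix e
    show "Poly_Mapping.lookup Q e = Poly_Mapping.lookup 0 e"
    proof (cases "e \<in> Poly_Mapping.keys Q")
      case True
      let ?i = "Poly_Mapping.lookup e z"
      have "Poly_Mapping.lookup (P ?i) (strip e) = (\<Sum>d\<in>E ?i. Poly_Mapping.lookup Q d when strip d = strip e)"
        by (simp add: P_def lookup_sum lookup_single)
      also have "\<dots> = (\<Sum>d\<in>E ?i. if d = e then Poly_Mapping.lookup Q e else 0)"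
      proof (rule sum.cong[OF refl])
        fix d assume "d \<in> E ?i"
        then have "strip d = strip e \<longleftrightarrow> d = e" using strip[of d] strip[of e] by (auto simp: E_def)
        then show "(Poly_Mapping.lookup Q d when strip d = strip e) = (if d = e then Poly_Mapping.lookup Q e else 0)"
          by (simp add: when_def)
      qed
      also have "\<dots> = Poly_Mapping.lookup Q e" using True fin by (simp add: E_def)
      finally show ?thesis using P0[OF n[OF True]] by simp
    qed (simp add: in_keys_iff)
  qed
qed

lemma alg_independent_nonzero: assumes "alg_independent S" shows "0 \<notin> S"
proof
  assume "0 \<in> S"
  then have "Poly_Mapping.single (Poly_Mapping.single 0 1) 1 \<in> mpolys_in S" by (intro mpolys_in_single) auto
  moreover have "eval_mpoly (Poly_Mapping.single (Poly_Mapping.single (0::'a) 1) 1) = 0"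
    by (simp add: eval_mpoly_single eval_monom_single)
  ultimately have "Poly_Mapping.single (Poly_Mapping.single (0::'a) (1::nat)) (1::rat) = 0"
    using alg_independentD[OF assms] by blast
  then show False by (metis lookup_single_eq lookup_zero zero_neq_one)
qed

text \<open>A relation for \<open>q/z\<close> becomes one for \<open>z\<close> after multiplication
  by a power of \<open>z\<close>; this reverses the order of the coefficients and multiplies them by
  powers of the nonzero \<open>q\<close>.\<close>

lemma alg_independent_exchange:
  fixes z :: "'f::field_char_0"
  assumes ind: "alg_independent (insert z S)" and z: "z \<notin> S" and q: "q \<in> mpoly_values S" "q \<noteq> 0"
  shows "alg_independent (insert (inverse z * q) S)" "inverse z * q \<notin> S"
proof -
  let ?z = "inverse z * q"
  have z0: "z \<noteq> 0" using alg_independent_nonzero[OF ind] by auto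
  have tr: "transcendental_over S z" using alg_independent_insert_transcendental[OF ind z] .
  have tr': "transcendental_over S ?z" unfolding transcendental_over_def
  proof (intro allI impI)
    fix n c i assume c: "\<forall>i\<le>n. c i \<in> mpoly_values S" and eq: "(\<Sum>i\<le>n. c i * ?z ^ i) = 0" and i: "i \<le> n"
    define d where "d j = c (n - j) * q ^ (n - j)" for j
    have "(\<Sum>j\<le>n. d j * z ^ j) = (\<Sum>j\<le>n. d (n - j) * z ^ (n - j))"
      by (rule sum.reindex_bij_witness[of _ "\<lambda>j. n - j" "\<lambda>j. n - j"]) auto
    also have "\<dots> = (\<Sum>j\<le>n. z ^ n * (c j * ?z ^ j))"
    proof (rule sum.cong[OF refl])
      fix j assume "j \<in> {..n}"
      then have j: "j \<le> n" by simp
      have "z ^ n = z ^ (n - j) * z ^ j" using j by (simp flip: power_add)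
      then have "z ^ n * inverse z ^ j = z ^ (n - j)" using z0 by (simp add: power_inverse)
      then show "d (n - j) * z ^ (n - j) = z ^ n * (c j * ?z ^ j)"
        using j by (simp add: d_def power_mult_distrib mult_ac)
    qed
    also have "\<dots> = 0" using eq by (simp flip: sum_distrib_left)
    finally have s0: "(\<Sum>j\<le>n. d j * z ^ j) = 0" .
    have "\<forall>j\<le>n. d j \<in> mpoly_values S" unfolding d_def
      using c q by (auto intro!: mpoly_values_mult mpoly_values_power)
    with tr[unfolded transcendental_over_def, THEN spec, THEN spec, of n d] s0 have "\<forall>j\<le>n. d j = 0" by blast
    then have "d (n - i) = 0" by simp
    then show "c i = 0" using i q(2) by (simp add: d_def)
  qed
  show "alg_independent (insert ?z S)"
    using alg_independent_insertI[OF alg_independent_subset[OF ind] tr'] by blast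
  show "?z \<notin> S"
  proof
    assume zS: "?z \<in> S"
    \<comment> \<open>An element of \<open>S\<close> is a root of a monic linear polynomial over the
      ring generated by \<open>S\<close>, so it is not transcendental over \<open>S\<close>.\<close>
    define c where "c = (\<lambda>i::nat. if i = 0 then - ?z else 1)"
    have "\<forall>i\<le>1. c i \<in> mpoly_values S" using mpoly_values_neg[OF zS] mpoly_values_one by (auto simp: c_def)
    moreover have "(\<Sum>i\<le>1. c i * ?z ^ i) = 0" by (simp add: c_def)
    ultimately have "\<forall>i\<le>1. c i = 0" using tr'[unfolded transcendental_over_def, THEN spec, THEN spec, of 1 c] by blast
    then show False by (auto simp: c_def)
  qed
qed

text \<open>The two monomials may coincide, for instance when both products are empty; the
  coefficient is then 2 instead of 1, which is still nonzero in characteristic zero.\<close>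

lemma mpoly_values_exchange_polynomial:
  fixes S :: "'f::field_char_0 set"
  assumes ind: "alg_independent S" and A: "finite A" "A \<subseteq> S" and B: "finite B" "B \<subseteq> S"
  shows "(\<Prod>x\<in>A. x ^ f x) + (\<Prod>x\<in>B. x ^ h x) \<in> mpoly_values S"
    "(\<Prod>x\<in>A. x ^ f x) + (\<Prod>x\<in>B. x ^ h x) \<noteq> 0"
proof -
  have ex: "\<exists>e. Poly_Mapping.keys e \<subseteq> C \<and> eval_monom e = (\<Prod>x\<in>C. x ^ k x)" if "finite C" for C :: "'f set" and k
  proof -
    define e where "e = (\<Sum>x\<in>C. Poly_Mapping.single x (k x))"
    have l: "Poly_Mapping.lookup e x = (if x \<in> C then k x else 0)" for x
      using that by (simp add: e_def lookup_sum lookup_single when_def)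
    have "Poly_Mapping.keys e \<subseteq> C" using l by (auto simp: in_keys_iff split: if_splits)
    then show ?thesis using eval_monom_superset[OF that, of e] l by (intro exI[of _ e]) simp
  qed
  obtain e where e: "Poly_Mapping.keys e \<subseteq> A" "eval_monom e = (\<Prod>x\<in>A. x ^ f x)" using ex[OF A(1)] by blast
  obtain e' where e': "Poly_Mapping.keys e' \<subseteq> B" "eval_monom e' = (\<Prod>x\<in>B. x ^ h x)" using ex[OF B(1)] by blast
  let ?p = "Poly_Mapping.single e (1::rat) + Poly_Mapping.single e' 1"
  have p: "?p \<in> mpolys_in S" using e e' A B by (intro mpolys_in_add mpolys_in_single) auto
  have ev: "eval_mpoly ?p = (\<Prod>x\<in>A. x ^ f x) + (\<Prod>x\<in>B. x ^ h x)"
    using e e' by (simp add: eval_mpoly_add eval_mpoly_single)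
  show "(\<Prod>x\<in>A. x ^ f x) + (\<Prod>x\<in>B. x ^ h x) \<in> mpoly_values S" unfolding mpoly_values_def ev[symmetric] using p by (rule imageI)
  show "(\<Prod>x\<in>A. x ^ f x) + (\<Prod>x\<in>B. x ^ h x) \<noteq> 0"
  proof
    assume "(\<Prod>x\<in>A. x ^ f x) + (\<Prod>x\<in>B. x ^ h x) = 0"
    then have "?p = 0" using alg_independentD[OF ind p] ev by simp
    then have "Poly_Mapping.lookup ?p e = 0" by simp
    then show False by (simp add: lookup_add lookup_single when_def split: if_splits)
  qed
qed

section \<open>Generated subfields and transcendence bases\<close>

lemma is_subfield_hull: "is_subfield (is_subfield hull S)"
  by (rule hull_in) (auto simp: is_subfield_def)

lemma is_subring_hull: "is_subring (is_subring hull S)"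
  by (rule hull_in) (auto simp: is_subring_def)

lemma subfield_mult: "is_subfield K \<Longrightarrow> x \<in> K \<Longrightarrow> y \<in> K \<Longrightarrow> x * y \<in> K"
  and subfield_diff: "is_subfield K \<Longrightarrow> x \<in> K \<Longrightarrow> y \<in> K \<Longrightarrow> x - y \<in> K"
  and subfield_inverse: "is_subfield K \<Longrightarrow> x \<in> K \<Longrightarrow> inverse x \<in> K"
  and subfield_zero: "is_subfield K \<Longrightarrow> 0 \<in> K"
  and subfield_one: "is_subfield K \<Longrightarrow> 1 \<in> K"
  by (simp_all add: is_subfield_def)

lemma subfield_add: "is_subfield K \<Longrightarrow> x \<in> K \<Longrightarrow> y \<in> K \<Longrightarrow> x + y \<in> K"
  using subfield_diff[of K x "0 - y"] subfield_diff[of K 0 y] subfield_zero[of K] by simp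

lemma subfield_prod:
  assumes "is_subfield K" "\<And>x. x \<in> A \<Longrightarrow> x \<in> K" shows "(\<Prod>x\<in>A. x ^ f x) \<in> K"
proof -
  have pow: "x ^ n \<in> K" if "x \<in> K" for x n using assms(1) that by (induction n) (auto simp: is_subfield_def)
  show ?thesis using assms(2)
    by (induction A rule: infinite_finite_induct) (use assms(1) pow in \<open>auto simp: is_subfield_def\<close>)
qed

lemma subring_prod_list: "is_subring R \<Longrightarrow> set xs \<subseteq> R \<Longrightarrow> prod_list xs \<in> R"
  by (induction xs) (auto simp: is_subring_def)

text \<open>\<open>z\<close> is recovered as the quotient of the exchange polynomial by
  \<open>z'\<close>, so the field generated by the new set contains the one generated by the old
  set, and algebraic elements stay algebraic.\<close>

lemma transcendence_basis_exchange:
  fixes z :: "'f::field_char_0"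
  assumes tb: "transcendence_basis UNIV S" and z: "z \<in> S"
    and A: "finite A" "A \<subseteq> S - {z}" and B: "finite B" "B \<subseteq> S - {z}"
    and z': "z' = inverse z * ((\<Prod>x\<in>A. x ^ f x) + (\<Prod>x\<in>B. x ^ h x))"
  shows "transcendence_basis UNIV (insert z' (S - {z}))" "z' \<notin> S - {z}"
proof -
  let ?q = "(\<Prod>x\<in>A. x ^ f x) + (\<Prod>x\<in>B. x ^ h x)"
  have ins: "insert z (S - {z}) = S" using z by auto
  have ind: "alg_independent S" and alg: "\<And>x. algebraic_over (is_subfield hull S) x"
    using tb by (auto simp: transcendence_basis_def)
  have z0: "z \<noteq> 0" using alg_independent_nonzero[OF ind] z by auto
  note q = mpoly_values_exchange_polynomial[OF alg_independent_subset[OF ind] A B, of f h, OF Diff_subset]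
  note ex = alg_independent_exchange[of z "S - {z}" ?q, unfolded ins, OF ind _ q]
  show "z' \<notin> S - {z}" using ex(2) z' by auto
  let ?H = "is_subfield hull (insert z' (S - {z}))"
  have H: "is_subfield ?H" by (rule is_subfield_hull)
  have sub: "insert z' (S - {z}) \<subseteq> ?H" by (rule hull_subset)
  have "?q \<in> ?H" using sub A B by (intro subfield_add[OF H] subfield_prod[OF H]) auto
  moreover have "z' \<in> ?H" using sub by blast
  then have "inverse z' \<in> ?H" by (rule subfield_inverse[OF H])
  ultimately have "?q * inverse z' \<in> ?H" by (rule subfield_mult[OF H])
  moreover have "?q * inverse z' = z" using z' z0 q(2) by simp
  ultimately have "z \<in> ?H" by simp
  then have "S \<subseteq> ?H" using sub by auto
  then have "is_subfield hull S \<subseteq> ?H" using H by (intro hull_minimal)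
  then have "algebraic_over ?H x" for x using alg[of x] unfolding algebraic_over_def by blast
  then show "transcendence_basis UNIV (insert z' (S - {z}))"
    using ex(1) z' by (auto simp: transcendence_basis_def)
qed

text \<open>Terms in the field operations, countably many over countably many variables; their
  values exhaust a generated subfield. The aim is countability of the ambient field:
  \<open>rational_function_field\<close> numbers its variables by naturals, so a subset of a cluster
  has to be countable.\<close>

datatype 'a field_expr = Var 'a | Zero | One | Minus "'a field_expr" "'a field_expr"
  | Times "'a field_expr" "'a field_expr" | Inverse "'a field_expr"

instance field_expr :: (countable) countable
  by countable_datatype

primrec eval_expr :: "('a \<Rightarrow> 'f::field) \<Rightarrow> 'a field_expr \<Rightarrow> 'f" where
  "eval_expr v (Var a) = v a"
| "eval_expr v Zero = 0"
| "eval_expr v One = 1"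
| "eval_expr v (Minus s t) = eval_expr v s - eval_expr v t"
| "eval_expr v (Times s t) = eval_expr v s * eval_expr v t"
| "eval_expr v (Inverse s) = inverse (eval_expr v s)"

lemma countable_subfield_hull:
  fixes S :: "'f::field set" assumes "countable S" shows "countable (is_subfield hull S)"
proof -
  obtain v :: "nat \<Rightarrow> 'f" where v: "S \<subseteq> range v"
  proof (cases "S = {}")
    case True then show ?thesis using that by blast
  next
    case False
    then show ?thesis using that[of "from_nat_into S"] range_from_nat_into[OF False assms] by simp
  qed
  have "is_subfield (range (eval_expr v))" unfolding is_subfield_def
  proof (intro conjI ballI)
    show "0 \<in> range (eval_expr v)" using rangeI[of "eval_expr v" Zero] by simp
    show "1 \<in> range (eval_expr v)" using rangeI[of "eval_expr v" One] by simp
    fix x y assume "x \<in> range (eval_expr v)" "y \<in> range (eval_expr v)"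
    then obtain s t where st: "x = eval_expr v s" "y = eval_expr v t" by blast
    show "x - y \<in> range (eval_expr v)" using rangeI[of "eval_expr v" "Minus s t"] st by simp
    show "x * y \<in> range (eval_expr v)" using rangeI[of "eval_expr v" "Times s t"] st by simp
  next
    fix x assume "x \<in> range (eval_expr v)"
    then obtain s where s: "x = eval_expr v s" by blast
    show "inverse x \<in> range (eval_expr v)" using rangeI[of "eval_expr v" "Inverse s"] s by simp
  qed
  moreover have "S \<subseteq> range (eval_expr v)" 
  proof
    fix x assume "x \<in> S"
    then obtain i where "x = v i" using v by blast
    then show "x \<in> range (eval_expr v)" using rangeI[of "eval_expr v" "Var i"] by simp
  qed
  ultimately have "is_subfield hull S \<subseteq> range (eval_expr v)" by (intro hull_minimal)
  moreover have "countable (range (eval_expr v))" by simp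
  ultimately show ?thesis by (rule countable_subset)
qed

lemma rational_function_field_hull:
  fixes S :: "'f::field_char_0 set"
  assumes "countable S" "alg_independent S"
  shows "\<exists>m. rational_function_field (is_subfield hull S) m"
proof -
  \<comment> \<open>The number of variables is the cardinality of \<open>S\<close>, or infinity when
    all naturals are needed.\<close>
  obtain m and u :: "nat \<Rightarrow> 'f" where "bij_betw u {i. enat i < m} S"
  proof (cases "finite S")
    case True
    then obtain u where "bij_betw u {..<card S} S" using ex_bij_betw_nat_finite by (metis atLeast0LessThan)
    then show ?thesis using that[of u "enat (card S)"] by (simp add: lessThan_def)
  next
    case False
    then show ?thesis using that[of "from_nat_into S" \<infinity>] bij_betw_from_nat_into[OF assms(1)] by simp
  qed
  then show ?thesis unfolding rational_function_field_def using assms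
    by (intro exI[of _ m] exI[of _ u]) (auto simp: bij_betw_def)
qed

lemma rational_function_field_countable:
  "rational_function_field F m \<Longrightarrow> countable F"
  unfolding rational_function_field_def using countable_subfield_hull by (metis countable_image countableI_type)

lemma transcendence_basis_hull:
  "alg_independent S \<Longrightarrow> transcendence_basis (is_subfield hull S) S"
  unfolding transcendence_basis_def
proof (intro conjI ballI)
  fix x assume x: "x \<in> is_subfield hull S"
  have H: "is_subfield (is_subfield hull S)" by (rule is_subfield_hull)
  have "- x = 0 - x" by simp
  then have "- x \<in> is_subfield hull S" using subfield_diff[OF H subfield_zero[OF H] x] by simp
  then show "algebraic_over (is_subfield hull S) x" unfolding algebraic_over_def
    using subfield_zero[OF H] subfield_one[OF H]
    by (intro exI[of _ "[:- x, 1:]"]) (auto simp: coeff_pCons split: nat.split)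
qed (auto intro: hull_subset[THEN subsetD])

section \<open>Seeds of cluster tilting objects\<close>

lemma prod_list_count:
  fixes us :: "'f::comm_monoid_mult list"
  shows "finite A \<Longrightarrow> set us \<subseteq> A \<Longrightarrow> prod_list us = (\<Prod>x\<in>A. x ^ count_list us x)"
proof (induction us)
  case (Cons a us)
  have "(\<Prod>x\<in>A. x ^ count_list (a # us) x) = (\<Prod>x\<in>A. (if x = a then a else 1) * x ^ count_list us x)"
    by (rule prod.cong) auto
  also have "\<dots> = a * (\<Prod>x\<in>A. x ^ count_list us x)" using Cons.prems by (simp add: prod.distrib)
  finally show ?case using Cons by simp
qed simp

text \<open>The lists will hold the images of the summands of the two middle terms. As no value
  occurs in both, they are the positive and the negative part of the column, and the exchange
  polynomial is the sum of the two list products.\<close>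

lemma new_var_count:
  assumes ex: "\<And>x. exmat S x z = int (count_list us x) - int (count_list vs x)"
    and disj: "\<And>x. count_list us x = 0 \<or> count_list vs x = 0"
  shows "{x. exmat S x z > 0} = set us" "{x. exmat S x z < 0} = set vs"
    "new_var S z = inverse z * (prod_list us + prod_list vs)"
proof -
  have pos: "0 < count_list us x \<longleftrightarrow> x \<in> set us" "0 < count_list vs x \<longleftrightarrow> x \<in> set vs" for x
    using count_list_0_iff[of us x] count_list_0_iff[of vs x] by auto
  show 1: "{x. exmat S x z > 0} = set us"
  proof (intro set_eqI)
    fix x show "x \<in> {x. exmat S x z > 0} \<longleftrightarrow> x \<in> set us" using disj[of x] pos(1)[of x] by (auto simp: ex)
  qed
  show 2: "{x. exmat S x z < 0} = set vs"
  proof (intro set_eqI)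
    fix x show "x \<in> {x. exmat S x z < 0} \<longleftrightarrow> x \<in> set vs" using disj[of x] pos(2)[of x] by (auto simp: ex)
  qed
  have "(\<Prod>x\<in>set us. x ^ nat (exmat S x z)) = (\<Prod>x\<in>set us. x ^ count_list us x)"
  proof (rule prod.cong[OF refl])
    fix x assume "x \<in> set us"
    then show "x ^ nat (exmat S x z) = x ^ count_list us x" using disj[of x] pos(1)[of x] by (simp add: ex)
  qed
  moreover have "(\<Prod>x\<in>set vs. x ^ nat (- exmat S x z)) = (\<Prod>x\<in>set vs. x ^ count_list vs x)"
  proof (rule prod.cong[OF refl])
    fix x assume "x \<in> set vs"
    then show "x ^ nat (- exmat S x z) = x ^ count_list vs x" using disj[of x] pos(2)[of x] by (simp add: ex)
  qed
  ultimately show "new_var S z = inverse z * (prod_list us + prod_list vs)"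
    unfolding new_var_def 1 2 by (simp add: prod_list_count[of "set us" us] prod_list_count[of "set vs" vs])
qed

text \<open>The field of rational functions is the whole type \<open>'f\<close>, hence
  \<open>UNIV\<close>. The bound \<open>1 \<le> n\<close> enters in the form
  \<open>nonprojective\<close>, which provides a summand in every cluster tilting object.\<close>

locale cluster_category = extension_category X
  for X :: "('o, 'm::ab_group_add, 'k::alg_closed_field) ext_cat" +
  fixes \<phi> :: "'o \<Rightarrow> 'f::field_char_0" and \<Delta> :: "'o set set"
  assumes cluster_structure: "cluster_structure X (ob X)"
    and nonprojective: "\<And>T. cluster_tilting X (ob X) T \<Longrightarrow> \<exists>M\<in>T. \<not> projective_in X (ob X) M"
    and component: "ct_component X (ob X) \<Delta>"
    and cluster_map: "cluster_map X (ob X) \<Delta> \<phi> UNIV"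
begin

abbreviation "\<E> \<equiv> component_subcat X \<Delta>"

lemma weak: "weak_cluster_structure X (ob X)"
  using cluster_structure by (simp add: cluster_structure_def)

lemma ct_edge_sym: "ct_edge X S T T' \<Longrightarrow> ct_edge X S T' T"
  unfolding ct_edge_def by blast

text \<open>Edges are symmetric, so any vertex can serve as the base point of its component.\<close>

lemma component_eq:
  assumes D: "ct_component X S D" and T: "T \<in> D" shows "D = {T'. (ct_edge X S)\<^sup>*\<^sup>* T T'}"
proof -
  from D obtain T0 where D: "D = {T'. (ct_edge X S)\<^sup>*\<^sup>* T0 T'}" unfolding ct_component_def by blast
  have "symp (ct_edge X S)" by (rule sympI) (rule ct_edge_sym)
  then have "symp (ct_edge X S)\<^sup>*\<^sup>*" by (rule symp_rtranclp)
  then have "(ct_edge X S)\<^sup>*\<^sup>* T T0" using T D by (auto dest: sympD)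
  then show ?thesis using T D by (auto intro: rtranclp_trans)
qed

lemma component_ct: assumes D: "ct_component X S D" and T: "T \<in> D" shows "cluster_tilting X S T"
proof -
  from D obtain T0 where T0: "cluster_tilting X S T0" "D = {T'. (ct_edge X S)\<^sup>*\<^sup>* T0 T'}" unfolding ct_component_def by blast
  then have "(ct_edge X S)\<^sup>*\<^sup>* T0 T" using T by blast
  then show ?thesis using T0(1) by cases (auto simp: ct_edge_def)
qed

lemma component_step: "ct_component X S D \<Longrightarrow> T \<in> D \<Longrightarrow> ct_edge X S T T' \<Longrightarrow> T' \<in> D"
  using component_eq by (metis mem_Collect_eq r_into_rtranclp)

lemmas \<Delta>_ct = component_ct[OF component]

lemma \<Delta>_indec: "T \<in> \<Delta> \<Longrightarrow> indec_closed T"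
  using \<Delta>_ct cluster_tilting_indec by blast

lemma \<Delta>_ob: "T \<in> \<Delta> \<Longrightarrow> M \<in> T \<Longrightarrow> M \<in> ob X"
  using indec_closedD(2)[OF \<Delta>_indec] .

lemma indec_closed_Union: "(\<And>T. T \<in> D \<Longrightarrow> indec_closed T) \<Longrightarrow> indec_closed (\<Union>D)"
  unfolding indec_closed_def by blast

lemma \<E>_sumlist: "sumlist X ys C \<Longrightarrow> set ys \<subseteq> \<Union>\<Delta> \<Longrightarrow> C \<in> \<E>"
  unfolding component_subcat_def by (rule sumlist_add)

lemma \<E>_mem: "T \<in> \<Delta> \<Longrightarrow> M \<in> T \<Longrightarrow> M \<in> \<E>"
  unfolding component_subcat_def using add_closure_superset[of M "\<Union>\<Delta>"] \<Delta>_ob by blast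

lemma \<phi>_iso: "A \<in> \<E> \<Longrightarrow> B \<in> \<E> \<Longrightarrow> isomorphic X A B \<Longrightarrow> \<phi> A = \<phi> B"
  using cluster_map unfolding cluster_map_def Let_def by blast

lemma \<phi>_sum: "A \<in> \<E> \<Longrightarrow> B \<in> \<E> \<Longrightarrow> C \<in> \<E> \<Longrightarrow> biproduct X A B C \<Longrightarrow> \<phi> C = \<phi> A * \<phi> B"
  using cluster_map unfolding cluster_map_def Let_def by blast

lemma \<phi>_exchange:
  assumes "M \<in> \<E>" "N \<in> \<E>" "V \<in> \<E>" "V' \<in> \<E>" "indecomposable X M" "indecomposable X N" "ext_dim_1 X M N"
    "nonsplit_cfl X N V M" "nonsplit_cfl X M V' N"
  shows "\<phi> M * \<phi> N = \<phi> V + \<phi> V'"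
proof -
  have "\<forall>M\<in>\<E>. \<forall>N\<in>\<E>. \<forall>V\<in>\<E>. \<forall>V'\<in>\<E>.
           indecomposable X M \<and> indecomposable X N \<and> ext_dim_1 X M N \<and>
           nonsplit_cfl X N V M \<and> nonsplit_cfl X M V' N \<longrightarrow> \<phi> M * \<phi> N = \<phi> V + \<phi> V'"
    using cluster_map unfolding cluster_map_def Let_def by (elim conjE)
  then show ?thesis using assms by blast
qed

text \<open>\<open>cluster_map\<close> asks for this at one vertex of \<Delta> only;
  \<open>good_replace\<close> carries it along edges. Separation of isomorphism classes is what
  makes field elements usable as indices of summands.\<close>

definition good :: "'o set \<Rightarrow> bool" where
  "good T \<longleftrightarrow> T \<in> \<Delta> \<and> (\<forall>M\<in>T. \<forall>N\<in>T. \<phi> M = \<phi> N \<longrightarrow> isomorphic X M N) \<and> transcendence_basis UNIV (\<phi> ` T)"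

lemma good_ex: "\<exists>T. good T"
  using cluster_map unfolding cluster_map_def Let_def good_def by blast

lemma goodD:
  assumes "good T"
  shows "T \<in> \<Delta>" "cluster_tilting X (ob X) T" "indec_closed T" "transcendence_basis UNIV (\<phi> ` T)"
    "\<And>A B. A \<in> T \<Longrightarrow> B \<in> T \<Longrightarrow> \<phi> A = \<phi> B \<longleftrightarrow> isomorphic X A B"
proof -
  show T: "T \<in> \<Delta>" "transcendence_basis UNIV (\<phi> ` T)" using assms by (auto simp: good_def)
  show "cluster_tilting X (ob X) T" "indec_closed T" using T \<Delta>_ct \<Delta>_indec by auto
  show "\<phi> A = \<phi> B \<longleftrightarrow> isomorphic X A B" if "A \<in> T" "B \<in> T" for A B
    using assms that \<phi>_iso \<E>_mem[OF T(1)] unfolding good_def by blast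
qed

text \<open>\<open>M\<close> is also the direct sum of \<open>M\<close> and \<open>Z\<close>, so
  multiplicativity gives \<open>\<phi> M = \<phi> M * \<phi> Z\<close>, and \<open>\<phi> M\<close>
  is nonzero as a member of an independent set.\<close>

lemma \<phi>_zero: assumes "is_zero X Z" shows "\<phi> Z = 1"
proof -
  obtain T where T: "good T" using good_ex by blast
  note g = goodD[OF T]
  obtain M where M: "M \<in> T" using nonprojective[OF g(2)] by blast
  have "alg_independent (\<phi> ` T)" using g(4) by (simp add: transcendence_basis_def)
  then have nz: "\<phi> M \<noteq> 0" using alg_independent_nonzero M by (metis image_eqI)
  have "Z \<in> \<E>" using \<E>_sumlist[OF sumlist.Nil[OF assms]] by simp
  moreover have "biproduct X M Z M" using biproduct_zero_right \<Delta>_ob[OF g(1) M] assms by blast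
  ultimately have "\<phi> M = \<phi> M * \<phi> Z" using \<phi>_sum \<E>_mem[OF g(1) M] by blast
  then show ?thesis using nz by simp
qed

lemma \<phi>_sumlist: "sumlist X ys C \<Longrightarrow> set ys \<subseteq> \<Union>\<Delta> \<Longrightarrow> \<phi> C = prod_list (map \<phi> ys)"
proof (induction rule: sumlist.induct)
  case (Nil Z) then show ?case by (simp add: \<phi>_zero)
next
  case (Cons ys C' y C)
  have "C \<in> \<E>" using \<E>_sumlist[OF sumlist.Cons[OF Cons.hyps]] Cons.prems by simp
  moreover have "C' \<in> \<E>" using \<E>_sumlist[OF Cons.hyps(1)] Cons.prems by simp
  moreover have "y \<in> \<E>" using \<E>_mem Cons.prems by auto
  ultimately show ?case using \<phi>_sum Cons by simp
qed

text \<open>The seed of \<open>T'\<close> in the subcategory \<open>S\<close>, with the projectives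
  of \<open>S\<close> as coefficients, but with entries taken from the quiver of the larger
  \<open>T\<close> in \<open>X\<close>: if \<open>S\<close> carries only a weak cluster structure,
  its own quivers are not known to mutate. For \<open>S = ob X\<close> and \<open>T' = T\<close> it
  is the ordinary seed.\<close>

definition subseed :: "'o set \<Rightarrow> 'o set \<Rightarrow> 'o set \<Rightarrow> 'f seed" where
  "subseed S T' T =
     (let cl = \<phi> ` {M\<in>T'. \<not> projective_in X S M}; co = \<phi> ` {M\<in>T'. projective_in X S M}
      in \<lparr>cluster = cl, coeffs = co,
          exmat = (\<lambda>x y. if x \<in> cl \<union> co \<and> y \<in> cl then exmat (seed_of X (ob X) \<phi> T) x y else 0)\<rparr>)"

lemma seed_of_eq_subseed: "seed_of X (ob X) \<phi> T = subseed (ob X) T T"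
  unfolding subseed_def Let_def by (simp add: seed_of_def Let_def fun_eq_iff)

lemma nonprojective_sub: "S \<subseteq> ob X \<Longrightarrow> M \<in> S \<Longrightarrow> \<not> projective_in X S M \<Longrightarrow> \<not> projective_in X (ob X) M"
  unfolding projective_in_def by blast

lemma quiver_matrix_iso:
  assumes "isomorphic X A A'" "isomorphic X B B'"
  shows "quiver_matrix X (ob X) T A B = quiver_matrix X (ob X) T A' B'"
proof -
  have ob: "A \<in> ob X" "A' \<in> ob X" "B \<in> ob X" "B' \<in> ob X" using assms by (auto simp: isomorphic_def)
  show ?thesis unfolding quiver_matrix_def
    using projective_iso[OF assms(1) ob(1,2) order.refl] projective_iso[OF assms(2) ob(3,4) order.refl]
      arrows_iso[OF assms, of T] arrows_iso[OF assms(2,1), of T] by simp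
qed

text \<open>\<phi> separates isomorphism classes on a good \<open>T\<close>, so whatever summand
  \<open>seed_of\<close> chooses for an index is isomorphic to the intended one.\<close>

lemma exmat_seed_of:
  assumes T: "good T" and A: "A \<in> T" and B: "B \<in> T" "\<not> projective_in X (ob X) B"
  shows "exmat (seed_of X (ob X) \<phi> T) (\<phi> A) (\<phi> B) = quiver_matrix X (ob X) T A B"
proof -
  have some: "isomorphic X (SOME M. M \<in> T \<and> \<phi> M = \<phi> C) C" if "C \<in> T" for C
  proof -
    have "(SOME M. M \<in> T \<and> \<phi> M = \<phi> C) \<in> T \<and> \<phi> (SOME M. M \<in> T \<and> \<phi> M = \<phi> C) = \<phi> C"
      by (rule someI[of _ C]) (use that in blast)
    then show ?thesis using goodD(5)[OF T] that by blast
  qed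
  have "\<phi> A \<in> \<phi> ` {M \<in> T. \<not> projective_in X (ob X) M} \<union> \<phi> ` {M \<in> T. projective_in X (ob X) M}"
    using A by blast
  moreover have "\<phi> B \<in> \<phi> ` {M \<in> T. \<not> projective_in X (ob X) M}" using B by blast
  ultimately have "exmat (seed_of X (ob X) \<phi> T) (\<phi> A) (\<phi> B) =
      quiver_matrix X (ob X) T (SOME M. M \<in> T \<and> \<phi> M = \<phi> A) (SOME M. M \<in> T \<and> \<phi> M = \<phi> B)"
    by (simp add: seed_of_def Let_def)
  then show ?thesis using quiver_matrix_iso[OF some[OF A] some[OF B(1)]] by simp
qed

lemma exmat_seed_of_outside:
  "x \<notin> \<phi> ` T \<Longrightarrow> exmat (seed_of X (ob X) \<phi> T) x y = 0"
  by (auto simp: seed_of_def Let_def)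

text \<open>Arrows count list positions up to isomorphism, exchange polynomials count equal field
  elements; the two agree because \<phi> separates classes.\<close>

lemma card_iso_count:
  assumes T: "good T" and A: "A \<in> T" and ys: "set ys \<subseteq> T"
  shows "card {j. j < length ys \<and> isomorphic X A (ys ! j)} = count_list (map \<phi> ys) (\<phi> A)"
proof -
  have "count_list (map \<phi> ys) (\<phi> A) = length (filter (\<lambda>x. \<phi> A = x) (map \<phi> ys))" by (simp add: count_list_eq_length_filter)
  also have "\<dots> = card {j. j < length ys \<and> \<phi> A = map \<phi> ys ! j}" by (simp add: length_filter_conv_card)
  also have "{j. j < length ys \<and> \<phi> A = map \<phi> ys ! j} = {j. j < length ys \<and> isomorphic X A (ys ! j)}"
  proof (rule Collect_cong, rule conj_cong[OF refl])
    fix j assume j: "j < length ys"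
    then have "ys ! j \<in> T" using ys nth_mem by blast
    then show "\<phi> A = map \<phi> ys ! j \<longleftrightarrow> isomorphic X A (ys ! j)"
      using goodD(5)[OF T A] j by simp
  qed
  finally show ?thesis by simp
qed

lemma exchange_\<Delta>:
  "T \<in> \<Delta> \<Longrightarrow> exchangeable X (ob X) T M N \<Longrightarrow> replace X T M N \<in> \<Delta>"
  using component_step[OF component] exchange_ct_edge by blast

text \<open>\<open>U\<close> is a set of summands whose additive closure contains the middle terms
  of the exchange: all of \<open>T\<close> except \<open>M\<close>, or only those that belong to a
  subcategory. The column of \<open>\<phi> M\<close> is then supported on the image of
  \<open>U\<close>.\<close>

lemma exchange_columns:
  assumes T: "good T" and ex: "exchangeable X (ob X) T M N"
    and U: "U \<subseteq> T - iso_class X M" "indec_closed U"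
    and seq: "exchange_sequence X (add_closure X U) N M" "exchange_sequence X (add_closure X U) M N"
  shows "\<exists>ys ys'. set ys \<subseteq> U \<and> set ys' \<subseteq> U \<and>
    \<phi> M * \<phi> N = prod_list (map \<phi> ys) + prod_list (map \<phi> ys') \<and>
    (\<forall>x. exmat (seed_of X (ob X) \<phi> T) x (\<phi> M) = int (count_list (map \<phi> ys) x) - int (count_list (map \<phi> ys') x)) \<and>
    (\<forall>x. count_list (map \<phi> ys) x = 0 \<or> count_list (map \<phi> ys') x = 0)"
proof -
  note g = goodD[OF T]
  have M: "M \<in> T" "\<not> projective_in X (ob X) M" and R: "cluster_tilting X (ob X) (replace X T M N)"
    and N: "N \<in> ob X" "indecomposable X N" using ex unfolding exchangeable_def by blast+
  have quiver: "finite_quiver X (ob X) T" "no_loops_or_2_cycles X (ob X) T"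
    using cluster_structure g(2) unfolding cluster_structure_def by blast+
  have sub: "add_closure X U \<subseteq> add_closure X (T - iso_class X M)" using add_closure_mono[OF U(1)] .
  obtain f B h where c1: "cfl X N f B h M" "B \<in> add_closure X U" "right_minimal X B h"
    using seq(1) unfolding exchange_sequence_def right_approx_def by blast
  obtain s B' t where c2: "cfl X M s B' t N" "B' \<in> add_closure X U" "left_minimal X s B'"
    using seq(2) unfolding exchange_sequence_def left_approx_def by blast
  obtain ys where ys: "set ys \<subseteq> U" "sumlist X ys B" using add_closure_sumlist[OF U(2) c1(2)] .
  obtain ys' where ys': "set ys' \<subseteq> U" "sumlist X ys' B'" using add_closure_sumlist[OF U(2) c2(2)] .
  note ea = exchange_arrows[OF g(2) M R N quiver c1(1) subsetD[OF sub c1(2)] c1(3) c2(1) subsetD[OF sub c2(2)] c2(3)]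
  have yT: "set ys \<subseteq> T" "set ys' \<subseteq> T" using ys ys' U by blast+
  have NR: "N \<in> replace X T M N" using isomorphic_refl[OF N(1)] by (simp add: replace_def iso_class_def)
  have "N \<in> \<E>" using \<E>_mem[OF exchange_\<Delta>[OF g(1) ex] NR] .
  moreover have "B \<in> \<E>" "B' \<in> \<E>" using \<E>_sumlist ys ys' yT g(1) by blast+
  ultimately have rel: "\<phi> M * \<phi> N = \<phi> B + \<phi> B'"
    using \<phi>_exchange[of M N B B'] ea(1-3) N(2) M(1) \<E>_mem[OF g(1) M(1)] indec_closedD(1)[OF g(3) M(1)] indecomposable_local
    by blast
  have "\<phi> B = prod_list (map \<phi> ys)" "\<phi> B' = prod_list (map \<phi> ys')" using \<phi>_sumlist ys ys' yT g(1) by blast+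
  then have 1: "\<phi> M * \<phi> N = prod_list (map \<phi> ys) + prod_list (map \<phi> ys')" using rel by simp
  have cnt: "exmat (seed_of X (ob X) \<phi> T) (\<phi> A) (\<phi> M) = int (count_list (map \<phi> ys) (\<phi> A)) - int (count_list (map \<phi> ys') (\<phi> A)) \<and>
      (count_list (map \<phi> ys) (\<phi> A) = 0 \<or> count_list (map \<phi> ys') (\<phi> A) = 0)" if A: "A \<in> T" for A
  proof (cases "A \<in> iso_class X M")
    case True
    then have iso: "isomorphic X A M" using isomorphic_sym by (simp add: iso_class_def)
    have "\<phi> A \<notin> \<phi> ` set ys" "\<phi> A \<notin> \<phi> ` set ys'"
    proof -
      have "\<not> isomorphic X A y" if "y \<in> U" for y
        using that U(1) True isomorphic_trans unfolding iso_class_def by blast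
      then show "\<phi> A \<notin> \<phi> ` set ys" "\<phi> A \<notin> \<phi> ` set ys'" using g(5)[OF A] ys(1) ys'(1) yT by blast+
    qed
    then have "count_list (map \<phi> ys) (\<phi> A) = 0" "count_list (map \<phi> ys') (\<phi> A) = 0" by (simp_all add: count_list_0_iff)
    moreover have "exmat (seed_of X (ob X) \<phi> T) (\<phi> A) (\<phi> M) = 0"
      using exmat_seed_of[OF T A M] quiver_matrix_iso[OF iso isomorphic_refl] \<Delta>_ob[OF g(1) M(1)]
      by (simp add: quiver_matrix_def)
    ultimately show ?thesis by simp
  next
    case False
    then have A0: "A \<in> T - iso_class X M" using A by blast
    have sub0: "set ys \<subseteq> T - iso_class X M" "set ys' \<subseteq> T - iso_class X M" using ys(1) ys'(1) U(1) by blast+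
    have a: "arrows X T A M = count_list (map \<phi> ys) (\<phi> A)" "arrows X T M A = count_list (map \<phi> ys') (\<phi> A)"
      unfolding ea(4)[OF ys(2) sub0(1) A0] ea(5)[OF ys'(2) sub0(2) A0]
      using card_iso_count[OF T A yT(1)] card_iso_count[OF T A yT(2)] .
    moreover have "arrows X T A M = 0 \<or> arrows X T M A = 0"
      using quiver(2)[unfolded no_loops_or_2_cycles_def, THEN conjunct2, THEN bspec, OF A, THEN bspec, OF M(1)] M(2) by simp
    ultimately show ?thesis using exmat_seed_of[OF T A M] M(2) by (simp add: quiver_matrix_def)
  qed
  have out: "count_list (map \<phi> ys) x = 0 \<and> count_list (map \<phi> ys') x = 0" if "x \<notin> \<phi> ` T" for x
    using that yT by (auto simp: count_list_0_iff)
  have 2: "exmat (seed_of X (ob X) \<phi> T) x (\<phi> M) = int (count_list (map \<phi> ys) x) - int (count_list (map \<phi> ys') x)" for x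
  proof (cases "x \<in> \<phi> ` T")
    case True
    then obtain A where "A \<in> T" "x = \<phi> A" by blast
    then show ?thesis using cnt[of A] by simp
  qed (simp add: out exmat_seed_of_outside)
  have 3: "count_list (map \<phi> ys) x = 0 \<or> count_list (map \<phi> ys') x = 0" for x
  proof (cases "x \<in> \<phi> ` T")
    case True
    then obtain A where "A \<in> T" "x = \<phi> A" by blast
    then show ?thesis using cnt[of A] by simp
  qed (simp add: out)
  show ?thesis using ys(1) ys'(1) 1 2 3 by blast
qed

lemma exchange_sequences:
  assumes "weak_cluster_structure X S" "exchangeable X S T M N"
  shows "exchange_sequence X (add_closure X (T - iso_class X M)) N M"
    "exchange_sequence X (add_closure X (T - iso_class X M)) M N"
  using assms unfolding weak_cluster_structure_def exchangeable_def by blast+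

text \<open>The exchange relation writes \<open>\<phi> N\<close> as a polynomial in the other
  variables divided by \<open>\<phi> M\<close>. Replacing \<open>\<phi> M\<close> by it keeps a
  transcendence basis, and the new element differs from all remaining ones.\<close>

lemma good_replace:
  assumes T: "good T" and ex: "exchangeable X (ob X) T M N"
  shows "good (replace X T M N)" "\<phi> N \<notin> \<phi> ` (T - iso_class X M)"
proof -
  note g = goodD[OF T]
  let ?T0 = "T - iso_class X M"
  have M: "M \<in> T" "\<not> projective_in X (ob X) M" and N: "N \<in> ob X" using ex unfolding exchangeable_def by blast+
  obtain ys ys' where ys: "set ys \<subseteq> ?T0" "set ys' \<subseteq> ?T0"
    "\<phi> M * \<phi> N = prod_list (map \<phi> ys) + prod_list (map \<phi> ys')"
    using exchange_columns[OF T ex order.refl indec_closed_diff[OF g(3)] exchange_sequences[OF weak ex]] by blast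
  have "\<phi> A = \<phi> M \<longleftrightarrow> A \<in> iso_class X M" if "A \<in> T" for A
    using g(5)[OF M(1) that] by (auto simp: iso_class_def)
  then have T0: "\<phi> ` ?T0 = \<phi> ` T - {\<phi> M}" by auto
  have nz: "\<phi> M \<noteq> 0" using alg_independent_nonzero g(4) M(1) unfolding transcendence_basis_def by (metis image_eqI)
  have "\<phi> N = inverse (\<phi> M) * (prod_list (map \<phi> ys) + prod_list (map \<phi> ys'))" using ys(3) nz by (simp add: field_simps)
  then have eq: "\<phi> N = inverse (\<phi> M) * ((\<Prod>x\<in>set (map \<phi> ys). x ^ count_list (map \<phi> ys) x) +
      (\<Prod>x\<in>set (map \<phi> ys'). x ^ count_list (map \<phi> ys') x))"
    by (simp only: prod_list_count[OF finite_set order.refl, symmetric])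
  have sub: "set (map \<phi> ys) \<subseteq> \<phi> ` T - {\<phi> M}" "set (map \<phi> ys') \<subseteq> \<phi> ` T - {\<phi> M}"
    using ys(1,2) unfolding T0[symmetric] by auto
  note tb = transcendence_basis_exchange[OF g(4) imageI[OF M(1)] finite_set sub(1) finite_set sub(2) eq]
  show nN: "\<phi> N \<notin> \<phi> ` ?T0" using tb(2) T0 by simp
  let ?R = "replace X T M N"
  have R: "?R \<in> \<Delta>" using exchange_\<Delta>[OF g(1) ex] .
  have NR: "N \<in> ?R" using isomorphic_refl[OF N] by (simp add: replace_def iso_class_def)
  have \<phi>N: "\<phi> A = \<phi> N" if "A \<in> iso_class X N" for A
  proof -
    have "A \<in> ?R" using that by (simp add: replace_def)
    then show ?thesis using \<phi>_iso[OF \<E>_mem[OF R] \<E>_mem[OF R NR]] that isomorphic_sym by (auto simp: iso_class_def)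
  qed
  have "N \<in> iso_class X N" using isomorphic_refl[OF N] by (simp add: iso_class_def)
  then have "\<phi> ` iso_class X N = {\<phi> N}" using \<phi>N by blast
  then have "\<phi> ` ?R = insert (\<phi> N) (\<phi> ` T - {\<phi> M})" by (simp add: replace_def image_Un T0)
  then have "transcendence_basis UNIV (\<phi> ` ?R)" using tb(1) by simp
  moreover have "isomorphic X A B" if A: "A \<in> ?R" and B: "B \<in> ?R" and AB: "\<phi> A = \<phi> B" for A B
  proof (cases "A \<in> ?T0")
    case True
    then have "\<phi> A \<noteq> \<phi> N" using nN by (metis imageI)
    then have "B \<notin> iso_class X N" using \<phi>N[of B] AB by auto
    then have "B \<in> T" using B by (simp add: replace_def)
    then show ?thesis using g(5) AB True by blast
  next
    case False
    then have AN: "A \<in> iso_class X N" using A by (auto simp: replace_def)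
    then have "\<phi> B = \<phi> N" using \<phi>N AB by simp
    then have "B \<notin> ?T0" using nN by (metis imageI)
    then have "B \<in> iso_class X N" using B by (auto simp: replace_def)
    then show ?thesis using AN isomorphic_sym isomorphic_trans unfolding iso_class_def by blast
  qed
  ultimately show "good ?R" using R unfolding good_def by blast
qed

text \<open>If \<open>Ext(M,N)\<close> were zero, the identity of \<open>M\<close> would lift along
  \<open>B \<rightarrow> M\<close>, and \<open>M\<close> would be a summand of the middle term
  \<open>B\<close>, which avoids it. A projective \<open>N\<close> is excluded by the symmetry of
  vanishing.\<close>

lemma exchange_nonprojective:
  assumes e: "exchangeable X S T M N" and w: "weak_cluster_structure X S" and S: "S \<subseteq> ob X"
  shows "\<not> ext_zero X M N" "\<not> projective_in X S N"
proof -
  have M: "M \<in> T" and T: "cluster_tilting X S T" and N: "N \<in> S" using e unfolding exchangeable_def by blast+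
  have MS: "M \<in> S" using T M unfolding cluster_tilting_def by blast
  note ic = cluster_tilting_indec[OF T]
  note ic0 = indec_closed_diff[OF ic, of M]
  have Mob: "M \<in> ob X" using indec_closedD(2)[OF ic M] .
  show nz: "\<not> ext_zero X M N"
  proof
    assume z: "ext_zero X M N"
    obtain f B g where c: "cfl X N f B g M" "B \<in> add_closure X (T - iso_class X M)"
      using exchange_sequences(1)[OF w e] unfolding exchange_sequence_def right_approx_def by blast
    obtain s where s: "arr M B s" "idn X M = cmp X g s" using lift_along_deflation[OF c(1) z arr_id[OF Mob]] .
    have "M \<in> T - iso_class X M"
      using add_closure_retract[OF ic0 indec_closedD(1)[OF ic M] c(2) s(1) cfl_arr(2)[OF c(1)]] s(2) by simp
    then show False using isomorphic_refl[OF Mob] by (simp add: iso_class_def)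
  qed
  show "\<not> projective_in X S N" using nz ext_zero_sym[of N M] MS N Mob S unfolding projective_in_def by blast
qed

text \<open>The exchange happens in \<open>S\<close> and in \<open>X\<close> at once. Passing to the
  rows and columns of \<open>T'\<close> commutes with matrix mutation entry by entry, so the
  mutation rule in \<open>X\<close> suffices. For the new variable it matters that the column of
  \<open>\<phi> M\<close> has no entries outside the image of \<open>T'\<close>: otherwise the
  restricted exchange polynomial would lose factors.\<close>

lemma mutate_subseed:
  assumes T: "good T" and S: "S \<subseteq> ob X" and w: "weak_cluster_structure X S"
    and T': "T' \<subseteq> T" and ex: "exchangeable X (ob X) T M N" and ex': "exchangeable X S T' M N"
  shows "mutate (subseed S T' T) (\<phi> M) = subseed S (replace X T' M N) (replace X T M N)"
proof -
  note g = goodD[OF T]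
  let ?R = "replace X T M N" and ?R' = "replace X T' M N"
  note gR = goodD[OF good_replace(1)[OF T ex]]
  have M: "M \<in> T'" "\<not> projective_in X S M" and ct': "cluster_tilting X S T'" "cluster_tilting X S ?R'"
    and N: "N \<in> S" "N \<in> ob X" using ex ex' unfolding exchangeable_def by blast+
  have T'S: "T' \<subseteq> S" "?R' \<subseteq> S" using ct' unfolding cluster_tilting_def by blast+
  note ic' = cluster_tilting_indec[OF ct'(1)]
  have Mob: "M \<in> ob X" using indec_closedD(2)[OF ic' M(1)] .
  have MT: "M \<in> T" using M T' by blast
  have R'R: "?R' \<subseteq> ?R" using T' unfolding replace_def by blast
  have NR': "N \<in> ?R'" using isomorphic_refl[OF N(2)] by (simp add: replace_def iso_class_def)
  let ?z = "\<phi> M" and ?z' = "\<phi> N"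
  let ?cl = "\<phi> ` {M\<in>T'. \<not> projective_in X S M}" and ?co = "\<phi> ` {M\<in>T'. projective_in X S M}"
  let ?cl' = "\<phi> ` {M\<in>?R'. \<not> projective_in X S M}" and ?co' = "\<phi> ` {M\<in>?R'. projective_in X S M}"
  have ss: "cluster (subseed S T' T) = ?cl" "coeffs (subseed S T' T) = ?co"
     "cluster (subseed S ?R' ?R) = ?cl'" "coeffs (subseed S ?R' ?R) = ?co'"
    by (simp_all add: subseed_def Let_def)
  have exm: "exmat (subseed S T' T) (\<phi> A) (\<phi> B) = quiver_matrix X (ob X) T A B"
    if "A \<in> T'" "B \<in> T'" "\<not> projective_in X S B" for A B
    using that exmat_seed_of[OF T, of A B] T' nonprojective_sub[OF S, of B] T'S by (auto simp: subseed_def Let_def)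
  have exmR: "exmat (subseed S ?R' ?R) (\<phi> A) (\<phi> B) = quiver_matrix X (ob X) ?R A B"
    if "A \<in> ?R'" "B \<in> ?R'" "\<not> projective_in X S B" for A B
    using that exmat_seed_of[OF good_replace(1)[OF T ex], of A B] R'R nonprojective_sub[OF S, of B] T'S
    by (auto simp: subseed_def Let_def)
  obtain ys ys' where ys: "set ys \<subseteq> T' - iso_class X M" "set ys' \<subseteq> T' - iso_class X M"
    "\<phi> M * \<phi> N = prod_list (map \<phi> ys) + prod_list (map \<phi> ys')"
    "\<forall>x. exmat (seed_of X (ob X) \<phi> T) x (\<phi> M) = int (count_list (map \<phi> ys) x) - int (count_list (map \<phi> ys') x)"
    "\<forall>x. count_list (map \<phi> ys) x = 0 \<or> count_list (map \<phi> ys') x = 0"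
    using exchange_columns[OF T ex _ indec_closed_diff[OF ic'] exchange_sequences[OF w ex']] T' by blast
  \<comment> \<open>Restriction loses nothing in this column, because both middle terms have their
    summands in \<open>T'\<close>.\<close>
  have col: "exmat (subseed S T' T) x ?z = int (count_list (map \<phi> ys) x) - int (count_list (map \<phi> ys') x)" for x
  proof (cases "x \<in> \<phi> ` T'")
    case True
    then have "x \<in> ?cl \<union> ?co" by blast
    moreover have "?z \<in> ?cl" using M by blast
    ultimately show ?thesis using ys(4) by (simp add: subseed_def Let_def)
  next
    case False
    then have "x \<notin> ?cl \<union> ?co" by blast
    then have "exmat (subseed S T' T) x ?z = 0" by (simp add: subseed_def Let_def)
    moreover have "count_list (map \<phi> ys) x = 0" "count_list (map \<phi> ys') x = 0"
      using False ys(1,2) by (auto simp: count_list_0_iff)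
    ultimately show ?thesis by simp
  qed
  have nz: "?z \<noteq> 0" using alg_independent_nonzero g(4) MT unfolding transcendence_basis_def by (metis image_eqI)
  have nv: "new_var (subseed S T' T) ?z = ?z'"
  proof -
    have "new_var (subseed S T' T) ?z = inverse ?z * (?z * ?z')"
      using new_var_count(3)[of "subseed S T' T" ?z, OF col] ys(3,5) by simp
    then show ?thesis using nz by simp
  qed
  have \<phi>N: "\<phi> A = ?z'" if "A \<in> iso_class X N" for A
  proof -
    have "A \<in> ?R" using that by (simp add: replace_def)
    then show ?thesis using gR(5)[of A N] R'R NR' that isomorphic_sym by (auto simp: iso_class_def)
  qed
  have nN: "?z' \<notin> \<phi> ` (T - iso_class X M)" by (rule good_replace(2)[OF T ex])
  have npN: "\<not> projective_in X S A" if "A \<in> iso_class X N" for A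
  proof -
    have "A \<in> ?R'" using that by (simp add: replace_def)
    then have "A \<in> S" using T'S by blast
    then show ?thesis using projective_iso[of N A S] that exchange_nonprojective(2)[OF ex' w S] N(1) S by (auto simp: iso_class_def)
  qed
  have npM: "\<not> projective_in X S A" if "A \<in> iso_class X M" for A
  proof -
    have "A \<in> T'" using that indec_closedD(3)[OF ic' M(1)] by (simp add: iso_class_def)
    then have "A \<in> S" using T'S by blast
    then show ?thesis using projective_iso[of M A S] that M T'S S by (auto simp: iso_class_def)
  qed
  have zM: "\<phi> A = ?z \<longleftrightarrow> A \<in> iso_class X M" if "A \<in> T'" for A
    using g(5)[OF MT, of A] that T' by (auto simp: iso_class_def)
  have cl: "?cl' = insert ?z' (?cl - {?z})"
  proof (intro equalityI subsetI)
    fix x assume "x \<in> ?cl'"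
    then obtain A where A: "A \<in> ?R'" "\<not> projective_in X S A" "x = \<phi> A" by blast
    show "x \<in> insert ?z' (?cl - {?z})"
    proof (cases "A \<in> iso_class X N")
      case True then show ?thesis using \<phi>N A(3) by simp
    next
      case False
      then have "A \<in> T'" "A \<notin> iso_class X M" using A(1) by (auto simp: replace_def)
      then show ?thesis using zM[of A] A(2,3) by simp
    qed
  next
    fix x assume "x \<in> insert ?z' (?cl - {?z})"
    then consider "x = ?z'" | A where "A \<in> T'" "\<not> projective_in X S A" "x = \<phi> A" "x \<noteq> ?z" by blast
    then show "x \<in> ?cl'"
    proof cases
      case 1
      then show ?thesis using NR' exchange_nonprojective(2)[OF ex' w S] by blast
    next
      case 2
      then have "A \<in> ?R'" using zM[of A] by (simp add: replace_def)
      then show ?thesis using 2 by blast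
    qed
  qed
  have co: "?co' = ?co"
  proof -
    have "{M\<in>?R'. projective_in X S M} = {M\<in>T'. projective_in X S M}"
      using npN npM unfolding replace_def by blast
    then show ?thesis by simp
  qed
  have mut: "quiver_matrix X (ob X) ?R (if isomorphic X M A then N else A) (if isomorphic X M B then N else B) =
      fz_mutation (quiver_matrix X (ob X) T) (isomorphic X M) M A B"
    if "A \<in> T" "B \<in> T" "\<not> projective_in X (ob X) B" for A B
    using cluster_structure ex that unfolding cluster_structure_def by blast
  \<comment> \<open>Every index \<open>x\<close> of the new seed is matched with the summand
    \<open>A\<close> of \<open>T'\<close> that occupied its place before the exchange:
    \<open>M\<close> if \<open>x\<close> is the new variable, otherwise the summand that
    \<open>x\<close> comes from. This mirrors the renaming of indices in
    \<open>mutate\<close>.\<close>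
  have old: "\<exists>A\<in>T'. (if x = ?z' then ?z else x) = \<phi> A \<and> (if isomorphic X M A then N else A) \<in> ?R' \<and>
      \<phi> (if isomorphic X M A then N else A) = x \<and> (x \<in> ?cl' \<longrightarrow> \<not> projective_in X S A \<and> \<not> projective_in X S (if isomorphic X M A then N else A))"
    if x: "x \<in> ?cl' \<union> ?co'" for x
  proof (cases "x = ?z'")
    case True
    show ?thesis
      by (rule bexI[of _ M]) (use True M isomorphic_refl[OF Mob] NR' exchange_nonprojective(2)[OF ex' w S] in auto)
  next
    case False
    have "\<exists>A\<in>?R'. x = \<phi> A \<and> (x \<in> ?cl' \<longrightarrow> \<not> projective_in X S A)"
    proof (cases "x \<in> ?cl'")
      case False then show ?thesis using x by blast
    qed blast
    then obtain A where A: "A \<in> ?R'" "x = \<phi> A" "x \<in> ?cl' \<longrightarrow> \<not> projective_in X S A" by blast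
    then have "A \<notin> iso_class X N" using False \<phi>N by blast
    then have "A \<in> T'" "\<not> isomorphic X M A" using A(1) by (auto simp: replace_def iso_class_def)
    then show ?thesis using A False by (intro bexI[of _ A]) auto
  qed
  have em: "(if x \<in> ?cl' \<union> ?co' \<and> y \<in> ?cl' then
      fz_mutation (exmat (subseed S T' T)) (\<lambda>x. x = ?z) ?z (if x = ?z' then ?z else x) (if y = ?z' then ?z else y) else 0) =
    exmat (subseed S ?R' ?R) x y" for x y
  proof (cases "x \<in> ?cl' \<union> ?co' \<and> y \<in> ?cl'")
    case True
    then have x: "x \<in> ?cl' \<union> ?co'" and y: "y \<in> ?cl' \<union> ?co'" "y \<in> ?cl'" by auto
    obtain A where A: "A \<in> T'" "(if x = ?z' then ?z else x) = \<phi> A" "(if isomorphic X M A then N else A) \<in> ?R'"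
      "\<phi> (if isomorphic X M A then N else A) = x" using old[OF x] by blast
    obtain B where B: "B \<in> T'" "(if y = ?z' then ?z else y) = \<phi> B" "(if isomorphic X M B then N else B) \<in> ?R'"
      "\<phi> (if isomorphic X M B then N else B) = y" "\<not> projective_in X S B" "\<not> projective_in X S (if isomorphic X M B then N else B)"
      using old[OF y(1)] y(2) by blast
    have "fz_mutation (exmat (subseed S T' T)) (\<lambda>x. x = ?z) ?z (\<phi> A) (\<phi> B) =
        fz_mutation (quiver_matrix X (ob X) T) (isomorphic X M) M A B"
      using zM A(1) B(1) exm[OF A(1) B(1,5)] exm[OF A(1) M] exm[OF M(1) B(1,5)]
      by (simp add: fz_mutation_def iso_class_def)
    also have "\<dots> = quiver_matrix X (ob X) ?R (if isomorphic X M A then N else A) (if isomorphic X M B then N else B)"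
    proof -
      have "A \<in> T" "B \<in> T" "\<not> projective_in X (ob X) B"
        using A(1) B(1,5) T' T'S nonprojective_sub[OF S, of B] by blast+
      from mut[OF this] show ?thesis by (rule sym)
    qed
    also have "\<dots> = exmat (subseed S ?R' ?R) x y" using exmR[OF A(3) B(3,6)] A(4) B(4) by simp
    finally show ?thesis using True A(2) B(2) by simp
  next
    case False
    then show ?thesis by (auto simp: subseed_def Let_def)
  qed
  have "exmat (mutate (subseed S T' T) ?z) = exmat (subseed S ?R' ?R)"
    unfolding mutate_def Let_def nv ss cl[symmetric] co[symmetric] using em by (simp add: fun_eq_iff)
  moreover have "cluster (mutate (subseed S T' T) ?z) = cluster (subseed S ?R' ?R)"
    unfolding mutate_def Let_def nv ss cl by simp
  moreover have "coeffs (mutate (subseed S T' T) ?z) = coeffs (subseed S ?R' ?R)"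
    unfolding mutate_def Let_def ss co by simp
  ultimately show ?thesis by (intro seed.equality) simp_all
qed

end

section \<open>Cluster algebras of components\<close>

context cluster_category begin

lemma good_all: assumes "T \<in> \<Delta>" shows "good T"
proof -
  obtain T0 where T0: "good T0" using good_ex by blast
  have "(ct_edge X (ob X))\<^sup>*\<^sup>* T0 T" using component_eq[OF component goodD(1)[OF T0]] assms by blast
  then show ?thesis
  proof (induction rule: rtranclp_induct)
    case (step T T')
    from ct_edge_exchange[OF step.hyps(2) order.refl] show ?case using good_replace(1)[OF step.IH] by metis
  qed (rule T0)
qed

text \<open>\<phi> turns direct sums into products, so the images of the indecomposable summands
  already generate the ring.\<close>

lemma hull_component_subcat:
  assumes D: "\<And>T. T \<in> D \<Longrightarrow> indec_closed T" and sub: "\<Union>D \<subseteq> \<Union>\<Delta>"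
  shows "is_subring hull (\<phi> ` component_subcat X D) = is_subring hull (\<phi> ` \<Union>D)"
proof (rule antisym)
  let ?H = "is_subring hull (\<phi> ` \<Union>D)"
  have "\<phi> ` component_subcat X D \<subseteq> ?H"
  proof
    fix x assume "x \<in> \<phi> ` component_subcat X D"
    then obtain C where C: "C \<in> add_closure X (\<Union>D)" "x = \<phi> C" unfolding component_subcat_def by blast
    obtain ys where ys: "set ys \<subseteq> \<Union>D" "sumlist X ys C" using add_closure_sumlist[OF indec_closed_Union C(1)] D by blast
    have "set (map \<phi> ys) \<subseteq> \<phi> ` \<Union>D" using ys(1) by (simp add: image_mono)
    then have "set (map \<phi> ys) \<subseteq> ?H" using hull_subset[of "\<phi> ` \<Union>D" is_subring] by (rule order.trans)
    then have "prod_list (map \<phi> ys) \<in> ?H" by (rule subring_prod_list[OF is_subring_hull])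
    then show "x \<in> ?H" using \<phi>_sumlist[OF ys(2)] ys(1) sub C(2) by auto
  qed
  then show "is_subring hull (\<phi> ` component_subcat X D) \<subseteq> ?H" using is_subring_hull by (rule hull_minimal)
  have "\<Union>D \<subseteq> component_subcat X D" unfolding component_subcat_def
    using add_closure_superset D indec_closedD(2) by blast
  then show "?H \<subseteq> is_subring hull (\<phi> ` component_subcat X D)" by (intro hull_mono image_mono)
qed

text \<open>The exchange sequences in \<open>S\<close> list all nonzero rows of a column. This gives
  local finiteness, and it shows that the restricted column agrees with the full one, since rows
  outside the image of \<open>T'\<close> are zero in both.\<close>

lemma is_seed_subseed:
  assumes T: "good T" and S: "S \<subseteq> ob X" "weak_cluster_structure X S"
    and T': "T' \<subseteq> T" "cluster_tilting X S T'"
    and ex: "\<And>M N. exchangeable X S T' M N \<Longrightarrow> exchangeable X (ob X) T M N"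
  shows "transcendence_basis F (\<phi> ` T') \<Longrightarrow> is_seed F (subseed S T' T)"
    and "y \<in> cluster (subseed S T' T) \<Longrightarrow> exmat (subseed S T' T) x y = exmat (seed_of X (ob X) \<phi> T) x y"
proof -
  note g = goodD[OF T]
  have T'S: "T' \<subseteq> S" using T'(2) unfolding cluster_tilting_def by blast
  note ic' = cluster_tilting_indec[OF T'(2)]
  let ?cl = "\<phi> ` {M\<in>T'. \<not> projective_in X S M}" and ?co = "\<phi> ` {M\<in>T'. projective_in X S M}"
  have ss: "cluster (subseed S T' T) = ?cl" "coeffs (subseed S T' T) = ?co"
    by (simp_all add: subseed_def Let_def)
  have un: "?cl \<union> ?co = \<phi> ` T'" by blast
  have ex0: "exmat (subseed S T' T) x y = (if x \<in> \<phi> ` T' \<and> y \<in> ?cl then exmat (seed_of X (ob X) \<phi> T) x y else 0)" for x y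
    unfolding un[symmetric] by (simp add: subseed_def Let_def)
  have col: "\<exists>us. set us \<subseteq> \<phi> ` T' \<and> (\<forall>x. exmat (seed_of X (ob X) \<phi> T) x y \<noteq> 0 \<longrightarrow> x \<in> set us)" if y: "y \<in> ?cl" for y
  proof -
    obtain M where M: "M \<in> T'" "\<not> projective_in X S M" "y = \<phi> M" using y by blast
    obtain N where N: "exchangeable X S T' M N" using S(2) T'(2) M unfolding weak_cluster_structure_def by blast
    obtain ys ys' where ys: "set ys \<subseteq> T' - iso_class X M" "set ys' \<subseteq> T' - iso_class X M"
      "\<forall>x. exmat (seed_of X (ob X) \<phi> T) x (\<phi> M) = int (count_list (map \<phi> ys) x) - int (count_list (map \<phi> ys') x)"
      using exchange_columns[OF T ex[OF N] _ indec_closed_diff[OF ic'] exchange_sequences[OF S(2) N]] T'(1) by blast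
    show ?thesis
    proof (intro exI[of _ "map \<phi> ys @ map \<phi> ys'"] conjI allI impI)
      show "set (map \<phi> ys @ map \<phi> ys') \<subseteq> \<phi> ` T'" using ys(1,2) by auto
      fix x assume "exmat (seed_of X (ob X) \<phi> T) x y \<noteq> 0"
      then have "count_list (map \<phi> ys) x \<noteq> 0 \<or> count_list (map \<phi> ys') x \<noteq> 0" using ys(3) M(3) by auto
      then show "x \<in> set (map \<phi> ys @ map \<phi> ys')" by (auto simp: count_list_0_iff)
    qed
  qed
  show "exmat (subseed S T' T) x y = exmat (seed_of X (ob X) \<phi> T) x y" if "y \<in> cluster (subseed S T' T)" for x y
    using that col[of y] unfolding ss ex0 by auto
  have exm: "exmat (subseed S T' T) (\<phi> A) (\<phi> B) = quiver_matrix X (ob X) T A B"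
    if "A \<in> T'" "B \<in> T'" "\<not> projective_in X S B" for A B
    using that exmat_seed_of[OF T, of A B] T' nonprojective_sub[OF S(1), of B] T'S by (auto simp: ex0)
  show "is_seed F (subseed S T' T)" if tb: "transcendence_basis F (\<phi> ` T')"
    unfolding is_seed_def ss un
  proof (intro conjI allI ballI impI)
    show "?cl \<inter> ?co = {}"
    proof (rule ccontr)
      assume "?cl \<inter> ?co \<noteq> {}"
      then obtain A B where AB: "A \<in> T'" "B \<in> T'" "\<not> projective_in X S A" "projective_in X S B" "\<phi> A = \<phi> B" by blast
      have "isomorphic X A B" using g(5)[of A B] AB T'(1) by blast
      then show False using projective_iso[of A B S] AB T'S S(1) by blast
    qed
    show "transcendence_basis F (\<phi> ` T')" by (rule tb)
  next
    fix x y assume "exmat (subseed S T' T) x y \<noteq> 0"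
    then show "x \<in> \<phi> ` T'" "y \<in> ?cl" by (auto simp: ex0 split: if_splits)
  next
    fix x y assume "x \<in> ?cl" "y \<in> ?cl"
    then obtain A B where AB: "A \<in> T'" "\<not> projective_in X S A" "x = \<phi> A" "B \<in> T'" "\<not> projective_in X S B" "y = \<phi> B" by blast
    then show "exmat (subseed S T' T) x y = - exmat (subseed S T' T) y x"
      using exm[of A B] exm[of B A] by (simp add: quiver_matrix_def)
  next
    fix y
    show "finite {x. exmat (subseed S T' T) x y \<noteq> 0}"
    proof (cases "y \<in> ?cl")
      case True
      then obtain us where "\<forall>x. exmat (seed_of X (ob X) \<phi> T) x y \<noteq> 0 \<longrightarrow> x \<in> set us" using col by blast
      then have "{x. exmat (subseed S T' T) x y \<noteq> 0} \<subseteq> set us" by (auto simp: ex0)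
      then show ?thesis using finite_subset by blast
    qed (simp add: ex0)
  qed
qed

text \<open>
  \<open>P\<close> is the set of the summands that are added to the cluster tilting objects of \<open>S\<close> in order to
  obtain those of \<open>X\<close>; it is empty if \<open>S\<close> consists of all objects of \<open>X\<close>.
\<close>

lemma component_cluster_algebra:
  assumes S: "S \<subseteq> ob X" "weak_cluster_structure X S"
    and D: "ct_component X S D" and T0: "T0 \<in> D"
    and good: "\<And>T. T \<in> D \<Longrightarrow> good (T \<union> P)"
    and ex: "\<And>T M N. T \<in> D \<Longrightarrow> exchangeable X S T M N \<Longrightarrow>
      exchangeable X (ob X) (T \<union> P) M N \<and> replace X (T \<union> P) M N = replace X T M N \<union> P"
    and F: "\<exists>m. rational_function_field F m" "transcendence_basis F (\<phi> ` T0)"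
  shows "T \<in> D \<Longrightarrow> subseed S T (T \<union> P) \<in> mutation_class (subseed S T0 (T0 \<union> P))"
    and "is_cluster_algebra F (is_subring hull (\<phi> ` component_subcat X D)) (mutation_class (subseed S T0 (T0 \<union> P))) {}"
proof -
  let ?s = "\<lambda>T. subseed S T (T \<union> P)"
  let ?C = "mutation_class (?s T0)"
  have ct: "cluster_tilting X S T" if "T \<in> D" for T using component_ct[OF D that] .
  have mut: "mutate (?s T) (\<phi> M) = ?s (replace X T M N)" if "T \<in> D" "exchangeable X S T M N" for T M N
    using mutate_subseed[OF good[OF that(1)] S _ _ that(2)] ex[OF that] by simp
  have cl: "cluster (?s T) = \<phi> ` {M\<in>T. \<not> projective_in X S M}" "coeffs (?s T) = \<phi> ` {M\<in>T. projective_in X S M}" for T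
    by (simp_all add: subseed_def Let_def)
  have mem: "?s T \<in> ?C" if "T \<in> D" for T
  proof -
    have "(ct_edge X S)\<^sup>*\<^sup>* T0 T" using component_eq[OF D T0] that by blast
    then have "T \<in> D \<and> ?s T \<in> ?C"
    proof (induction rule: rtranclp_induct)
      case base show ?case using T0 mutation_class.initial by blast
    next
      case (step T T')
      obtain M N where MN: "exchangeable X S T M N" "T' = replace X T M N" using ct_edge_exchange[OF step.hyps(2) S(1)] .
      have "\<phi> M \<in> cluster (?s T)" using MN(1) unfolding cl exchangeable_def by blast
      then have "mutate (?s T) (\<phi> M) \<in> ?C" using step.IH mutation_class.step by blast
      then show ?case using mut MN step component_step[OF D] by metis
    qed
    then show ?thesis ..
  qed
  then show "T \<in> D \<Longrightarrow> ?s T \<in> ?C" .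
  \<comment> \<open>Each cluster variable of a seed is the image of a non-projective summand, which
    can be exchanged without leaving \<open>D\<close>; so mutation never leaves the seeds of
    \<open>D\<close>.\<close>
  have rep: "\<exists>T\<in>D. \<Sigma> = ?s T" if "\<Sigma> \<in> ?C" for \<Sigma>
    using that
  proof induction
    case initial then show ?case using T0 by blast
  next
    case (step \<Sigma> z)
    then obtain T where T: "T \<in> D" "\<Sigma> = ?s T" by blast
    then obtain M where M: "M \<in> T" "\<not> projective_in X S M" "z = \<phi> M" using step.hyps(2) cl by auto
    obtain N where N: "exchangeable X S T M N" using S(2) ct[OF T(1)] M unfolding weak_cluster_structure_def by blast
    have "replace X T M N \<in> D" using component_step[OF D T(1) exchange_ct_edge[OF N S(1)]] .
    then show ?case using mut[OF T(1) N] T(2) M(3) by blast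
  qed
  have co: "coeffs \<Sigma> = coeffs (?s T0)" if "\<Sigma> \<in> ?C" for \<Sigma>
    using that by induction (simp_all add: mutate_def Let_def)
  have ic: "indec_closed T" if "T \<in> D" for T using cluster_tilting_indec[OF ct[OF that]] .
  have sub: "\<Union>D \<subseteq> \<Union>\<Delta>"
  proof
    fix M assume "M \<in> \<Union>D"
    then obtain T where "T \<in> D" "M \<in> T" by blast
    then have "M \<in> T \<union> P" "T \<union> P \<in> \<Delta>" using goodD(1)[OF good] by blast+
    then show "M \<in> \<Union>\<Delta>" by blast
  qed
  \<comment> \<open>Mutation does not change the coefficients, so the initial ones account for the
    projective summands of every member of \<open>D\<close>. No coefficient is inverted.\<close>
  have gens: "coeffs (?s T0) \<union> inverse ` {} \<union> (\<Union>\<Sigma>\<in>?C. cluster \<Sigma>) = \<phi> ` \<Union>D"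
  proof (intro equalityI subsetI)
    fix x assume "x \<in> coeffs (?s T0) \<union> inverse ` {} \<union> (\<Union>\<Sigma>\<in>?C. cluster \<Sigma>)"
    then consider "x \<in> coeffs (?s T0)" | \<Sigma> where "\<Sigma> \<in> ?C" "x \<in> cluster \<Sigma>" by blast
    then show "x \<in> \<phi> ` \<Union>D"
    proof cases
      case 1 then show ?thesis using T0 unfolding cl by blast
    next
      case 2
      then obtain T where "T \<in> D" "x \<in> cluster (?s T)" using rep by blast
      then show ?thesis unfolding cl by blast
    qed
  next
    fix x assume "x \<in> \<phi> ` \<Union>D"
    then obtain T M where T: "T \<in> D" "M \<in> T" "x = \<phi> M" by blast
    show "x \<in> coeffs (?s T0) \<union> inverse ` {} \<union> (\<Union>\<Sigma>\<in>?C. cluster \<Sigma>)"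
    proof (cases "projective_in X S M")
      case True
      then have "x \<in> coeffs (?s T)" using T unfolding cl by blast
      then show ?thesis using co[OF mem[OF T(1)]] by blast
    next
      case False
      then have "x \<in> cluster (?s T)" using T unfolding cl by blast
      then show ?thesis using mem[OF T(1)] by blast
    qed
  qed
  have seed: "is_seed F (?s T0)"
    by (rule is_seed_subseed(1)[OF good[OF T0] S _ ct[OF T0] _ F(2)]) (use ex[OF T0] in blast)+
  have "is_subring hull (\<phi> ` component_subcat X D) = is_subring hull (coeffs (?s T0) \<union> inverse ` {} \<union> (\<Union>\<Sigma>\<in>?C. cluster \<Sigma>))"
    unfolding gens using hull_component_subcat[OF ic sub] .
  then show "is_cluster_algebra F (is_subring hull (\<phi> ` component_subcat X D)) ?C {}"
    unfolding is_cluster_algebra_def using F(1) seed by blast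
qed

text \<open>The added summands are untouched: were \<open>M\<close> in \<open>P\<close>, it would
  lie next to \<open>N\<close> in the exchanged cluster tilting object of \<open>X\<close>, although
  \<open>Ext(M,N)\<close> is nonzero.\<close>

lemma exchange_lift:
  assumes S: "S \<subseteq> ob X" "weak_cluster_structure X S" and P: "\<And>L. L \<in> P \<Longrightarrow> iso_class X L \<subseteq> P"
    and T: "cluster_tilting X (ob X) (T \<union> P)" and e: "exchangeable X S T M N"
    and R: "cluster_tilting X (ob X) (replace X T M N \<union> P)"
  shows "exchangeable X (ob X) (T \<union> P) M N \<and> replace X (T \<union> P) M N = replace X T M N \<union> P"
proof -
  have M: "M \<in> T" "\<not> projective_in X S M" and N: "N \<in> S" "indecomposable X N" "\<not> isomorphic X M N"
    and ct: "cluster_tilting X S T" using e unfolding exchangeable_def by blast+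
  have MS: "M \<in> S" using ct M unfolding cluster_tilting_def by blast
  have NR: "N \<in> replace X T M N" using isomorphic_refl N(1) S(1) by (auto simp: replace_def iso_class_def)
  have "M \<notin> P"
  proof
    assume "M \<in> P"
    then have "ext_zero X M N" using cluster_tilting_ext_zero[OF R] NR by blast
    then show False using exchange_nonprojective(1)[OF e S(2,1)] by blast
  qed
  then have "iso_class X M \<inter> P = {}" using P isomorphic_sym unfolding iso_class_def by blast
  then have r: "replace X (T \<union> P) M N = replace X T M N \<union> P" unfolding replace_def by blast
  then show ?thesis unfolding exchangeable_def
    using T R M N nonprojective_sub[OF S(1) MS M(2)] S(1) by auto
qed

text \<open>The subalgebra lives in the smaller field generated by the image of \<open>T'\<close>,
  which is algebraically independent as part of a transcendence basis.
  \<open>subcluster_algebra\<close> compares whole columns, including the rows outside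
  \<open>T'\<close>; they agree by the support statement in \<open>is_seed_subseed\<close>.\<close>

lemma subcluster_algebra_component:
  assumes sub: "induces_substructure X \<B> T' \<A>" and D: "ct_component X \<B> D" and T': "T' \<in> D" and \<Delta>: "T' \<union> iso_closure X \<A> \<in> \<Delta>"
    and \<S>: "\<And>T. T \<in> \<Delta> \<Longrightarrow> seed_of X (ob X) \<phi> T \<in> \<S>" and ctbl: "countable (UNIV :: 'f set)"
  shows "subcluster_algebra (is_subring hull (\<phi> ` component_subcat X D)) \<S> {}"
proof -
  let ?P = "iso_closure X \<A>"
  have B: "\<B> \<subseteq> ob X" and weakB: "weak_cluster_structure X \<B>"
    and step: "\<And>T''. (exchange_step X \<B>)\<^sup>*\<^sup>* T' T'' \<Longrightarrow> cluster_tilting X (ob X) (T'' \<union> ?P)"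
    using sub unfolding induces_substructure_def full_subcat_def by blast+
  have P: "iso_class X L \<subseteq> ?P" if "L \<in> ?P" for L
    using that isomorphic_trans unfolding iso_closure_def iso_class_def by blast
  \<comment> \<open>Substructures are defined by iterated exchanges, components by edges; each edge
    is an exchange.\<close>
  have reach: "(exchange_step X \<B>)\<^sup>*\<^sup>* T' T" if "T \<in> D" for T
  proof -
    have "(ct_edge X \<B>)\<^sup>*\<^sup>* T' T" using component_eq[OF D T'] that by blast
    then show ?thesis
    proof (induction rule: rtranclp_induct)
      case (step T1 T2)
      have "exchange_step X \<B> T1 T2" unfolding exchange_step_def using ct_edge_exchange[OF step.hyps(2) B] by metis
      then show ?case using step.IH by (rule rtranclp.rtrancl_into_rtrancl[rotated])
    qed simp
  qed
  have lift: "exchangeable X (ob X) (T \<union> ?P) M N \<and> replace X (T \<union> ?P) M N = replace X T M N \<union> ?P"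
    if T: "T \<in> D" and e: "exchangeable X \<B> T M N" for T M N
  proof (rule exchange_lift[OF B weakB P _ e])
    show "cluster_tilting X (ob X) (T \<union> ?P)" using step[OF reach[OF T]] .
    have "replace X T M N \<in> D" using component_step[OF D T exchange_ct_edge[OF e B]] .
    then show "cluster_tilting X (ob X) (replace X T M N \<union> ?P)" using step reach by blast
  qed
  \<comment> \<open>Exchanges in \<open>\<B>\<close> lift to exchanges in the big category, so
    adding the fixed summands carries the whole component into \<Delta> once it does so for
    \<open>T'\<close>.\<close>
  have inD: "T \<union> ?P \<in> \<Delta>" if "T \<in> D" for T
  proof -
    have "(ct_edge X \<B>)\<^sup>*\<^sup>* T' T" using component_eq[OF D T'] that by blast
    then have "T \<in> D \<and> T \<union> ?P \<in> \<Delta>"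
    proof (induction rule: rtranclp_induct)
      case base then show ?case using T' \<Delta> by blast
    next
      case (step T1 T2)
      obtain M N where MN: "exchangeable X \<B> T1 M N" "T2 = replace X T1 M N" using ct_edge_exchange[OF step.hyps(2) B] .
      have "T2 \<in> D" using component_step[OF D _ step.hyps(2)] step.IH by blast
      then show ?case using exchange_\<Delta>[of "T1 \<union> ?P" M N] lift[of T1 M N] step.IH MN by auto
    qed
    then show ?thesis ..
  qed
  have good: "good (T \<union> ?P)" if "T \<in> D" for T using good_all[OF inD[OF that]] .
  let ?F = "is_subfield hull (\<phi> ` T')"
  have "alg_independent (\<phi> ` (T' \<union> ?P))" using goodD(4)[OF good[OF T']] by (simp add: transcendence_basis_def)
  then have ind: "alg_independent (\<phi> ` T')" by (rule alg_independent_subset) blast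
  have F: "\<exists>m. rational_function_field ?F m"
    using rational_function_field_hull[OF countable_subset[OF subset_UNIV ctbl] ind] .
  note tb = transcendence_basis_hull[OF ind]
  let ?s = "subseed \<B> T' (T' \<union> ?P)"
  have ca: "is_cluster_algebra ?F (is_subring hull (\<phi> ` component_subcat X D)) (mutation_class ?s) {}"
    by (rule component_cluster_algebra(2)[OF B weakB D T' good lift F tb])
  have ct': "cluster_tilting X \<B> T'" using component_ct[OF D T'] .
  then have T'B: "T' \<subseteq> \<B>" unfolding cluster_tilting_def by blast
  have s: "cluster ?s = \<phi> ` {M\<in>T'. \<not> projective_in X \<B> M}" "coeffs ?s = \<phi> ` {M\<in>T'. projective_in X \<B> M}"
    by (simp_all add: subseed_def Let_def)
  let ?big = "seed_of X (ob X) \<phi> (T' \<union> ?P)"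
  have b: "cluster ?big = \<phi> ` {M\<in>T' \<union> ?P. \<not> projective_in X (ob X) M}" "coeffs ?big = \<phi> ` {M\<in>T' \<union> ?P. projective_in X (ob X) M}"
    by (simp_all add: seed_of_def Let_def)
  have 1: "cluster ?s \<subseteq> cluster ?big" unfolding s b
  proof (intro image_mono subsetI)
    fix M assume "M \<in> {M \<in> T'. \<not> projective_in X \<B> M}"
    then show "M \<in> {M \<in> T' \<union> ?P. \<not> projective_in X (ob X) M}" using nonprojective_sub[OF B, of M] T'B by blast
  qed
  have 2: "coeffs ?s \<subseteq> cluster ?big \<union> coeffs ?big" unfolding s b by blast
  have 3: "\<forall>y\<in>cluster ?s. \<forall>x. exmat ?s x y = exmat ?big x y"
    using is_seed_subseed(2)[OF good[OF T'] B weakB _ ct'] lift[OF T'] by blast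
  show ?thesis unfolding subcluster_algebra_def
    using ca \<S>[OF \<Delta>] mutation_class.initial[of ?s] 1 2 3 by blast
qed

end

theorem theorem3p1p2:
  fixes X :: "('o, 'm::ab_group_add, 'k::alg_closed_field) ext_cat"
    and \<phi> :: "'o \<Rightarrow> 'f::field_char_0"
    and \<Delta> :: "'o set set"
    and n c m :: enat
  assumes "stably_2CY X"
    and "cluster_structure X (ob X)"
    and "\<And>T. cluster_tilting X (ob X) T \<Longrightarrow>
           num_cluster_vars X (ob X) T = n \<and> num_coeffs X (ob X) T = c"
    and "1 \<le> n"
    and "m = n + c"
    and "rational_function_field (UNIV :: 'f set) m"
    and "ct_component X (ob X) \<Delta>"
    and "cluster_map X (ob X) \<Delta> \<phi> UNIV"
  shows "\<exists>\<S>.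
      is_cluster_algebra UNIV (is_subring hull (\<phi> ` component_subcat X \<Delta>)) \<S> {} \<and>
      (\<forall>T\<in>\<Delta>. is_seed UNIV (seed_of X (ob X) \<phi> T) \<and> seed_of X (ob X) \<phi> T \<in> \<S>) \<and>
      (\<forall>\<B> \<Delta>' T' \<A>.
         induces_substructure X \<B> T' \<A> \<and> ct_component X \<B> \<Delta>' \<and> T' \<in> \<Delta>' \<and>
         T' \<union> iso_closure X \<A> \<in> \<Delta> \<longrightarrow>
         subcluster_algebra (is_subring hull (\<phi> ` component_subcat X \<Delta>')) \<S> {})"
proof -
  \<comment> \<open>A cluster tilting object with projective summands only would have no cluster
    variables, against \<open>1 \<le> n\<close>.\<close>
  have nonproj: "\<exists>M\<in>T. \<not> projective_in X (ob X) M" if T: "cluster_tilting X (ob X) T" for T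
  proof (rule ccontr)
    assume "\<not> (\<exists>M\<in>T. \<not> projective_in X (ob X) M)"
    then have none: "{M\<in>T. \<not> projective_in X (ob X) M} = {}" by blast
    have "num_cluster_vars X (ob X) T = 0" unfolding num_cluster_vars_def none by (simp add: ecard_def zero_enat_def)
    then show False using assms(3)[OF T] assms(4) by simp
  qed
  interpret extension_category X using stably_2CY_extension_category[OF assms(1)] .
  interpret cluster_category X \<phi> \<Delta> using assms nonproj by unfold_locales auto
  obtain T0 where T0: "good T0" using good_ex by blast
  note T0D = goodD(1)[OF T0]
  let ?\<S> = "mutation_class (seed_of X (ob X) \<phi> T0)"
  \<comment> \<open>For the whole category nothing is added to the cluster tilting objects, so the
    set \<open>P\<close> of extra summands is empty.\<close>
  have good: "good (T \<union> {})" if "T \<in> \<Delta>" for T using good_all[OF that] by simp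
  have ex: "exchangeable X (ob X) (T \<union> {}) M N \<and> replace X (T \<union> {}) M N = replace X T M N \<union> {}"
    if "T \<in> \<Delta>" "exchangeable X (ob X) T M N" for T M N using that by simp
  have rf: "\<exists>m. rational_function_field (UNIV :: 'f set) m" using assms(6) by blast
  note ca = component_cluster_algebra[OF order.refl weak component T0D good ex rf goodD(4)[OF T0], simplified, folded seed_of_eq_subseed]
  have mem: "seed_of X (ob X) \<phi> T \<in> ?\<S>" if "T \<in> \<Delta>" for T using ca(1)[OF that] .
  have seed: "is_seed UNIV (seed_of X (ob X) \<phi> T)" if "T \<in> \<Delta>" for T
    unfolding seed_of_eq_subseed
    by (rule is_seed_subseed(1)[OF good_all[OF that] order.refl weak order.refl \<Delta>_ct[OF that] _ goodD(4)[OF good_all[OF that]]])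
  note sub = subcluster_algebra_component[OF _ _ _ _ mem rational_function_field_countable[OF assms(6)]]
  show ?thesis
  proof (intro exI[of _ ?\<S>] conjI ballI allI impI)
    show "is_cluster_algebra UNIV (is_subring hull (\<phi> ` component_subcat X \<Delta>)) ?\<S> {}" by (rule ca(2))
  next
    fix T assume "T \<in> \<Delta>"
    then show "is_seed UNIV (seed_of X (ob X) \<phi> T)" "seed_of X (ob X) \<phi> T \<in> ?\<S>" using seed mem by auto
  next
    fix \<B> \<Delta>' T' \<A>
    assume "induces_substructure X \<B> T' \<A> \<and> ct_component X \<B> \<Delta>' \<and> T' \<in> \<Delta>' \<and> T' \<union> iso_closure X \<A> \<in> \<Delta>"
    then show "subcluster_algebra (is_subring hull (\<phi> ` component_subcat X \<Delta>')) ?\<S> {}" using sub by blast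
  qed
qed

end
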